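(* Let $k\ge 2$ and let $\mathcal{G}_k$ be a generic ultrafilter forced by $\mathcal{P}(\omega^k)/\mathrm{Fin}^{\otimes k}$. In $V[\mathcal{G}_k]$: if $\mathcal{V}$ is a nonprincipal ultrafilter (on $\omega$) with $\mathcal{V}\le_T\mathcal{G}_k$, then $\mathcal{V}\equiv_T\pi_l(\mathcal{G}_k)$ for some $l\le k$.
   Context: $\mathrm{Fin}^{\otimes 1}$ is the ideal of finite subsets of $\omega$; $\mathrm{Fin}^{\otimes(k+1)}$ is the ideal of all $X\subseteq\omega^{k+1}$ such that for all but finitely many $i\in\omega$, $\{(j_1,\dots,j_k):(i,j_1,\dots,j_k)\in X\}\in\mathrm{Fin}^{\otimes k}$. The generic $\mathcal{G}_k$ is an ultrafilter on $\omega^k$. Identify $[\omega]^k$ with the set of strictly increasing $k$-tuples in $\omega^k$. The space $\mathcal{E}_k$: let $\omega^{\not\downarrow\le k}$ be the set of non-decreasing sequences of natural numbers of length $\le k$ (including $()$), and $\omega^{\not\downarrow k}$ those of length exactly $k$. Well-order $\omega^{\not\downarrow\le k}$ by $\prec$: $()$ is least, and for nonempty $(j_0,\dots,j_{p-1}),(l_0,\dots,l_{q-1})$, $(j_0,\dots,j_{p-1})\prec(l_0,\dots,l_{q-1})$ iff $j_{p-1}<l_{q-1}$, or $j_{p-1}=l_{q-1}$ and $(j_0,\dots,j_{p-1})$ is lexicographically below $(l_0,\dots,l_{q-1})$ (a proper initial segment counts as lexicographically below). This has order type $\omega$; let $\vec j_m$ be its $m$-th element, $m_{\vec l}$ the index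 with $\vec l=\vec j_{m_{\vec l}}$, and $\vec i_n$ the $n$-th element of $\omega^{\not\downarrow k}$ under $\prec$. Put $\mathbb{W}_k(\vec j)=\{m_{\vec j\restriction q}:1\le q\le|\vec j|\}$, $\widehat{\mathbb{W}}_k=\{\mathbb{W}_k(\vec j):\vec j\in\omega^{\not\downarrow\le k}\}$, $\mathbb{W}_k=\{\mathbb{W}_k(\vec i):\vec i\in\omega^{\not\downarrow k}\}\subseteq[\omega]^k$. An $\mathcal{E}_k$-tree is a function $\hat X:\omega^{\not\downarrow\le k}\to\widehat{\mathbb{W}}_k$ with (i) $|\hat X(\vec j_m)|=|\vec j_m|$; (ii) $\max\hat X(\vec j_m)<\max\hat X(\vec j_{m+1})$ for $m\ge1$; (iii) $\hat X(\vec j_m)$ is a proper initial segment of $\hat X(\vec j_n)$ (finite sets listed increasingly) iff $\vec j_m$ is a proper initial segment of $\vec j_n$. $\mathcal{E}_k$ is the set of restrictions $X=\hat X\restriction\omega^{\not\downarrow k}$ of $\mathcal{E}_k$-trees, each identified with its range $\subseteq\mathbb{W}_k\subseteq[\omega]^k$. Let $\mathcal{B}_k=\mathcal{G}_k\cap\mathcal{E}_k$. Projections: for $0\le l\le k$ and a finite set $w\subseteq\omega$ with at least $l$ elements, $\pi_l(w)$ is the set of the $l$ smallest elements of $w$ ($\pi_0(w)=\emptyset$); for a set $S$ of such $w$, $\pi_l(S)=\{\pi_l(w):w\in S\}$. $\pi_l(\mathcal{G}_k)$ denotes the filter on $\pi_l(\mathbb{W}_k)$ generated by $\{\pi_l(X):X\in\mathcal{B}_k\}$.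 Tukey order: for ultrafilters $\mathcal{U},\mathcal{V}$ (ordered by reverse inclusion), $\mathcal{V}\le_T\mathcal{U}$ iff there is $f:\mathcal{U}\to\mathcal{V}$ sending every filter base of $\mathcal{U}$ to a filter base of $\mathcal{V}$; $\mathcal{U}\equiv_T\mathcal{V}$ iff both $\mathcal{U}\le_T\mathcal{V}$ and $\mathcal{V}\le_T\mathcal{U}$.
   Formalization: The formal theorem assumes W_k ∈ G_k. For k ≥ 2 a generic may omit W_k; then B_k is empty, every π_l(G_k) is the trivial filter {π_l(W_k)}, and the claim fails for every nonprincipal V ≤_T G_k, such as a copy of G_k on ω. *)

theory Defs
  imports Main "HOL-Library.Sublist"
begin

section \<open>Forcing statements about an extension \<open>V[G]\<close>\<close>

text \<open>
  The ground model \<open>V\<close> is the universe of HOL. A notion of forcing is a preorder \<open>r\<close> on its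
  field; \<open>(q, p) \<in> r\<close> says that \<open>q\<close> extends \<open>p\<close>. Statements about \<open>V[G]\<close> are interpreted by the
  forcing relation: for a statement \<open>\<phi>\<close>, \<open>\<phi> r p\<close> means that \<open>p\<close> forces \<open>\<phi>\<close>. The clauses are the
  usual ones for the connectives and quantifiers, with disjunction, implication and existence
  taken as the classical abbreviations. ``\<open>\<phi>\<close> holds in \<open>V[G]\<close>'' means that every condition
  forces \<open>\<phi>\<close>.

  Quantifiers are typed. Over hereditarily finite objects (numbers, finite tuples, finite sets of
  numbers), which are the same in \<open>V\<close> and \<open>V[G]\<close>, they range over the ground model. Over subsets
  of such a collection, over families of such subsets, and over binary relations between such
  subsets, they range over all the objects of that kind that belong to \<open>V[G]\<close>, that is, over names.
\<close>

type_synonym 'p sentence = "'p rel \<Rightarrow> 'p \<Rightarrow> bool"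

definition holds_in_extension :: "'p rel \<Rightarrow> 'p sentence \<Rightarrow> bool" where
  "holds_in_extension r \<phi> \<longleftrightarrow> (\<forall>p\<in>Field r. \<phi> r p)"

definition dense_below :: "'p rel \<Rightarrow> 'p \<Rightarrow> ('p \<Rightarrow> bool) \<Rightarrow> bool" where
  "dense_below r p D \<longleftrightarrow> (\<forall>q. (q, p) \<in> r \<longrightarrow> (\<exists>q'. (q', q) \<in> r \<and> D q'))"

definition fground :: "bool \<Rightarrow> 'p sentence"  (\<open>\<guillemotleft>_\<guillemotright>\<close>) where
  "\<guillemotleft>b\<guillemotright> = (\<lambda>r p. b)"

definition fnot :: "'p sentence \<Rightarrow> 'p sentence"  (\<open>\<^bold>\<not> _\<close> [40] 40) where
  "(\<^bold>\<not> \<phi>) = (\<lambda>r p. \<forall>q. (q, p) \<in> r \<longrightarrow> \<not> \<phi> r q)"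

definition fand :: "'p sentence \<Rightarrow> 'p sentence \<Rightarrow> 'p sentence"  (infixr \<open>\<^bold>\<and>\<close> 35) where
  "(\<phi> \<^bold>\<and> \<psi>) = (\<lambda>r p. \<phi> r p \<and> \<psi> r p)"

definition fdisj :: "'p sentence \<Rightarrow> 'p sentence \<Rightarrow> 'p sentence"  (infixr \<open>\<^bold>\<or>\<close> 30) where
  "(\<phi> \<^bold>\<or> \<psi>) = (\<^bold>\<not> (\<^bold>\<not> \<phi> \<^bold>\<and> \<^bold>\<not> \<psi>))"

definition fimp :: "'p sentence \<Rightarrow> 'p sentence \<Rightarrow> 'p sentence"  (infixr \<open>\<^bold>\<longrightarrow>\<close> 25) where
  "(\<phi> \<^bold>\<longrightarrow> \<psi>) = (\<^bold>\<not> (\<phi> \<^bold>\<and> \<^bold>\<not> \<psi>))"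

definition fiff :: "'p sentence \<Rightarrow> 'p sentence \<Rightarrow> 'p sentence"  (infixr \<open>\<^bold>\<longleftrightarrow>\<close> 25) where
  "(\<phi> \<^bold>\<longleftrightarrow> \<psi>) = ((\<phi> \<^bold>\<longrightarrow> \<psi>) \<^bold>\<and> (\<psi> \<^bold>\<longrightarrow> \<phi>))"

definition fall :: "('a \<Rightarrow> 'p sentence) \<Rightarrow> 'p sentence"  (binder \<open>\<^bold>\<forall>\<close> 10) where
  "(\<^bold>\<forall>x. \<Phi> x) = (\<lambda>r p. \<forall>x. \<Phi> x r p)"

definition fex :: "('a \<Rightarrow> 'p sentence) \<Rightarrow> 'p sentence"  (binder \<open>\<^bold>\<exists>\<close> 10) where
  "(\<^bold>\<exists>x. \<Phi> x) = (\<^bold>\<not> (\<^bold>\<forall>x. \<^bold>\<not> \<Phi> x))"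

text \<open>
  A definable subset of the ground type \<open>'a\<close> is given by the statement ``\<open>a\<close> belongs to it'', a
  definable family of subsets by ``\<open>X\<close> belongs to it'', and similarly for binary relations.
\<close>

type_synonym ('a, 'p) iset = "'a \<Rightarrow> 'p sentence"
type_synonym ('a, 'p) ifam = "('a, 'p) iset \<Rightarrow> 'p sentence"
type_synonym ('a, 'b, 'p) irel = "('a, 'p) iset \<Rightarrow> ('b, 'p) iset \<Rightarrow> 'p sentence"

definition iset_eq :: "('a, 'p) iset \<Rightarrow> ('a, 'p) iset \<Rightarrow> 'p sentence"  (infix \<open>\<^bold>\<doteq>\<close> 50) where
  "(X \<^bold>\<doteq> Y) = (\<^bold>\<forall>a. X a \<^bold>\<longleftrightarrow> Y a)"

definition iset_subset :: "('a, 'p) iset \<Rightarrow> ('a, 'p) iset \<Rightarrow> 'p sentence"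
    (infix \<open>\<^bold>\<subseteq>\<close> 50) where
  "(X \<^bold>\<subseteq> Y) = (\<^bold>\<forall>a. X a \<^bold>\<longrightarrow> Y a)"

text \<open>
  Names are sets of pairs (name of an element, condition). Each set in \<open>V[G]\<close> of the type in
  question is the value of such a name. The clauses below are the standard forcing clause for
  ``\<open>x\<close> is an element of the value of the name''; pairs whose second component is not a condition
  have no effect.
\<close>

type_synonym ('a, 'p) set_name = "('a \<times> 'p) set"
type_synonym ('a, 'p) fam_name = "(('a, 'p) set_name \<times> 'p) set"
type_synonym ('a, 'b, 'p) rel_name = "((('a, 'p) set_name \<times> ('b, 'p) set_name) \<times> 'p) set"

definition val_set :: "('a, 'p) set_name \<Rightarrow> ('a, 'p) iset" where
  "val_set \<tau> = (\<lambda>a r p. dense_below r p (\<lambda>q. \<exists>s. (a, s) \<in> \<tau> \<and> (q, s) \<in> r))"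

definition val_fam :: "('a, 'p) fam_name \<Rightarrow> ('a, 'p) ifam" where
  "val_fam F = (\<lambda>X r p. dense_below r p
     (\<lambda>q. \<exists>\<tau> s. (\<tau>, s) \<in> F \<and> (q, s) \<in> r \<and> (X \<^bold>\<doteq> val_set \<tau>) r q))"

definition val_rel :: "('a, 'b, 'p) rel_name \<Rightarrow> ('a, 'b, 'p) irel" where
  "val_rel R = (\<lambda>X Y r p. dense_below r p
     (\<lambda>q. \<exists>\<tau> \<sigma> s. ((\<tau>, \<sigma>), s) \<in> R \<and> (q, s) \<in> r \<and>
            (X \<^bold>\<doteq> val_set \<tau>) r q \<and> (Y \<^bold>\<doteq> val_set \<sigma>) r q))"

definition fall_set :: "(('a, 'p) iset \<Rightarrow> 'p sentence) \<Rightarrow> 'p sentence"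
    (binder \<open>\<^bold>\<forall>\<^sub>S\<close> 10) where
  "(\<^bold>\<forall>\<^sub>S X. \<Phi> X) = (\<^bold>\<forall>\<tau>. \<Phi> (val_set \<tau>))"

definition fex_set :: "(('a, 'p) iset \<Rightarrow> 'p sentence) \<Rightarrow> 'p sentence"
    (binder \<open>\<^bold>\<exists>\<^sub>S\<close> 10) where
  "(\<^bold>\<exists>\<^sub>S X. \<Phi> X) = (\<^bold>\<exists>\<tau>. \<Phi> (val_set \<tau>))"

definition fall_fam :: "(('a, 'p) ifam \<Rightarrow> 'p sentence) \<Rightarrow> 'p sentence"
    (binder \<open>\<^bold>\<forall>\<^sub>F\<close> 10) where
  "(\<^bold>\<forall>\<^sub>F U. \<Phi> U) = (\<^bold>\<forall>F. \<Phi> (val_fam F))"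

definition fex_rel :: "(('a, 'b, 'p) irel \<Rightarrow> 'p sentence) \<Rightarrow> 'p sentence"
    (binder \<open>\<^bold>\<exists>\<^sub>R\<close> 10) where
  "(\<^bold>\<exists>\<^sub>R f. \<Phi> f) = (\<^bold>\<exists>R. \<Phi> (val_rel R))"

definition check_set :: "'a set \<Rightarrow> ('a, 'p) iset" where
  "check_set A = (\<lambda>a. \<guillemotleft>a \<in> A\<guillemotright>)"

definition iset_Int :: "('a, 'p) iset \<Rightarrow> ('a, 'p) iset \<Rightarrow> ('a, 'p) iset" where
  "iset_Int X Y = (\<lambda>a. X a \<^bold>\<and> Y a)"

definition iset_Compl :: "('a, 'p) iset \<Rightarrow> ('a, 'p) iset" where
  "iset_Compl X = (\<lambda>a. \<^bold>\<not> X a)"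

definition iset_image :: "('a \<Rightarrow> 'b) \<Rightarrow> ('a, 'p) iset \<Rightarrow> ('b, 'p) iset" where
  "iset_image f X = (\<lambda>b. \<^bold>\<exists>a. X a \<^bold>\<and> \<guillemotleft>b = f a\<guillemotright>)"


section \<open>Ultrafilters and the Tukey order in \<open>V[G]\<close>\<close>

definition ultrafilter_on_omega :: "(nat, 'p) ifam \<Rightarrow> 'p sentence" where
  "ultrafilter_on_omega U =
     (U (check_set UNIV) \<^bold>\<and>
      \<^bold>\<not> U (check_set {}) \<^bold>\<and>
      (\<^bold>\<forall>\<^sub>S X. \<^bold>\<forall>\<^sub>S Y. U X \<^bold>\<and> U Y \<^bold>\<longrightarrow> U (iset_Int X Y)) \<^bold>\<and>
      (\<^bold>\<forall>\<^sub>S X. \<^bold>\<forall>\<^sub>S Y. U X \<^bold>\<and> X \<^bold>\<subseteq> Y \<^bold>\<longrightarrow> U Y) \<^bold>\<and>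
      (\<^bold>\<forall>\<^sub>S X. U X \<^bold>\<or> U (iset_Compl X)))"

definition nonprincipal :: "('a, 'p) ifam \<Rightarrow> 'p sentence" where
  "nonprincipal U = (\<^bold>\<forall>n. \<^bold>\<not> U (check_set {n}))"

definition filter_base_of :: "('a, 'p) ifam \<Rightarrow> ('a, 'p) ifam \<Rightarrow> 'p sentence" where
  "filter_base_of B U =
     ((\<^bold>\<forall>\<^sub>S X. B X \<^bold>\<longrightarrow> U X) \<^bold>\<and> (\<^bold>\<forall>\<^sub>S X. U X \<^bold>\<longrightarrow> (\<^bold>\<exists>\<^sub>S Y. B Y \<^bold>\<and> Y \<^bold>\<subseteq> X)))"

definition function_from_to ::
    "('a, 'b, 'p) irel \<Rightarrow> ('a, 'p) ifam \<Rightarrow> ('b, 'p) ifam \<Rightarrow> 'p sentence" where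
  "function_from_to f U V =
     ((\<^bold>\<forall>\<^sub>S X. \<^bold>\<forall>\<^sub>S Y. f X Y \<^bold>\<longrightarrow> U X \<^bold>\<and> V Y) \<^bold>\<and>
      (\<^bold>\<forall>\<^sub>S X. U X \<^bold>\<longrightarrow> (\<^bold>\<exists>\<^sub>S Y. f X Y)) \<^bold>\<and>
      (\<^bold>\<forall>\<^sub>S X. \<^bold>\<forall>\<^sub>S Y. \<^bold>\<forall>\<^sub>S Z. f X Y \<^bold>\<and> f X Z \<^bold>\<longrightarrow> Y \<^bold>\<doteq> Z))"

definition fam_image :: "('a, 'b, 'p) irel \<Rightarrow> ('a, 'p) ifam \<Rightarrow> ('b, 'p) ifam" where
  "fam_image f B = (\<lambda>Y. \<^bold>\<exists>\<^sub>S X. B X \<^bold>\<and> f X Y)"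

definition tukey_le :: "('b, 'p) ifam \<Rightarrow> ('a, 'p) ifam \<Rightarrow> 'p sentence"
    (infix \<open>\<^bold>\<le>\<^sub>T\<close> 50) where
  "(V \<^bold>\<le>\<^sub>T U) =
     (\<^bold>\<exists>\<^sub>R f. function_from_to f U V \<^bold>\<and>
       (\<^bold>\<forall>\<^sub>F B. filter_base_of B U \<^bold>\<longrightarrow> filter_base_of (fam_image f B) V))"

definition tukey_equiv :: "('b, 'p) ifam \<Rightarrow> ('a, 'p) ifam \<Rightarrow> 'p sentence"
    (infix \<open>\<^bold>\<equiv>\<^sub>T\<close> 50) where
  "(V \<^bold>\<equiv>\<^sub>T U) = (V \<^bold>\<le>\<^sub>T U \<^bold>\<and> U \<^bold>\<le>\<^sub>T V)"


section \<open>The forcing \<open>P(\<omega>\<^sup>k)/Fin\<^sup>\<otimes>\<^sup>k\<close> and its generic ultrafilter\<close>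

definition tuples :: "nat \<Rightarrow> nat list set" where
  "tuples k = {xs. length xs = k}"

text \<open>The value at \<open>0\<close> is a dummy.\<close>

fun fin_ideal :: "nat \<Rightarrow> nat list set set" where
  "fin_ideal 0 = {{}}"
| "fin_ideal (Suc 0) = {X. X \<subseteq> tuples 1 \<and> finite X}"
| "fin_ideal (Suc (Suc k)) =
     {X. X \<subseteq> tuples (Suc (Suc k)) \<and> finite {i. {js. i # js \<in> X} \<notin> fin_ideal (Suc k)}}"

definition fin_equiv :: "nat \<Rightarrow> nat list set rel" where
  "fin_equiv k = {(X, Y). X \<subseteq> tuples k \<and> Y \<subseteq> tuples k \<and> (X - Y) \<union> (Y - X) \<in> fin_ideal k}"

definition fin_class :: "nat \<Rightarrow> nat list set \<Rightarrow> nat list set set" where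
  "fin_class k X = fin_equiv k `` {X}"

text \<open>The nonzero elements of the quotient algebra, with its order.\<close>

definition pow_mod_fin :: "nat \<Rightarrow> nat list set set rel" where
  "pow_mod_fin k = {(fin_class k X, fin_class k Y) | X Y.
     X \<in> Pow (tuples k) - fin_ideal k \<and> Y \<in> Pow (tuples k) - fin_ideal k \<and>
     X - Y \<in> fin_ideal k}"

text \<open>The name \<open>{(X, [X]) | X}\<close>: in \<open>V[G]\<close>, a set is in \<open>\<G>\<^sub>k\<close> iff it is some ground model
  \<open>X \<subseteq> \<omega>\<^sup>k\<close> whose class belongs to the generic filter.\<close>

definition generic_ultrafilter :: "nat \<Rightarrow> (nat list, nat list set set) ifam" where
  "generic_ultrafilter k =
     val_fam {(X \<times> UNIV, fin_class k X) | X. X \<in> Pow (tuples k) - fin_ideal k}"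


section \<open>The space \<open>\<E>\<^sub>k\<close>\<close>

definition nondec_upto :: "nat \<Rightarrow> nat list set" where
  "nondec_upto k = {js. sorted js \<and> length js \<le> k}"

definition nondec :: "nat \<Rightarrow> nat list set" where
  "nondec k = {js. sorted js \<and> length js = k}"

text \<open>In \<^const>\<open>lexord\<close> a proper initial segment counts as below.\<close>

definition seq_prec :: "nat list \<Rightarrow> nat list \<Rightarrow> bool"  (infix \<open>\<prec>\<close> 50) where
  "js \<prec> ls \<longleftrightarrow> ls \<noteq> [] \<and>
     (js = [] \<or> last js < last ls \<or> (last js = last ls \<and> (js, ls) \<in> lexord less_than))"

text \<open>\<open>seq_index k js\<close> is \<open>m\<^bsub>js\<^esub>\<close>, and \<open>seq_enum k m\<close> is the \<open>m\<close>-th element of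
  \<open>nondec_upto k\<close>, counting from \<open>0\<close>.\<close>

definition seq_index :: "nat \<Rightarrow> nat list \<Rightarrow> nat" where
  "seq_index k ls = card {js \<in> nondec_upto k. js \<prec> ls}"

definition seq_enum :: "nat \<Rightarrow> nat \<Rightarrow> nat list" where
  "seq_enum k m = inv_into (nondec_upto k) (seq_index k) m"

definition W_of :: "nat \<Rightarrow> nat list \<Rightarrow> nat set" where
  "W_of k js = {seq_index k (take q js) | q. 1 \<le> q \<and> q \<le> length js}"

definition W_hat :: "nat \<Rightarrow> nat set set" where
  "W_hat k = W_of k ` nondec_upto k"

definition W_max :: "nat \<Rightarrow> nat set set" where
  "W_max k = W_of k ` nondec k"

definition proper_initial_segment :: "nat set \<Rightarrow> nat set \<Rightarrow> bool" where
  "proper_initial_segment v w \<longleftrightarrow>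
     strict_prefix (sorted_list_of_set v) (sorted_list_of_set w)"

text \<open>A function in \<open>V[G]\<close> from sequences to finite sets is given by its graph \<open>T\<close>.\<close>

definition is_E_tree :: "nat \<Rightarrow> (nat list \<times> nat set, 'p) iset \<Rightarrow> 'p sentence" where
  "is_E_tree k T =
     ((\<^bold>\<forall>js. \<^bold>\<forall>w. T (js, w) \<^bold>\<longrightarrow> \<guillemotleft>js \<in> nondec_upto k \<and> w \<in> W_hat k\<guillemotright>) \<^bold>\<and>
      (\<^bold>\<forall>js. \<guillemotleft>js \<in> nondec_upto k\<guillemotright> \<^bold>\<longrightarrow> (\<^bold>\<exists>w. T (js, w))) \<^bold>\<and>
      (\<^bold>\<forall>js. \<^bold>\<forall>v. \<^bold>\<forall>w. T (js, v) \<^bold>\<and> T (js, w) \<^bold>\<longrightarrow> \<guillemotleft>v = w\<guillemotright>) \<^bold>\<and>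
      (\<^bold>\<forall>m. \<^bold>\<forall>w. T (seq_enum k m, w) \<^bold>\<longrightarrow> \<guillemotleft>card w = length (seq_enum k m)\<guillemotright>) \<^bold>\<and>
      (\<^bold>\<forall>m. \<^bold>\<forall>v. \<^bold>\<forall>w. \<guillemotleft>1 \<le> m\<guillemotright> \<^bold>\<and> T (seq_enum k m, v) \<^bold>\<and> T (seq_enum k (Suc m), w)
         \<^bold>\<longrightarrow> \<guillemotleft>Max v < Max w\<guillemotright>) \<^bold>\<and>
      (\<^bold>\<forall>m. \<^bold>\<forall>n. \<^bold>\<forall>v. \<^bold>\<forall>w. T (seq_enum k m, v) \<^bold>\<and> T (seq_enum k n, w) \<^bold>\<longrightarrow>
         \<guillemotleft>proper_initial_segment v w \<longleftrightarrow> strict_prefix (seq_enum k m) (seq_enum k n)\<guillemotright>))"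

text \<open>Elements of \<open>\<E>\<^sub>k\<close>, identified with their ranges.\<close>

definition E_space :: "nat \<Rightarrow> (nat set, 'p) ifam" where
  "E_space k = (\<lambda>X. \<^bold>\<exists>\<^sub>S T. is_E_tree k T \<^bold>\<and>
     (\<^bold>\<forall>w. X w \<^bold>\<longleftrightarrow> (\<^bold>\<exists>js. \<guillemotleft>js \<in> nondec k\<guillemotright> \<^bold>\<and> T (js, w))))"

text \<open>A set of \<open>k\<close>-element sets of numbers is identified with the set of the corresponding
  strictly increasing \<open>k\<close>-tuples by \<^const>\<open>sorted_list_of_set\<close>.\<close>

definition mem_generic :: "nat \<Rightarrow> (nat set, nat list set set) ifam" where
  "mem_generic k = (\<lambda>X. generic_ultrafilter k (iset_image sorted_list_of_set X))"

text \<open>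
  For \<open>k \<ge> 2\<close> both \<open>\<W>\<^sub>k\<close> and its complement in \<open>\<omega>\<^sup>k\<close> are positive, so the trivial condition does not
  decide whether \<open>\<W>\<^sub>k \<in> \<G>\<^sub>k\<close>. Since members of \<open>\<E>\<^sub>k\<close> are subsets of \<open>\<W>\<^sub>k\<close>, the family
  \<open>\<B>\<^sub>k = \<G>\<^sub>k \<inter> \<E>\<^sub>k\<close> is empty if \<open>\<W>\<^sub>k \<notin> \<G>\<^sub>k\<close>; using it as a base of \<open>\<G>\<^sub>k\<close> presupposes
  \<open>\<W>\<^sub>k \<in> \<G>\<^sub>k\<close>.
\<close>

definition B_generic :: "nat \<Rightarrow> (nat set, nat list set set) ifam" where
  "B_generic k = (\<lambda>X. mem_generic k X \<^bold>\<and> E_space k X)"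


section \<open>Projections\<close>

definition proj :: "nat \<Rightarrow> nat set \<Rightarrow> nat set" where
  "proj l w = set (take l (sorted_list_of_set w))"

text \<open>The filter on \<open>A\<close> generated by \<open>S\<close>: the subsets of \<open>A\<close> that contain the intersection (within
  \<open>A\<close>) of finitely many members of \<open>S\<close>. The finite sequence \<open>X 0, \<dots>, X (n - 1)\<close> of sets in
  \<open>V[G]\<close> is coded by one set of pairs.\<close>

definition generated_filter :: "'a set \<Rightarrow> ('a, 'p) ifam \<Rightarrow> ('a, 'p) ifam" where
  "generated_filter A S = (\<lambda>Y. Y \<^bold>\<subseteq> check_set A \<^bold>\<and>
     (\<^bold>\<exists>n::nat. \<^bold>\<exists>\<^sub>S X. (\<^bold>\<forall>i. \<guillemotleft>i < n\<guillemotright> \<^bold>\<longrightarrow> S (\<lambda>a. X (i, a))) \<^bold>\<and>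
       (\<^bold>\<forall>a. \<guillemotleft>a \<in> A\<guillemotright> \<^bold>\<and> (\<^bold>\<forall>i. \<guillemotleft>i < n\<guillemotright> \<^bold>\<longrightarrow> X (i, a)) \<^bold>\<longrightarrow> Y a)))"

definition proj_generic :: "nat \<Rightarrow> nat \<Rightarrow> (nat set, nat list set set) ifam" where
  "proj_generic k l = generated_filter (proj l ` W_max k)
     (\<lambda>Y. \<^bold>\<exists>\<^sub>S X. B_generic k X \<^bold>\<and> Y \<^bold>\<doteq> iset_image (proj l) X)"

end

theory Submission
  imports Defs "HOL-Library.Infinite_Set" "HOL-Library.Nat_Bijection" "HOL-Library.Countable_Set"
begin

text \<open>
  The nondecreasing sequences of length at most \<open>k\<close>, numbered by \<open>\<prec>\<close>, form a tree on \<open>\<omega>\<close> in which all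
  nodes below level \<open>k\<close> branch infinitely. A set of leaves is positive iff it contains the leaves of a
  perfect subtree, so that perfect subtrees are dense among the conditions that force \<open>\<W>\<^sub>k \<in> \<G>\<^sub>k\<close>. No
  subsets of \<open>\<omega>\<close> are added; hence a Tukey map from \<open>\<G>\<^sub>k\<close> to \<open>\<V>\<close> acts on ground model sets.

  By fusion, below some condition the map is given by a well-founded game: a play enumerates a subtree
  of a perfect tree \<open>Y\<close> node by node until some number \<open>n\<close> cannot be kept out of the images of subsets of
  the tree, and then outputs \<open>n\<close>. The sets \<open>S Y\<close> of all outputs of plays in \<open>Y\<close> generate \<open>\<V>\<close>. After
  shrinking, at each position the possible moves are either separated (they lead to pairwise disjoint
  sets of outputs) or mixed (these sets always meet). Prescribing one move at each mixed position leaves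
  a set \<open>h Y\<close> of outputs that still meets \<open>S Z\<close> for all \<open>Z \<subseteq> Y\<close>, so the sets \<open>h Y\<close> generate \<open>\<V>\<close> too.
  Below a node that was created by a mixed move, no separated move ever occurs. So if \<open>l\<close> is the
  highest level on which separated moves cannot be avoided, \<open>h Y\<close> depends only on the levels of \<open>Y\<close> up to
  \<open>l\<close>, and conversely every element of \<open>h Y\<close> determines a node of \<open>Y\<close> on level \<open>l\<close>. These two dependencies
  are the Tukey maps between \<open>\<V>\<close> and \<open>\<pi>\<^sub>l(\<G>\<^sub>k)\<close>.
\<close>

section \<open>Fan trees and fusion\<close>

text \<open>The rule that every move exceeds all previous nodes shapes the proof. It makes fusion
  possible: a stage has to treat only the finitely many subtrees whose maximum is the new node, and
  their cones contain no other nodes up to that maximum. It also makes a play blind to the nodes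
  that it has passed over, so that a subtree can be attached for one move without affecting the
  outputs after later moves.

  The obstacle is that a projection knows only the levels up to \<open>l\<close>, whereas a play
  also chooses nodes on higher levels. There, after shrinking, the choices are mixed: outputs do not
  tell the moves apart. Prescribing such a move is harmless because outputs can be decided: some
  perfect subset has all its outputs in a given set or none of them. So outputs that meet a set in
  every subtree can be shrunk into it, and one move can stand for all the others.

  The bar that ends the plays has a simple source: an infinite play would enumerate a perfect tree
  that keeps every number out of the images, but images are members of \<open>\<V>\<close> and hence
  nonempty.\<close>

lemma dependent_choice_from:
  assumes "good P0" "\<And>P n. good P \<Longrightarrow> \<exists>P'. good P' \<and> rel n P P'"
  shows "\<exists>f. f 0 = P0 \<and> (\<forall>n. good (f n) \<and> rel n (f n) (f (Suc n)))"
proof -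
  have "\<exists>f. \<forall>n. (good (f n) \<and> (n = 0 \<longrightarrow> f n = P0)) \<and> rel n (f n) (f (Suc n))"
    by (rule dependent_nat_choice) (use assms in auto)
  then show ?thesis by blast
qed

text \<open>The root is its own parent, so that closure under \<open>par\<close> needs no exception
  for it. For the same reason 0 is explicitly excluded from sets of children.\<close>

locale fan_tree =
  fixes k :: nat and par lev :: "nat \<Rightarrow> nat"
  assumes k_pos: "0 < k" and par_0: "par 0 = 0" and lev_0: "lev 0 = 0"
    and par_less: "0 < m \<Longrightarrow> par m < m"
    and lev_par: "0 < m \<Longrightarrow> lev m = Suc (lev (par m))"
    and lev_le: "lev m \<le> k"
    and infinite_children: "lev s < k \<Longrightarrow> infinite {m. 0 < m \<and> par m = s}"
begin

definition ch :: "nat \<Rightarrow> nat set" where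
  "ch s = {m. 0 < m \<and> par m = s}"

definition perfect :: "nat set \<Rightarrow> bool" where
  "perfect X \<longleftrightarrow> 0 \<in> X \<and> par ` X \<subseteq> X \<and> (\<forall>s\<in>X. lev s < k \<longrightarrow> infinite (X \<inter> ch s))"

definition fincl :: "nat set \<Rightarrow> bool" where
  "fincl A \<longleftrightarrow> finite A \<and> 0 \<in> A \<and> par ` A \<subseteq> A"

inductive_set grow :: "nat set \<Rightarrow> nat set \<Rightarrow> nat set" for U B where
  base: "b \<in> B \<Longrightarrow> b \<in> grow U B"
| step: "\<lbrakk>u \<in> U; 0 < u; par u \<in> grow U B\<rbrakk> \<Longrightarrow> u \<in> grow U B"

text \<open>In a play from the position \<open>A\<close> every new node exceeds all the previous ones; \<open>cone A\<close> contains
  all the nodes that can occur in such a play.\<close>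

definition cone :: "nat set \<Rightarrow> nat set" where
  "cone A = grow {Max A<..} A"

lemma ch_D: "m \<in> ch s \<Longrightarrow> 0 < m" "m \<in> ch s \<Longrightarrow> par m = s" "m \<in> ch s \<Longrightarrow> s < m"
  "m \<in> ch s \<Longrightarrow> lev m = Suc (lev s)"
  using par_less lev_par by (auto simp: ch_def)

lemma fincl_D: "fincl A \<Longrightarrow> finite A" "fincl A \<Longrightarrow> 0 \<in> A" "fincl A \<Longrightarrow> u \<in> A \<Longrightarrow> par u \<in> A"
  by (auto simp: fincl_def)

lemma fincl_Max: "fincl A \<Longrightarrow> u \<in> A \<Longrightarrow> u \<le> Max A" "fincl A \<Longrightarrow> Max A \<in> A"
  by (auto simp: fincl_def intro: Max_in)

lemma fincl_Max_mono: "fincl A \<Longrightarrow> fincl B \<Longrightarrow> A \<subseteq> B \<Longrightarrow> Max A \<le> Max B"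
  using fincl_Max by blast

lemma fincl_insert: "fincl A \<Longrightarrow> s \<in> A \<Longrightarrow> m \<in> ch s \<Longrightarrow> fincl (insert m A)"
  by (auto simp: fincl_def ch_def)

lemma Max_insert_gt: "fincl A \<Longrightarrow> Max A < m \<Longrightarrow> Max (insert m A) = m"
  by (subst Max_insert) (auto simp: fincl_def)

lemma fincl_0: "fincl {0}"
  by (auto simp: fincl_def par_0)

lemma perfect_D: "perfect X \<Longrightarrow> 0 \<in> X" "perfect X \<Longrightarrow> u \<in> X \<Longrightarrow> par u \<in> X"
  "perfect X \<Longrightarrow> s \<in> X \<Longrightarrow> lev s < k \<Longrightarrow> infinite (X \<inter> ch s)"
  by (auto simp: perfect_def)

lemma perfect_UNIV: "perfect UNIV"
  using infinite_children by (auto simp: perfect_def ch_def)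

section \<open>Growing subtrees, and cones of positions\<close>

lemma grow_subset: "grow U B \<subseteq> U \<union> B"
  by (auto elim: grow.cases)

lemma grow_mono: "U \<subseteq> U' \<Longrightarrow> B \<subseteq> grow U' B' \<Longrightarrow> grow U B \<subseteq> grow U' B'"
proof
  fix u assume "U \<subseteq> U'" "B \<subseteq> grow U' B'" "u \<in> grow U B"
  from this(3) show "u \<in> grow U' B'"
    by induction (use \<open>U \<subseteq> U'\<close> \<open>B \<subseteq> grow U' B'\<close> in \<open>auto intro: grow.intros\<close>)
qed

lemma base_subset_grow: "B \<subseteq> grow U B"
  by (auto intro: grow.base)

lemma perfect_grow:
  assumes "0 \<in> grow U B" "\<And>b. b \<in> B \<Longrightarrow> par b \<in> grow U B"
    and "\<And>s. s \<in> grow U B \<Longrightarrow> lev s < k \<Longrightarrow> infinite (U \<inter> ch s)"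
  shows "perfect (grow U B)"
  unfolding perfect_def
proof (intro conjI ballI impI)
  show "par ` grow U B \<subseteq> grow U B"
    using assms(2) by (auto elim: grow.cases)
  fix s assume s: "s \<in> grow U B" "lev s < k"
  have "U \<inter> ch s \<subseteq> grow U B \<inter> ch s"
    using s by (auto intro: grow.step simp: ch_def)
  then show "infinite (grow U B \<inter> ch s)"
    using assms(3)[OF s] infinite_super by blast
qed (use assms in auto)

lemma infinite_Int_greaterThan: "infinite (X :: nat set) \<Longrightarrow> infinite ({d<..} \<inter> X)"
proof
  assume "infinite X" "finite ({d<..} \<inter> X)"
  moreover have "X \<subseteq> {..d} \<union> ({d<..} \<inter> X)" by auto
  ultimately show False
    by (meson finite_Un finite_atMost finite_subset)
qed

lemma cone_base: "A \<subseteq> cone A"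
  by (auto simp: cone_def intro: grow.base)

lemma cone_gt: "u \<in> cone A \<Longrightarrow> u \<notin> A \<Longrightarrow> Max A < u \<and> 0 < u \<and> par u \<in> cone A"
  by (auto simp: cone_def elim: grow.cases)

lemma cone_step: "par u \<in> cone A \<Longrightarrow> Max A < u \<Longrightarrow> u \<in> cone A"
  by (auto simp: cone_def intro: grow.step)

lemma perfect_Int_cone:
  assumes "perfect X" "fincl A" "A \<subseteq> X"
  shows "perfect (X \<inter> cone A)"
  unfolding perfect_def
proof (intro conjI ballI impI)
  show "0 \<in> X \<inter> cone A" using assms cone_base fincl_D(2) by blast
  show "par ` (X \<inter> cone A) \<subseteq> X \<inter> cone A"
  proof (rule image_subsetI)
    fix u assume u: "u \<in> X \<inter> cone A"
    have "par u \<in> cone A"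
    proof (cases "u \<in> A")
      case True
      then show ?thesis using fincl_D(3)[OF assms(2)] cone_base by blast
    next
      case False
      then show ?thesis using u cone_gt by blast
    qed
    then show "par u \<in> X \<inter> cone A" using u assms(1) perfect_D(2) by blast
  qed
  fix s assume s: "s \<in> X \<inter> cone A" "lev s < k"
  have "infinite ({Max A<..} \<inter> (X \<inter> ch s))"
    using s assms(1) by (intro infinite_Int_greaterThan) (auto simp: perfect_def)
  moreover have "{Max A<..} \<inter> (X \<inter> ch s) \<subseteq> X \<inter> cone A \<inter> ch s"
    using s by (auto simp: ch_def intro: cone_step)
  ultimately show "infinite (X \<inter> cone A \<inter> ch s)"
    using infinite_super by blast
qed

lemma cone_insert:
  assumes "fincl A" "s \<in> A" "m \<in> ch s" "Max A < m"
  shows "cone (insert m A) \<subseteq> cone A"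
proof -
  have "par m \<in> cone A" using assms(2,3) cone_base ch_D(2) by blast
  then have m: "m \<in> cone A" using assms(4) by (rule cone_step)
  have "grow {m<..} (insert m A) \<subseteq> grow {Max A<..} A"
    by (rule grow_mono) (use m assms(4) cone_base[of A] in \<open>auto simp: cone_def\<close>)
  then show ?thesis
    unfolding cone_def Max_insert_gt[OF assms(1,4)] .
qed

text \<open>The part of \<open>X\<close> in \<open>cone A\<close> is replaced by that of \<open>X'\<close>.\<close>

lemma perfect_graft:
  assumes "perfect X" "perfect X'" "fincl A" "A \<subseteq> X'" "X' \<subseteq> X"
  shows "perfect (X - (cone A - X'))"
  unfolding perfect_def
proof (intro conjI ballI impI)
  show "0 \<in> X - (cone A - X')" using assms perfect_D(1) by auto
  show "par ` (X - (cone A - X')) \<subseteq> X - (cone A - X')"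
  proof (rule image_subsetI)
    fix u assume u: "u \<in> X - (cone A - X')"
    show "par u \<in> X - (cone A - X')"
    proof (rule ccontr)
      assume "par u \<notin> X - (cone A - X')"
      then have v: "par u \<in> cone A" "par u \<notin> X'" using u assms(1) perfect_D(2) by auto
      then have "par u \<notin> A" using assms by auto
      then have "Max A < par u" "0 < par u" using cone_gt v by auto
      moreover have "par u < u" using par_0 par_less \<open>0 < par u\<close> by (metis gr0I)
      ultimately have "u \<in> cone A" using v cone_step by auto
      then show False using u v assms perfect_D(2) by auto
    qed
  qed
  fix s assume s: "s \<in> X - (cone A - X')" "lev s < k"
  show "infinite ((X - (cone A - X')) \<inter> ch s)"
  proof (cases "s \<in> X'")
    case True
    then have "infinite (X' \<inter> ch s)" using assms s perfect_D(3) by auto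
    then show ?thesis using assms(5) by (elim infinite_super[rotated]) auto
  next
    case False
    have "infinite (X \<inter> ch s)" using assms s perfect_D(3) by auto
    moreover have "X \<inter> ch s \<subseteq> (X - (cone A - X')) \<inter> ch s"
    proof safe
      fix u assume u: "u \<in> ch s" "u \<in> cone A" "u \<notin> X'"
      then have "par u \<in> cone A" using assms(4) cone_gt by blast
      then show False using u s False ch_D(2) by auto
    qed
    ultimately show ?thesis using infinite_super by blast
  qed
qed

text \<open>The members of \<open>\<A>\<close> have the common maximum \<open>d\<close>. So
  \<open>cone A\<close> meets \<open>{..d}\<close> only in \<open>A\<close>, and a graft inside one
  cone keeps all nodes up to \<open>d\<close>, in particular the other members of
  \<open>\<A>\<close>. Locality preserves the instances of \<open>\<Phi>\<close> achieved
  before.\<close>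

lemma shrink_finitely_many:
  assumes local: "\<And>A X X'. \<lbrakk>fincl A; perfect X; perfect X'; A \<subseteq> X; A \<subseteq> X'; X' \<inter> cone A \<subseteq> X; \<Phi> A X\<rbrakk> \<Longrightarrow> \<Phi> A X'"
    and dense: "\<And>A X. \<lbrakk>A \<in> \<A>; perfect X; A \<subseteq> X; X \<subseteq> X0\<rbrakk> \<Longrightarrow> \<exists>X'\<subseteq>X. perfect X' \<and> A \<subseteq> X' \<and> \<Phi> A X'"
    and "finite \<A>" "\<And>A. A \<in> \<A> \<Longrightarrow> fincl A \<and> Max A = d \<and> A \<subseteq> X0" "perfect X0"
  shows "\<exists>X'\<subseteq>X0. perfect X' \<and> X0 \<inter> {..d} \<subseteq> X' \<and> (\<forall>A\<in>\<A>. \<Phi> A X')"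
  using assms(3) subset_refl[of \<A>]
proof (induction rule: finite_subset_induct')
  case empty
  then show ?case using assms(5) by auto
next
  case (insert A \<B>)
  then obtain X1 where X1: "X1 \<subseteq> X0" "perfect X1" "X0 \<inter> {..d} \<subseteq> X1" "\<forall>A\<in>\<B>. \<Phi> A X1" by blast
  have A: "fincl A" "Max A = d" "A \<subseteq> X0" using assms(4) insert by auto
  have low: "B \<subseteq> X0 \<inter> {..d}" if "B \<in> \<A>" for B
    using assms(4)[OF that] fincl_Max(1)[of B] by auto
  have AX1: "B \<subseteq> X1" if "B \<in> \<A>" for B
    using low[OF that] X1(3) by (rule subset_trans)
  obtain X' where X': "X' \<subseteq> X1" "perfect X'" "A \<subseteq> X'" "\<Phi> A X'"
    using dense[OF insert(2) X1(2) AX1[OF insert(2)] X1(1)] by blast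
  define X2 where "X2 = X1 - (cone A - X')"
  have p: "perfect X2" unfolding X2_def by (rule perfect_graft) (use X1 X' A in auto)
  have s: "X2 \<subseteq> X0" using X1 by (auto simp: X2_def)
  have d: "X0 \<inter> {..d} \<subseteq> X2"
  proof
    fix u assume u: "u \<in> X0 \<inter> {..d}"
    then have "u \<in> cone A \<Longrightarrow> u \<in> A" using cone_gt[of u A] A(2) by auto
    then show "u \<in> X2" using u X'(3) X1(3) by (auto simp: X2_def)
  qed
  have sub: "B \<subseteq> X2" if "B \<in> \<A>" for B
    using low[OF that] d by (rule subset_trans)
  have "\<Phi> A X2"
  proof (rule local[of A X'])
    show "A \<subseteq> X2" using sub[OF insert(2)] .
    show "X2 \<inter> cone A \<subseteq> X'" by (auto simp: X2_def)
  qed (use A p X' in simp_all)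
  moreover have "\<Phi> B X2" if "B \<in> \<B>" for B
  proof (rule local[of B X1])
    have B: "B \<in> \<A>" using that insert by auto
    show "fincl B" "B \<subseteq> X2" "B \<subseteq> X1" using B assms(4) sub AX1 by blast+
    show "X2 \<inter> cone B \<subseteq> X1" by (auto simp: X2_def)
  qed (use that p X1 in auto)
  ultimately show ?case using p s d by (intro exI[of _ X2]) simp
qed

text \<open>Every node of the limit is served infinitely often by the bookkeeping
  \<^term>\<open>fst (prod_decode n)\<close>, so that the limit is perfect again.\<close>

lemma fusion:
  assumes X0: "perfect X0" and A0: "fincl A0" "A0 \<subseteq> X0"
    and local: "\<And>A X X'. \<lbrakk>fincl A; perfect X; perfect X'; A \<subseteq> X; A \<subseteq> X'; X' \<inter> cone A \<subseteq> X; \<Phi> A X\<rbrakk> \<Longrightarrow> \<Phi> A X'"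
    and dense: "\<And>A X. \<lbrakk>fincl A; A0 \<subseteq> A; \<forall>u\<in>A - A0. Max A0 < u; perfect X; A \<subseteq> X; X \<subseteq> X0\<rbrakk>
      \<Longrightarrow> \<exists>X'\<subseteq>X. perfect X' \<and> A \<subseteq> X' \<and> \<Phi> A X'"
  obtains Y where "Y \<subseteq> X0" "perfect Y" "A0 \<subseteq> Y" "\<And>u. u \<in> Y - A0 \<Longrightarrow> Max A0 < u"
    "\<And>A. \<lbrakk>fincl A; A0 \<subseteq> A; A \<subseteq> Y\<rbrakk> \<Longrightarrow> \<Phi> A Y"
proof -
  define good where "good P \<longleftrightarrow> (case P of (B, X) \<Rightarrow> fincl B \<and> perfect X \<and> B \<subseteq> X \<and> X \<subseteq> X0 \<and> A0 \<subseteq> B \<and> (\<forall>u\<in>B - A0. Max A0 < u))"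
    for P
  \<comment> \<open>The root stands in if the scheduled node is not yet present or is a leaf: every
    stage has to extend some node.\<close>
  define tgt where "tgt n B = (let s = fst (prod_decode n) in if s \<in> B \<and> lev s < k then s else 0)" for n B
  define rel where "rel n P P' \<longleftrightarrow> (case (P, P') of ((B, X), (B', X')) \<Rightarrow>
      (\<exists>m\<in>ch (tgt n B). Max B < m \<and> B' = insert m B \<and> X' \<subseteq> X \<and>
        (\<forall>A. fincl A \<and> A0 \<subseteq> A \<and> A \<subseteq> B' \<and> Max A = m \<longrightarrow> \<Phi> A X')))" for n P P'
  \<comment> \<open>\<open>A0\<close> is treated in advance, since a stage treats only subtrees that
    contain its new node.\<close>
  obtain X1 where X1: "X1 \<subseteq> X0" "perfect X1" "A0 \<subseteq> X1" "\<Phi> A0 X1"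
    using dense[of A0 X0] X0 A0 by auto
  have "\<exists>f. f 0 = (A0, X1) \<and> (\<forall>n. good (f n) \<and> rel n (f n) (f (Suc n)))"
  proof (rule dependent_choice_from)
    show "good (A0, X1)" using X1 A0 by (auto simp: good_def)
    fix P n assume P: "good P"
    obtain B X where BX: "P = (B, X)" by force
    have g: "fincl B" "perfect X" "B \<subseteq> X" "X \<subseteq> X0" "A0 \<subseteq> B" "\<forall>u\<in>B - A0. Max A0 < u"
      using P by (auto simp: good_def BX)
    have t: "tgt n B \<in> B" "lev (tgt n B) < k"
      using g fincl_D(2) k_pos lev_0 by (auto simp: tgt_def Let_def)
    then have "infinite (X \<inter> ch (tgt n B))"
      using g perfect_D(3) by auto
    then obtain m where m: "Max B < m" "m \<in> X" "m \<in> ch (tgt n B)"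
      unfolding infinite_nat_iff_unbounded by blast
    define B' where "B' = insert m B"
    have B': "fincl B'" "B' \<subseteq> X" "Max B' = m"
      using g m t fincl_insert Max_insert_gt by (auto simp: B'_def)
    have gt: "\<forall>u\<in>B' - A0. Max A0 < u"
      using g m fincl_Max[of A0] A0 fincl_Max(1)[OF g(1), of "Max A0"] by (auto simp: B'_def)
    \<comment> \<open>Subtrees with a smaller maximum were treated at earlier stages.\<close>
    define \<A> where "\<A> = {A. fincl A \<and> A0 \<subseteq> A \<and> A \<subseteq> B' \<and> Max A = m}"
    have "\<exists>X'\<subseteq>X. perfect X' \<and> X \<inter> {..m} \<subseteq> X' \<and> (\<forall>A\<in>\<A>. \<Phi> A X')"
    proof (rule shrink_finitely_many)
      show "finite \<A>"
        using B'(1) by (intro finite_subset[of \<A> "Pow B'"]) (auto simp: \<A>_def fincl_def)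
      show "\<exists>X'\<subseteq>Z. perfect X' \<and> A \<subseteq> X' \<and> \<Phi> A X'" if "A \<in> \<A>" "perfect Z" "A \<subseteq> Z" "Z \<subseteq> X" for A Z
        using that g gt by (intro dense) (auto simp: \<A>_def)
      show "\<Phi> A X'" if "fincl A" "perfect X" "perfect X'" "A \<subseteq> X" "A \<subseteq> X'" "X' \<inter> cone A \<subseteq> X" "\<Phi> A X" for A X X'
        using that by (rule local)
    qed (use B' g in \<open>auto simp: \<A>_def\<close>)
    then obtain X' where X': "X' \<subseteq> X" "perfect X'" "X \<inter> {..m} \<subseteq> X'" "\<forall>A\<in>\<A>. \<Phi> A X'" by blast
    have "B' \<subseteq> X'" using fincl_Max(1)[OF B'(1)] B' X'(3) by auto
    then have "good (B', X')" using X' B' g gt by (auto simp: good_def B'_def)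
    moreover have "rel n P (B', X')"
      using m X' by (auto simp: rel_def BX B'_def \<A>_def)
    ultimately show "\<exists>P'. good P' \<and> rel n P P'" by blast
  qed
  then obtain f where f0: "f 0 = (A0, X1)" and f: "\<And>n. good (f n)" "\<And>n. rel n (f n) (f (Suc n))"
    by blast
  define B where "B n = fst (f n)" for n
  define X where "X n = snd (f n)" for n
  have g: "fincl (B n)" "perfect (X n)" "B n \<subseteq> X n" "X n \<subseteq> X0" "A0 \<subseteq> B n" "\<forall>u\<in>B n - A0. Max A0 < u" for n
    using f(1)[of n] by (auto simp: good_def B_def X_def split: prod.splits)
  have "\<forall>n. \<exists>m\<in>ch (tgt n (B n)). Max (B n) < m \<and> B (Suc n) = insert m (B n) \<and> X (Suc n) \<subseteq> X n \<and>
        (\<forall>A. fincl A \<and> A0 \<subseteq> A \<and> A \<subseteq> B (Suc n) \<and> Max A = m \<longrightarrow> \<Phi> A (X (Suc n)))"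
    using f(2) by (simp add: rel_def B_def X_def case_prod_beta)
  then obtain y where y: "\<And>n. y n \<in> ch (tgt n (B n))" "\<And>n. Max (B n) < y n"
    "\<And>n. B (Suc n) = insert (y n) (B n)" "\<And>n. X (Suc n) \<subseteq> X n"
    "\<And>n A. fincl A \<Longrightarrow> A0 \<subseteq> A \<Longrightarrow> A \<subseteq> B (Suc n) \<Longrightarrow> Max A = y n \<Longrightarrow> \<Phi> A (X (Suc n))"
    by metis
  have MaxB: "Max (B (Suc n)) = y n" for n
    using g y Max_insert_gt by simp
  have B_mono: "i \<le> j \<Longrightarrow> B i \<subseteq> B j" for i j
    by (rule lift_Suc_mono_le) (auto simp: y)
  have X_anti: "i \<le> j \<Longrightarrow> X j \<subseteq> X i" for i j
    by (rule lift_Suc_antimono_le) (auto simp: y)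
  define Y where "Y = (\<Union>n. B n)"
  have YX: "Y \<subseteq> X n" for n
  proof -
    have "B i \<subseteq> X n" for i
      using B_mono[of i n] g(3)[of n] g(3)[of i] X_anti[of n i] by (cases "i \<le> n") auto
    then show ?thesis by (auto simp: Y_def)
  qed
  \<comment> \<open>New nodes exceed all older ones, so the part of the limit up to
    \<open>Max (B n)\<close> is complete at stage \<open>n\<close>.\<close>
  have new: "u \<in> B n" if "u \<in> Y" "u \<le> Max (B n)" for u n
  proof -
    have *: "u \<in> B (n + i) \<Longrightarrow> u \<in> B n" for i
    proof (induction i)
      case (Suc i)
      have "Max (B n) \<le> Max (B (n + i))"
        using B_mono[of n "n + i"] g(1) by (intro fincl_Max_mono) auto
      then have "y (n + i) \<noteq> u" using y(2)[of "n + i"] that by simp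
      then show ?case using Suc y(3)[of "n + i"] by auto
    qed simp
    obtain j where "u \<in> B j" using \<open>u \<in> Y\<close> unfolding Y_def by blast
    then have "u \<in> B (n + j)" using B_mono[of j "n + j"] by auto
    then show ?thesis by (rule *)
  qed
  have pY: "perfect Y" unfolding perfect_def
  proof (intro conjI ballI impI)
    show "0 \<in> Y" using g(1)[of 0] fincl_D by (auto simp: Y_def)
    show "par ` Y \<subseteq> Y" using g(1) fincl_D(3) by (fastforce simp: Y_def)
    fix s assume s: "s \<in> Y" "lev s < k"
    then obtain i where i: "s \<in> B i" unfolding Y_def by blast
    have le: "n \<le> Max (B n)" for n
    proof (induction n)
      case (Suc n)
      then show ?case using y(2)[of n] MaxB[of n] by simp
    qed simp
    show "infinite (Y \<inter> ch s)"
      unfolding infinite_nat_iff_unbounded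
    proof
      fix d
      \<comment> \<open>A code of \<open>s\<close> that is at least \<open>i\<close> and
        \<open>d\<close>: at that stage \<open>s\<close> is already present, and its new child
        exceeds \<open>d\<close>.\<close>
      define n where "n = prod_encode (s, max i d)"
      have "max i d \<le> n" unfolding n_def by (rule le_prod_encode_2)
      then have n: "s \<in> B n" "d \<le> n" using i B_mono[of i n] by auto
      have "tgt n (B n) = s" using n s by (auto simp: tgt_def n_def)
      then have "y n \<in> ch s" "d < y n" using n y(1,2)[of n] le[of n] by auto
      then show "\<exists>n>d. n \<in> Y \<inter> ch s" using y(3)[of n] by (auto simp: Y_def)
    qed
  qed
  have A0Y: "A0 \<subseteq> Y" using g(5)[of 0] by (auto simp: Y_def)
  have gtY: "Max A0 < u" if "u \<in> Y - A0" for u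
    using that g(6) by (auto simp: Y_def)
  show ?thesis
  proof (rule that[of Y])
    show "Y \<subseteq> X0" using YX[of 0] g(4)[of 0] by auto
    fix A assume A: "fincl A" "A0 \<subseteq> A" "A \<subseteq> Y"
    show "\<Phi> A Y"
    proof (cases "A = A0")
      case True
      show ?thesis
        by (rule local[of A X1]) (use True A0 X1 pY A0Y YX[of 0] f0 X_def in auto)
    next
      case False
      have "Max A \<notin> A0"
      proof
        assume "Max A \<in> A0"
        moreover obtain u where "u \<in> A - A0" using False A by auto
        ultimately show False
          using gtY[of u] A fincl_Max(1)[OF A(1), of u] fincl_Max(1)[OF A0(1), of "Max A"] by auto
      qed
      moreover have "Max A \<in> Y" using A fincl_Max by auto
      then obtain j where "Max A \<in> B j" unfolding Y_def by blast
      \<comment> \<open>The stage that adds \<open>Max A\<close>. By then all of \<open>A\<close> is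
        present, and \<open>A\<close> is among the subtrees treated there.\<close>
      ultimately obtain n where n: "Max A \<notin> B n" "Max A \<in> B (Suc n)"
      proof (induction j)
        case 0
        then show ?case using f0 by (auto simp: B_def)
      qed blast
      then have M: "Max A = y n" using y(3) by auto
      have AB: "A \<subseteq> B (Suc n)"
        using new[of _ "Suc n"] A fincl_Max(1)[OF A(1)] MaxB M by auto
      show ?thesis
        by (rule local[of A "X (Suc n)"]) (use A pY g(2) AB y(5)[OF A(1,2) AB M] YX[of "Suc n"] in auto)
    qed
  qed (use pY A0Y gtY in auto)
qed

section \<open>Pruning, attaching, and controlling the moves at one position\<close>

lemma perfect_grow_fincl:
  assumes "fincl A" "\<And>s. s \<in> grow U A \<Longrightarrow> lev s < k \<Longrightarrow> infinite (U \<inter> ch s)"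
  shows "perfect (grow U A)"
  by (rule perfect_grow) (use assms fincl_D in \<open>auto intro: grow.base\<close>)

text \<open>Growing from \<open>A\<close> keeps the nodes of \<open>A\<close> even if they are
  children of \<open>s\<close> outside \<open>I\<close>; this is why only the children beyond
  \<open>Max A\<close> are constrained.\<close>

lemma prune_children:
  assumes "perfect X" "fincl A" "A \<subseteq> X" "infinite I" "I \<subseteq> X \<inter> ch s"
  obtains Y where "Y \<subseteq> X" "perfect Y" "A \<subseteq> Y" "\<And>m. m \<in> Y \<Longrightarrow> m \<in> ch s \<Longrightarrow> Max A < m \<Longrightarrow> m \<in> I"
proof
  let ?U = "X - (ch s - I)"
  let ?Y = "grow ?U A"
  show sub: "?Y \<subseteq> X" using grow_subset assms(3) by blast
  show "A \<subseteq> ?Y" by (rule base_subset_grow)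
  show "perfect ?Y"
  proof (rule perfect_grow_fincl)
    fix t assume t: "t \<in> ?Y" "lev t < k"
    show "infinite (?U \<inter> ch t)"
    proof (cases "t = s")
      case True
      then have "?U \<inter> ch t = I" using assms(5) by auto
      then show ?thesis using assms(4) by simp
    next
      case False
      then have "?U \<inter> ch t = X \<inter> ch t" by (auto simp: ch_def)
      then show ?thesis using perfect_D(3)[OF assms(1)] t sub by auto
    qed
  qed (use assms in auto)
  show "m \<in> I" if "m \<in> ?Y" "m \<in> ch s" "Max A < m" for m
  proof -
    have "m \<notin> A" using fincl_Max(1)[OF assms(2), of m] that by auto
    then show ?thesis using that grow_subset[of ?U A] by auto
  qed
qed

lemma perfect_attach:
  assumes "perfect Y" "par m \<in> Y" "\<And>s. s \<in> grow U {m} \<Longrightarrow> lev s < k \<Longrightarrow> infinite (U \<inter> ch s)"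
  shows "perfect (Y \<union> grow U {m})"
  unfolding perfect_def
proof (intro conjI ballI impI)
  show "0 \<in> Y \<union> grow U {m}" using assms perfect_D(1) by auto
  show "par ` (Y \<union> grow U {m}) \<subseteq> Y \<union> grow U {m}"
    using assms(2) perfect_D(2)[OF assms(1)] by (auto elim: grow.cases)
  fix s assume s: "s \<in> Y \<union> grow U {m}" "lev s < k"
  show "infinite ((Y \<union> grow U {m}) \<inter> ch s)"
  proof (cases "s \<in> Y")
    case True
    then have "infinite (Y \<inter> ch s)" using assms(1) s perfect_D(3) by auto
    then show ?thesis by (rule infinite_super[rotated]) auto
  next
    case False
    then have "infinite (U \<inter> ch s)" using assms(3) s by auto
    moreover have "U \<inter> ch s \<subseteq> (Y \<union> grow U {m}) \<inter> ch s"
      using s False by (auto simp: ch_def intro: grow.step)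
    ultimately show ?thesis by (rule infinite_super[rotated])
  qed
qed

lemma grow_Int_fincl:
  assumes "fincl A" "m \<notin> A" "u \<in> grow U {m}"
  shows "u \<notin> A"
  using assms(3) by induction (use assms fincl_D(3) in auto)

text \<open>A node that was passed over stays unreachable: it is at most \<open>Max A\<close> and
  not in \<open>A\<close>, and outside \<open>A\<close> membership in the cone passes to parents.
  Hence a subtree attached at \<open>m\<close> is invisible to plays that made a later move
  instead.\<close>

lemma grow_Int_cone:
  assumes "fincl A" "m \<le> Max A" "m \<notin> A" "u \<in> grow U {m}"
  shows "u \<notin> cone A"
  using assms(4)
proof induction
  case (step u)
  then have "u \<notin> A" using grow_Int_fincl[OF assms(1,3)] by (blast intro: grow.step)
  then show ?case using step cone_gt by blast
qed (use assms cone_gt in force)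

text \<open>The form of locality that fusion asks for: the property sees only the part of the tree
  in \<open>cone A\<close> and is inherited when that part shrinks, whatever happens
  elsewhere.\<close>

definition localp :: "nat set \<Rightarrow> (nat set \<Rightarrow> bool) \<Rightarrow> bool" where
  "localp A P \<longleftrightarrow> (\<forall>X X'. perfect X \<longrightarrow> perfect X' \<longrightarrow> A \<subseteq> X \<longrightarrow> A \<subseteq> X' \<longrightarrow> X' \<inter> cone A \<subseteq> X \<longrightarrow> P X \<longrightarrow> P X')"

lemma localpD: "localp A P \<Longrightarrow> perfect X \<Longrightarrow> perfect X' \<Longrightarrow> A \<subseteq> X \<Longrightarrow> A \<subseteq> X' \<Longrightarrow> X' \<inter> cone A \<subseteq> X \<Longrightarrow> P X \<Longrightarrow> P X'"
  unfolding localp_def by blast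

text \<open>Fusion that starts from \<open>A\<close> and constrains only the positions reached by
  one move at \<open>s\<close>; for all other finite subtrees the requirement is void.\<close>

lemma one_step:
  assumes X: "perfect X" and A: "fincl A" "A \<subseteq> X" "s \<in> A"
    and loc: "\<And>m. m \<in> ch s \<Longrightarrow> Max A < m \<Longrightarrow> localp (insert m A) (\<Psi> m)"
    and dense: "\<And>m X'. \<lbrakk>m \<in> ch s; Max A < m; perfect X'; X' \<subseteq> X; insert m A \<subseteq> X'\<rbrakk>
      \<Longrightarrow> \<exists>X''\<subseteq>X'. perfect X'' \<and> insert m A \<subseteq> X'' \<and> \<Psi> m X''"
  obtains Y where "Y \<subseteq> X" "perfect Y" "A \<subseteq> Y" "\<And>m. m \<in> Y \<Longrightarrow> m \<in> ch s \<Longrightarrow> Max A < m \<Longrightarrow> \<Psi> m Y"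
proof -
  define \<Phi> where "\<Phi> C Z \<longleftrightarrow> (\<forall>m\<in>ch s. Max A < m \<longrightarrow> C = insert m A \<longrightarrow> \<Psi> m Z)" for C Z
  obtain Y where Y: "Y \<subseteq> X" "perfect Y" "A \<subseteq> Y" "\<And>C. \<lbrakk>fincl C; A \<subseteq> C; C \<subseteq> Y\<rbrakk> \<Longrightarrow> \<Phi> C Y"
  proof (rule fusion[of X A \<Phi>])
    show "\<Phi> C Z'" if "fincl C" "perfect Z" "perfect Z'" "C \<subseteq> Z" "C \<subseteq> Z'" "Z' \<inter> cone C \<subseteq> Z" "\<Phi> C Z" for C Z Z'
      unfolding \<Phi>_def
    proof (intro ballI impI)
      fix m assume m: "m \<in> ch s" "Max A < m" "C = insert m A"
      show "\<Psi> m Z'"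
        by (rule localpD[OF loc[OF m(1,2)], of Z]) (use that m in \<open>auto simp: \<Phi>_def\<close>)
    qed
    show "\<exists>Z'\<subseteq>Z. perfect Z' \<and> C \<subseteq> Z' \<and> \<Phi> C Z'" if C: "fincl C" "perfect Z" "C \<subseteq> Z" "Z \<subseteq> X" for C Z
    proof (cases "\<exists>m\<in>ch s. Max A < m \<and> C = insert m A")
      case True
      then obtain m where m: "m \<in> ch s" "Max A < m" "C = insert m A" by blast
      then obtain Z' where Z': "Z' \<subseteq> Z" "perfect Z'" "insert m A \<subseteq> Z'" "\<Psi> m Z'"
        using dense[OF m(1,2) C(2,4)] C(3) m(3) by auto
      \<comment> \<open>The move is recovered from the new position as its maximum.\<close>
      have "m' = m" if "C = insert m' A" "Max A < m'" for m'
        using that m Max_insert_gt[OF A(1)] by metis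
      then have "\<Phi> C Z'" using Z'(4) m(3) unfolding \<Phi>_def by metis
      then show ?thesis using Z'(1-3) m(3) by (intro exI[of _ Z']) simp
    next
      case False
      then have "\<Phi> C Z" by (auto simp: \<Phi>_def)
      then show ?thesis using C by (intro exI[of _ Z]) simp
    qed
  qed (use X A in auto)
  show ?thesis
  proof (rule that[OF Y(1-3)])
    fix m assume m: "m \<in> Y" "m \<in> ch s" "Max A < m"
    then have "\<Phi> (insert m A) Y"
      using Y(3) A fincl_insert by (intro Y(4)) auto
    then show "\<Psi> m Y" using m by (auto simp: \<Phi>_def)
  qed
qed

text \<open>Pigeonhole: one of the alternatives holds for infinitely many moves, and the other moves
  are pruned. The threshold \<open>d\<close> is there for \<open>H_decide\<close>, where
  \<open>A\<close> is only a part of the position and moves have to exceed the maximum of the whole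
  position.\<close>

lemma one_step_cases:
  assumes X: "perfect X" and A: "fincl A" "A \<subseteq> X" "s \<in> A" "lev s < k"
    and loc1: "\<And>m. m \<in> ch s \<Longrightarrow> d < m \<Longrightarrow> Max A < m \<Longrightarrow> localp (insert m A) (\<Psi>1 m)"
    and loc2: "\<And>m. m \<in> ch s \<Longrightarrow> d < m \<Longrightarrow> Max A < m \<Longrightarrow> localp (insert m A) (\<Psi>2 m)"
    and dense: "\<And>m X'. \<lbrakk>m \<in> ch s; d < m; Max A < m; perfect X'; X' \<subseteq> X; insert m A \<subseteq> X'\<rbrakk>
      \<Longrightarrow> \<exists>X''\<subseteq>X'. perfect X'' \<and> insert m A \<subseteq> X'' \<and> (\<Psi>1 m X'' \<or> \<Psi>2 m X'')"
  obtains Y where "Y \<subseteq> X" "perfect Y" "A \<subseteq> Y"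
    "(\<forall>m\<in>Y \<inter> ch s. d < m \<longrightarrow> Max A < m \<longrightarrow> \<Psi>1 m Y) \<or> (\<forall>m\<in>Y \<inter> ch s. d < m \<longrightarrow> Max A < m \<longrightarrow> \<Psi>2 m Y)"
proof -
  obtain Y where Y: "Y \<subseteq> X" "perfect Y" "A \<subseteq> Y"
    "\<And>m. m \<in> Y \<Longrightarrow> m \<in> ch s \<Longrightarrow> Max A < m \<Longrightarrow> d < m \<longrightarrow> \<Psi>1 m Y \<or> \<Psi>2 m Y"
  proof (rule one_step[OF X A(1-3), of "\<lambda>m Y. d < m \<longrightarrow> \<Psi>1 m Y \<or> \<Psi>2 m Y"])
    show "localp (insert m A) (\<lambda>Y. d < m \<longrightarrow> \<Psi>1 m Y \<or> \<Psi>2 m Y)" if "m \<in> ch s" "Max A < m" for m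
      using loc1[of m] loc2[of m] that unfolding localp_def by blast
    show "\<exists>X''\<subseteq>X'. perfect X'' \<and> insert m A \<subseteq> X'' \<and> (d < m \<longrightarrow> \<Psi>1 m X'' \<or> \<Psi>2 m X'')"
      if "m \<in> ch s" "Max A < m" "perfect X'" "X' \<subseteq> X" "insert m A \<subseteq> X'" for m X'
      using dense[of m X'] that by (cases "d < m") auto
  qed (assumption | blast)+
  define I where "I = {m \<in> Y \<inter> ch s. d < m \<and> Max A < m}"
  have "infinite (Y \<inter> ch s)" using Y A perfect_D(3) by auto
  then have "infinite ({max d (Max A)<..} \<inter> (Y \<inter> ch s))" by (rule infinite_Int_greaterThan)
  then have "infinite I" by (rule infinite_super[rotated]) (auto simp: I_def)
  moreover have "I = {m \<in> I. \<Psi>1 m Y} \<union> {m \<in> I. \<Psi>2 m Y}" using Y(4) by (auto simp: I_def)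
  ultimately have inf: "infinite {m \<in> I. \<Psi>1 m Y} \<or> infinite {m \<in> I. \<Psi>2 m Y}"
    by (metis finite_UnI)
  have fin: thesis
    if J: "infinite J" "J \<subseteq> I" and \<Psi>: "\<And>m. m \<in> J \<Longrightarrow> \<Psi> m Y"
      and loc: "\<And>m. m \<in> ch s \<Longrightarrow> d < m \<Longrightarrow> Max A < m \<Longrightarrow> localp (insert m A) (\<Psi> m)"
      and fin: "\<And>Z. Z \<subseteq> X \<Longrightarrow> perfect Z \<Longrightarrow> A \<subseteq> Z \<Longrightarrow> (\<forall>m\<in>Z \<inter> ch s. d < m \<longrightarrow> Max A < m \<longrightarrow> \<Psi> m Z) \<Longrightarrow> thesis"
    for J \<Psi>
  proof -
    obtain Z where Z: "Z \<subseteq> Y" "perfect Z" "A \<subseteq> Z" "\<And>m. m \<in> Z \<Longrightarrow> m \<in> ch s \<Longrightarrow> Max A < m \<Longrightarrow> m \<in> J"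
      using prune_children[OF Y(2) A(1) Y(3) J(1), of s] J(2) by (auto simp: I_def)
    show thesis
    proof (rule fin[of Z])
      show "\<forall>m\<in>Z \<inter> ch s. d < m \<longrightarrow> Max A < m \<longrightarrow> \<Psi> m Z"
      proof (intro ballI impI)
        fix m assume m: "m \<in> Z \<inter> ch s" "d < m" "Max A < m"
        show "\<Psi> m Z"
          by (rule localpD[OF loc, of m Y]) (use m Z Y \<Psi> in auto)
      qed
    qed (use Z Y in auto)
  qed
  show thesis
    using inf
  proof
    assume "infinite {m \<in> I. \<Psi>1 m Y}"
    then show thesis by (rule fin[where \<Psi> = \<Psi>1]) (use loc1 that in auto)
  next
    assume "infinite {m \<in> I. \<Psi>2 m Y}"
    then show thesis by (rule fin[where \<Psi> = \<Psi>2]) (use loc2 that in auto)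
  qed
qed

end

section \<open>Plays with mixed and separated moves\<close>

text \<open>The positions of a play are finite subtrees \<open>A\<close>. A move adds a child of \<open>sel A\<close> that exceeds
  \<open>Max A\<close>; the play ends with output \<open>n\<close> once \<open>val A = Some n\<close>. Below, \<open>outs M U A\<close> collects the outputs of
  the plays from \<open>A\<close> that follow \<open>M\<close> where it is defined and use only nodes of \<open>U\<close> otherwise.\<close>

locale barred_tree = fan_tree +
  fixes sel :: "nat set \<Rightarrow> nat" and val :: "nat set \<Rightarrow> nat option"
  assumes sel: "fincl A \<Longrightarrow> sel A \<in> A" "fincl A \<Longrightarrow> lev (sel A) < k"
    and bar: "wf {(insert m A, A) | A m. fincl A \<and> val A = None \<and> m \<in> ch (sel A) \<and> Max A < m}"
begin

definition nxt :: "nat set \<Rightarrow> nat set \<Rightarrow> nat set" where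
  "nxt A X = {m \<in> X. m \<in> ch (sel A) \<and> Max A < m}"

inductive out :: "(nat set \<Rightarrow> nat option) \<Rightarrow> nat set \<Rightarrow> nat set \<Rightarrow> nat \<Rightarrow> bool" for M U where
  "val A = Some n \<Longrightarrow> out M U A n"
| "\<lbrakk>val A = None; M A = None; m \<in> nxt A U; out M U (insert m A) n\<rbrakk> \<Longrightarrow> out M U A n"
| "\<lbrakk>val A = None; M A = Some m; out M U (insert m A) n\<rbrakk> \<Longrightarrow> out M U A n"

definition outs :: "(nat set \<Rightarrow> nat option) \<Rightarrow> nat set \<Rightarrow> nat set \<Rightarrow> nat set" where
  "outs M U A = {n. out M U A n}"

abbreviation S :: "nat set \<Rightarrow> nat set \<Rightarrow> nat set" where
  "S \<equiv> outs (\<lambda>_. None)"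

section \<open>Outputs of plays\<close>

lemma outs_decided: "val A = Some n \<Longrightarrow> outs M U A = {n}"
  by (auto simp: outs_def intro: out.intros elim: out.cases)

lemma outs_branch: "val A = None \<Longrightarrow> M A = None \<Longrightarrow> outs M U A = (\<Union>m\<in>nxt A U. outs M U (insert m A))"
  by (auto simp: outs_def intro: out.intros elim: out.cases)

lemma outs_strategic: "val A = None \<Longrightarrow> M A = Some m \<Longrightarrow> outs M U A = outs M U (insert m A)"
  by (auto simp: outs_def intro: out.intros elim: out.cases)

lemma nxt_D: "m \<in> nxt A X \<Longrightarrow> m \<in> X" "m \<in> nxt A X \<Longrightarrow> m \<in> ch (sel A)" "m \<in> nxt A X \<Longrightarrow> Max A < m"
  by (auto simp: nxt_def)

lemma nxt_mono: "X \<subseteq> Y \<Longrightarrow> nxt A X \<subseteq> nxt A Y"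
  by (auto simp: nxt_def)

lemma fincl_nxt: "fincl A \<Longrightarrow> m \<in> nxt A X \<Longrightarrow> fincl (insert m A)"
  using fincl_insert sel nxt_D by blast

lemma Max_nxt: "fincl A \<Longrightarrow> m \<in> nxt A X \<Longrightarrow> Max (insert m A) = m"
  using Max_insert_gt nxt_D by blast

lemma cone_nxt: "fincl A \<Longrightarrow> m \<in> nxt A X \<Longrightarrow> cone (insert m A) \<subseteq> cone A"
  using cone_insert sel(1) nxt_D by blast

lemma nxt_in_cone: "fincl A \<Longrightarrow> m \<in> nxt A X \<Longrightarrow> m \<in> cone A"
  using cone_nxt cone_base by blast

lemma infinite_nxt: "perfect X \<Longrightarrow> fincl A \<Longrightarrow> A \<subseteq> X \<Longrightarrow> infinite (nxt A X)"
proof -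
  assume "perfect X" "fincl A" "A \<subseteq> X"
  then have "infinite (X \<inter> ch (sel A))" using perfect_D(3) sel by blast
  then have "infinite ({Max A<..} \<inter> (X \<inter> ch (sel A)))" by (rule infinite_Int_greaterThan)
  then show "infinite (nxt A X)" by (rule infinite_super[rotated]) (auto simp: nxt_def)
qed

lemma nxt_greater: "perfect X \<Longrightarrow> fincl A \<Longrightarrow> A \<subseteq> X \<Longrightarrow> \<exists>m\<in>nxt A X. d < m"
  using infinite_nxt[of X A] unfolding infinite_nat_iff_unbounded by blast

lemma bar_induct [consumes 1, case_names step]:
  assumes "fincl A"
    and "\<And>A. fincl A \<Longrightarrow> (\<And>m X. val A = None \<Longrightarrow> m \<in> nxt A X \<Longrightarrow> P (insert m A)) \<Longrightarrow> P A"
  shows "P A"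
  using bar assms(1)
proof (induction A rule: wf_induct_rule)
  case (less A)
  show ?case
  proof (rule assms(2)[OF less(2)])
    fix m X assume m: "val A = None" "m \<in> nxt A X"
    show "P (insert m A)"
      by (rule less(1)) (use m less(2) nxt_D[OF m(2)] fincl_nxt[OF less(2) m(2)] in auto)
  qed
qed

text \<open>A play from \<open>A\<close> stays in \<open>cone A\<close>; the last assumption ensures
  this for the prescribed moves, too.\<close>

lemma outs_cone:
  assumes "fincl A" "X' \<inter> cone A \<subseteq> X" "\<And>A. fincl A \<Longrightarrow> M A \<in> insert None (Some ` nxt A UNIV)"
  shows "outs M X' A \<subseteq> outs M X A"
  using assms(1,2)
proof (induction A rule: bar_induct)
  case (step A)
  have IH: "outs M X' (insert m A) \<subseteq> outs M X (insert m A)" if "val A = None" "m \<in> nxt A UNIV" for m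
    using step(2)[OF that] step(3) cone_nxt[OF step(1) that(2)] by blast
  show ?case
  proof (cases "val A")
    case None
    show ?thesis
    proof (cases "M A")
      case None': None
      have "m \<in> nxt A X" if "m \<in> nxt A X'" for m
        using that nxt_in_cone[OF step(1) that] step(3) by (auto simp: nxt_def)
      then show ?thesis
        unfolding outs_branch[of A M, OF None None'] using IH[OF None] by (fastforce simp: nxt_def)
    next
      case (Some m)
      then have "m \<in> nxt A UNIV" using assms(3)[OF step(1)] by auto
      then show ?thesis unfolding outs_strategic[of A M, OF None Some] by (rule IH[OF None])
    qed
  qed (simp add: outs_decided)
qed

lemma S_cone: "fincl A \<Longrightarrow> X' \<inter> cone A \<subseteq> X \<Longrightarrow> S X' A \<subseteq> S X A"
  by (rule outs_cone) auto

lemma S_mono: "fincl A \<Longrightarrow> X' \<subseteq> X \<Longrightarrow> S X' A \<subseteq> S X A"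
  by (rule S_cone) auto

lemma S_nxt: "fincl A \<Longrightarrow> val A = None \<Longrightarrow> m \<in> nxt A X \<Longrightarrow> S X (insert m A) \<subseteq> S X A"
  by (auto simp: outs_branch)

lemma localp_S_subset: "fincl A \<Longrightarrow> localp A (\<lambda>X. S X A \<subseteq> B)"
  unfolding localp_def using S_cone by blast

lemma localp_S_disjoint: "fincl A \<Longrightarrow> localp A (\<lambda>X. S X A \<inter> B = {})"
  unfolding localp_def using S_cone by blast

lemma one_step_nxt:
  assumes X: "perfect X" and A: "fincl A" "A \<subseteq> X"
    and loc1: "\<And>m. m \<in> nxt A UNIV \<Longrightarrow> localp (insert m A) (\<Psi>1 m)"
    and loc2: "\<And>m. m \<in> nxt A UNIV \<Longrightarrow> localp (insert m A) (\<Psi>2 m)"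
    and dense: "\<And>m X'. \<lbrakk>m \<in> nxt A X'; perfect X'; X' \<subseteq> X; insert m A \<subseteq> X'\<rbrakk>
      \<Longrightarrow> \<exists>X''\<subseteq>X'. perfect X'' \<and> insert m A \<subseteq> X'' \<and> (\<Psi>1 m X'' \<or> \<Psi>2 m X'')"
  obtains Y where "Y \<subseteq> X" "perfect Y" "A \<subseteq> Y"
    "(\<forall>m\<in>nxt A Y. \<Psi>1 m Y) \<or> (\<forall>m\<in>nxt A Y. \<Psi>2 m Y)"
proof (rule one_step_cases[OF X A sel[OF A(1)], of 0 \<Psi>1 \<Psi>2])
  show "localp (insert m A) (\<Psi>1 m)" "localp (insert m A) (\<Psi>2 m)" if "m \<in> ch (sel A)" "Max A < m" for m
    using that loc1 loc2 by (auto simp: nxt_def)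
  show "\<exists>X''\<subseteq>X'. perfect X'' \<and> insert m A \<subseteq> X'' \<and> (\<Psi>1 m X'' \<or> \<Psi>2 m X'')"
    if "m \<in> ch (sel A)" "Max A < m" "perfect X'" "X' \<subseteq> X" "insert m A \<subseteq> X'" for m X'
    by (rule dense) (use that in \<open>auto simp: nxt_def\<close>)
  fix Y assume Y: "Y \<subseteq> X" "perfect Y" "A \<subseteq> Y" "(\<forall>m\<in>Y \<inter> ch (sel A). 0 < m \<longrightarrow> Max A < m \<longrightarrow> \<Psi>1 m Y) \<or>
    (\<forall>m\<in>Y \<inter> ch (sel A). 0 < m \<longrightarrow> Max A < m \<longrightarrow> \<Psi>2 m Y)"
  show thesis by (rule that[OF Y(1-3)]) (use Y(4) ch_D(1) in \<open>fastforce simp: nxt_def\<close>)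
qed

text \<open>Bar induction: a decided position has a single output, and \<open>one_step_nxt\<close>
  makes the moves at an undecided one agree. Later this turns meeting into inclusion: if the outputs
  of all subtrees meet \<open>B\<close>, those of some subtree lie in \<open>B\<close>.\<close>

lemma decide:
  assumes "fincl A" "perfect X" "A \<subseteq> X"
  shows "\<exists>Y\<subseteq>X. perfect Y \<and> A \<subseteq> Y \<and> (S Y A \<subseteq> B \<or> S Y A \<inter> B = {})"
  using assms
proof (induction A arbitrary: X rule: bar_induct)
  case (step A)
  show ?case
  proof (cases "val A")
    case None
    obtain Y where Y: "Y \<subseteq> X" "perfect Y" "A \<subseteq> Y"
      "(\<forall>m\<in>nxt A Y. S Y (insert m A) \<subseteq> B) \<or> (\<forall>m\<in>nxt A Y. S Y (insert m A) \<inter> B = {})"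
    proof (rule one_step_nxt[OF step(3) step(1) step(4), of "\<lambda>m Y. S Y (insert m A) \<subseteq> B" "\<lambda>m Y. S Y (insert m A) \<inter> B = {}"])
      show "\<exists>X''\<subseteq>X'. perfect X'' \<and> insert m A \<subseteq> X'' \<and> (S X'' (insert m A) \<subseteq> B \<or> S X'' (insert m A) \<inter> B = {})"
        if "m \<in> nxt A X'" "perfect X'" "insert m A \<subseteq> X'" for m X'
        using step(2)[OF None that(1) that(2,3)] .
    qed (use localp_S_subset localp_S_disjoint fincl_nxt[OF step(1)] in auto)
    then have "S Y A \<subseteq> B \<or> S Y A \<inter> B = {}" using None by (auto simp: outs_branch)
    then show ?thesis using Y(1-3) by (intro exI[of _ Y]) simp
  next
    case (Some n)
    then have "S X A \<subseteq> B \<or> S X A \<inter> B = {}" by (auto simp: outs_decided)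
    then show ?thesis using step(3,4) by (intro exI[of _ X]) simp
  qed
qed

section \<open>Reachable and unavoidable positions\<close>

inductive meets :: "nat set set \<Rightarrow> nat set \<Rightarrow> nat set \<Rightarrow> bool" for \<C> X where
  "A \<in> \<C> \<Longrightarrow> meets \<C> X A"
| "\<lbrakk>val A = None; m \<in> nxt A X; meets \<C> X (insert m A)\<rbrakk> \<Longrightarrow> meets \<C> X A"

text \<open>\<open>\<C>\<close> is a bar for the plays in \<open>X\<close>; a play that ends without
  having passed \<open>\<C>\<close> is a miss. The inductive form provides the induction on the bar
  for \<open>hits_witness\<close>.\<close>

inductive hits :: "nat set set \<Rightarrow> nat set \<Rightarrow> nat set \<Rightarrow> bool" for \<C> X where
  "A \<in> \<C> \<Longrightarrow> hits \<C> X A"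
| "\<lbrakk>val A = None; \<And>m. m \<in> nxt A X \<Longrightarrow> hits \<C> X (insert m A)\<rbrakk> \<Longrightarrow> hits \<C> X A"

lemma meets_cone: "meets \<C> X A \<Longrightarrow> fincl A \<Longrightarrow> X \<inter> cone A \<subseteq> X' \<Longrightarrow> meets \<C> X' A"
proof (induction rule: meets.induct)
  case (2 A m)
  have "m \<in> nxt A X'" using nxt_in_cone[OF 2(5,2)] 2(2,6) by (auto simp: nxt_def)
  moreover have "meets \<C> X' (insert m A)"
    using 2 fincl_nxt[OF 2(5,2)] cone_nxt[OF 2(5,2)] by blast
  ultimately show ?case using 2(1) meets.intros(2) by blast
qed (rule meets.intros)

lemma hits_cone: "hits \<C> X A \<Longrightarrow> fincl A \<Longrightarrow> X' \<inter> cone A \<subseteq> X \<Longrightarrow> hits \<C> X' A"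
proof (induction rule: hits.induct)
  case (2 A)
  show ?case
  proof (rule hits.intros(2)[OF 2(1)])
    fix m assume m: "m \<in> nxt A X'"
    then have m': "m \<in> nxt A X" using nxt_in_cone[OF 2(4) m] 2(5) by (auto simp: nxt_def)
    show "hits \<C> X' (insert m A)"
      using 2(3)[OF m'] fincl_nxt[OF 2(4) m] cone_nxt[OF 2(4) m] 2(5) by blast
  qed
qed (rule hits.intros)

text \<open>Bar induction: the moves at a position can be pruned until all of them avoid
  \<open>\<C>\<close> or all of them lead into it.\<close>

lemma meets_or_hits:
  assumes "fincl A" "perfect X" "A \<subseteq> X"
  shows "\<exists>Y\<subseteq>X. perfect Y \<and> A \<subseteq> Y \<and> (\<not> meets \<C> Y A \<or> hits \<C> Y A)"
  using assms
proof (induction A arbitrary: X rule: bar_induct)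
  case (step A)
  consider "A \<in> \<C>" | "A \<notin> \<C>" "val A \<noteq> None" | "A \<notin> \<C>" "val A = None" by blast
  then show ?case
  proof cases
    case 1
    then show ?thesis using step(3,4) hits.intros(1) by blast
  next
    case 2
    then have "\<not> meets \<C> X A" by (auto elim: meets.cases)
    then show ?thesis using step(3,4) by blast
  next
    case 3
    obtain Y where Y: "Y \<subseteq> X" "perfect Y" "A \<subseteq> Y"
      "(\<forall>m\<in>nxt A Y. \<not> meets \<C> Y (insert m A)) \<or> (\<forall>m\<in>nxt A Y. hits \<C> Y (insert m A))"
    proof (rule one_step_nxt[OF step(3) step(1) step(4), of "\<lambda>m Y. \<not> meets \<C> Y (insert m A)" "\<lambda>m Y. hits \<C> Y (insert m A)"])
      show "localp (insert m A) (\<lambda>Y. \<not> meets \<C> Y (insert m A))" if "m \<in> nxt A UNIV" for m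
        unfolding localp_def using meets_cone fincl_nxt[OF step(1) that] by blast
      show "localp (insert m A) (\<lambda>Y. hits \<C> Y (insert m A))" if "m \<in> nxt A UNIV" for m
        unfolding localp_def using hits_cone fincl_nxt[OF step(1) that] by blast
      show "\<exists>X''\<subseteq>X'. perfect X'' \<and> insert m A \<subseteq> X'' \<and> (\<not> meets \<C> X'' (insert m A) \<or> hits \<C> X'' (insert m A))"
        if "m \<in> nxt A X'" "perfect X'" "insert m A \<subseteq> X'" for m X'
        using step(2)[OF 3(2) that] .
    qed
    have "\<not> meets \<C> Y A \<or> hits \<C> Y A"
      using Y(4)
    proof
      assume "\<forall>m\<in>nxt A Y. \<not> meets \<C> Y (insert m A)"
      then show ?thesis using 3(1) by (auto elim: meets.cases)
    qed (use 3 in \<open>auto intro: hits.intros(2)\<close>)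
    then show ?thesis using Y(1-3) by (intro exI[of _ Y]) simp
  qed
qed

section \<open>Mixed and separated positions\<close>

definition Mix :: "nat set \<Rightarrow> nat set \<Rightarrow> bool" where
  "Mix A X \<longleftrightarrow> (\<forall>Y\<subseteq>X. perfect Y \<longrightarrow> A \<subseteq> Y \<longrightarrow>
     (\<forall>m\<in>nxt A Y. \<forall>m'\<in>nxt A Y. m < m' \<longrightarrow> S Y (insert m A) \<inter> S Y (insert m' A) \<noteq> {}))"

definition Sep :: "nat set \<Rightarrow> nat set \<Rightarrow> bool" where
  "Sep A X \<longleftrightarrow> (\<forall>m\<in>nxt A X. \<forall>m'\<in>nxt A X. m \<noteq> m' \<longrightarrow> S X (insert m A) \<inter> S X (insert m' A) = {})"

text \<open>\<open>Mix\<close> refers to all perfect subsets. A perfect subset of \<open>X'\<close>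
  is cut down to \<open>cone A\<close>, which keeps its moves and puts it inside \<open>X\<close>;
  common outputs found there persist in the larger set.\<close>

lemma localp_Mix: "fincl A \<Longrightarrow> localp A (Mix A)"
  unfolding localp_def
proof (intro allI impI)
  fix X X' assume *: "fincl A" "perfect X" "perfect X'" "A \<subseteq> X" "A \<subseteq> X'" "X' \<inter> cone A \<subseteq> X" "Mix A X"
  show "Mix A X'"
    unfolding Mix_def
  proof (intro allI impI ballI)
    fix Y m m' assume Y: "Y \<subseteq> X'" "perfect Y" "A \<subseteq> Y" "m \<in> nxt A Y" "m' \<in> nxt A Y" "m < m'"
    let ?Z = "Y \<inter> cone A"
    have "?Z \<subseteq> X" "perfect ?Z" "A \<subseteq> ?Z"
      using Y *(6) perfect_Int_cone[OF Y(2) *(1) Y(3)] cone_base by auto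
    moreover have "m \<in> nxt A ?Z" "m' \<in> nxt A ?Z"
      using Y(4,5) nxt_in_cone[OF *(1)] by (auto simp: nxt_def)
    ultimately have "S ?Z (insert m A) \<inter> S ?Z (insert m' A) \<noteq> {}"
      using *(7) Y(6) unfolding Mix_def by blast
    then show "S Y (insert m A) \<inter> S Y (insert m' A) \<noteq> {}"
      using S_mono[of "insert m A" ?Z Y] S_mono[of "insert m' A" ?Z Y] fincl_nxt[OF *(1)] Y(4,5) by blast
  qed
qed

lemma localp_Sep: "fincl A \<Longrightarrow> localp A (Sep A)"
  unfolding localp_def
proof (intro allI impI)
  fix X X' assume *: "fincl A" "perfect X" "perfect X'" "A \<subseteq> X" "A \<subseteq> X'" "X' \<inter> cone A \<subseteq> X" "Sep A X"
  have *: "m \<in> nxt A X" "S X' (insert m A) \<subseteq> S X (insert m A)" if "m \<in> nxt A X'" for m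
  proof -
    show "m \<in> nxt A X" using that nxt_in_cone[OF *(1) that] *(6) by (auto simp: nxt_def)
    show "S X' (insert m A) \<subseteq> S X (insert m A)"
      using S_cone[of "insert m A" X' X] fincl_nxt[OF *(1) that] cone_nxt[OF *(1) that] *(6) by blast
  qed
  show "Sep A X'" using \<open>Sep A X\<close> * unfolding Sep_def by blast
qed

lemma Mix_mono:
  assumes "Mix A X" "X' \<subseteq> X"
  shows "Mix A X'"
  unfolding Mix_def
proof (intro allI impI)
  fix Y assume Y: "Y \<subseteq> X'" "perfect Y" "A \<subseteq> Y"
  have "Y \<subseteq> X" using Y(1) assms(2) by (rule subset_trans)
  then show "\<forall>m\<in>nxt A Y. \<forall>m'\<in>nxt A Y. m < m' \<longrightarrow> S Y (insert m A) \<inter> S Y (insert m' A) \<noteq> {}"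
    using assms(1) Y(2,3) by (simp add: Mix_def)
qed

lemma Sep_mono: "fincl A \<Longrightarrow> Sep A X \<Longrightarrow> X' \<subseteq> X \<Longrightarrow> Sep A X'"
proof -
  assume *: "fincl A" "Sep A X" "X' \<subseteq> X"
  show ?thesis
    unfolding Sep_def
  proof (intro ballI impI)
    fix m m' assume m: "m \<in> nxt A X'" "m' \<in> nxt A X'" "m \<noteq> m'"
    then have "S X (insert m A) \<inter> S X (insert m' A) = {}"
      using *(2) nxt_mono[OF *(3)] unfolding Sep_def by blast
    then show "S X' (insert m A) \<inter> S X' (insert m' A) = {}"
      using S_mono[OF fincl_nxt[OF *(1) m(1)] *(3)] S_mono[OF fincl_nxt[OF *(1) m(2)] *(3)] by blast
  qed
qed

end

lemma infinite_split:
  fixes A :: "nat set"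
  assumes "infinite A"
  shows "\<exists>E\<subseteq>A. infinite E \<and> infinite (A - E)"
proof -
  let ?e = "enumerate A"
  have inj: "inj ?e" using strict_mono_enumerate[OF assms] strict_mono_imp_inj_on by blast
  let ?E = "range (\<lambda>n. ?e (2 * n))"
  have "infinite ?E"
    by (rule range_inj_infinite) (auto intro!: injI dest: injD[OF inj])
  moreover have "infinite (range (\<lambda>n. ?e (2 * n + 1)))"
    by (rule range_inj_infinite) (auto intro!: injI dest: injD[OF inj])
  moreover have "range (\<lambda>n. ?e (2 * n + 1)) \<subseteq> A - ?E"
  proof
    fix x assume "x \<in> range (\<lambda>n. ?e (2 * n + 1))"
    then obtain n where n: "x = ?e (2 * n + 1)" by blast
    have "x \<notin> ?E"
    proof
      assume "x \<in> ?E"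
      then obtain n' where "x = ?e (2 * n')" by blast
      then have "?e (2 * n + 1) = ?e (2 * n')" using n by simp
      then have "2 * n + 1 = 2 * n'" by (rule injD[OF inj])
      then show False by presburger
    qed
    then show "x \<in> A - ?E" using n enumerate_in_set[OF assms] by auto
  qed
  ultimately show ?thesis
    using enumerate_in_set[OF assms] infinite_super[of "range (\<lambda>n. ?e (2 * n + 1))" "A - ?E"]
    by (intro exI[of _ ?E]) auto
qed

context fan_tree
begin

text \<open>Unachievability is local as well: a witness inside \<open>X'\<close> can be cut down to
  \<open>cone A\<close> and then lies inside \<open>X\<close>.\<close>

lemma localp_none:
  assumes "fincl A" "localp A P"
  shows "localp A (\<lambda>X. \<not> (\<exists>Y\<subseteq>X. perfect Y \<and> A \<subseteq> Y \<and> P Y))"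
  unfolding localp_def
proof (intro allI impI notI)
  fix X X' assume X: "perfect X" "perfect X'" "A \<subseteq> X" "A \<subseteq> X'" "X' \<inter> cone A \<subseteq> X"
    and none: "\<not> (\<exists>Y\<subseteq>X. perfect Y \<and> A \<subseteq> Y \<and> P Y)" and "\<exists>Y\<subseteq>X'. perfect Y \<and> A \<subseteq> Y \<and> P Y"
  then obtain Y where Y: "Y \<subseteq> X'" "perfect Y" "A \<subseteq> Y" "P Y" by blast
  let ?Z = "Y \<inter> cone A"
  have Z: "perfect ?Z" "A \<subseteq> ?Z" using perfect_Int_cone[OF Y(2) assms(1) Y(3)] Y(3) cone_base by auto
  have "P ?Z" by (rule localpD[OF assms(2) Y(2) Z(1) Y(3) Z(2) _ Y(4)]) auto
  moreover have "?Z \<subseteq> X" using Y(1) X(5) by auto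
  ultimately show False using none Z by blast
qed

lemma attach_Int_cone:
  assumes "fincl C" "p \<le> Max C" "p \<notin> C"
  shows "(Y \<union> grow U {p}) \<inter> cone C \<subseteq> Y"
  using grow_Int_cone[OF assms] by blast

lemma grow_par: "u \<in> grow U B \<Longrightarrow> u \<notin> B \<Longrightarrow> u \<in> U \<and> 0 < u \<and> par u \<in> grow U B"
  by (erule grow.cases) auto

lemma grow_ge: "u \<in> grow U {i} \<Longrightarrow> i \<le> u"
proof (induction rule: grow.induct)
  case (step u)
  then show ?case using par_less[of u] by simp
qed simp

lemma perfect_remove_subtree:
  assumes "perfect X" "0 < i"
  shows "perfect (X - grow UNIV {i})"
  unfolding perfect_def
proof (intro conjI ballI impI)
  show "0 \<in> X - grow UNIV {i}" using assms perfect_D(1) grow_ge[of 0 UNIV i] by auto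
  show "par ` (X - grow UNIV {i}) \<subseteq> X - grow UNIV {i}"
  proof (rule image_subsetI)
    fix u assume u: "u \<in> X - grow UNIV {i}"
    have "par u \<notin> grow UNIV {i}"
      using u par_0 by (cases "u = 0") (auto intro: grow.step)
    then show "par u \<in> X - grow UNIV {i}" using u perfect_D(2)[OF assms(1)] by auto
  qed
  fix s assume s: "s \<in> X - grow UNIV {i}" "lev s < k"
  then have "infinite (X \<inter> ch s - {i})" using assms perfect_D(3) by simp
  moreover have "X \<inter> ch s - {i} \<subseteq> (X - grow UNIV {i}) \<inter> ch s"
    using s(1) ch_D(2) grow_par[of _ UNIV "{i}"] by blast
  ultimately show "infinite ((X - grow UNIV {i}) \<inter> ch s)" by (rule infinite_super[rotated])
qed

end

context barred_tree
begin

text \<open>What can be played after a later move at the same position was still available after the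
  earlier one. So being disjoint from all later moves is a property that is local at the earlier
  move.\<close>

lemma cone_later_sibling:
  assumes "fincl A" "m \<in> nxt A X" "m' \<in> nxt A X'" "m < m'"
  shows "m' \<in> cone (insert m A)" "cone (insert m' A) \<subseteq> cone (insert m A)"
proof -
  have "par m' \<in> insert m A" using ch_D(2)[OF nxt_D(2)[OF assms(3)]] sel(1)[OF assms(1)] by simp
  then have "par m' \<in> cone (insert m A)" using cone_base by blast
  moreover have M: "Max (insert m A) = m" "Max (insert m' A) = m'"
    using Max_nxt[OF assms(1,2)] Max_nxt[OF assms(1,3)] .
  ultimately show *: "m' \<in> cone (insert m A)"
    using assms(4) by (simp add: cone_step)
  have "insert m' A \<subseteq> cone (insert m A)" using * cone_base[of "insert m A"] by simp
  moreover have "{m'<..} \<subseteq> {m<..}" using assms(4) by auto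
  ultimately show "cone (insert m' A) \<subseteq> cone (insert m A)"
    unfolding cone_def M by (intro grow_mono)
qed

text \<open>If no \<open>Y\<close> mixes the next moves at \<open>A\<close>, then below every \<open>Y\<close> some next move \<open>p\<close> can be
  separated from all later ones: two moves with disjoint outputs cannot both fail to be
  separated from infinitely many others.\<close>

lemma mix_or_sep:
  assumes A: "fincl A" and X: "perfect X" "A \<subseteq> X"
  shows "\<exists>Y\<subseteq>X. perfect Y \<and> A \<subseteq> Y \<and> (Mix A Y \<or> Sep A Y)"
proof (rule ccontr)
  assume neg: "\<not> ?thesis"
  \<comment> \<open>Comparing \<open>m\<close> with later moves only makes this local at
    \<open>insert m A\<close>; by symmetry it still gives separation of all pairs.\<close>
  define good where "good m Z \<longleftrightarrow> (\<forall>m''\<in>nxt A Z. m < m'' \<longrightarrow> S Z (insert m A) \<inter> S Z (insert m'' A) = {})" for m Z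
  have loc: "localp (insert m A) (good m)" if m: "m \<in> nxt A UNIV" for m
    unfolding localp_def
  proof (intro allI impI)
    fix Z Z' assume Z: "insert m A \<subseteq> Z" "insert m A \<subseteq> Z'" "Z' \<inter> cone (insert m A) \<subseteq> Z" "good m Z"
    show "good m Z'"
      unfolding good_def
    proof (intro ballI impI)
      fix m'' assume m'': "m'' \<in> nxt A Z'" "m < m''"
      note c = cone_later_sibling[OF A m m'']
      have "m'' \<in> nxt A Z" using c(1) m''(1) Z(3) by (auto simp: nxt_def)
      then have "S Z (insert m A) \<inter> S Z (insert m'' A) = {}" using Z(4) m''(2) by (simp add: good_def)
      moreover have "S Z' (insert m A) \<subseteq> S Z (insert m A)"
        using S_cone[OF fincl_nxt[OF A m] Z(3)] .
      moreover have "S Z' (insert m'' A) \<subseteq> S Z (insert m'' A)"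
        using S_cone[OF fincl_nxt[OF A m''(1)], of Z' Z] c(2) Z(3) by blast
      ultimately show "S Z' (insert m A) \<inter> S Z' (insert m'' A) = {}" by blast
    qed
  qed
  define bad where "bad m Z \<longleftrightarrow> \<not> (\<exists>Y\<subseteq>Z. perfect Y \<and> insert m A \<subseteq> Y \<and> good m Y)" for m Z
  obtain Y where Y: "Y \<subseteq> X" "perfect Y" "A \<subseteq> Y" "(\<forall>m\<in>nxt A Y. good m Y) \<or> (\<forall>m\<in>nxt A Y. bad m Y)"
  proof (rule one_step_nxt[OF X(1) A X(2), of good bad])
    show "localp (insert m A) (bad m)" if "m \<in> nxt A UNIV" for m
      unfolding bad_def by (rule localp_none[OF fincl_nxt[OF A that] loc[OF that]])
    show "\<exists>X''\<subseteq>X'. perfect X'' \<and> insert m A \<subseteq> X'' \<and> (good m X'' \<or> bad m X'')"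
      if "perfect X'" "insert m A \<subseteq> X'" for m X'
      using that unfolding bad_def by blast
  qed (use loc in auto)
  from Y(4) show False
  proof
    assume g: "\<forall>m\<in>nxt A Y. good m Y"
    have "Sep A Y"
      unfolding Sep_def
    proof (intro ballI impI)
      fix m m' assume m: "m \<in> nxt A Y" "m' \<in> nxt A Y" "m \<noteq> m'"
      then consider "m < m'" | "m' < m" by linarith
      then show "S Y (insert m A) \<inter> S Y (insert m' A) = {}"
        using g m by cases (auto simp: good_def)
    qed
    then show False using neg Y(1-3) by blast
  next
    assume b: "\<forall>m\<in>nxt A Y. bad m Y"
    have "\<not> Mix A Y" using neg Y(1-3) by blast
    then obtain Y1 m m' where Y1: "Y1 \<subseteq> Y" "perfect Y1" "A \<subseteq> Y1"
      and m: "m \<in> nxt A Y1" "m' \<in> nxt A Y1" "m < m'" and disj: "S Y1 (insert m A) \<inter> S Y1 (insert m' A) = {}"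
      unfolding Mix_def by blast
    \<comment> \<open>All moves of a subtree are now made to have their outputs inside
      \<open>B\<close> or all of them outside it. In the first case \<open>m'\<close> is separated
      from them, in the second case \<open>m\<close>.\<close>
    define B where "B = S Y1 (insert m A)"
    obtain Y2 where Y2: "Y2 \<subseteq> Y1" "perfect Y2" "A \<subseteq> Y2"
      "(\<forall>m\<in>nxt A Y2. S Y2 (insert m A) \<subseteq> B) \<or> (\<forall>m\<in>nxt A Y2. S Y2 (insert m A) \<inter> B = {})"
    proof (rule one_step_nxt[OF Y1(2) A Y1(3), of "\<lambda>m Z. S Z (insert m A) \<subseteq> B" "\<lambda>m Z. S Z (insert m A) \<inter> B = {}"])
      show "\<exists>X''\<subseteq>X'. perfect X'' \<and> insert m A \<subseteq> X'' \<and> (S X'' (insert m A) \<subseteq> B \<or> S X'' (insert m A) \<inter> B = {})"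
        if "m \<in> nxt A X'" "perfect X'" "insert m A \<subseteq> X'" for m X'
        using decide[OF fincl_nxt[OF A that(1)] that(2,3)] .
    qed (use localp_S_subset localp_S_disjoint fincl_nxt[OF A] in auto)
    have "infinite {x \<in> nxt A Y2. m' < x}"
      using infinite_Int_greaterThan[OF infinite_nxt[OF Y2(2) A Y2(3)], of m']
      by (rule infinite_super[rotated]) auto
    then obtain Y3 where Y3: "Y3 \<subseteq> Y2" "perfect Y3" "A \<subseteq> Y3"
      and late: "\<And>x. x \<in> Y3 \<Longrightarrow> x \<in> ch (sel A) \<Longrightarrow> Max A < x \<Longrightarrow> x \<in> {x \<in> nxt A Y2. m' < x}"
      by (rule prune_children[OF Y2(2) A Y2(3), of "{x \<in> nxt A Y2. m' < x}" "sel A"]) (auto simp: nxt_def)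
    have contra: False if p: "p \<in> nxt A Y1" "p \<le> m'"
      and sep: "\<And>x. x \<in> nxt A Y2 \<Longrightarrow> S Y2 (insert x A) \<inter> S Y1 (insert p A) = {}" for p
    proof -
      \<comment> \<open>The subtree at \<open>p\<close> is put back. Later moves do not see it, so
        their outputs in \<open>?Z\<close> are outputs in \<open>Y2\<close>, and \<open>p\<close>
        has become good although no subset of \<open>Y\<close> was to make it so.\<close>
      let ?Z = "Y3 \<union> grow Y1 {p}"
      have pA: "p \<notin> A" using nxt_D(3)[OF p(1)] fincl_Max(1)[OF A, of p] by auto
      have sub: "?Z \<subseteq> Y1" using grow_subset[of Y1 "{p}"] Y3(1) Y2(1) nxt_D(1)[OF p(1)] by blast
      have "perfect ?Z"
      proof (rule perfect_attach[OF Y3(2)])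
        show "par p \<in> Y3" using nxt_D(2)[OF p(1)] sel(1)[OF A] Y3(3) ch_D(2)[OF nxt_D(2)[OF p(1)]] by auto
        show "infinite (Y1 \<inter> ch s)" if "s \<in> grow Y1 {p}" "lev s < k" for s
          using that sub perfect_D(3)[OF Y1(2)] by blast
      qed
      moreover have "good p ?Z"
        unfolding good_def
      proof (intro ballI impI)
        fix x assume x: "x \<in> nxt A ?Z" "p < x"
        have "par x \<in> A" using ch_D(2)[OF nxt_D(2)[OF x(1)]] sel(1)[OF A] by simp
        then have "x \<notin> grow Y1 {p}" using grow_Int_fincl[OF A pA] x(2) grow_par[of x Y1 "{p}"] by blast
        then have xY3: "x \<in> nxt A Y3" using x(1) by (auto simp: nxt_def)
        then have xY2: "x \<in> nxt A Y2" using nxt_mono[OF Y3(1)] by blast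
        have "?Z \<inter> cone (insert x A) \<subseteq> Y2"
          using attach_Int_cone[OF fincl_nxt[OF A x(1)], of p Y3 Y1] Max_nxt[OF A x(1)] x(2) pA Y3(1) by auto
        then have "S ?Z (insert x A) \<subseteq> S Y2 (insert x A)" by (rule S_cone[OF fincl_nxt[OF A x(1)]])
        moreover have "S ?Z (insert p A) \<subseteq> S Y1 (insert p A)" by (rule S_mono[OF fincl_nxt[OF A p(1)] sub])
        ultimately show "S ?Z (insert p A) \<inter> S ?Z (insert x A) = {}" using sep[OF xY2] by blast
      qed
      moreover have "insert p A \<subseteq> ?Z" using Y3(3) by (auto intro: grow.base)
      moreover have "?Z \<subseteq> Y" using sub Y1(1) by blast
      moreover have "bad p Y" using b p(1) nxt_mono[OF Y1(1)] by blast
      ultimately show False unfolding bad_def by blast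
    qed
    from Y2(4) show False
    proof
      assume "\<forall>m\<in>nxt A Y2. S Y2 (insert m A) \<subseteq> B"
      then show False using disj m unfolding B_def by (intro contra[of m']) blast+
    next
      assume "\<forall>m\<in>nxt A Y2. S Y2 (insert m A) \<inter> B = {}"
      then show False using m unfolding B_def by (intro contra[of m]) auto
    qed
  qed
qed

lemma homogeneous:
  assumes "perfect X"
  shows "\<exists>Y\<subseteq>X. perfect Y \<and> (\<forall>A. fincl A \<longrightarrow> A \<subseteq> Y \<longrightarrow> Mix A Y \<or> Sep A Y)"
proof -
  obtain Y where Y: "Y \<subseteq> X" "perfect Y" "\<And>A. \<lbrakk>fincl A; {0} \<subseteq> A; A \<subseteq> Y\<rbrakk> \<Longrightarrow> Mix A Y \<or> Sep A Y"
  proof (rule fusion[OF assms fincl_0, of "\<lambda>A Y. Mix A Y \<or> Sep A Y"])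
    show "Mix A Z' \<or> Sep A Z'"
      if "fincl A" "perfect Z" "perfect Z'" "A \<subseteq> Z" "A \<subseteq> Z'" "Z' \<inter> cone A \<subseteq> Z" "Mix A Z \<or> Sep A Z" for A Z Z'
      using that(7) localpD[OF localp_Mix[OF that(1)] that(2-6)] localpD[OF localp_Sep[OF that(1)] that(2-6)]
      by blast
    show "\<exists>X'\<subseteq>Z. perfect X' \<and> A \<subseteq> X' \<and> (Mix A X' \<or> Sep A X')" if "fincl A" "perfect Z" "A \<subseteq> Z" for A Z
      using mix_or_sep[OF that] .
  qed (use perfect_D(1)[OF assms] in auto)
  then show ?thesis using fincl_D(2) by (intro exI[of _ Y]) auto
qed

end

section \<open>Outputs of strategic plays\<close>

text \<open>The verdict \<open>mx\<close> is a parameter instead of \<open>Mix A X\<close>: it is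
  fixed once for a large tree, so that it and the sets of positions defined from it do not change
  when \<open>X\<close> shrinks.\<close>

locale strategic = barred_tree +
  fixes X :: "nat set" and mx :: "nat set \<Rightarrow> bool"
  assumes X: "perfect X"
    and mix: "fincl A \<Longrightarrow> A \<subseteq> X \<Longrightarrow> mx A \<Longrightarrow> Mix A X"
    and sep: "fincl A \<Longrightarrow> A \<subseteq> X \<Longrightarrow> \<not> mx A \<Longrightarrow> Sep A X"
begin

text \<open>The prescribed move is taken from \<open>X\<close> and not from the set \<open>U\<close>
  to which a play is restricted. Hence \<open>H U A\<close> depends on \<open>U\<close> only through
  the separated moves.\<close>

definition strat :: "nat set \<Rightarrow> nat option" where
  "strat A = (if mx A \<and> nxt A X \<noteq> {} then Some (SOME m. m \<in> nxt A X) else None)"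

abbreviation H :: "nat set \<Rightarrow> nat set \<Rightarrow> nat set" where
  "H \<equiv> outs strat"

lemma strat_mx:
  assumes "fincl A" "A \<subseteq> X" "mx A"
  obtains m where "strat A = Some m" "m \<in> nxt A X" "insert m A \<subseteq> X" "fincl (insert m A)"
proof -
  have ne: "nxt A X \<noteq> {}" using infinite_nxt[OF X assms(1,2)] by auto
  have m: "(SOME m. m \<in> nxt A X) \<in> nxt A X" using ne by (simp add: some_in_eq)
  show ?thesis
    by (rule that[OF _ m]) (use ne assms m nxt_D(1)[OF m] fincl_nxt[OF assms(1) m] in \<open>auto simp: strat_def\<close>)
qed

lemma strat_not_mx: "\<not> mx A \<Longrightarrow> strat A = None"
  by (simp add: strat_def)

lemma strat_range: "strat A \<in> insert None (Some ` nxt A UNIV)"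
proof (cases "strat A")
  case (Some m)
  then have "nxt A X \<noteq> {}" "m = (SOME m. m \<in> nxt A X)"
    by (auto simp: strat_def split: if_splits)
  then have "m \<in> nxt A X" by (simp add: some_in_eq)
  then have "m \<in> nxt A UNIV" by (simp add: nxt_def)
  then show ?thesis using Some by simp
qed simp

lemma H_cone: "fincl A \<Longrightarrow> U' \<inter> cone A \<subseteq> U \<Longrightarrow> H U' A \<subseteq> H U A"
  using outs_cone[of A U' U strat] strat_range by blast

lemma H_mono: "fincl A \<Longrightarrow> U' \<subseteq> U \<Longrightarrow> H U' A \<subseteq> H U A"
  by (rule H_cone) auto

lemma H_mx: "fincl A \<Longrightarrow> A \<subseteq> X \<Longrightarrow> val A = None \<Longrightarrow> mx A \<Longrightarrow>
  \<exists>m\<in>nxt A X. insert m A \<subseteq> X \<and> fincl (insert m A) \<and> (\<forall>U. H U A = H U (insert m A))"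
  by (erule (2) strat_mx) (auto simp: outs_strategic)

lemma H_not_mx: "val A = None \<Longrightarrow> \<not> mx A \<Longrightarrow> H U A = (\<Union>m\<in>nxt A U. H U (insert m A))"
  by (simp add: outs_branch strat_not_mx)

lemma insert_nxt_subset: "A \<subseteq> X \<Longrightarrow> m \<in> nxt A X \<Longrightarrow> insert m A \<subseteq> X"
  using nxt_D(1) by blast

lemma H_subset_S:
  assumes "fincl A" "A \<subseteq> X" "U \<subseteq> X"
  shows "H U A \<subseteq> S X A"
  using assms(1,2)
proof (induction A rule: bar_induct)
  case (step A)
  show ?case
  proof (cases "val A")
    case None
    show ?thesis
    proof (cases "mx A")
      case True
      then obtain m where m: "m \<in> nxt A X" "insert m A \<subseteq> X" "H U A = H U (insert m A)"
        using H_mx[OF step(1,3) None] by blast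
      then show ?thesis using step(2)[OF None m(1) m(2)] S_nxt[OF step(1) None m(1)] by blast
    next
      case False
      have "H U (insert m A) \<subseteq> S X A" if "m \<in> nxt A U" for m
      proof -
        have m: "m \<in> nxt A X" using that nxt_mono[OF assms(3)] by blast
        show ?thesis
          using step(2)[OF None m insert_nxt_subset[OF step(3) m]] S_nxt[OF step(1) None m] by (rule subset_trans)
      qed
      then show ?thesis unfolding H_not_mx[OF None False] by blast
    qed
  qed (simp add: outs_decided)
qed

text \<open>At a mixing move the subtree of the strategic move \<open>m\<close> is attached to \<open>W\<close>; its outputs are
  mixed with those of the moves already in \<open>W\<close>.\<close>

lemma S_meets_H:
  assumes U: "U \<subseteq> X" "\<And>s. s \<in> X \<Longrightarrow> lev s < k \<Longrightarrow> infinite (U \<inter> ch s)"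
    and "fincl A" "A \<subseteq> W" "W \<subseteq> X" "perfect W" "W \<inter> cone A \<subseteq> U \<union> A"
  shows "S W A \<inter> H U A \<noteq> {}"
  using assms(3-)
proof (induction A arbitrary: W rule: bar_induct)
  case (step A)
  note W = step(3-6)
  have AX: "A \<subseteq> X" using W by blast
  show ?case
  proof (cases "val A")
    case None
    show ?thesis
    proof (cases "mx A")
      case True
      then obtain m where m: "m \<in> nxt A X" "insert m A \<subseteq> X" "fincl (insert m A)" "H U A = H U (insert m A)"
        using H_mx[OF step(1) AX None] by blast
      have mA: "m \<notin> A" using nxt_D(3)[OF m(1)] fincl_Max(1)[OF step(1), of m] by auto
      define V where "V = W \<union> grow U {m}"
      have VX: "V \<subseteq> X" using W(2) grow_subset[of U "{m}"] U(1) m(2) by (auto simp: V_def)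
      have V: "perfect V"
        unfolding V_def
      proof (rule perfect_attach[OF W(3)])
        show "par m \<in> W" using ch_D(2)[OF nxt_D(2)[OF m(1)]] sel(1)[OF step(1)] W(1) by auto
        show "infinite (U \<inter> ch s)" if "s \<in> grow U {m}" "lev s < k" for s
          by (rule U(2)) (use that VX V_def in auto)
      qed
      have mV: "insert m A \<subseteq> V" using W(1) by (auto simp: V_def intro: grow.base)
      obtain V' where V': "V' \<subseteq> V" "perfect V'" "insert m A \<subseteq> V'"
        "S V' (insert m A) \<subseteq> H U A \<or> S V' (insert m A) \<inter> H U A = {}"
        using decide[OF m(3) V mV, of "H U A"] by blast
      have "S V' (insert m A) \<inter> H U (insert m A) \<noteq> {}"
      proof (rule step(2)[OF None m(1) V'(3) _ V'(2)])
        show "V' \<subseteq> X" using V'(1) VX by blast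
        show "V' \<inter> cone (insert m A) \<subseteq> U \<union> insert m A"
          using V'(1) cone_nxt[OF step(1) m(1)] W(4) grow_subset[of U "{m}"] unfolding V_def by blast
      qed
      \<comment> \<open>The induction hypothesis excludes the disjoint alternative.\<close>
      then have sub: "S V' (insert m A) \<subseteq> H U A" using V'(4) m(4) by blast
      have AV': "A \<subseteq> V'" using V'(3) by blast
      \<comment> \<open>Plays after the later move \<open>m'\<close> do not see the subtree attached
        at \<open>m\<close>. So their outputs are outputs in \<open>W\<close>, while mixing makes
        them meet those after \<open>m\<close>.\<close>
      obtain m' where m': "m' \<in> nxt A V'" "m < m'" using nxt_greater[OF V'(2) step(1) AV'] by blast
      have mm: "m \<in> nxt A V'" using m(1) V'(3) by (auto simp: nxt_def)
      have "V' \<inter> cone (insert m' A) \<subseteq> W"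
        using attach_Int_cone[OF fincl_nxt[OF step(1) m'(1)], of m W U] Max_nxt[OF step(1) m'(1)] m'(2) mA V'(1)
        unfolding V_def by auto
      then have *: "S V' (insert m' A) \<subseteq> S W (insert m' A)" "m' \<in> W"
        using S_cone[OF fincl_nxt[OF step(1) m'(1)]] nxt_D(1)[OF m'(1)] cone_base[of "insert m' A"] by auto
      have "m' \<in> nxt A W" using *(2) m'(1) by (auto simp: nxt_def)
      then have "S V' (insert m' A) \<subseteq> S W A" using S_nxt[OF step(1) None] *(1) by blast
      moreover have "S V' (insert m A) \<inter> S V' (insert m' A) \<noteq> {}"
        using mix[OF step(1) AX True, unfolded Mix_def, rule_format, OF _ V'(2) AV' mm m'] V'(1) VX by blast
      ultimately show ?thesis using sub by blast
    next
      case False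
      obtain m where m: "m \<in> nxt A W" using nxt_greater[OF W(3) step(1) W(1)] by blast
      have "m \<in> U" using nxt_in_cone[OF step(1) m] nxt_D(1,3)[OF m] W(4) fincl_Max(1)[OF step(1), of m] by auto
      then have mU: "m \<in> nxt A U" using m by (auto simp: nxt_def)
      have "S W (insert m A) \<inter> H U (insert m A) \<noteq> {}"
      proof (rule step(2)[OF None m _ W(2,3)])
        show "insert m A \<subseteq> W" using W(1) nxt_D(1)[OF m] by blast
        show "W \<inter> cone (insert m A) \<subseteq> U \<union> insert m A" using cone_nxt[OF step(1) m] W(4) by blast
      qed
      then show ?thesis
        unfolding H_not_mx[OF None False] using S_nxt[OF step(1) None m] mU by blast
    qed
  qed (simp add: outs_decided)
qed

text \<open>An output determines the separated moves that lead to it: outputs in \<open>U\<close>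
  are outputs in \<open>X\<close> by \<open>H_subset_S\<close>, and there different moves have
  disjoint outputs. The mixed moves are prescribed. So the play that leads to \<open>n\<close> is
  the same for all \<open>U\<close> until it reaches \<open>\<C>\<close>, and \<open>u\<close> is
  the move made there.\<close>

lemma hits_witness:
  assumes "hits \<C> X A" "fincl A" "A \<subseteq> X" "\<And>b. b \<in> \<C> \<Longrightarrow> val b = None \<and> \<not> mx b" "n \<in> H X A"
  shows "\<exists>b\<in>\<C>. \<exists>u\<in>ch (sel b). \<forall>U\<subseteq>X. n \<in> H U A \<longrightarrow> u \<in> U"
  using assms(1,2,3,5)
proof (induction rule: hits.induct)
  case (1 A)
  have A: "val A = None" "\<not> mx A" using assms(4)[OF 1(1)] by auto
  obtain m where m: "m \<in> nxt A X" "n \<in> H X (insert m A)" using 1(4) unfolding H_not_mx[OF A] by blast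
  have "m \<in> U" if U: "U \<subseteq> X" "n \<in> H U A" for U
  proof -
    obtain m' where m': "m' \<in> nxt A U" "n \<in> H U (insert m' A)" using U(2) unfolding H_not_mx[OF A] by blast
    have mX: "m' \<in> nxt A X" using m'(1) nxt_mono[OF U(1)] by blast
    have "n \<in> S X (insert m' A)" "n \<in> S X (insert m A)"
      using H_subset_S[OF fincl_nxt[OF 1(2) mX] insert_nxt_subset[OF 1(3) mX] U(1)] m'(2)
        H_subset_S[OF fincl_nxt[OF 1(2) m(1)] insert_nxt_subset[OF 1(3) m(1)] subset_refl] m(2) by auto
    then have "m = m'" using sep[OF 1(2,3) A(2)] m(1) mX unfolding Sep_def by blast
    then show ?thesis using nxt_D(1)[OF m'(1)] by simp
  qed
  then show ?case using 1(1) nxt_D(2)[OF m(1)] by blast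
next
  case (2 A)
  show ?case
  proof (cases "mx A")
    case True
    then obtain m where m: "m \<in> nxt A X" "insert m A \<subseteq> X" "fincl (insert m A)" "\<And>U. H U A = H U (insert m A)"
      using H_mx[OF 2(4,5) 2(1)] by blast
    show ?thesis using 2(3)[OF m(1,3,2)] 2(6) unfolding m(4) by blast
  next
    case False
    obtain m where m: "m \<in> nxt A X" "n \<in> H X (insert m A)" using 2(6) unfolding H_not_mx[OF 2(1) False] by blast
    then obtain b u where bu: "b \<in> \<C>" "u \<in> ch (sel b)" "\<And>U. U \<subseteq> X \<Longrightarrow> n \<in> H U (insert m A) \<Longrightarrow> u \<in> U"
      using 2(3)[OF m(1) fincl_nxt[OF 2(4) m(1)] insert_nxt_subset[OF 2(5) m(1)] m(2)] by blast
    have "u \<in> U" if U: "U \<subseteq> X" "n \<in> H U A" for U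
    proof -
      obtain m' where m': "m' \<in> nxt A U" "n \<in> H U (insert m' A)" using U(2) unfolding H_not_mx[OF 2(1) False] by blast
      have mX: "m' \<in> nxt A X" using m'(1) nxt_mono[OF U(1)] by blast
      have "n \<in> S X (insert m' A)" "n \<in> S X (insert m A)"
        using H_subset_S[OF fincl_nxt[OF 2(4) mX] insert_nxt_subset[OF 2(5) mX] U(1)] m'(2)
          H_subset_S[OF fincl_nxt[OF 2(4) m(1)] insert_nxt_subset[OF 2(5) m(1)] subset_refl] m(2) by auto
      then have "m = m'" using sep[OF 2(4,5) False] m(1) mX unfolding Sep_def by blast
      then show ?thesis using bu(3)[OF U(1)] m'(2) by simp
    qed
    then show ?thesis using bu(1,2) by blast
  qed
qed

section \<open>No separated moves below a mixed move\<close>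

definition below :: "nat \<Rightarrow> nat set set" where
  "below i = {b. val b = None \<and> \<not> mx b \<and> sel b \<in> grow UNIV {i}}"

text \<open>If the moves below \<open>i\<close> were separated, then two perfect sets that are disjoint below \<open>i\<close> but
  agree elsewhere would have disjoint outputs after \<open>i\<close>; by mixing, both would have to share outputs
  with the moves other than \<open>i\<close>, on which the two sets agree.\<close>

lemma not_hits_below:
  assumes A: "fincl A" "A \<subseteq> X" "val A = None" "mx A" and i: "i \<in> nxt A X"
  shows "\<not> hits (below i) X (insert i A)"
proof
  assume hits: "hits (below i) X (insert i A)"
  define A1 where "A1 = insert i A"
  have A1: "fincl A1" "A1 \<subseteq> X" using fincl_nxt[OF A(1) i] insert_nxt_subset[OF A(2) i] by (auto simp: A1_def)
  have iA: "i \<notin> A" "0 < i" using nxt_D(3)[OF i] fincl_Max(1)[OF A(1), of i] by auto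
  have "\<forall>s. \<exists>E. s \<in> X \<longrightarrow> lev s < k \<longrightarrow> E \<subseteq> X \<inter> ch s \<and> infinite E \<and> infinite (X \<inter> ch s - E)"
    using infinite_split perfect_D(3)[OF X] by blast
  then obtain E where E: "\<And>s. s \<in> X \<Longrightarrow> lev s < k \<Longrightarrow> E s \<subseteq> X \<inter> ch s \<and> infinite (E s) \<and> infinite (X \<inter> ch s - E s)"
    by metis
  \<comment> \<open>A colouring of the nodes by which every node has infinitely many children of
    either colour. The sets \<open>U True\<close> and \<open>U False\<close> have no proper
    descendant of \<open>i\<close> in common and agree elsewhere.\<close>
  define F where "F j = (if j then {u. u \<in> E (par u)} else {u. u \<notin> E (par u)})" for j
  define U where "U j = {u \<in> X. u \<in> grow UNIV {i} \<longrightarrow> u \<noteq> i \<longrightarrow> u \<in> F j}" for j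
  have UX: "U j \<subseteq> X" for j by (auto simp: U_def)
  have fat: "infinite (U j \<inter> ch s)" if s: "s \<in> X" "lev s < k" for j s
  proof -
    have "infinite (X \<inter> ch s \<inter> F j)"
    proof (cases j)
      case True
      have "E s \<subseteq> X \<inter> ch s \<inter> F j" using E[OF s] True by (auto simp: F_def ch_def)
      then show ?thesis using E[OF s] infinite_super by blast
    next
      case False
      have "X \<inter> ch s - E s \<subseteq> X \<inter> ch s \<inter> F j" using False by (auto simp: F_def ch_def)
      then show ?thesis using E[OF s] infinite_super by blast
    qed
    then show ?thesis by (rule infinite_super[rotated]) (auto simp: U_def)
  qed
  have disj: "H (U True) A1 \<inter> H (U False) A1 = {}"
  proof (rule ccontr)
    assume "\<not> ?thesis"
    then obtain n where n: "n \<in> H (U True) A1" "n \<in> H (U False) A1" by blast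
    then have "n \<in> H X A1" using H_mono[OF A1(1) UX] by blast
    then obtain b u where bu: "b \<in> below i" "u \<in> ch (sel b)" "\<forall>V\<subseteq>X. n \<in> H V A1 \<longrightarrow> u \<in> V"
      using hits_witness[OF hits[folded A1_def] A1, of n] by (auto simp: below_def)
    then have u: "u \<in> U True" "u \<in> U False" using n UX by auto
    have b: "sel b \<in> grow UNIV {i}" using bu(1) by (simp add: below_def)
    have "u \<in> grow UNIV {i}"
      by (rule grow.step) (use b ch_D(1,2)[OF bu(2)] in auto)
    moreover have "u \<noteq> i" using grow_ge[OF b] ch_D(3)[OF bu(2)] by simp
    ultimately show False using u by (auto simp: U_def F_def)
  qed
  \<comment> \<open>Without the subtree at \<open>i\<close>, so that \<open>Y\<close> is contained
    in both \<open>U True\<close> and \<open>U False\<close>.\<close>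
  define Y where "Y = X - grow UNIV {i}"
  have Y: "perfect Y" "A \<subseteq> Y" "Y \<subseteq> X" "\<And>j. Y \<subseteq> U j"
    using perfect_remove_subtree[OF X iA(2)] grow_Int_fincl[OF A(1) iA(1)] A(2) by (auto simp: Y_def U_def)
  obtain Z where Z: "Z \<subseteq> Y" "perfect Z" "A \<subseteq> Z" "S Z A \<subseteq> H (U True) A1 \<or> S Z A \<inter> H (U True) A1 = {}"
    using decide[OF A(1) Y(1,2)] by blast
  have "S Z A \<inter> H (U j) A1 \<noteq> {}" for j
  proof -
    define W where "W = Z \<union> grow (U j) {i}"
    have WU: "W \<subseteq> U j \<union> A1" using Z(1) Y(4) grow_subset[of "U j" "{i}"] by (auto simp: W_def A1_def)
    then have WX: "W \<subseteq> X" using UX A1 by blast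
    have W: "perfect W"
      unfolding W_def
    proof (rule perfect_attach[OF Z(2)])
      show "par i \<in> Z" using ch_D(2)[OF nxt_D(2)[OF i]] sel(1)[OF A(1)] Z(3) by auto
      show "infinite (U j \<inter> ch s)" if "s \<in> grow (U j) {i}" "lev s < k" for s
        by (rule fat) (use that WX W_def in auto)
    qed
    have AW: "A1 \<subseteq> W" using Z(3) by (auto simp: W_def A1_def intro: grow.base)
    obtain V where V: "V \<subseteq> W" "perfect V" "A1 \<subseteq> V" "S V A1 \<subseteq> H (U j) A1 \<or> S V A1 \<inter> H (U j) A1 = {}"
      using decide[OF A1(1) W AW] by blast
    have VX: "V \<subseteq> X" using V(1) WX by blast
    have "S V A1 \<inter> H (U j) A1 \<noteq> {}"
      by (rule S_meets_H[OF UX fat A1(1) V(3) VX V(2)]) (use V(1) WU in auto)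
    then have sub: "S V A1 \<subseteq> H (U j) A1" using V(4) by blast
    have AV: "A \<subseteq> V" using V(3) by (auto simp: A1_def)
    obtain i' where i': "i' \<in> nxt A V" "i < i'" using nxt_greater[OF V(2) A(1) AV] by blast
    have iV: "i \<in> nxt A V" using i V(3) by (auto simp: nxt_def A1_def)
    have "V \<inter> cone (insert i' A) \<subseteq> Z"
      using attach_Int_cone[OF fincl_nxt[OF A(1) i'(1)], of i Z "U j"] Max_nxt[OF A(1) i'(1)] i'(2) iA(1) V(1)
      unfolding W_def by auto
    then have *: "S V (insert i' A) \<subseteq> S Z (insert i' A)" "i' \<in> Z"
      using S_cone[OF fincl_nxt[OF A(1) i'(1)]] nxt_D(1)[OF i'(1)] cone_base[of "insert i' A"] by auto
    have "i' \<in> nxt A Z" using *(2) i'(1) by (auto simp: nxt_def)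
    then have "S V (insert i' A) \<subseteq> S Z A" using S_nxt[OF A(1,3)] *(1) by blast
    moreover have "S V (insert i A) \<inter> S V (insert i' A) \<noteq> {}"
      using mix[OF A(1,2,4), unfolded Mix_def, rule_format, OF VX V(2) AV iV i'] .
    ultimately show ?thesis using sub unfolding A1_def by blast
  qed
  \<comment> \<open>\<open>S Z A\<close> meets both sets, hence lies inside the first one by the
    choice of \<open>Z\<close>; but the two sets are disjoint.\<close>
  from this[of True] this[of False] Z(4) disj show False by blast
qed

end

context barred_tree
begin

lemma meets_mono: "meets \<C> X A \<Longrightarrow> X \<subseteq> X' \<Longrightarrow> meets \<C> X' A"
  by (induction rule: meets.induct) (use nxt_mono in \<open>blast intro: meets.intros\<close>)+

end

context strategic
begin

lemma strategic_subset:
  assumes "Y \<subseteq> X" "perfect Y"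
  shows "strategic k par lev sel val Y mx"
proof unfold_locales
  fix A assume A: "fincl A" "A \<subseteq> Y"
  then have AX: "A \<subseteq> X" using assms(1) by blast
  show "mx A \<Longrightarrow> Mix A Y" using mix[OF A(1) AX] Mix_mono assms(1) by blast
  show "\<not> mx A \<Longrightarrow> Sep A Y" using sep[OF A(1) AX] Sep_mono[OF A(1)] assms(1) by blast
qed (rule assms(2))

text \<open>In every perfect subset \<open>not_hits_below\<close> rules out one half of the
  dichotomy \<open>meets_or_hits\<close>. So the other half can be achieved at any one position, and
  fusion achieves it at all positions at once.\<close>

lemma closure:
  "\<exists>Y\<subseteq>X. perfect Y \<and> (\<forall>A i. fincl A \<longrightarrow> A \<subseteq> Y \<longrightarrow> val A = None \<longrightarrow> mx A \<longrightarrow> i \<in> nxt A Y \<longrightarrow>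
     \<not> meets (below i) Y (insert i A))"
proof -
  define \<Phi> where "\<Phi> C Z \<longleftrightarrow> (\<forall>A i. fincl A \<longrightarrow> val A = None \<longrightarrow> mx A \<longrightarrow> i \<in> nxt A UNIV \<longrightarrow> C = insert i A \<longrightarrow>
    \<not> meets (below i) Z C)" for C Z
  obtain Y where Y: "Y \<subseteq> X" "perfect Y" "\<And>C. \<lbrakk>fincl C; {0} \<subseteq> C; C \<subseteq> Y\<rbrakk> \<Longrightarrow> \<Phi> C Y"
  proof (rule fusion[OF X fincl_0, of \<Phi>])
    show "\<Phi> C Z'" if "fincl C" "Z' \<inter> cone C \<subseteq> Z" "\<Phi> C Z" for C Z Z'
      using that(3) meets_cone[OF _ that(1,2)] unfolding \<Phi>_def by blast
    show "\<exists>Z'\<subseteq>Z. perfect Z' \<and> C \<subseteq> Z' \<and> \<Phi> C Z'" if C: "fincl C" "perfect Z" "C \<subseteq> Z" "Z \<subseteq> X" for C Z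
    proof (cases "\<exists>A i. fincl A \<and> val A = None \<and> mx A \<and> i \<in> nxt A UNIV \<and> C = insert i A")
      case True
      then obtain A i where A: "fincl A" "val A = None" "mx A" "i \<in> nxt A UNIV" "C = insert i A" by blast
      obtain Z' where Z': "Z' \<subseteq> Z" "perfect Z'" "C \<subseteq> Z'" "\<not> meets (below i) Z' C \<or> hits (below i) Z' C"
        using meets_or_hits[OF C(1-3)] by blast
      have Z'X: "Z' \<subseteq> X" using Z'(1) C(4) by blast
      have iZ: "i \<in> nxt A Z'" "A \<subseteq> Z'" using A(4,5) Z'(3) by (auto simp: nxt_def)
      have nm: "\<not> meets (below i) Z' C"
        using strategic.not_hits_below[OF strategic_subset[OF Z'X Z'(2)] A(1) iZ(2) A(2,3) iZ(1)] Z'(4) A(5)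
        by blast
      have "\<Phi> C Z'"
        unfolding \<Phi>_def
      proof (intro allI impI)
        fix A' i' assume "fincl A'" "i' \<in> nxt A' UNIV" "C = insert i' A'"
        then have "i' = i" using Max_nxt[of A' i' UNIV] Max_nxt[OF A(1,4)] A(5) by simp
        then show "\<not> meets (below i') Z' C" using nm by simp
      qed
      then show ?thesis using Z'(1-3) by (intro exI[of _ Z']) simp
    next
      case False
      then have "\<Phi> C Z" unfolding \<Phi>_def by blast
      then show ?thesis using C by (intro exI[of _ Z]) simp
    qed
  qed (use perfect_D(1)[OF X] in auto)
  show ?thesis
  proof (intro exI[of _ Y] conjI allI impI)
    fix A i assume A: "fincl A" "A \<subseteq> Y" "val A = None" "mx A" "i \<in> nxt A Y"
    have "\<Phi> (insert i A) Y"
      using Y(3)[OF fincl_nxt[OF A(1,5)]] fincl_D(2)[OF A(1)] A(2) nxt_D(1)[OF A(5)] by blast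
    then show "\<not> meets (below i) Y (insert i A)"
      using A nxt_mono[of Y UNIV A] unfolding \<Phi>_def by blast
  qed (use Y in auto)
qed

definition level_moves :: "nat \<Rightarrow> nat set set" where
  "level_moves j = {b. val b = None \<and> \<not> mx b \<and> Suc (lev (sel b)) = j}"

text \<open>\<open>l\<close> is least such that the separated moves beyond level \<open>l\<close>
  can be avoided. If those on level \<open>l\<close> could be avoided as well, then
  \<open>l - 1\<close> would do. The least value exists because moves create nodes on levels up to
  \<open>k\<close> only.\<close>

lemma top_level:
  "\<exists>Y\<subseteq>X. perfect Y \<and> (\<exists>l\<le>k. (\<forall>j>l. \<not> meets (level_moves j) Y {0}) \<and> (0 < l \<longrightarrow> hits (level_moves l) Y {0}))"
proof -
  define P where "P l \<longleftrightarrow> (\<exists>Y\<subseteq>X. perfect Y \<and> (\<forall>j>l. \<not> meets (level_moves j) Y {0}))" for l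
  have no: "\<not> meets (level_moves j) X A" if "j > k" "fincl A" for j A
  proof
    assume "meets (level_moves j) X A"
    then show False using that(2)
    proof (induction rule: meets.induct)
      case (1 A)
      then show False using sel(2)[of A] that(1) by (simp add: level_moves_def)
    next
      case (2 A m)
      then show False using fincl_nxt by blast
    qed
  qed
  have Pk: "P k" unfolding P_def using X no[OF _ fincl_0] by blast
  define l where "l = (LEAST l. P l)"
  have "P l" unfolding l_def using Pk by (rule LeastI)
  have lk: "l \<le> k" unfolding l_def using Pk by (rule Least_le)
  obtain Y where Y: "Y \<subseteq> X" "perfect Y" "\<forall>j>l. \<not> meets (level_moves j) Y {0}"
    using \<open>P l\<close> unfolding P_def by blast
  obtain Z where Z: "Z \<subseteq> Y" "perfect Z" "\<not> meets (level_moves l) Z {0} \<or> hits (level_moves l) Z {0}"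
    using meets_or_hits[OF fincl_0 Y(2)] perfect_D(1)[OF Y(2)] by blast
  have Zl: "\<forall>j>l. \<not> meets (level_moves j) Z {0}" using Y(3) meets_mono[OF _ Z(1)] by blast
  have "hits (level_moves l) Z {0}" if "0 < l"
  proof (rule ccontr)
    assume "\<not> ?thesis"
    then have "\<not> meets (level_moves l) Z {0}" using Z(3) by blast
    then have "\<forall>j>l - 1. \<not> meets (level_moves j) Z {0}"
      using Zl that by (metis Suc_diff_1 Suc_lessI)
    then have "P (l - 1)" unfolding P_def using Z Y(1) by blast
    then have "l \<le> l - 1" unfolding l_def by (rule Least_le)
    then show False using that by simp
  qed
  then show ?thesis using Z(1,2) Y(1) Zl lk by (intro exI[of _ Z]) blast
qed

end

text \<open>\<open>Inv A K\<close>: the set \<open>K\<close> consists of those nodes of \<open>A\<close> that were created by separated moves.\<close>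

locale closed_strategic = strategic +
  fixes l :: nat
  assumes closed: "\<lbrakk>fincl A; A \<subseteq> X; val A = None; mx A; i \<in> nxt A X\<rbrakk> \<Longrightarrow> \<not> meets (below i) X (insert i A)"
    and top: "l < j \<Longrightarrow> \<not> meets (level_moves j) X {0}"
    and hit: "0 < l \<Longrightarrow> hits (level_moves l) X {0}"
begin

definition Inv :: "nat set \<Rightarrow> nat set \<Rightarrow> bool" where
  "Inv A K \<longleftrightarrow> fincl A \<and> A \<subseteq> X \<and> fincl K \<and> K \<subseteq> A \<and> (\<forall>u\<in>A - K. \<not> meets (below u) X A) \<and>
    (\<forall>j>l. \<not> meets (level_moves j) X A)"

section \<open>Strategic outputs are controlled by the nodes of separated moves\<close>

lemma Inv_D: "Inv A K \<Longrightarrow> fincl A" "Inv A K \<Longrightarrow> A \<subseteq> X" "Inv A K \<Longrightarrow> fincl K" "Inv A K \<Longrightarrow> K \<subseteq> A"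
  "Inv A K \<Longrightarrow> Max K \<le> Max A"
  using fincl_Max_mono by (auto simp: Inv_def)

lemma Inv_0: "Inv {0} {0}"
  using fincl_0 perfect_D(1)[OF X] top by (auto simp: Inv_def)

lemma Inv_mx:
  assumes "Inv A K" "val A = None" "mx A" "m \<in> nxt A X"
  shows "Inv (insert m A) K"
proof -
  have up: "meets \<C> X (insert m A) \<Longrightarrow> meets \<C> X A" for \<C>
    using meets.intros(2) assms(2,4) by blast
  show ?thesis
    using assms(1) fincl_nxt[OF Inv_D(1)[OF assms(1)] assms(4)] nxt_D(1)[OF assms(4)] up
      closed[OF Inv_D(1,2)[OF assms(1)] assms(2-4)]
    unfolding Inv_def by blast
qed

text \<open>A separated move at a node \<open>u\<close> outside \<open>K\<close> would put
  \<open>A\<close> itself into \<open>below u\<close>, and one that creates a node beyond level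
  \<open>l\<close> would put it into a forbidden \<open>level_moves j\<close>.\<close>

lemma Inv_not_mx:
  assumes "Inv A K" "val A = None" "\<not> mx A"
  shows "sel A \<in> K" "Suc (lev (sel A)) \<le> l" "m \<in> nxt A X \<Longrightarrow> Inv (insert m A) (insert m K)"
proof -
  note A = Inv_D(1)[OF assms(1)]
  show *: "sel A \<in> K"
  proof (rule ccontr)
    assume "sel A \<notin> K"
    then have "\<not> meets (below (sel A)) X A" using assms(1) sel(1)[OF A] unfolding Inv_def by blast
    moreover have "A \<in> below (sel A)" using assms by (auto simp: below_def intro: grow.base)
    ultimately show False using meets.intros(1) by blast
  qed
  show "Suc (lev (sel A)) \<le> l"
  proof (rule ccontr)
    assume "\<not> ?thesis"
    then have "\<not> meets (level_moves (Suc (lev (sel A)))) X A" using assms(1) unfolding Inv_def by auto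
    moreover have "A \<in> level_moves (Suc (lev (sel A)))" using assms by (auto simp: level_moves_def)
    ultimately show False using meets.intros(1) by blast
  qed
  assume m: "m \<in> nxt A X"
  have up: "meets \<C> X (insert m A) \<Longrightarrow> meets \<C> X A" for \<C>
    using meets.intros(2) assms(2) m by blast
  have "fincl (insert m K)" using fincl_insert[OF Inv_D(3)[OF assms(1)] * nxt_D(2)[OF m]] .
  then show "Inv (insert m A) (insert m K)"
    using assms(1) fincl_nxt[OF A m] nxt_D(1)[OF m] up unfolding Inv_def by blast
qed

text \<open>Separated moves add children of nodes of \<open>K\<close>, which is contained in
  \<open>Y\<close>; so the new nodes are in \<open>Y\<close> as well, and on levels up to
  \<open>l\<close> by the invariant. Mixed moves are prescribed and do not consult the set.\<close>

lemma H_level: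
  assumes "Inv A K" "K \<subseteq> Y" "Y \<subseteq> X"
  shows "H {u \<in> X. par u \<in> Y \<longrightarrow> u \<in> Y} A \<subseteq> H {u \<in> Y. lev u \<le> l} A"
  using Inv_D(1)[OF assms(1)] assms(1,2)
proof (induction A arbitrary: K rule: bar_induct)
  case (step A)
  note I = step(3)
  show ?case
  proof (cases "val A")
    case None
    show ?thesis
    proof (cases "mx A")
      case True
      then obtain m where m: "m \<in> nxt A X" "\<And>U. H U A = H U (insert m A)"
        using H_mx[OF Inv_D(1,2)[OF I] None] by blast
      show ?thesis unfolding m(2) by (rule step(2)[OF None m(1) Inv_mx[OF I None True m(1)] step(4)])
    next
      case False
      note N = Inv_not_mx[OF I None False]
      have "n \<in> H {u \<in> Y. lev u \<le> l} A"
        if m: "m \<in> nxt A {u \<in> X. par u \<in> Y \<longrightarrow> u \<in> Y}" "n \<in> H {u \<in> X. par u \<in> Y \<longrightarrow> u \<in> Y} (insert m A)" for m n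
      proof -
        have c: "par m = sel A" "lev m = Suc (lev (sel A))" using nxt_D(2)[OF m(1)] ch_D by auto
        have mX: "m \<in> nxt A X" and mY: "m \<in> Y" using m(1) c(1) N(1) step(4) by (auto simp: nxt_def)
        have "n \<in> H {u \<in> Y. lev u \<le> l} (insert m A)"
          using step(2)[OF None mX N(3)[OF mX]] step(4) mY m(2) by blast
        moreover have "m \<in> nxt A {u \<in> Y. lev u \<le> l}" using m(1) mY c(2) N(2) by (auto simp: nxt_def)
        ultimately show ?thesis unfolding H_not_mx[OF None False] by blast
      qed
      then show ?thesis unfolding H_not_mx[OF None False, of "{u \<in> X. par u \<in> Y \<longrightarrow> u \<in> Y}"] by blast
    qed
  qed (simp add: outs_decided)
qed

text \<open>Locality for strategic plays with \<open>K\<close> in place of \<open>A\<close>: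
  separated moves extend nodes of \<open>K\<close>, so only nodes in \<open>cone K\<close> are ever
  looked up in the set.\<close>

lemma H_cone_K:
  assumes "Inv A K" "U \<subseteq> X" "U \<inter> cone K \<subseteq> U'"
  shows "H U A \<subseteq> H U' A"
  using Inv_D(1)[OF assms(1)] assms(1,3)
proof (induction A arbitrary: K rule: bar_induct)
  case (step A)
  note I = step(3)
  show ?case
  proof (cases "val A")
    case None
    show ?thesis
    proof (cases "mx A")
      case True
      then obtain m where m: "m \<in> nxt A X" "\<And>U. H U A = H U (insert m A)"
        using H_mx[OF Inv_D(1,2)[OF I] None] by blast
      show ?thesis unfolding m(2) by (rule step(2)[OF None m(1) Inv_mx[OF I None True m(1)] step(4)])
    next
      case False
      note N = Inv_not_mx[OF I None False]
      have "n \<in> H U' A" if m: "m \<in> nxt A U" "n \<in> H U (insert m A)" for m n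
      proof -
        have mX: "m \<in> nxt A X" using m(1) nxt_mono[OF assms(2)] by blast
        have gt: "Max K < m" using nxt_D(3)[OF m(1)] Inv_D(5)[OF I] by simp
        have sub: "cone (insert m K) \<subseteq> cone K" by (rule cone_insert[OF Inv_D(3)[OF I] N(1) nxt_D(2)[OF m(1)] gt])
        then have "m \<in> cone K" using cone_base[of "insert m K"] by blast
        then have mU: "m \<in> nxt A U'" using m(1) step(4) by (auto simp: nxt_def)
        have "n \<in> H U' (insert m A)"
          using step(2)[OF None mX N(3)[OF mX]] sub step(4) m(2) by blast
        then show ?thesis unfolding H_not_mx[OF None False] using mU by blast
      qed
      then show ?thesis unfolding H_not_mx[OF None False, of U] by blast
    qed
  qed (simp add: outs_decided)
qed

text \<open>The analogue of \<open>decide\<close> for strategic plays. Since prescribed nodes are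
  not looked up in the tree, the shrinking takes place around \<open>K\<close> instead of the whole
  position.\<close>

lemma H_decide:
  assumes "Inv A K" "perfect Y" "Y \<subseteq> X" "K \<subseteq> Y"
  shows "\<exists>Z\<subseteq>Y. perfect Z \<and> K \<subseteq> Z \<and> (H Z A \<subseteq> B \<or> H Z A \<inter> B = {})"
  using Inv_D(1)[OF assms(1)] assms
proof (induction A arbitrary: K Y rule: bar_induct)
  case (step A)
  note I = step(3) and Y = step(4-6)
  show ?case
  proof (cases "val A")
    case None
    show ?thesis
    proof (cases "mx A")
      case True
      then obtain m where m: "m \<in> nxt A X" "\<And>U. H U A = H U (insert m A)"
        using H_mx[OF Inv_D(1,2)[OF I] None] by blast
      show ?thesis unfolding m(2) by (rule step(2)[OF None m(1) Inv_mx[OF I None True m(1)] Y])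
    next
      case False
      note N = Inv_not_mx[OF I None False]
      \<comment> \<open>The intersection with \<open>Y\<close> is there because locality speaks of
        arbitrary perfect sets, while \<open>H_cone_K\<close> applies to subsets of
        \<open>X\<close>.\<close>
      have loc: "localp (insert m K) (\<lambda>Z. H (Z \<inter> Y) (insert m A) \<subseteq> B)"
        "localp (insert m K) (\<lambda>Z. H (Z \<inter> Y) (insert m A) \<inter> B = {})" if "m \<in> nxt A X" for m
      proof -
        have "H (Z' \<inter> Y) (insert m A) \<subseteq> H (Z \<inter> Y) (insert m A)" if "Z' \<inter> cone (insert m K) \<subseteq> Z" for Z Z'
          by (rule H_cone_K[OF N(3)[OF \<open>m \<in> nxt A X\<close>]]) (use that Y(2) in auto)
        then show "localp (insert m K) (\<lambda>Z. H (Z \<inter> Y) (insert m A) \<subseteq> B)"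
          "localp (insert m K) (\<lambda>Z. H (Z \<inter> Y) (insert m A) \<inter> B = {})"
          unfolding localp_def by blast+
      qed
      obtain Z where Z: "Z \<subseteq> Y" "perfect Z" "K \<subseteq> Z"
        "(\<forall>m\<in>Z \<inter> ch (sel A). Max A < m \<longrightarrow> Max K < m \<longrightarrow> m \<in> X \<longrightarrow> H (Z \<inter> Y) (insert m A) \<subseteq> B) \<or>
         (\<forall>m\<in>Z \<inter> ch (sel A). Max A < m \<longrightarrow> Max K < m \<longrightarrow> m \<in> X \<longrightarrow> H (Z \<inter> Y) (insert m A) \<inter> B = {})"
      proof (rule one_step_cases[OF Y(1) Inv_D(3)[OF I] Y(3) N(1) sel(2)[OF Inv_D(1)[OF I]], of "Max A"
            "\<lambda>m Z. m \<in> X \<longrightarrow> H (Z \<inter> Y) (insert m A) \<subseteq> B" "\<lambda>m Z. m \<in> X \<longrightarrow> H (Z \<inter> Y) (insert m A) \<inter> B = {}"])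
        show "localp (insert m K) (\<lambda>Z. m \<in> X \<longrightarrow> H (Z \<inter> Y) (insert m A) \<subseteq> B)"
          "localp (insert m K) (\<lambda>Z. m \<in> X \<longrightarrow> H (Z \<inter> Y) (insert m A) \<inter> B = {})"
          if "m \<in> ch (sel A)" "Max A < m" for m
          using loc[of m] that by (auto simp: localp_def nxt_def)
        show "\<exists>X''\<subseteq>X'. perfect X'' \<and> insert m K \<subseteq> X'' \<and> ((m \<in> X \<longrightarrow> H (X'' \<inter> Y) (insert m A) \<subseteq> B) \<or>
            (m \<in> X \<longrightarrow> H (X'' \<inter> Y) (insert m A) \<inter> B = {}))"
          if m: "m \<in> ch (sel A)" "Max A < m" "perfect X'" "X' \<subseteq> Y" "insert m K \<subseteq> X'" for m X'
        proof -
          have mX: "m \<in> nxt A X" and X': "X' \<subseteq> X" using m Y(2) by (auto simp: nxt_def)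
          obtain X'' where X'': "X'' \<subseteq> X'" "perfect X''" "insert m K \<subseteq> X''"
            "H X'' (insert m A) \<subseteq> B \<or> H X'' (insert m A) \<inter> B = {}"
            using step(2)[OF None mX N(3)[OF mX] m(3) X' m(5)] by blast
          moreover have "X'' \<inter> Y = X''" using X''(1) m(4) by blast
          ultimately show ?thesis by (intro exI[of _ X'']) auto
        qed
      qed
      have ZY: "Z \<inter> Y = Z" using Z(1) by blast
      have "m \<in> Z \<inter> ch (sel A)" "Max A < m" "Max K < m" "m \<in> X" if "m \<in> nxt A Z" for m
        using nxt_D[OF that] Z(1) Y(2) Inv_D(5)[OF I] by auto
      then have "H Z A \<subseteq> B \<or> H Z A \<inter> B = {}"
        using Z(4) unfolding H_not_mx[OF None False] ZY by blast
      then show ?thesis using Z(1-3) by (intro exI[of _ Z]) simp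
    qed
  next
    case (Some n)
    then have "H Y A \<subseteq> B \<or> H Y A \<inter> B = {}" by (auto simp: outs_decided)
    then show ?thesis using Y by (intro exI[of _ Y]) simp
  qed
qed

text \<open>\<open>?U\<close> agrees with \<open>Y\<close> on the children of nodes of
  \<open>Y\<close> and with \<open>X\<close> elsewhere. So every node of \<open>X\<close> keeps
  infinitely many children, as \<open>S_meets_H\<close> requires, and \<open>H_level\<close> then
  removes the excess.\<close>

lemma S_meets_H_level:
  assumes "perfect Y" "Y \<subseteq> X"
  shows "S Y {0} \<inter> H {u \<in> Y. lev u \<le> l} {0} \<noteq> {}"
proof -
  let ?U = "{u \<in> X. par u \<in> Y \<longrightarrow> u \<in> Y}"
  have "S Y {0} \<inter> H ?U {0} \<noteq> {}"
  proof (rule S_meets_H[OF _ _ fincl_0 _ assms(2,1)])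
    show "infinite (?U \<inter> ch s)" if s: "s \<in> X" "lev s < k" for s
    proof (cases "s \<in> Y")
      case True
      have "Y \<inter> ch s \<subseteq> ?U \<inter> ch s" using assms(2) by auto
      then show ?thesis using perfect_D(3)[OF assms(1) True s(2)] infinite_super by blast
    next
      case False
      have "X \<inter> ch s \<subseteq> ?U \<inter> ch s" using False by (auto simp: ch_def)
      then show ?thesis using perfect_D(3)[OF X s] infinite_super by blast
    qed
  qed (use assms perfect_D(1)[OF assms(1)] in auto)
  moreover have "H ?U {0} \<subseteq> H {u \<in> Y. lev u \<le> l} {0}"
    by (rule H_level[OF Inv_0]) (use assms perfect_D(1)[OF assms(1)] in auto)
  ultimately show ?thesis by blast
qed

text \<open>By \<open>top_level\<close> every play passes a separated move that creates a node on
  level \<open>l\<close>, and \<open>hits_witness\<close> recovers this node from the output. For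
  \<open>l = 0\<close> the root serves.\<close>

lemma ex_code: "\<exists>c :: nat \<Rightarrow> nat. \<forall>Z\<subseteq>X. 0 \<in> Z \<longrightarrow> (\<forall>n\<in>H Z {0}. c n \<in> Z \<and> lev (c n) = l)"
proof (cases "l = 0")
  case True
  then show ?thesis by (intro exI[of _ "\<lambda>_. 0"]) (simp add: lev_0)
next
  case False
  have "\<exists>u. lev u = l \<and> (\<forall>Z\<subseteq>X. n \<in> H Z {0} \<longrightarrow> u \<in> Z)" if "n \<in> H X {0}" for n
  proof -
    have "\<exists>b\<in>level_moves l. \<exists>u\<in>ch (sel b). \<forall>U\<subseteq>X. n \<in> H U {0} \<longrightarrow> u \<in> U"
      by (rule hits_witness[OF hit fincl_0 _ _ that]) (use False perfect_D(1)[OF X] in \<open>auto simp: level_moves_def\<close>)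
    then obtain b u where u: "b \<in> level_moves l" "u \<in> ch (sel b)" "\<forall>U\<subseteq>X. n \<in> H U {0} \<longrightarrow> u \<in> U" by blast
    then have "lev u = l" using ch_D(4)[OF u(2)] by (simp add: level_moves_def)
    then show ?thesis using u(3) by blast
  qed
  then obtain c where c: "\<And>n. n \<in> H X {0} \<Longrightarrow> lev (c n) = l \<and> (\<forall>Z\<subseteq>X. n \<in> H Z {0} \<longrightarrow> c n \<in> Z)" by metis
  show ?thesis
    by (intro exI[of _ c]) (use c H_mono[OF fincl_0] in blast)
qed

end

context barred_tree
begin

text \<open>All that the forcing argument needs to know about the game: \<open>h U\<close> is the
  set of outputs of the strategic plays in \<open>U\<close>, and \<open>c\<close> decodes an output
  to a node on level \<open>l\<close>.\<close>

lemma projection_structure: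
  assumes "perfect X0"
  obtains X l h c where "X \<subseteq> X0" "perfect X" "l \<le> k"
    "\<And>U U'. U \<subseteq> U' \<Longrightarrow> h U \<subseteq> h U'"
    "\<And>Y. perfect Y \<Longrightarrow> Y \<subseteq> X \<Longrightarrow> S Y {0} \<inter> h {u \<in> Y. lev u \<le> l} \<noteq> {}"
    "\<And>B Y. perfect Y \<Longrightarrow> Y \<subseteq> X \<Longrightarrow> \<exists>Z\<subseteq>Y. perfect Z \<and> (h {u \<in> Z. lev u \<le> l} \<subseteq> B \<or> h {u \<in> Z. lev u \<le> l} \<inter> B = {})"
    "\<And>Z n. Z \<subseteq> X \<Longrightarrow> 0 \<in> Z \<Longrightarrow> n \<in> h Z \<Longrightarrow> c n \<in> Z \<and> lev (c n) = l"
proof -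
  obtain X1 where X1: "X1 \<subseteq> X0" "perfect X1" "\<forall>A. fincl A \<longrightarrow> A \<subseteq> X1 \<longrightarrow> Mix A X1 \<or> Sep A X1"
    using homogeneous[OF assms] by blast
  define mx where "mx A \<longleftrightarrow> Mix A X1" for A
  interpret s1: strategic k par lev sel val X1 mx
    by unfold_locales (use X1 in \<open>auto simp: mx_def\<close>)
  obtain X2 where X2: "X2 \<subseteq> X1" "perfect X2" and
    cl: "\<And>A i. \<lbrakk>fincl A; A \<subseteq> X2; val A = None; mx A; i \<in> nxt A X2\<rbrakk> \<Longrightarrow> \<not> meets (s1.below i) X2 (insert i A)"
    using s1.closure by blast
  interpret s2: strategic k par lev sel val X2 mx
    by (rule s1.strategic_subset[OF X2])
  obtain X l where X: "X \<subseteq> X2" "perfect X" "l \<le> k" "\<And>j. j > l \<Longrightarrow> \<not> meets (s2.level_moves j) X {0}"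
    "0 < l \<Longrightarrow> hits (s2.level_moves l) X {0}"
    using s2.top_level by blast
  interpret s3: strategic k par lev sel val X mx
    by (rule s2.strategic_subset[OF X(1,2)])
  interpret c: closed_strategic k par lev sel val X mx l
  proof unfold_locales
    fix A i assume A: "fincl A" "A \<subseteq> X" "val A = None" "mx A" "i \<in> nxt A X"
    have "\<not> meets (s1.below i) X2 (insert i A)"
      using cl[OF A(1) _ A(3,4)] A(2,5) X(1) nxt_mono[OF X(1)] by blast
    then show "\<not> meets (s1.below i) X (insert i A)" using meets_mono[OF _ X(1)] by blast
  qed (use X in auto)
  obtain code where code: "\<forall>Z\<subseteq>X. 0 \<in> Z \<longrightarrow> (\<forall>n\<in>s3.H Z {0}. code n \<in> Z \<and> lev (code n) = l)"
    using c.ex_code by blast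
  show ?thesis
  proof (rule that[of X l "\<lambda>U. s3.H U {0}" code])
    show "X \<subseteq> X0" using X1 X2 X by blast
    show "s3.H U {0} \<subseteq> s3.H U' {0}" if "U \<subseteq> U'" for U U' by (rule s3.H_mono[OF fincl_0 that])
    show "S Y {0} \<inter> s3.H {u \<in> Y. lev u \<le> l} {0} \<noteq> {}" if "perfect Y" "Y \<subseteq> X" for Y
      by (rule c.S_meets_H_level[OF that])
    show "\<exists>Z\<subseteq>Y. perfect Z \<and> (s3.H {u \<in> Z. lev u \<le> l} {0} \<subseteq> B \<or> s3.H {u \<in> Z. lev u \<le> l} {0} \<inter> B = {})"
      if Y: "perfect Y" "Y \<subseteq> X" for B Y
    proof -
      have "{0} \<subseteq> Y" using perfect_D(1)[OF Y(1)] by simp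
      then obtain Z where Z: "Z \<subseteq> Y" "perfect Z" "s3.H Z {0} \<subseteq> B \<or> s3.H Z {0} \<inter> B = {}"
        using c.H_decide[OF c.Inv_0 Y, of B] by metis
      have sub: "s3.H {u \<in> Z. lev u \<le> l} {0} \<subseteq> s3.H Z {0}" by (rule s3.H_mono[OF fincl_0]) auto
      have "s3.H {u \<in> Z. lev u \<le> l} {0} \<subseteq> B \<or> s3.H {u \<in> Z. lev u \<le> l} {0} \<inter> B = {}"
        using Z(3)
      proof
        assume "s3.H Z {0} \<subseteq> B"
        with sub show ?thesis by (rule disjI1[OF subset_trans])
      next
        assume "s3.H Z {0} \<inter> B = {}"
        then show ?thesis using sub by (intro disjI2) auto
      qed
      then show ?thesis using Z(1,2) by (intro exI[of _ Z]) simp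
    qed
    show "code n \<in> Z \<and> lev (code n) = l" if "Z \<subseteq> X" "0 \<in> Z" "n \<in> s3.H Z {0}" for Z n
      using code that by simp
  qed (use X in auto)
qed

end

section \<open>Forcing without new subsets of countable sets\<close>

text \<open>\<open>D\<close> is the set of conditions at which sentences are evaluated. It will be
  the conditions below \<open>cond UNIV\<close> for the main argument, and the whole field for
  locating these.\<close>

locale forcing_base =
  fixes r :: "'p rel" and D :: "'p set"
  assumes D_refl: "p \<in> D \<Longrightarrow> (p, p) \<in> r" and r_trans: "trans r"
    and D_down: "p \<in> D \<Longrightarrow> (q, p) \<in> r \<Longrightarrow> q \<in> D"
begin

lemma le_trans: "(x, y) \<in> r \<Longrightarrow> (y, z) \<in> r \<Longrightarrow> (x, z) \<in> r"
  using r_trans by (rule transD)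

section \<open>Persistent and regular sentences\<close>

definition pers :: "'p sentence \<Rightarrow> bool" where
  "pers \<phi> \<longleftrightarrow> (\<forall>p q. \<phi> r p \<longrightarrow> (q, p) \<in> r \<longrightarrow> \<phi> r q)"

text \<open>The two general properties of a forcing relation. They have to be derived for each
  sentence in turn, since the type of sentences contains arbitrary predicates of conditions.\<close>

definition reg :: "'p sentence \<Rightarrow> bool" where
  "reg \<phi> \<longleftrightarrow> pers \<phi> \<and> (\<forall>p\<in>D. (\<forall>q. (q, p) \<in> r \<longrightarrow> (\<exists>q'. (q', q) \<in> r \<and> \<phi> r q')) \<longrightarrow> \<phi> r p)"

definition regs :: "('a, 'p) iset \<Rightarrow> bool" where
  "regs X \<longleftrightarrow> (\<forall>a. reg (X a))"

lemma persD: "pers \<phi> \<Longrightarrow> \<phi> r p \<Longrightarrow> (q, p) \<in> r \<Longrightarrow> \<phi> r q"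
  unfolding pers_def by blast

lemma reg_pers: "reg \<phi> \<Longrightarrow> pers \<phi>"
  by (simp add: reg_def)

lemma regD: "reg \<phi> \<Longrightarrow> \<phi> r p \<Longrightarrow> (q, p) \<in> r \<Longrightarrow> \<phi> r q"
  using persD reg_pers by blast

lemma reg_dense: "reg \<phi> \<Longrightarrow> p \<in> D \<Longrightarrow> (\<And>q. (q, p) \<in> r \<Longrightarrow> \<exists>q'. (q', q) \<in> r \<and> \<phi> r q') \<Longrightarrow> \<phi> r p"
  unfolding reg_def by blast

lemma regs_reg: "regs X \<Longrightarrow> reg (X a)"
  by (simp add: regs_def)

lemma pers_fnot: "pers (\<^bold>\<not> \<phi>)"
  unfolding pers_def fnot_def using le_trans by blast

lemma pers_fand: "pers \<phi> \<Longrightarrow> pers \<psi> \<Longrightarrow> pers (\<phi> \<^bold>\<and> \<psi>)"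
  unfolding pers_def fand_def by blast

lemma pers_fall: "(\<And>x. pers (\<Phi> x)) \<Longrightarrow> pers (\<^bold>\<forall>x. \<Phi> x)"
  unfolding pers_def fall_def by blast

lemma reg_fnot: assumes "pers \<phi>" shows "reg (\<^bold>\<not> \<phi>)"
  unfolding reg_def
proof (intro conjI ballI impI)
  fix p assume p: "p \<in> D" "\<forall>q. (q, p) \<in> r \<longrightarrow> (\<exists>q'. (q', q) \<in> r \<and> (\<^bold>\<not> \<phi>) r q')"
  show "(\<^bold>\<not> \<phi>) r p"
    unfolding fnot_def
  proof (intro allI impI notI)
    fix q assume q: "(q, p) \<in> r" "\<phi> r q"
    then obtain q' where q': "(q', q) \<in> r" "(\<^bold>\<not> \<phi>) r q'" using p(2) by blast
    have "q' \<in> D" using D_down[OF D_down[OF p(1) q(1)] q'(1)] .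
    then show False using q'(2) D_refl persD[OF assms q(2) q'(1)] unfolding fnot_def by blast
  qed
qed (rule pers_fnot)

lemma reg_fand: "reg \<phi> \<Longrightarrow> reg \<psi> \<Longrightarrow> reg (\<phi> \<^bold>\<and> \<psi>)"
proof -
  assume *: "reg \<phi>" "reg \<psi>"
  show ?thesis
    unfolding reg_def
  proof (intro conjI ballI impI)
    show "pers (\<phi> \<^bold>\<and> \<psi>)" using * by (intro pers_fand reg_pers)
    fix p assume p: "p \<in> D" "\<forall>q. (q, p) \<in> r \<longrightarrow> (\<exists>q'. (q', q) \<in> r \<and> (\<phi> \<^bold>\<and> \<psi>) r q')"
    then show "(\<phi> \<^bold>\<and> \<psi>) r p"
      using reg_dense[OF *(1) p(1)] reg_dense[OF *(2) p(1)] unfolding fand_def by blast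
  qed
qed

lemma reg_fground: "reg \<guillemotleft>b\<guillemotright>"
  unfolding reg_def pers_def fground_def using D_refl by blast

lemma reg_fimp: "pers \<phi> \<Longrightarrow> reg (\<phi> \<^bold>\<longrightarrow> \<psi>)"
  unfolding fimp_def by (intro reg_fnot pers_fand pers_fnot)

lemma reg_fiff: "pers \<phi> \<Longrightarrow> pers \<psi> \<Longrightarrow> reg (\<phi> \<^bold>\<longleftrightarrow> \<psi>)"
  unfolding fiff_def by (intro reg_fand reg_fimp)

lemma reg_fall: assumes "\<And>x. reg (\<Phi> x)" shows "reg (\<^bold>\<forall>x. \<Phi> x)"
  unfolding reg_def
proof (intro conjI ballI impI)
  show "pers (\<^bold>\<forall>x. \<Phi> x)" using assms by (intro pers_fall reg_pers)
  fix p assume p: "p \<in> D" "\<forall>q. (q, p) \<in> r \<longrightarrow> (\<exists>q'. (q', q) \<in> r \<and> (\<^bold>\<forall>x. \<Phi> x) r q')"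
  then show "(\<^bold>\<forall>x. \<Phi> x) r p" using reg_dense[OF assms p(1)] unfolding fall_def by blast
qed

lemma reg_fex: "reg (\<^bold>\<exists>x. \<Phi> x)"
  unfolding fex_def by (intro reg_fnot pers_fall pers_fnot)

lemma reg_dense_below: "reg (\<lambda>r p. dense_below r p (P r))"
  unfolding reg_def pers_def dense_below_def
proof (intro conjI ballI allI impI)
  fix p q q2 assume "\<forall>q. (q, p) \<in> r \<longrightarrow> (\<exists>q'. (q', q) \<in> r \<and> P r q')" "(q, p) \<in> r" "(q2, q) \<in> r"
  then show "\<exists>q'. (q', q2) \<in> r \<and> P r q'" using le_trans by blast
next
  fix p q assume p: "p \<in> D" "(q, p) \<in> r"
    "\<forall>q. (q, p) \<in> r \<longrightarrow> (\<exists>q'. (q', q) \<in> r \<and> (\<forall>qa. (qa, q') \<in> r \<longrightarrow> (\<exists>q'. (q', qa) \<in> r \<and> P r q')))"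
  then obtain q' where q': "(q', q) \<in> r" "\<And>qa. (qa, q') \<in> r \<Longrightarrow> (\<exists>q'. (q', qa) \<in> r \<and> P r q')" by blast
  have "q' \<in> D" using D_down p q' by blast
  then obtain q3 where "(q3, q') \<in> r" "P r q3" using q'(2) D_refl by blast
  then show "\<exists>q'. (q', q) \<in> r \<and> P r q'" using q'(1) le_trans by blast
qed

lemma regs_val_set: "regs (val_set \<tau>)"
  unfolding regs_def val_set_def using reg_dense_below[of "\<lambda>r q. \<exists>s. (_, s) \<in> \<tau> \<and> (q, s) \<in> r"] by auto

lemma reg_val_fam: "reg (val_fam F X)"
  unfolding val_fam_def
  by (rule reg_dense_below[of "\<lambda>r q. \<exists>\<tau> s. (\<tau>, s) \<in> F \<and> (q, s) \<in> r \<and> (X \<^bold>\<doteq> val_set \<tau>) r q"])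

lemma reg_val_rel: "reg (val_rel R X Y)"
  unfolding val_rel_def
  by (rule reg_dense_below[of "\<lambda>r q. \<exists>\<tau> \<sigma> s. ((\<tau>, \<sigma>), s) \<in> R \<and> (q, s) \<in> r \<and> (X \<^bold>\<doteq> val_set \<tau>) r q \<and> (Y \<^bold>\<doteq> val_set \<sigma>) r q"])

lemma regs_check: "regs (check_set A)"
  unfolding regs_def check_set_def by (simp add: reg_fground)

text \<open>Implication abbreviates a negated conjunction. The direct clause is recovered because
  regularity of \<open>\<psi>\<close> removes the double negation.\<close>

lemma fimp_iff: "pers \<phi> \<Longrightarrow> reg \<psi> \<Longrightarrow> p \<in> D \<Longrightarrow> (\<phi> \<^bold>\<longrightarrow> \<psi>) r p \<longleftrightarrow> (\<forall>q. (q, p) \<in> r \<longrightarrow> \<phi> r q \<longrightarrow> \<psi> r q)"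
proof
  assume *: "pers \<phi>" "reg \<psi>" "p \<in> D" and imp: "(\<phi> \<^bold>\<longrightarrow> \<psi>) r p"
  show "\<forall>q. (q, p) \<in> r \<longrightarrow> \<phi> r q \<longrightarrow> \<psi> r q"
  proof (intro allI impI)
    fix q assume q: "(q, p) \<in> r" "\<phi> r q"
    show "\<psi> r q"
    proof (rule reg_dense[OF *(2) D_down[OF *(3) q(1)]])
      fix q' assume q': "(q', q) \<in> r"
      have "\<phi> r q'" by (rule persD[OF *(1) q(2) q'])
      then show "\<exists>q''. (q'', q') \<in> r \<and> \<psi> r q''"
        using imp le_trans[OF q' q(1)] unfolding fimp_def fnot_def fand_def by blast
    qed
  qed
next
  assume *: "pers \<phi>" "reg \<psi>" "p \<in> D" and imp: "\<forall>q. (q, p) \<in> r \<longrightarrow> \<phi> r q \<longrightarrow> \<psi> r q"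
  show "(\<phi> \<^bold>\<longrightarrow> \<psi>) r p"
    unfolding fimp_def fnot_def fand_def using imp D_refl D_down[OF *(3)] by blast
qed

lemma fimpI: "(\<And>q. (q, p) \<in> r \<Longrightarrow> \<phi> r q \<Longrightarrow> \<psi> r q) \<Longrightarrow> p \<in> D \<Longrightarrow> (\<phi> \<^bold>\<longrightarrow> \<psi>) r p"
  unfolding fimp_def fnot_def fand_def using D_refl D_down by blast

lemma fex_iff: "(\<^bold>\<exists>x. \<Phi> x) r p \<longleftrightarrow> (\<forall>q. (q, p) \<in> r \<longrightarrow> (\<exists>q' x. (q', q) \<in> r \<and> \<Phi> x r q'))"
  unfolding fex_def fnot_def fall_def by blast

lemma fallI: "(\<And>x. \<Phi> x r p) \<Longrightarrow> (\<^bold>\<forall>x. \<Phi> x) r p"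
  by (simp add: fall_def)

lemma fallD: "(\<^bold>\<forall>x. \<Phi> x) r p \<Longrightarrow> \<Phi> a r p"
  by (simp add: fall_def)

lemma fexD: "(\<^bold>\<exists>x. \<Phi> x) r p \<Longrightarrow> (q, p) \<in> r \<Longrightarrow> \<exists>q' x. (q', q) \<in> r \<and> \<Phi> x r q'"
  by (simp add: fex_iff)

lemma fdisj_iff: "(\<phi> \<^bold>\<or> \<psi>) r p \<longleftrightarrow> (\<forall>q. (q, p) \<in> r \<longrightarrow> (\<exists>q'. (q', q) \<in> r \<and> (\<phi> r q' \<or> \<psi> r q')))"
  unfolding fdisj_def fnot_def fand_def by blast

lemma fiff_iff: "reg \<phi> \<Longrightarrow> reg \<psi> \<Longrightarrow> p \<in> D \<Longrightarrow> (\<phi> \<^bold>\<longleftrightarrow> \<psi>) r p \<longleftrightarrow> (\<forall>q. (q, p) \<in> r \<longrightarrow> (\<phi> r q \<longleftrightarrow> \<psi> r q))"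
  unfolding fiff_def fand_def using fimp_iff[OF reg_pers] by blast

lemma iset_eq_iff: "regs X \<Longrightarrow> regs Y \<Longrightarrow> p \<in> D \<Longrightarrow>
  (X \<^bold>\<doteq> Y) r p \<longleftrightarrow> (\<forall>a q. (q, p) \<in> r \<longrightarrow> (X a r q \<longleftrightarrow> Y a r q))"
  unfolding iset_eq_def fall_def by (simp add: fiff_iff regs_reg)

lemma iset_subset_iff: "regs X \<Longrightarrow> regs Y \<Longrightarrow> p \<in> D \<Longrightarrow>
  (X \<^bold>\<subseteq> Y) r p \<longleftrightarrow> (\<forall>a q. (q, p) \<in> r \<longrightarrow> X a r q \<longrightarrow> Y a r q)"
  unfolding iset_subset_def fall_def by (simp add: fimp_iff reg_pers regs_reg)

lemma reg_iset_eq: "regs X \<Longrightarrow> regs Y \<Longrightarrow> reg (X \<^bold>\<doteq> Y)"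
  unfolding iset_eq_def by (intro reg_fall reg_fiff reg_pers regs_reg)

lemma reg_iset_subset: "regs X \<Longrightarrow> reg (X \<^bold>\<subseteq> Y)"
  unfolding iset_subset_def by (intro reg_fall reg_fimp reg_pers regs_reg)

lemma iset_eq_refl: "regs X \<Longrightarrow> p \<in> D \<Longrightarrow> (X \<^bold>\<doteq> X) r p"
  by (simp add: iset_eq_iff)

lemma iset_eq_sym: "regs X \<Longrightarrow> regs Y \<Longrightarrow> p \<in> D \<Longrightarrow> (X \<^bold>\<doteq> Y) r p \<Longrightarrow> (Y \<^bold>\<doteq> X) r p"
  by (simp add: iset_eq_iff)

lemma iset_eq_trans: "regs X \<Longrightarrow> regs Y \<Longrightarrow> regs Z \<Longrightarrow> p \<in> D \<Longrightarrow> (X \<^bold>\<doteq> Y) r p \<Longrightarrow> (Y \<^bold>\<doteq> Z) r p \<Longrightarrow> (X \<^bold>\<doteq> Z) r p"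
  by (simp add: iset_eq_iff)

lemma iset_subset_cong:
  "regs X \<Longrightarrow> regs Y \<Longrightarrow> regs X' \<Longrightarrow> regs Y' \<Longrightarrow> p \<in> D \<Longrightarrow> (X \<^bold>\<doteq> X') r p \<Longrightarrow> (Y \<^bold>\<doteq> Y') r p \<Longrightarrow>
    (X \<^bold>\<subseteq> Y) r p \<Longrightarrow> (X' \<^bold>\<subseteq> Y') r p"
  by (simp add: iset_eq_iff iset_subset_iff)

section \<open>Ground model sets and their names\<close>

lemma check_set_iff: "check_set A a r p \<longleftrightarrow> a \<in> A"
  by (simp add: check_set_def fground_def)

abbreviation gname :: "'a set \<Rightarrow> ('a, 'p) iset" where
  "gname A \<equiv> val_set (A \<times> UNIV)"

lemma gname_iff: "p \<in> D \<Longrightarrow> gname A a r p \<longleftrightarrow> a \<in> A"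
  unfolding val_set_def dense_below_def using D_refl D_down by blast

lemma gname_eq: "p \<in> D \<Longrightarrow> (gname A \<^bold>\<doteq> check_set A) r p"
  by (simp add: iset_eq_iff regs_val_set regs_check check_set_iff gname_iff[OF D_down])

lemma check_eq_iff: "p \<in> D \<Longrightarrow> (check_set A \<^bold>\<doteq> check_set B) r p \<longleftrightarrow> A = B"
  using D_refl by (auto simp: iset_eq_iff regs_check check_set_iff)

lemma check_subset_iff: "p \<in> D \<Longrightarrow> (check_set A \<^bold>\<subseteq> check_set B) r p \<longleftrightarrow> A \<subseteq> B"
  using D_refl by (auto simp: iset_subset_iff regs_check check_set_iff)

end

text \<open>\<open>decide_countably\<close> says that no new subsets of countable sets are added, see
  \<open>ground_value\<close>.\<close>

locale forcing = forcing_base r D for r :: "'p rel" and D :: "'p set" +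
  assumes decide_countably: "p \<in> D \<Longrightarrow> (\<And>n p q. \<Phi> n p \<Longrightarrow> (q, p) \<in> r \<Longrightarrow> \<Phi> n q) \<Longrightarrow>
      \<exists>q. (q, p) \<in> r \<and> (\<forall>n::nat. \<Phi> n q \<or> (\<forall>q'. (q', q) \<in> r \<longrightarrow> \<not> \<Phi> n q'))"
begin

text \<open>A single condition decides membership for all elements of the countable set
  \<open>A\<close>; \<open>B\<close> consists of those that it decides positively.\<close>

lemma ground_value:
  assumes "regs X" "p \<in> D" "countable A" "(X \<^bold>\<subseteq> check_set A) r p"
  obtains q B where "(q, p) \<in> r" "B \<subseteq> A" "(X \<^bold>\<doteq> check_set B) r q"
proof -
  have "\<exists>q. (q, p) \<in> r \<and> (\<forall>n. X (from_nat_into A n) r q \<or> (\<forall>q'. (q', q) \<in> r \<longrightarrow> \<not> X (from_nat_into A n) r q'))"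
    by (rule decide_countably[OF assms(2), of "\<lambda>n q. X (from_nat_into A n) r q"])
      (rule regD[OF regs_reg[OF assms(1)]])
  then obtain q where q: "(q, p) \<in> r"
    "\<And>n. X (from_nat_into A n) r q \<or> (\<forall>q'. (q', q) \<in> r \<longrightarrow> \<not> X (from_nat_into A n) r q')" by blast
  have qD: "q \<in> D" using D_down[OF assms(2) q(1)] .
  have sub: "a \<in> A" if "(q', q) \<in> r" "X a r q'" for a q'
    using assms(4) le_trans[OF that(1) q(1)] that(2)
    unfolding iset_subset_iff[OF assms(1) regs_check assms(2)] check_set_iff by blast
  have "X a r q' \<longleftrightarrow> a \<in> {a \<in> A. X a r q}" if q': "(q', q) \<in> r" for a q'
  proof
    assume X: "X a r q'"
    have "a \<in> A" by (rule sub[OF q' X])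
    then obtain n where "from_nat_into A n = a" using from_nat_into_surj[OF assms(3)] by blast
    then show "a \<in> {a \<in> A. X a r q}" using q(2)[of n] X q' \<open>a \<in> A\<close> by auto
  next
    assume "a \<in> {a \<in> A. X a r q}"
    then show "X a r q'" using regD[OF regs_reg[OF assms(1)] _ q'] by blast
  qed
  then have "(X \<^bold>\<doteq> check_set {a \<in> A. X a r q}) r q"
    unfolding iset_eq_iff[OF assms(1) regs_check qD] check_set_iff by blast
  then show ?thesis by (intro that[OF q(1)]) auto
qed

text \<open>Regular and extensional families of subsets of a countable ground model set. Densely
  often a member of such a family is a ground model set, by \<open>family_ground\<close>, so that
  Tukey maps between them can be studied on ground model sets.\<close>

definition family :: "'a set \<Rightarrow> ('a, 'p) ifam \<Rightarrow> bool" where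
  "family A U \<longleftrightarrow> countable A \<and> (\<forall>X. regs X \<longrightarrow> reg (U X)) \<and>
    (\<forall>X p. regs X \<longrightarrow> p \<in> D \<longrightarrow> U X r p \<longrightarrow> (X \<^bold>\<subseteq> check_set A) r p) \<and>
    (\<forall>X Y p. regs X \<longrightarrow> regs Y \<longrightarrow> p \<in> D \<longrightarrow> (X \<^bold>\<doteq> Y) r p \<longrightarrow> U X r p \<longrightarrow> U Y r p)"

lemma family_reg: "family A U \<Longrightarrow> regs X \<Longrightarrow> reg (U X)"
  by (simp add: family_def)

lemma family_ext: "family A U \<Longrightarrow> regs X \<Longrightarrow> regs Y \<Longrightarrow> p \<in> D \<Longrightarrow> (X \<^bold>\<doteq> Y) r p \<Longrightarrow> U X r p \<Longrightarrow> U Y r p"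
  unfolding family_def by blast

lemma family_ground:
  assumes "family A U" "regs X" "p \<in> D" "U X r p"
  obtains q B where "(q, p) \<in> r" "(X \<^bold>\<doteq> check_set B) r q" "U (check_set B) r q"
proof -
  have "countable A" "(X \<^bold>\<subseteq> check_set A) r p" using assms unfolding family_def by blast+
  then obtain q B where q: "(q, p) \<in> r" "B \<subseteq> A" "(X \<^bold>\<doteq> check_set B) r q"
    using ground_value[OF assms(2,3)] by blast
  have "U (check_set B) r q"
    by (rule family_ext[OF assms(1,2) regs_check D_down[OF assms(3) q(1)] q(3)])
      (rule regD[OF family_reg[OF assms(1,2)] assms(4) q(1)])
  then show ?thesis by (rule that[OF q(1,3)])
qed

lemma val_fam_ext:
  assumes "regs X" "regs Y" "p \<in> D" "(X \<^bold>\<doteq> Y) r p" "val_fam F X r p"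
  shows "val_fam F Y r p"
  unfolding val_fam_def dense_below_def
proof (intro allI impI)
  fix q assume q: "(q, p) \<in> r"
  then obtain q' \<tau> s where *: "(q', q) \<in> r" "(\<tau>, s) \<in> F" "(q', s) \<in> r" "(X \<^bold>\<doteq> val_set \<tau>) r q'"
    using assms(5) unfolding val_fam_def dense_below_def by blast
  have q'p: "(q', p) \<in> r" using le_trans[OF *(1) q] .
  have D: "q' \<in> D" using D_down[OF assms(3) q'p] .
  have "(X \<^bold>\<doteq> Y) r q'" using regD[OF reg_iset_eq[OF assms(1,2)] assms(4) q'p] .
  then have "(Y \<^bold>\<doteq> val_set \<tau>) r q'"
    using *(4) iset_eq_sym[OF assms(1,2) D] iset_eq_trans[OF assms(2,1) regs_val_set D] by blast
  then show "\<exists>q'. (q', q) \<in> r \<and> (\<exists>\<tau> s. (\<tau>, s) \<in> F \<and> (q', s) \<in> r \<and> (Y \<^bold>\<doteq> val_set \<tau>) r q')" using * by blast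
qed

lemma val_rel_ext:
  assumes "regs X" "regs X'" "regs Y" "regs Y'" "p \<in> D" "(X \<^bold>\<doteq> X') r p" "(Y \<^bold>\<doteq> Y') r p" "val_rel R X Y r p"
  shows "val_rel R X' Y' r p"
  unfolding val_rel_def dense_below_def
proof (intro allI impI)
  fix q assume q: "(q, p) \<in> r"
  then obtain q' \<tau> \<sigma> s where *: "(q', q) \<in> r" "((\<tau>, \<sigma>), s) \<in> R" "(q', s) \<in> r" "(X \<^bold>\<doteq> val_set \<tau>) r q'" "(Y \<^bold>\<doteq> val_set \<sigma>) r q'"
    using assms(8) unfolding val_rel_def dense_below_def by blast
  have q'p: "(q', p) \<in> r" using le_trans[OF *(1) q] .
  have D: "q' \<in> D" using D_down[OF assms(5) q'p] .
  have "(X \<^bold>\<doteq> X') r q'" "(Y \<^bold>\<doteq> Y') r q'"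
    using regD[OF reg_iset_eq[OF assms(1,2)] assms(6) q'p] regD[OF reg_iset_eq[OF assms(3,4)] assms(7) q'p] .
  then have "(X' \<^bold>\<doteq> val_set \<tau>) r q'" "(Y' \<^bold>\<doteq> val_set \<sigma>) r q'"
    using *(4,5) iset_eq_sym[OF assms(1,2) D] iset_eq_trans[OF assms(2,1) regs_val_set D]
      iset_eq_sym[OF assms(3,4) D] iset_eq_trans[OF assms(4,3) regs_val_set D] by blast+
  then show "\<exists>q'. (q', q) \<in> r \<and> (\<exists>\<tau> \<sigma> s. ((\<tau>, \<sigma>), s) \<in> R \<and> (q', s) \<in> r \<and> (X' \<^bold>\<doteq> val_set \<tau>) r q' \<and> (Y' \<^bold>\<doteq> val_set \<sigma>) r q')"
    using * by blast
qed

lemma family_val_fam: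
  assumes "countable A" "\<And>X p. regs X \<Longrightarrow> p \<in> D \<Longrightarrow> val_fam F X r p \<Longrightarrow> (X \<^bold>\<subseteq> check_set A) r p"
  shows "family A (val_fam F)"
  unfolding family_def using assms val_fam_ext by (auto simp: reg_val_fam)

lemma family_UNIV_val_fam: "family (UNIV :: 'a::countable set) (val_fam F)"
  by (rule family_val_fam) (auto simp: iset_subset_iff regs_check check_set_iff)

end

section \<open>Tukey reductions on ground model sets\<close>

context forcing
begin

lemma fall_setD: "(\<^bold>\<forall>\<^sub>S X. \<Phi> X) r p \<Longrightarrow> \<Phi> (val_set \<tau>) r p"
  unfolding fall_set_def fall_def by blast

lemma fall_setD2: "(\<^bold>\<forall>\<^sub>S X. \<^bold>\<forall>\<^sub>S Y. \<Phi> X Y) r p \<Longrightarrow> \<Phi> (val_set \<tau>) (val_set \<sigma>) r p"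
  unfolding fall_set_def fall_def by blast

lemma fall_setD3: "(\<^bold>\<forall>\<^sub>S X. \<^bold>\<forall>\<^sub>S Y. \<^bold>\<forall>\<^sub>S Z. \<Phi> X Y Z) r p \<Longrightarrow> \<Phi> (val_set \<tau>) (val_set \<sigma>) (val_set \<upsilon>) r p"
  unfolding fall_set_def fall_def by blast

lemma fall_setI: "(\<And>\<tau>. \<Phi> (val_set \<tau>) r p) \<Longrightarrow> (\<^bold>\<forall>\<^sub>S X. \<Phi> X) r p"
  unfolding fall_set_def fall_def by blast

lemma fex_set_iff: "(\<^bold>\<exists>\<^sub>S X. \<Phi> X) r p \<longleftrightarrow> (\<forall>q. (q, p) \<in> r \<longrightarrow> (\<exists>q' \<tau>. (q', q) \<in> r \<and> \<Phi> (val_set \<tau>) r q'))"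
  unfolding fex_set_def fex_iff ..

lemma fex_setD: "(\<^bold>\<exists>\<^sub>S X. \<Phi> X) r p \<Longrightarrow> (q, p) \<in> r \<Longrightarrow> \<exists>q' \<tau>. (q', q) \<in> r \<and> \<Phi> (val_set \<tau>) r q'"
  by (simp add: fex_set_iff)

lemma fandI: "\<phi> r p \<Longrightarrow> \<psi> r p \<Longrightarrow> (\<phi> \<^bold>\<and> \<psi>) r p"
  by (simp add: fand_def)

lemma fandD: "(\<phi> \<^bold>\<and> \<psi>) r p \<Longrightarrow> \<phi> r p" "(\<phi> \<^bold>\<and> \<psi>) r p \<Longrightarrow> \<psi> r p"
  by (simp_all add: fand_def)

lemma fimpD: "(\<phi> \<^bold>\<longrightarrow> \<psi>) r p \<Longrightarrow> pers \<phi> \<Longrightarrow> reg \<psi> \<Longrightarrow> p \<in> D \<Longrightarrow> (q, p) \<in> r \<Longrightarrow> \<phi> r q \<Longrightarrow> \<psi> r q"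
  using fimp_iff by blast

lemma reg_fex_set: "reg (\<^bold>\<exists>\<^sub>S X. \<Phi> X)"
  unfolding fex_set_def by (rule reg_fex)

lemma gname_check:
  assumes "family A U" "p \<in> D"
  shows "U (gname B) r p \<longleftrightarrow> U (check_set B) r p"
  using family_ext[OF assms(1) regs_val_set regs_check assms(2) gname_eq[OF assms(2)]]
    family_ext[OF assms(1) regs_check regs_val_set assms(2) iset_eq_sym[OF regs_val_set regs_check assms(2) gname_eq[OF assms(2)]]]
  by blast

lemma family_check_down: "family A U \<Longrightarrow> U (check_set B) r p \<Longrightarrow> (q, p) \<in> r \<Longrightarrow> U (check_set B) r q"
  using family_reg[OF _ regs_check, THEN regD] by blast

lemma ultrafilter_empty: "ultrafilter_on_omega V r p \<Longrightarrow> (q, p) \<in> r \<Longrightarrow> \<not> V (check_set {}) r q"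
  unfolding ultrafilter_on_omega_def fand_def fnot_def by blast

lemma ultrafilter_mono:
  assumes V: "family UNIV V" and p: "p \<in> D" "ultrafilter_on_omega V r p" and "(q, p) \<in> r" "V (check_set A) r q" "A \<subseteq> B"
  shows "V (check_set B) r q"
proof -
  have q: "q \<in> D" using D_down assms by blast
  have "(\<^bold>\<forall>\<^sub>S X. \<^bold>\<forall>\<^sub>S Y. V X \<^bold>\<and> X \<^bold>\<subseteq> Y \<^bold>\<longrightarrow> V Y) r p"
    using p(2) unfolding ultrafilter_on_omega_def fand_def by blast
  then have imp: "(V (gname A) \<^bold>\<and> gname A \<^bold>\<subseteq> gname B \<^bold>\<longrightarrow> V (gname B)) r p"
    by (rule fall_setD2[of "\<lambda>X Y. V X \<^bold>\<and> X \<^bold>\<subseteq> Y \<^bold>\<longrightarrow> V Y"])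
  have "V (gname B) r q"
  proof (rule fimpD[OF imp _ _ p(1) assms(4)])
    show "pers (V (gname A) \<^bold>\<and> gname A \<^bold>\<subseteq> gname B)"
      by (intro pers_fand reg_pers family_reg[OF V] regs_val_set reg_iset_subset)
    show "reg (V (gname B))" by (intro family_reg[OF V] regs_val_set)
    have "(gname A \<^bold>\<subseteq> gname B) r q"
      using assms(6) by (auto simp: iset_subset_iff regs_val_set q gname_iff[OF D_down[OF q]])
    then show "(V (gname A) \<^bold>\<and> gname A \<^bold>\<subseteq> gname B) r q"
      unfolding fand_def using assms(5) gname_check[where U=V, OF V q] by blast
  qed
  then show ?thesis using gname_check[where U=V, OF V q] by blast
qed

lemma ultrafilter_cases:
  assumes V: "family UNIV V" and p: "p \<in> D" "ultrafilter_on_omega V r p" and "(q, p) \<in> r"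
  shows "\<exists>q'. (q', q) \<in> r \<and> (V (check_set A) r q' \<or> V (check_set (- A)) r q')"
proof -
  have q: "q \<in> D" using D_down assms by blast
  have "(\<^bold>\<forall>\<^sub>S X. V X \<^bold>\<or> V (iset_Compl X)) r p"
    using p(2) unfolding ultrafilter_on_omega_def fand_def by blast
  then have "(V (gname A) \<^bold>\<or> V (iset_Compl (gname A))) r p"
    by (rule fall_setD[of "\<lambda>X. V X \<^bold>\<or> V (iset_Compl X)"])
  then obtain q' where q': "(q', q) \<in> r" "V (gname A) r q' \<or> V (iset_Compl (gname A)) r q'"
    using assms(4) unfolding fdisj_iff by blast
  have D: "q' \<in> D" using D_down[OF q q'(1)] .
  have regs: "regs (iset_Compl (gname A))"
    unfolding regs_def iset_Compl_def by (intro allI reg_fnot reg_pers regs_reg regs_val_set)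
  have "(iset_Compl (gname A) \<^bold>\<doteq> check_set (- A)) r q'"
    unfolding iset_eq_iff[OF regs regs_check D] check_set_iff
  proof (intro allI impI)
    fix a q2 assume "(q2, q') \<in> r"
    then have D2: "q2 \<in> D" using D_down[OF D] by blast
    show "iset_Compl (gname A) a r q2 \<longleftrightarrow> a \<in> - A"
      using D_refl[OF D2] by (auto simp: iset_Compl_def fnot_def gname_iff[OF D_down[OF D2]])
  qed
  then have "V (iset_Compl (gname A)) r q' \<Longrightarrow> V (check_set (- A)) r q'"
    using family_ext[where U=V, OF V regs regs_check D] by blast
  then show ?thesis using q' gname_check[where U=V, OF V D] by blast
qed

text \<open>\<open>f q A B\<close> says that \<open>q\<close> forces the image of \<open>A\<close>
  to be \<open>B\<close>, for ground model sets \<open>A\<close> and \<open>B\<close>. The last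
  property is the convergence of the map. If it failed for \<open>B\<close>, there would be a base
  of \<open>U\<close> whose image has no member inside \<open>B\<close>.\<close>

lemma tukey_elim:
  fixes U :: "('a, 'p) ifam" and V :: "('b, 'p) ifam"
  assumes U: "family A0 U" and V: "family B0 V" and p: "p \<in> D" "(V \<^bold>\<le>\<^sub>T U) r p"
  obtains q f where "(q, p) \<in> r"
    "\<And>q' A B. (q', q) \<in> r \<Longrightarrow> f q' A B \<Longrightarrow> V (check_set B) r q'"
    "\<And>q' A. (q', q) \<in> r \<Longrightarrow> U (check_set A) r q' \<Longrightarrow> \<exists>q''. (q'', q') \<in> r \<and> (\<exists>B. f q'' A B)"
    "\<And>q' B. (q', q) \<in> r \<Longrightarrow> V (check_set B) r q' \<Longrightarrow> \<exists>q''. (q'', q') \<in> r \<and> (\<exists>A. U (check_set A) r q'' \<and>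
      (\<forall>q3. (q3, q'') \<in> r \<longrightarrow> (\<forall>A'\<subseteq>A. U (check_set A') r q3 \<longrightarrow> (\<forall>B'. f q3 A' B' \<longrightarrow> B' \<subseteq> B))))"
proof -
  obtain q R where qp: "(q, p) \<in> r" and fn: "function_from_to (val_rel R) U V r q"
    and base: "\<And>F. (filter_base_of (val_fam F) U \<^bold>\<longrightarrow> filter_base_of (fam_image (val_rel R) (val_fam F)) V) r q"
    using p(2) D_refl[OF p(1)] unfolding tukey_le_def fex_rel_def fex_iff fand_def fall_fam_def fall_def by blast
  have qD: "q \<in> D" using D_down[OF p(1) qp] .
  define f where "f q A B \<longleftrightarrow> val_rel R (check_set A) (check_set B) r q" for q A B
  have f_down: "f q2 A B" if "f q1 A B" "(q2, q1) \<in> r" for q1 q2 A B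
    using that reg_val_rel[THEN regD] unfolding f_def by blast
  have reg_U: "reg (U (val_set \<tau>))" and reg_V: "reg (V (val_set \<sigma>))" for \<tau> \<sigma>
    by (intro family_reg[OF U] family_reg[OF V] regs_val_set)+
  have fUV: "U (val_set \<tau>) r q' \<and> V (val_set \<sigma>) r q'" if "(q', q) \<in> r" "val_rel R (val_set \<tau>) (val_set \<sigma>) r q'" for q' \<tau> \<sigma>
  proof -
    have "(\<^bold>\<forall>\<^sub>S X. \<^bold>\<forall>\<^sub>S Y. val_rel R X Y \<^bold>\<longrightarrow> U X \<^bold>\<and> V Y) r q"
      using fn unfolding function_from_to_def fand_def by blast
    then have "(val_rel R (val_set \<tau>) (val_set \<sigma>) \<^bold>\<longrightarrow> U (val_set \<tau>) \<^bold>\<and> V (val_set \<sigma>)) r q"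
      by (rule fall_setD2[of "\<lambda>X Y. val_rel R X Y \<^bold>\<longrightarrow> U X \<^bold>\<and> V Y"])
    then have "(U (val_set \<tau>) \<^bold>\<and> V (val_set \<sigma>)) r q'"
      by (rule fimpD[OF _ reg_pers[OF reg_val_rel] reg_fand[OF reg_U reg_V] qD that])
    then show ?thesis by (simp add: fand_def)
  qed
  have tot: "\<exists>q'' \<sigma>. (q'', q') \<in> r \<and> val_rel R (val_set \<tau>) (val_set \<sigma>) r q''"
    if "(q', q) \<in> r" "U (val_set \<tau>) r q'" for q' \<tau>
  proof -
    have "(\<^bold>\<forall>\<^sub>S X. U X \<^bold>\<longrightarrow> (\<^bold>\<exists>\<^sub>S Y. val_rel R X Y)) r q"
      using fn unfolding function_from_to_def fand_def by blast
    then have "(U (val_set \<tau>) \<^bold>\<longrightarrow> (\<^bold>\<exists>\<^sub>S Y. val_rel R (val_set \<tau>) Y)) r q"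
      by (rule fall_setD[of "\<lambda>X. U X \<^bold>\<longrightarrow> (\<^bold>\<exists>\<^sub>S Y. val_rel R X Y)"])
    then have "(\<^bold>\<exists>\<^sub>S Y. val_rel R (val_set \<tau>) Y) r q'"
      by (rule fimpD[OF _ reg_pers[OF reg_U] reg_fex_set qD that])
    then show ?thesis using D_refl[OF D_down[OF qD that(1)]] unfolding fex_set_iff by blast
  qed
  have fun_eq: "(val_set \<sigma> \<^bold>\<doteq> val_set \<sigma>') r q'"
    if "(q', q) \<in> r" "val_rel R (val_set \<tau>) (val_set \<sigma>) r q'" "val_rel R (val_set \<tau>) (val_set \<sigma>') r q'" for q' \<tau> \<sigma> \<sigma>'
  proof -
    have "(\<^bold>\<forall>\<^sub>S X. \<^bold>\<forall>\<^sub>S Y. \<^bold>\<forall>\<^sub>S Z. val_rel R X Y \<^bold>\<and> val_rel R X Z \<^bold>\<longrightarrow> Y \<^bold>\<doteq> Z) r q"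
      using fn unfolding function_from_to_def fand_def by blast
    then have *: "(val_rel R (val_set \<tau>) (val_set \<sigma>) \<^bold>\<and> val_rel R (val_set \<tau>) (val_set \<sigma>') \<^bold>\<longrightarrow> val_set \<sigma> \<^bold>\<doteq> val_set \<sigma>') r q"
      by (rule fall_setD3[of "\<lambda>X Y Z. val_rel R X Y \<^bold>\<and> val_rel R X Z \<^bold>\<longrightarrow> Y \<^bold>\<doteq> Z"])
    have both: "(val_rel R (val_set \<tau>) (val_set \<sigma>) \<^bold>\<and> val_rel R (val_set \<tau>) (val_set \<sigma>')) r q'"
      using that(2,3) by (simp add: fand_def)
    show ?thesis
      by (rule fimpD[OF * _ _ qD that(1) both])
        (intro pers_fand reg_pers reg_val_rel reg_iset_eq regs_val_set)+
  qed
  have f_gname: "f q' A B \<longleftrightarrow> val_rel R (gname A) (gname B) r q'" if q': "q' \<in> D" for q' A B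
    unfolding f_def
    using val_rel_ext[OF regs_check regs_val_set regs_check regs_val_set q'
        iset_eq_sym[OF regs_val_set regs_check q' gname_eq[OF q']] iset_eq_sym[OF regs_val_set regs_check q' gname_eq[OF q']]]
      val_rel_ext[OF regs_val_set regs_check regs_val_set regs_check q' gname_eq[OF q'] gname_eq[OF q']] by blast
  show ?thesis
  proof (rule that[OF qp, of f])
    fix q' A B assume q': "(q', q) \<in> r" "f q' A B"
    then show "V (check_set B) r q'"
      using fUV[OF q'(1)] f_gname[OF D_down[OF qD q'(1)]] gname_check[where U=V, OF V D_down[OF qD q'(1)]] by blast
  next
    fix q' A assume q': "(q', q) \<in> r" "U (check_set A) r q'"
    have D': "q' \<in> D" using D_down[OF qD q'(1)] .
    then obtain q2 \<sigma> where q2: "(q2, q') \<in> r" "val_rel R (gname A) (val_set \<sigma>) r q2"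
      using tot[OF q'(1), of "A \<times> UNIV"] gname_check[where U=U, OF U D'] q'(2) by blast
    have q2q: "(q2, q) \<in> r" using le_trans[OF q2(1) q'(1)] .
    have D2: "q2 \<in> D" using D_down[OF qD q2q] .
    obtain q3 B where q3: "(q3, q2) \<in> r" "(val_set \<sigma> \<^bold>\<doteq> check_set B) r q3" "V (check_set B) r q3"
      by (rule family_ground[where U=V, OF V regs_val_set D2 conjunct2[OF fUV[OF q2q q2(2)]]])
    have D3: "q3 \<in> D" using D_down[OF D2 q3(1)] .
    have "f q3 A B"
      unfolding f_def
      by (rule val_rel_ext[OF regs_val_set regs_check regs_val_set regs_check D3 gname_eq[OF D3] q3(2)])
        (rule reg_val_rel[THEN regD, OF q2(2) q3(1)])
    then show "\<exists>q''. (q'', q') \<in> r \<and> (\<exists>B. f q'' A B)" using le_trans[OF q3(1) q2(1)] by blast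
  next
    fix q' B assume q': "(q', q) \<in> r" "V (check_set B) r q'"
    have D': "q' \<in> D" using D_down[OF qD q'(1)] .
    show "\<exists>q''. (q'', q') \<in> r \<and> (\<exists>A. U (check_set A) r q'' \<and>
      (\<forall>q3. (q3, q'') \<in> r \<longrightarrow> (\<forall>A'\<subseteq>A. U (check_set A') r q3 \<longrightarrow> (\<forall>B'. f q3 A' B' \<longrightarrow> B' \<subseteq> B))))"
    proof (rule ccontr)
      assume "\<not> ?thesis"
      then have neg: "\<exists>q3 A' B'. (q3, q'') \<in> r \<and> A' \<subseteq> A \<and> U (check_set A') r q3 \<and> f q3 A' B' \<and> \<not> B' \<subseteq> B"
        if "(q'', q') \<in> r" "U (check_set A) r q''" for q'' A
        using that by meson
      \<comment> \<open>The sets whose image is not contained in \<open>B\<close> now form a base.\<close>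
      define F :: "('a, 'p) fam_name" where "F = {(A' \<times> UNIV, s) | A' s. U (check_set A') r s \<and> (\<exists>B'. f s A' B' \<and> \<not> B' \<subseteq> B)}"
      have "filter_base_of (val_fam F) U r q'"
        unfolding filter_base_of_def
      proof (rule fandI; rule fall_setI)
        fix \<tau>
        show "(val_fam F (val_set \<tau>) \<^bold>\<longrightarrow> U (val_set \<tau>)) r q'"
        proof (rule fimpI[OF _ D'])
          fix q2 assume q2: "(q2, q') \<in> r" "val_fam F (val_set \<tau>) r q2"
          have D2: "q2 \<in> D" using D_down[OF D' q2(1)] .
          show "U (val_set \<tau>) r q2"
          proof (rule reg_dense[OF reg_U D2])
            fix q3 assume q3: "(q3, q2) \<in> r"
            then obtain q4 A' s where q4: "(q4, q3) \<in> r" "U (check_set A') r s" "(q4, s) \<in> r" "(val_set \<tau> \<^bold>\<doteq> gname A') r q4"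
              using q2(2) unfolding val_fam_def dense_below_def F_def by blast
            have D4: "q4 \<in> D" using D_down[OF D_down[OF D2 q3] q4(1)] .
            have "U (gname A') r q4"
              unfolding gname_check[where U=U, OF U D4] by (rule family_check_down[where U=U, OF U q4(2,3)])
            then have "U (val_set \<tau>) r q4"
              by (rule family_ext[where U=U, OF U regs_val_set regs_val_set D4 iset_eq_sym[OF regs_val_set regs_val_set D4 q4(4)]])
            then show "\<exists>q'. (q', q3) \<in> r \<and> U (val_set \<tau>) r q'" using q4(1) by blast
          qed
        qed
      next
        fix \<tau>
        show "(U (val_set \<tau>) \<^bold>\<longrightarrow> (\<^bold>\<exists>\<^sub>S Y. val_fam F Y \<^bold>\<and> Y \<^bold>\<subseteq> val_set \<tau>)) r q'"
        proof (rule fimpI[OF _ D'])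
          fix q2 assume q2: "(q2, q') \<in> r" "U (val_set \<tau>) r q2"
          have D2: "q2 \<in> D" using D_down[OF D' q2(1)] .
          show "(\<^bold>\<exists>\<^sub>S Y. val_fam F Y \<^bold>\<and> Y \<^bold>\<subseteq> val_set \<tau>) r q2"
            unfolding fex_set_iff
          proof (intro allI impI)
            fix q3 assume q3: "(q3, q2) \<in> r"
            have D3: "q3 \<in> D" using D_down[OF D2 q3] .
            obtain q4 A where q4: "(q4, q3) \<in> r" "(val_set \<tau> \<^bold>\<doteq> check_set A) r q4" "U (check_set A) r q4"
              by (rule family_ground[where U=U, OF U regs_val_set D3 reg_U[THEN regD, OF q2(2) q3]])
            have "(q4, q') \<in> r" using le_trans[OF q4(1) le_trans[OF q3 q2(1)]] .
            then obtain q5 A' B' where q5: "(q5, q4) \<in> r" "A' \<subseteq> A" "U (check_set A') r q5" "f q5 A' B'" "\<not> B' \<subseteq> B"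
              using neg[OF _ q4(3)] by blast
            have D5: "q5 \<in> D" using D_down[OF D_down[OF D3 q4(1)] q5(1)] .
            have inF: "(A' \<times> UNIV, q5) \<in> F" unfolding F_def using q5(3,4,5) by blast
            have "val_fam F (gname A') r q5"
              unfolding val_fam_def dense_below_def
            proof (intro allI impI)
              fix q6 assume q6: "(q6, q5) \<in> r"
              have D6: "q6 \<in> D" using D_down[OF D5 q6] .
              show "\<exists>q'. (q', q6) \<in> r \<and> (\<exists>\<tau> s. (\<tau>, s) \<in> F \<and> (q', s) \<in> r \<and> (gname A' \<^bold>\<doteq> val_set \<tau>) r q')"
                using D_refl[OF D6] q6 inF iset_eq_refl[OF regs_val_set D6] by blast
            qed
            moreover have "(gname A' \<^bold>\<subseteq> val_set \<tau>) r q5"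
            proof (rule iset_subset_cong[OF regs_check regs_check regs_val_set regs_val_set D5])
              show "(check_set A' \<^bold>\<doteq> gname A') r q5"
                by (rule iset_eq_sym[OF regs_val_set regs_check D5 gname_eq[OF D5]])
              show "(check_set A \<^bold>\<doteq> val_set \<tau>) r q5"
                by (rule iset_eq_sym[OF regs_val_set regs_check D5]) (rule reg_iset_eq[OF regs_val_set regs_check, THEN regD, OF q4(2) q5(1)])
              show "(check_set A' \<^bold>\<subseteq> check_set A) r q5" using q5(2) by (simp add: check_subset_iff[OF D5])
            qed
            ultimately show "\<exists>q' \<tau>'. (q', q3) \<in> r \<and> (val_fam F (val_set \<tau>') \<^bold>\<and> val_set \<tau>' \<^bold>\<subseteq> val_set \<tau>) r q'"
              unfolding fand_def using le_trans[OF q5(1) q4(1)] by blast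
          qed
        qed
      qed
      moreover have "pers (filter_base_of (val_fam F) U)" "reg (filter_base_of (fam_image (val_rel R) (val_fam F)) V)"
        unfolding filter_base_of_def fall_set_def fam_image_def
        by (intro reg_pers reg_fand reg_fall reg_fimp reg_val_fam reg_U reg_V reg_fex_set)+
      ultimately have "filter_base_of (fam_image (val_rel R) (val_fam F)) V r q'"
        using fimpD[OF base _ _ qD q'(1)] by blast
      then have "(\<^bold>\<forall>\<^sub>S X. V X \<^bold>\<longrightarrow> (\<^bold>\<exists>\<^sub>S Y. fam_image (val_rel R) (val_fam F) Y \<^bold>\<and> Y \<^bold>\<subseteq> X)) r q'"
        unfolding filter_base_of_def fand_def by blast
      then have "(V (gname B) \<^bold>\<longrightarrow> (\<^bold>\<exists>\<^sub>S Y. fam_image (val_rel R) (val_fam F) Y \<^bold>\<and> Y \<^bold>\<subseteq> gname B)) r q'"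
        by (rule fall_setD[of "\<lambda>X. V X \<^bold>\<longrightarrow> (\<^bold>\<exists>\<^sub>S Y. fam_image (val_rel R) (val_fam F) Y \<^bold>\<and> Y \<^bold>\<subseteq> X)"])
      then have "(\<^bold>\<exists>\<^sub>S Y. fam_image (val_rel R) (val_fam F) Y \<^bold>\<and> Y \<^bold>\<subseteq> gname B) r q'"
        by (rule fimpD[OF _ reg_pers[OF reg_V] reg_fex_set D' D_refl[OF D']])
          (use q'(2) gname_check[where U=V, OF V D'] in blast)
      then obtain q2 \<tau> where q2: "(q2, q') \<in> r" "fam_image (val_rel R) (val_fam F) (val_set \<tau>) r q2" "(val_set \<tau> \<^bold>\<subseteq> gname B) r q2"
        using D_refl[OF D'] unfolding fex_set_iff fand_def by blast
      have D2: "q2 \<in> D" using D_down[OF D' q2(1)] .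
      obtain q3 \<sigma> where q3: "(q3, q2) \<in> r" "val_fam F (val_set \<sigma>) r q3" "val_rel R (val_set \<sigma>) (val_set \<tau>) r q3"
        using q2(2) D_refl[OF D2] unfolding fam_image_def fex_set_iff fand_def by blast
      have D3: "q3 \<in> D" using D_down[OF D2 q3(1)] .
      obtain q4 A' B' s where q4: "(q4, q3) \<in> r" "(q4, s) \<in> r" "f s A' B'" "\<not> B' \<subseteq> B" "(val_set \<sigma> \<^bold>\<doteq> gname A') r q4"
        using q3(2) D_refl[OF D3] unfolding val_fam_def dense_below_def F_def by blast
      have D4: "q4 \<in> D" using D_down[OF D3 q4(1)] .
      have "(q4, q) \<in> r" using q4(1) q3(1) q2(1) q'(1) le_trans by blast
      moreover have "val_rel R (gname A') (gname B') r q4"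
        using f_down[OF q4(3,2)] f_gname[OF D4] by blast
      moreover have "val_rel R (gname A') (val_set \<tau>) r q4"
        by (rule val_rel_ext[OF regs_val_set regs_val_set regs_val_set regs_val_set D4 q4(5) iset_eq_refl[OF regs_val_set D4]])
          (rule reg_val_rel[THEN regD, OF q3(3) q4(1)])
      ultimately have eq: "(gname B' \<^bold>\<doteq> val_set \<tau>) r q4" by (rule fun_eq)
      have sub: "(val_set \<tau> \<^bold>\<subseteq> gname B) r q4"
        using reg_iset_subset[OF regs_val_set, THEN regD, OF q2(3)] le_trans[OF q4(1) q3(1)] by blast
      have e: "(val_set \<tau> \<^bold>\<doteq> check_set B') r q4"
        by (rule iset_eq_trans[OF regs_val_set regs_val_set regs_check D4
              iset_eq_sym[OF regs_val_set regs_val_set D4 eq] gname_eq[OF D4]])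
      have "(check_set B' \<^bold>\<subseteq> check_set B) r q4"
        by (rule iset_subset_cong[OF regs_val_set regs_val_set regs_check regs_check D4 e gname_eq[OF D4] sub])
      then show False using q4(4) by (simp add: check_subset_iff[OF D4])
    qed
  qed
qed

text \<open>A base of \<open>U\<close> has a member inside the set \<open>A\<close> provided by
  cofinality, and monotonicity carries this to the images. The name \<open>R\<close> is the graph of
  \<open>f\<close> on the ground model sets that are forced into \<open>U\<close>.\<close>

lemma tukey_intro:
  fixes U :: "('a, 'p) ifam" and V :: "('b, 'p) ifam"
  assumes U: "family A0 U" and V: "family B0 V" and p: "p \<in> D"
    and f: "\<And>q A. (q, p) \<in> r \<Longrightarrow> U (check_set A) r q \<Longrightarrow> V (check_set (f A)) r q"
    and mono: "\<And>A A'. A \<subseteq> A' \<Longrightarrow> f A \<subseteq> f A'"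
    and cof: "\<And>q B. (q, p) \<in> r \<Longrightarrow> V (check_set B) r q \<Longrightarrow> \<exists>q' A. (q', q) \<in> r \<and> U (check_set A) r q' \<and> f A \<subseteq> B"
  shows "(V \<^bold>\<le>\<^sub>T U) r p"
proof -
  define R :: "('a, 'b, 'p) rel_name" where "R = {((A \<times> UNIV, f A \<times> UNIV), s) | A s. (s, p) \<in> r \<and> U (check_set A) r s}"
  have reg_U: "reg (U (val_set \<tau>))" and reg_V: "reg (V (val_set \<sigma>))" for \<tau> \<sigma>
    by (intro family_reg[OF U] family_reg[OF V] regs_val_set)+
  have RD: "\<exists>q' A. (q', q) \<in> r \<and> q' \<in> D \<and> U (check_set A) r q' \<and> (q', p) \<in> r \<and>
      (val_set \<tau> \<^bold>\<doteq> check_set A) r q' \<and> (val_set \<sigma> \<^bold>\<doteq> check_set (f A)) r q'"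
    if q: "q \<in> D" "val_rel R (val_set \<tau>) (val_set \<sigma>) r q" for q \<tau> \<sigma>
  proof -
    obtain q' A s where q': "(q', q) \<in> r" "(s, p) \<in> r" "U (check_set A) r s" "(q', s) \<in> r"
      "(val_set \<tau> \<^bold>\<doteq> gname A) r q'" "(val_set \<sigma> \<^bold>\<doteq> gname (f A)) r q'"
      using q(2) D_refl[OF q(1)] unfolding val_rel_def dense_below_def R_def by blast
    have D': "q' \<in> D" using D_down[OF q(1) q'(1)] .
    have "(val_set \<tau> \<^bold>\<doteq> check_set A) r q'" "(val_set \<sigma> \<^bold>\<doteq> check_set (f A)) r q'"
      by (rule iset_eq_trans[OF regs_val_set regs_val_set regs_check D' _ gname_eq[OF D']], rule q'(5,6))+
    then show ?thesis using q' D' family_check_down[where U=U, OF U q'(3,4)] le_trans[OF q'(4,2)] by blast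
  qed
  have RI: "val_rel R (val_set \<tau>) (gname (f A)) r q"
    if "(q, p) \<in> r" "U (check_set A) r q" "(val_set \<tau> \<^bold>\<doteq> check_set A) r q" for q A \<tau>
    unfolding val_rel_def dense_below_def
  proof (intro allI impI)
    fix q' assume q': "(q', q) \<in> r"
    have D': "q' \<in> D" using D_down[OF D_down[OF p that(1)] q'] .
    have "((A \<times> UNIV, f A \<times> UNIV), q) \<in> R" using that(1,2) by (auto simp: R_def)
    moreover have "(val_set \<tau> \<^bold>\<doteq> gname A) r q'"
      using iset_eq_trans[OF regs_val_set regs_check regs_val_set D' reg_iset_eq[OF regs_val_set regs_check, THEN regD, OF that(3) q']
        iset_eq_sym[OF regs_val_set regs_check D' gname_eq[OF D']]] .
    ultimately show "\<exists>qa. (qa, q') \<in> r \<and> (\<exists>\<tau>' \<sigma> s. ((\<tau>', \<sigma>), s) \<in> R \<and> (qa, s) \<in> r \<and>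
        (val_set \<tau> \<^bold>\<doteq> val_set \<tau>') r qa \<and> (gname (f A) \<^bold>\<doteq> val_set \<sigma>) r qa)"
      using D_refl[OF D'] q' iset_eq_refl[OF regs_val_set D'] by blast
  qed
  have fUV: "(U (val_set \<tau>) \<^bold>\<and> V (val_set \<sigma>)) r q"
    if q: "(q, p) \<in> r" "val_rel R (val_set \<tau>) (val_set \<sigma>) r q" for q \<tau> \<sigma>
  proof (rule reg_dense[OF reg_fand[OF reg_U reg_V] D_down[OF p q(1)]])
    fix q2 assume q2: "(q2, q) \<in> r"
    have D2: "q2 \<in> D" using D_down[OF D_down[OF p q(1)] q2] .
    obtain q' A where q': "(q', q2) \<in> r" "q' \<in> D" "U (check_set A) r q'" "(q', p) \<in> r"
      "(val_set \<tau> \<^bold>\<doteq> check_set A) r q'" "(val_set \<sigma> \<^bold>\<doteq> check_set (f A)) r q'"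
      using RD[OF D2 reg_val_rel[THEN regD, OF q(2) q2]] by blast
    have "U (val_set \<tau>) r q'"
      by (rule family_ext[where U=U, OF U regs_check regs_val_set q'(2) iset_eq_sym[OF regs_val_set regs_check q'(2,5)] q'(3)])
    moreover have "V (val_set \<sigma>) r q'"
      by (rule family_ext[where U=V, OF V regs_check regs_val_set q'(2) iset_eq_sym[OF regs_val_set regs_check q'(2,6)] f[OF q'(4,3)]])
    ultimately show "\<exists>q'. (q', q2) \<in> r \<and> (U (val_set \<tau>) \<^bold>\<and> V (val_set \<sigma>)) r q'"
      unfolding fand_def using q'(1) by blast
  qed
  have fn: "function_from_to (val_rel R) U V r p"
    unfolding function_from_to_def
  proof (intro fandI fall_setI)
    fix \<tau> \<sigma>
    show "(val_rel R (val_set \<tau>) (val_set \<sigma>) \<^bold>\<longrightarrow> U (val_set \<tau>) \<^bold>\<and> V (val_set \<sigma>)) r p"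
      by (rule fimpI[OF _ p]) (rule fUV)
  next
    fix \<tau>
    show "(U (val_set \<tau>) \<^bold>\<longrightarrow> (\<^bold>\<exists>\<^sub>S Y. val_rel R (val_set \<tau>) Y)) r p"
    proof (rule fimpI[OF _ p])
      fix q assume q: "(q, p) \<in> r" "U (val_set \<tau>) r q"
      show "(\<^bold>\<exists>\<^sub>S Y. val_rel R (val_set \<tau>) Y) r q"
        unfolding fex_set_iff
      proof (intro allI impI)
        fix q2 assume q2: "(q2, q) \<in> r"
        have q2p: "(q2, p) \<in> r" using le_trans[OF q2 q(1)] .
        obtain q3 A where q3: "(q3, q2) \<in> r" "(val_set \<tau> \<^bold>\<doteq> check_set A) r q3" "U (check_set A) r q3"
          by (rule family_ground[where U=U, OF U regs_val_set D_down[OF p q2p] reg_U[THEN regD, OF q(2) q2]])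
        then show "\<exists>q' \<sigma>. (q', q2) \<in> r \<and> val_rel R (val_set \<tau>) (val_set \<sigma>) r q'"
          using RI[OF le_trans[OF q3(1) q2p] q3(3,2)] by blast
      qed
    qed
  next
    fix \<tau> \<sigma> \<sigma>'
    show "(val_rel R (val_set \<tau>) (val_set \<sigma>) \<^bold>\<and> val_rel R (val_set \<tau>) (val_set \<sigma>') \<^bold>\<longrightarrow> val_set \<sigma> \<^bold>\<doteq> val_set \<sigma>') r p"
    proof (rule fimpI[OF _ p])
      fix q assume q: "(q, p) \<in> r" "(val_rel R (val_set \<tau>) (val_set \<sigma>) \<^bold>\<and> val_rel R (val_set \<tau>) (val_set \<sigma>')) r q"
      show "(val_set \<sigma> \<^bold>\<doteq> val_set \<sigma>') r q"
      proof (rule reg_dense[OF reg_iset_eq[OF regs_val_set regs_val_set] D_down[OF p q(1)]])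
        fix q2 assume q2: "(q2, q) \<in> r"
        have D2: "q2 \<in> D" using D_down[OF D_down[OF p q(1)] q2] .
        obtain q3 A where q3: "(q3, q2) \<in> r" "q3 \<in> D"
          "(val_set \<tau> \<^bold>\<doteq> check_set A) r q3" "(val_set \<sigma> \<^bold>\<doteq> check_set (f A)) r q3"
          using RD[OF D2 reg_val_rel[THEN regD, OF fandD(1)[OF q(2)] q2]] by blast
        obtain q4 A' where q4: "(q4, q3) \<in> r" "q4 \<in> D"
          "(val_set \<tau> \<^bold>\<doteq> check_set A') r q4" "(val_set \<sigma>' \<^bold>\<doteq> check_set (f A')) r q4"
          using RD[OF q3(2) reg_val_rel[THEN regD, OF fandD(2)[OF q(2)] le_trans[OF q3(1) q2]]] by blast
        note down = reg_iset_eq[OF regs_val_set regs_check, THEN regD, OF _ q4(1)]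
        have "(check_set A \<^bold>\<doteq> check_set A') r q4"
          by (rule iset_eq_trans[OF regs_check regs_val_set regs_check q4(2) iset_eq_sym[OF regs_val_set regs_check q4(2) down[OF q3(3)]] q4(3)])
        then have A: "A = A'" by (simp add: check_eq_iff[OF q4(2)])
        have "(val_set \<sigma> \<^bold>\<doteq> val_set \<sigma>') r q4"
          by (rule iset_eq_trans[OF regs_val_set regs_check regs_val_set q4(2) down[OF q3(4)[unfolded A]]
            iset_eq_sym[OF regs_val_set regs_check q4(2,4)]])
        then show "\<exists>q'. (q', q2) \<in> r \<and> (val_set \<sigma> \<^bold>\<doteq> val_set \<sigma>') r q'" using le_trans[OF q4(1) q3(1)] by blast
      qed
    qed
  qed
  have rb: "reg (filter_base_of (val_fam F) U)" "reg (filter_base_of (fam_image (val_rel R) (val_fam F)) V)"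
    for F :: "('a, 'p) fam_name"
    unfolding filter_base_of_def fall_set_def fam_image_def
    by (intro reg_pers reg_fand reg_fall reg_fimp reg_val_fam reg_U reg_V reg_fex_set)+
  have base: "(\<^bold>\<forall>\<^sub>F B. filter_base_of B U \<^bold>\<longrightarrow> filter_base_of (fam_image (val_rel R) B) V) r p"
    unfolding fall_fam_def fall_def
  proof (rule allI, rule fimpI)
    fix F q assume q: "(q, p) \<in> r" "filter_base_of (val_fam F) U r q"
    have D1: "q \<in> D" using D_down[OF p q(1)] .
    show "filter_base_of (fam_image (val_rel R) (val_fam F)) V r q"
      unfolding filter_base_of_def
    proof (rule fandI; rule fall_setI)
      fix \<sigma>
      show "(fam_image (val_rel R) (val_fam F) (val_set \<sigma>) \<^bold>\<longrightarrow> V (val_set \<sigma>)) r q"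
      proof (rule fimpI[OF _ D1])
        fix q2 assume q2: "(q2, q) \<in> r" "fam_image (val_rel R) (val_fam F) (val_set \<sigma>) r q2"
        have q2p: "(q2, p) \<in> r" using le_trans[OF q2(1) q(1)] .
        show "V (val_set \<sigma>) r q2"
        proof (rule reg_dense[OF reg_V D_down[OF p q2p]])
          fix q3 assume q3: "(q3, q2) \<in> r"
          then obtain q4 \<tau> where q4: "(q4, q3) \<in> r" "val_rel R (val_set \<tau>) (val_set \<sigma>) r q4"
            using q2(2) unfolding fam_image_def fex_set_iff fand_def by blast
          then show "\<exists>q'. (q', q3) \<in> r \<and> V (val_set \<sigma>) r q'"
            using fUV[OF le_trans[OF q4(1) le_trans[OF q3 q2p]] q4(2)] unfolding fand_def by blast
        qed
      qed
    next
      fix \<sigma>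
      show "(V (val_set \<sigma>) \<^bold>\<longrightarrow> (\<^bold>\<exists>\<^sub>S Y. fam_image (val_rel R) (val_fam F) Y \<^bold>\<and> Y \<^bold>\<subseteq> val_set \<sigma>)) r q"
      proof (rule fimpI[OF _ D1])
        fix q2 assume q2: "(q2, q) \<in> r" "V (val_set \<sigma>) r q2"
        show "(\<^bold>\<exists>\<^sub>S Y. fam_image (val_rel R) (val_fam F) Y \<^bold>\<and> Y \<^bold>\<subseteq> val_set \<sigma>) r q2"
          unfolding fex_set_iff
        proof (intro allI impI)
          fix q3 assume q3: "(q3, q2) \<in> r"
          have q3p: "(q3, p) \<in> r" using le_trans[OF q3 le_trans[OF q2(1) q(1)]] .
          obtain q4 B where q4: "(q4, q3) \<in> r" "(val_set \<sigma> \<^bold>\<doteq> check_set B) r q4" "V (check_set B) r q4"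
            by (rule family_ground[where U=V, OF V regs_val_set D_down[OF p q3p] reg_V[THEN regD, OF q2(2) q3]])
          have q4p: "(q4, p) \<in> r" using le_trans[OF q4(1) q3p] .
          obtain q5 A where q5: "(q5, q4) \<in> r" "U (check_set A) r q5" "f A \<subseteq> B" using cof[OF q4p q4(3)] by blast
          have q5p: "(q5, p) \<in> r" using le_trans[OF q5(1) q4p] .
          have D5: "q5 \<in> D" using D_down[OF p q5p] .
          have q5q: "(q5, q) \<in> r" using q5(1) q4(1) q3 q2(1) le_trans by blast
          have "(\<^bold>\<forall>\<^sub>S X. U X \<^bold>\<longrightarrow> (\<^bold>\<exists>\<^sub>S Y. val_fam F Y \<^bold>\<and> Y \<^bold>\<subseteq> X)) r q"
            using q(2) unfolding filter_base_of_def fand_def by blast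
          then have "(U (gname A) \<^bold>\<longrightarrow> (\<^bold>\<exists>\<^sub>S Y. val_fam F Y \<^bold>\<and> Y \<^bold>\<subseteq> gname A)) r q"
            by (rule fall_setD[of "\<lambda>X. U X \<^bold>\<longrightarrow> (\<^bold>\<exists>\<^sub>S Y. val_fam F Y \<^bold>\<and> Y \<^bold>\<subseteq> X)"])
          then have "(\<^bold>\<exists>\<^sub>S Y. val_fam F Y \<^bold>\<and> Y \<^bold>\<subseteq> gname A) r q5"
            by (rule fimpD[OF _ reg_pers[OF reg_U] reg_fex_set D1 q5q]) (use q5(2) gname_check[where U=U, OF U D5] in blast)
          then obtain q6 \<tau> where q6: "(q6, q5) \<in> r" "val_fam F (val_set \<tau>) r q6" "(val_set \<tau> \<^bold>\<subseteq> gname A) r q6"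
            using D_refl[OF D5] unfolding fex_set_iff fand_def by blast
          have q6q: "(q6, q) \<in> r" using le_trans[OF q6(1) q5q] .
          have q6p: "(q6, p) \<in> r" using le_trans[OF q6(1) q5p] .
          have D6: "q6 \<in> D" using D_down[OF p q6p] .
          have "(\<^bold>\<forall>\<^sub>S X. val_fam F X \<^bold>\<longrightarrow> U X) r q"
            using q(2) unfolding filter_base_of_def fand_def by blast
          then have "(val_fam F (val_set \<tau>) \<^bold>\<longrightarrow> U (val_set \<tau>)) r q"
            by (rule fall_setD[of "\<lambda>X. val_fam F X \<^bold>\<longrightarrow> U X"])
          then have Uq6: "U (val_set \<tau>) r q6"
            by (rule fimpD[OF _ reg_pers[OF reg_val_fam] reg_U D1 q6q q6(2)])
          obtain q7 A' where q7: "(q7, q6) \<in> r" "(val_set \<tau> \<^bold>\<doteq> check_set A') r q7" "U (check_set A') r q7"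
            by (rule family_ground[where U=U, OF U regs_val_set D6 Uq6])
          have q7p: "(q7, p) \<in> r" using le_trans[OF q7(1) q6p] .
          have D7: "q7 \<in> D" using D_down[OF p q7p] .
          have "(check_set A' \<^bold>\<subseteq> check_set A) r q7"
            by (rule iset_subset_cong[OF regs_val_set regs_val_set regs_check regs_check D7 q7(2) gname_eq[OF D7]])
              (rule reg_iset_subset[OF regs_val_set, THEN regD, OF q6(3) q7(1)])
          then have "f A' \<subseteq> B" using mono[of A' A] q5(3) by (auto simp: check_subset_iff[OF D7])
          have "(gname (f A') \<^bold>\<subseteq> val_set \<sigma>) r q7"
          proof (rule iset_subset_cong[OF regs_check regs_check regs_val_set regs_val_set D7])
            show "(check_set (f A') \<^bold>\<doteq> gname (f A')) r q7"
              by (rule iset_eq_sym[OF regs_val_set regs_check D7 gname_eq[OF D7]])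
            have "(q7, q4) \<in> r" using q7(1) q6(1) q5(1) le_trans by blast
            then show "(check_set B \<^bold>\<doteq> val_set \<sigma>) r q7"
              using iset_eq_sym[OF regs_val_set regs_check D7] reg_iset_eq[OF regs_val_set regs_check, THEN regD, OF q4(2)] by blast
            show "(check_set (f A') \<^bold>\<subseteq> check_set B) r q7" using \<open>f A' \<subseteq> B\<close> by (simp add: check_subset_iff[OF D7])
          qed
          moreover have "fam_image (val_rel R) (val_fam F) (gname (f A')) r q7"
            unfolding fam_image_def fex_set_iff
          proof (intro allI impI)
            fix q8 assume q8: "(q8, q7) \<in> r"
            have "val_fam F (val_set \<tau>) r q8"
              using reg_val_fam[THEN regD, OF q6(2) le_trans[OF q8 q7(1)]] .
            moreover have "val_rel R (val_set \<tau>) (gname (f A')) r q8"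
              using reg_val_rel[THEN regD, OF RI[OF q7p q7(3,2)] q8] .
            ultimately show "\<exists>q' \<tau>. (q', q8) \<in> r \<and> (val_fam F (val_set \<tau>) \<^bold>\<and> val_rel R (val_set \<tau>) (gname (f A'))) r q'"
              unfolding fand_def using D_refl[OF D_down[OF D7 q8]] by blast
          qed
          moreover have "(q7, q3) \<in> r" using q7(1) q6(1) q5(1) q4(1) le_trans by blast
          ultimately show "\<exists>q' \<tau>. (q', q3) \<in> r \<and> (fam_image (val_rel R) (val_fam F) (val_set \<tau>) \<^bold>\<and> val_set \<tau> \<^bold>\<subseteq> val_set \<sigma>) r q'"
            unfolding fand_def by blast
        qed
      qed
    qed
  qed (rule p)
  have both: "(function_from_to (val_rel R) U V \<^bold>\<and>
      (\<^bold>\<forall>\<^sub>F B. filter_base_of B U \<^bold>\<longrightarrow> filter_base_of (fam_image (val_rel R) B) V)) r p"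
    using fn base by (simp add: fand_def)
  show ?thesis
    unfolding tukey_le_def fex_rel_def fex_iff
  proof (intro allI impI)
    fix q assume q: "(q, p) \<in> r"
    have rg: "reg (function_from_to (val_rel R) U V \<^bold>\<and> (\<^bold>\<forall>\<^sub>F B. filter_base_of B U \<^bold>\<longrightarrow> filter_base_of (fam_image (val_rel R) B) V))"
      unfolding function_from_to_def filter_base_of_def fall_set_def fam_image_def fall_fam_def
      by (intro reg_fand reg_fall reg_fimp reg_pers reg_val_rel reg_U reg_V reg_fex_set reg_val_fam reg_iset_eq regs_val_set)
    show "\<exists>q' R. (q', q) \<in> r \<and> (function_from_to (val_rel R) U V \<^bold>\<and>
        (\<^bold>\<forall>\<^sub>F B. filter_base_of B U \<^bold>\<longrightarrow> filter_base_of (fam_image (val_rel R) B) V)) r q'"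
      by (intro exI conjI, rule D_refl[OF D_down[OF p q]], rule rg[THEN regD, OF both q])
  qed
qed

end

section \<open>Perfect trees as conditions\<close>

lemma sorted_list_of_set_insert_greater:
  fixes m :: nat
  assumes "finite A" "\<And>a. a \<in> A \<Longrightarrow> a < m"
  shows "sorted_list_of_set (insert m A) = sorted_list_of_set A @ [m]"
proof (rule sorted_distinct_set_unique)
  show "sorted (sorted_list_of_set A @ [m])"
    using assms by (auto simp: sorted_append intro: less_imp_le)
  show "distinct (sorted_list_of_set A @ [m])" using assms by auto
  have "finite (insert m A)" using assms by simp
  then have "set (sorted_list_of_set (insert m A)) = insert m A" by (rule set_sorted_list_of_set)
  then show "set (sorted_list_of_set (insert m A)) = set (sorted_list_of_set A @ [m])"
    using assms by simp
qed (rule sorted_sorted_list_of_set distinct_sorted_list_of_set)+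

text \<open>The dummy value \<open>{{}}\<close> makes the recursion uniform: in dimension 0 small
  means empty, so for 1-tuples the right-hand side says that \<open>X\<close> is finite.\<close>

lemma mem_fin_ideal_Suc:
  assumes "X \<subseteq> tuples (Suc n)"
  shows "X \<in> fin_ideal (Suc n) \<longleftrightarrow> finite {i. {js. i # js \<in> X} \<notin> fin_ideal n}"
proof (cases n)
  case 0
  have "{i. {js. i # js \<in> X} \<notin> fin_ideal n} = (\<lambda>js. hd js) ` X"
  proof
    show "{i. {js. i # js \<in> X} \<notin> fin_ideal n} \<subseteq> (\<lambda>js. hd js) ` X"
      using 0 by force
    show "(\<lambda>js. hd js) ` X \<subseteq> {i. {js. i # js \<in> X} \<notin> fin_ideal n}"
    proof
      fix i assume "i \<in> (\<lambda>js. hd js) ` X"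
      then obtain js where js: "js \<in> X" "i = hd js" by blast
      then have "js = i # tl js" using assms 0 by (cases js) (auto simp: tuples_def)
      then have "tl js \<in> {js. i # js \<in> X}" using js by simp
      then show "i \<in> {i. {js. i # js \<in> X} \<notin> fin_ideal n}" using 0 by auto
    qed
  qed
  moreover have "inj_on hd X"
  proof (rule inj_onI)
    fix x y assume xy: "x \<in> X" "y \<in> X" "hd x = hd y"
    then have "length x = Suc 0" "length y = Suc 0" using assms 0 by (auto simp: tuples_def)
    then show "x = y" using xy(3) by (auto simp: length_Suc_conv)
  qed
  ultimately show ?thesis using 0 assms by (auto simp: finite_image_iff)
next
  case (Suc m)
  then show ?thesis using assms by simp
qed

lemma fin_ideal_tuples: "X \<in> fin_ideal n \<Longrightarrow> X \<subseteq> tuples n"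
  by (induction n rule: fin_ideal.induct) auto

lemma fin_ideal_empty: "{} \<in> fin_ideal n"
proof (induction n)
  case (Suc n)
  then show ?case by (subst mem_fin_ideal_Suc) auto
qed simp

lemma fin_ideal_subset: "X \<in> fin_ideal n \<Longrightarrow> Y \<subseteq> X \<Longrightarrow> Y \<in> fin_ideal n"
proof (induction n arbitrary: X Y)
  case (Suc n)
  have X: "X \<subseteq> tuples (Suc n)" using Suc(2) by (rule fin_ideal_tuples)
  have Y: "Y \<subseteq> tuples (Suc n)" using X Suc(3) by blast
  have "{js. i # js \<in> Y} \<in> fin_ideal n" if "{js. i # js \<in> X} \<in> fin_ideal n" for i
    by (rule Suc(1)[OF that]) (use Suc(3) in blast)
  then have "{i. {js. i # js \<in> Y} \<notin> fin_ideal n} \<subseteq> {i. {js. i # js \<in> X} \<notin> fin_ideal n}" by blast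
  then show ?case
    using Suc(2) unfolding mem_fin_ideal_Suc[OF X] mem_fin_ideal_Suc[OF Y] by (rule finite_subset)
qed auto

lemma fin_ideal_Un: "X \<in> fin_ideal n \<Longrightarrow> Y \<in> fin_ideal n \<Longrightarrow> X \<union> Y \<in> fin_ideal n"
proof (induction n arbitrary: X Y)
  case (Suc n)
  have X: "X \<subseteq> tuples (Suc n)" "Y \<subseteq> tuples (Suc n)" "X \<union> Y \<subseteq> tuples (Suc n)"
    using fin_ideal_tuples Suc(2,3) by blast+
  have "{i. {js. i # js \<in> X \<union> Y} \<notin> fin_ideal n} \<subseteq>
    {i. {js. i # js \<in> X} \<notin> fin_ideal n} \<union> {i. {js. i # js \<in> Y} \<notin> fin_ideal n}"
  proof (rule ccontr)
    assume "\<not> ?thesis"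
    then obtain i where i: "{js. i # js \<in> X \<union> Y} \<notin> fin_ideal n" "{js. i # js \<in> X} \<in> fin_ideal n" "{js. i # js \<in> Y} \<in> fin_ideal n"
      by blast
    have "{js. i # js \<in> X \<union> Y} = {js. i # js \<in> X} \<union> {js. i # js \<in> Y}" by blast
    then show False using i Suc(1)[OF i(2,3)] by simp
  qed
  then show ?case
    using Suc(2,3) unfolding mem_fin_ideal_Suc[OF X(1)] mem_fin_ideal_Suc[OF X(2)] mem_fin_ideal_Suc[OF X(3)]
    by (rule finite_subset[OF _ finite_UnI])
qed auto

context fan_tree
begin

section \<open>Branches of the tree as strictly increasing tuples\<close>

definition chain :: "nat \<Rightarrow> nat set" where
  "chain m = {u. 0 < u \<and> (\<exists>i. u = (par ^^ i) m)}"

definition path :: "nat \<Rightarrow> nat list" where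
  "path m = sorted_list_of_set (chain m)"

definition anc :: "nat \<Rightarrow> nat \<Rightarrow> nat" where
  "anc l m = (par ^^ (lev m - l)) m"

definition leaves :: "nat set \<Rightarrow> nat set" where
  "leaves P = {m \<in> P. lev m = k}"

lemma par_le: "par m \<le> m"
  using par_less[of m] par_0 by (cases "m = 0") auto

lemma funpow_par_le: "(par ^^ i) m \<le> m"
  by (induction i) (auto intro: le_trans[OF par_le])

lemma chain_0: "chain 0 = {}"
  using funpow_par_le[of _ 0] by (auto simp: chain_def)

lemma chain_le: "u \<in> chain m \<Longrightarrow> u \<le> m"
  using funpow_par_le by (auto simp: chain_def)

lemma finite_chain: "finite (chain m)"
  using chain_le by (meson finite_nat_set_iff_bounded_le)

lemma chain_step: "0 < m \<Longrightarrow> chain m = insert m (chain (par m))"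
proof
  assume m: "0 < m"
  show "chain m \<subseteq> insert m (chain (par m))"
  proof
    fix u assume "u \<in> chain m"
    then obtain i where i: "0 < u" "u = (par ^^ i) m" by (auto simp: chain_def)
    then show "u \<in> insert m (chain (par m))"
      by (cases i) (auto simp: chain_def funpow_swap1 simp del: funpow.simps(2) simp: funpow_Suc_right)
  qed
  show "insert m (chain (par m)) \<subseteq> chain m"
  proof
    fix u assume "u \<in> insert m (chain (par m))"
    then consider "u = m" | i where "0 < u" "u = (par ^^ i) (par m)" by (auto simp: chain_def)
    then show "u \<in> chain m"
    proof cases
      case 1
      then have "u = (par ^^ 0) m" by simp
      moreover have "0 < u" using 1 m by simp
      ultimately show ?thesis unfolding chain_def mem_Collect_eq by (intro conjI exI)
    next
      case (2 i)
      then have "u = (par ^^ Suc i) m" by (simp add: funpow_swap1)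
      with 2(1) show ?thesis unfolding chain_def mem_Collect_eq by (intro conjI exI)
    qed
  qed
qed

lemma path_0: "path 0 = []"
  by (simp add: path_def chain_0)

text \<open>Parents have smaller numbers, so sorting a branch lists it from the root
  upwards.\<close>

lemma path_step: "0 < m \<Longrightarrow> path m = path (par m) @ [m]"
proof -
  assume m: "0 < m"
  have "a < m" if "a \<in> chain (par m)" for a using chain_le[OF that] par_less[OF m] by simp
  then show ?thesis
    unfolding path_def chain_step[OF m] by (rule sorted_list_of_set_insert_greater[OF finite_chain])
qed

lemma node_induct [case_names root step]:
  assumes "P 0" "\<And>m. 0 < m \<Longrightarrow> P (par m) \<Longrightarrow> P m"
  shows "P m"
proof (induction m rule: less_induct)
  case (less m)
  then show ?case using assms par_less[of m] by (cases "m = 0") simp_all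
qed

lemma set_path: "set (path m) = chain m"
  by (simp add: path_def finite_chain)

lemma length_path: "length (path m) = lev m"
proof (induction m rule: node_induct)
  case (step m)
  then show ?case using path_step[OF step(1)] lev_par[OF step(1)] by simp
qed (simp add: path_0 lev_0)

lemma card_chain: "card (chain m) = lev m"
  using length_path[of m] by (simp add: path_def)

lemma Max_chain: "0 < m \<Longrightarrow> Max (chain m) = m"
  using chain_step[of m] by (intro Max_eqI[OF finite_chain chain_le]) auto

lemma lev_eq_0: "lev m = 0 \<longleftrightarrow> m = 0"
  using lev_0 lev_par[of m] by (cases "m = 0") auto

lemma inj_chain: "inj chain"
proof (rule injI)
  fix m m' assume e: "chain m = chain m'"
  have lev: "lev m = lev m'" using arg_cong[OF e, of card] by (simp add: card_chain)
  show "m = m'"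
  proof (cases "m = 0")
    case True
    then show ?thesis using lev lev_eq_0[of m'] lev_0 by simp
  next
    case False
    then have m: "0 < m" "0 < m'" using lev lev_eq_0[of m] lev_eq_0[of m'] by simp_all
    have "m = Max (chain m)" using Max_chain[OF m(1)] ..
    also have "\<dots> = m'" unfolding e using Max_chain[OF m(2)] .
    finally show ?thesis .
  qed
qed

lemma inj_path: "inj path"
proof (rule injI)
  fix m m' assume "path m = path m'"
  then have "set (path m) = set (path m')" by simp
  then have "chain m = chain m'" by (simp only: set_path)
  then show "m = m'" by (rule injD[OF inj_chain])
qed

lemma lev_anc: "l \<le> lev m \<Longrightarrow> lev (anc l m) = l"
proof -
  have "i \<le> lev m \<Longrightarrow> lev ((par ^^ i) m) = lev m - i" for i
  proof (induction i)
    case (Suc i)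
    then have "0 < lev ((par ^^ i) m)" by simp
    then have "0 < (par ^^ i) m" using lev_0 by (cases "(par ^^ i) m = 0") simp_all
    then show ?case using Suc lev_par[of "(par ^^ i) m"] by simp
  qed simp
  then show "l \<le> lev m \<Longrightarrow> ?thesis" by (simp add: anc_def)
qed

lemma anc_step: "l < lev m \<Longrightarrow> anc l m = anc l (par m)"
proof -
  assume l: "l < lev m"
  then have "0 < m" using lev_0 by (cases "m = 0") simp_all
  then have "lev m - l = Suc (lev (par m) - l)" using l lev_par[of m] by simp
  then show ?thesis by (simp add: anc_def funpow_swap1)
qed

lemma anc_self: "anc (lev m) m = m"
  by (simp add: anc_def)

lemma proj_chain: "l \<le> lev m \<Longrightarrow> proj l (chain m) = chain (anc l m)"
proof (induction m rule: node_induct)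
  case root
  then show ?case by (simp add: proj_def chain_0 anc_def lev_0)
next
  case (step m)
  show ?case
  proof (cases "l = lev m")
    case True
    then show ?thesis using length_path[of m] set_path[of m]
      by (simp add: proj_def path_def[symmetric] anc_self)
  next
    case False
    then have l: "l < lev m" "l \<le> lev (par m)" using step lev_par[of m] by auto
    have "proj l (chain m) = proj l (chain (par m))"
      using path_step[OF step(1)] length_path[of "par m"] l(2) by (simp add: proj_def path_def[symmetric])
    then show ?thesis using step(2)[OF l(2)] anc_step[OF l(1)] by simp
  qed
qed

lemma anc_mem: "perfect P \<Longrightarrow> m \<in> P \<Longrightarrow> anc l m \<in> P"
proof -
  assume P: "perfect P" "m \<in> P"
  have "(par ^^ i) m \<in> P" for i by (induction i) (use P perfect_D(2) in auto)
  then show ?thesis by (simp add: anc_def)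
qed

lemma leaf_above: "perfect P \<Longrightarrow> s \<in> P \<Longrightarrow> \<exists>m\<in>leaves P. anc (lev s) m = s"
proof (induction "k - lev s" arbitrary: s)
  case 0
  then have "lev s = k" using lev_le[of s] by simp
  then show ?case using 0 anc_self by (auto simp: leaves_def)
next
  case (Suc n)
  then have "lev s < k" by simp
  then have "infinite (P \<inter> ch s)" using perfect_D(3)[OF Suc(3,4)] by blast
  then have "P \<inter> ch s \<noteq> {}" by auto
  then obtain u where u: "u \<in> P" "u \<in> ch s" by blast
  have lev: "lev u = Suc (lev s)" using ch_D(4)[OF u(2)] .
  then have "n = k - lev u" using Suc(2) by simp
  then obtain m where m: "m \<in> leaves P" "anc (lev u) m = u"
    using Suc(1)[OF _ Suc(3) u(1)] by blast
  have "lev m = k" using m(1) by (simp add: leaves_def)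
  then have "anc (lev s) m = par (anc (lev u) m)"
  proof -
    have "k - lev s = Suc (k - lev u)" using lev \<open>lev s < k\<close> by simp
    then show ?thesis using \<open>lev m = k\<close> by (simp add: anc_def)
  qed
  then show ?case using m ch_D(2)[OF u(2)] by auto
qed

lemma leaves_subset: "perfect P \<Longrightarrow> perfect Q \<Longrightarrow> leaves P \<subseteq> leaves Q \<Longrightarrow> P \<subseteq> Q"
proof
  fix s assume *: "perfect P" "perfect Q" "leaves P \<subseteq> leaves Q" "s \<in> P"
  obtain m where "m \<in> leaves P" "anc (lev s) m = s" using leaf_above[OF *(1,4)] by blast
  then show "s \<in> Q" using anc_mem[OF *(2), of m "lev s"] *(3) by (auto simp: leaves_def)
qed

section \<open>Positive sets of leaves\<close>

definition tails :: "nat set \<Rightarrow> nat \<Rightarrow> nat list set" where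
  "tails L s = {js. path s @ js \<in> path ` L}"

text \<open>Positivity of the part of \<open>L\<close> above \<open>s\<close>, in the remaining
  dimension. On level \<open>k\<close> this is dimension 0, where it means that \<open>s\<close>
  belongs to \<open>L\<close>.\<close>

definition large :: "nat set \<Rightarrow> nat \<Rightarrow> bool" where
  "large L s \<longleftrightarrow> tails L s \<notin> fin_ideal (k - lev s)"

lemma path_append:
  "path m = path s @ i # js \<Longrightarrow> i \<in> ch s \<and> path i = path s @ [i]"
proof (induction m arbitrary: js rule: node_induct)
  case root
  then show ?case by (simp add: path_0)
next
  case (step m)
  show ?case
  proof (cases "js = []")
    case True
    then have "path (par m) = path s" "i = m" using step(1,3) path_step[of m] by auto
    then have "par i = s" "i = m" using injD[OF inj_path] by auto
    then show ?thesis using step(1) path_step[of m] by (auto simp: ch_def)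
  next
    case False
    then have "path (par m) = path s @ i # butlast js"
      using step(1,3) path_step[of m] by (metis butlast_append butlast_snoc butlast.simps(2) list.simps(3))
    then show ?thesis by (rule step(2))
  qed
qed

lemma large_leaf: "L \<subseteq> leaves UNIV \<Longrightarrow> lev s = k \<Longrightarrow> large L s \<longleftrightarrow> s \<in> L"
proof -
  assume *: "L \<subseteq> leaves UNIV" "lev s = k"
  have "tails L s = {js. path s @ js = path s \<and> s \<in> L}"
  proof (intro set_eqI iffI)
    fix js assume "js \<in> tails L s"
    then obtain m where m: "m \<in> L" "path s @ js = path m" by (auto simp: tails_def)
    have "lev m = k" using m(1) *(1) by (auto simp: leaves_def)
    then have js: "js = []" using arg_cong[OF m(2), of length] *(2) by (simp add: length_path)
    then have "m = s" using m(2) injD[OF inj_path, of s m] by simp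
    then show "js \<in> {js. path s @ js = path s \<and> s \<in> L}" using m(1) js by simp
  qed (auto simp: tails_def)
  then show ?thesis using * by (auto simp: large_def)
qed

lemma large_step:
  assumes "L \<subseteq> leaves UNIV" "lev s < k"
  shows "large L s \<longleftrightarrow> infinite {i \<in> ch s. large L i}"
proof -
  obtain n where n: "k - lev s = Suc n" using assms(2) by (metis Suc_diff_Suc)
  have sub: "tails L s \<subseteq> tuples (Suc n)"
  proof
    fix js assume "js \<in> tails L s"
    then obtain m where m: "m \<in> L" "path s @ js = path m" by (auto simp: tails_def)
    have "lev m = k" using m(1) assms(1) by (auto simp: leaves_def)
    then have "length js = k - lev s"
      using arg_cong[OF m(2), of length] by (simp add: length_path)
    then show "js \<in> tuples (Suc n)" using n by (simp add: tuples_def)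
  qed
  have "{i. {js. i # js \<in> tails L s} \<notin> fin_ideal n} = {i \<in> ch s. large L i}"
  proof (intro set_eqI iffI)
    fix i assume i: "i \<in> {i. {js. i # js \<in> tails L s} \<notin> fin_ideal n}"
    have "{js. i # js \<in> tails L s} \<noteq> {}"
    proof
      assume "{js. i # js \<in> tails L s} = {}"
      then show False using i fin_ideal_empty[of n] by simp
    qed
    then obtain js where "path s @ i # js \<in> path ` L" unfolding tails_def by blast
    then obtain m where "path s @ i # js = path m" by blast
    from path_append[OF this[symmetric]] have c: "i \<in> ch s" "path i = path s @ [i]" by auto
    then have "{js. i # js \<in> tails L s} = tails L i" by (simp add: tails_def)
    moreover have "k - lev i = n" using ch_D(4)[OF c(1)] n by simp
    ultimately show "i \<in> {i \<in> ch s. large L i}" using i c by (simp add: large_def)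
  next
    fix i assume i: "i \<in> {i \<in> ch s. large L i}"
    then have "path i = path s @ [i]" using path_step[of i] ch_D(1,2) by auto
    then have "{js. i # js \<in> tails L s} = tails L i" by (simp add: tails_def)
    moreover have "k - lev i = n" using ch_D(4)[of i s] i n by simp
    ultimately show "i \<in> {i. {js. i # js \<in> tails L s} \<notin> fin_ideal n}" using i by (simp add: large_def)
  qed
  then show ?thesis unfolding large_def[of L s] n mem_fin_ideal_Suc[OF sub] by simp
qed

text \<open>By \<open>large_step\<close> a large node below level \<open>k\<close> has infinitely
  many large children, so the large nodes grow a perfect tree from a large root. Conversely, all
  nodes of a perfect tree with leaves in \<open>L\<close> are large, by induction from the leaves
  towards the root.\<close>

lemma positive_iff_perfect:
  assumes "L \<subseteq> leaves UNIV"
  shows "path ` L \<notin> fin_ideal k \<longleftrightarrow> (\<exists>P. perfect P \<and> leaves P \<subseteq> L)"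
proof -
  have root: "path ` L \<notin> fin_ideal k \<longleftrightarrow> large L 0"
    by (simp add: large_def tails_def path_0 lev_0)
  show ?thesis
    unfolding root
  proof
    assume l0: "large L 0"
    define P where "P = grow {m. large L m} {0}"
    have lP: "large L s" if "s \<in> P" for s using that l0 grow_subset unfolding P_def by blast
    have "perfect P"
      unfolding P_def
    proof (rule perfect_grow_fincl[OF fincl_0])
      fix s assume "s \<in> grow {m. large L m} {0}" "lev s < k"
      then have "infinite {i \<in> ch s. large L i}" using lP large_step[OF assms] P_def by blast
      then show "infinite ({m. large L m} \<inter> ch s)" by (rule infinite_super[rotated]) auto
    qed
    moreover have "leaves P \<subseteq> L" using lP large_leaf[OF assms] by (auto simp: leaves_def)
    ultimately show "\<exists>P. perfect P \<and> leaves P \<subseteq> L" by blast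
  next
    assume "\<exists>P. perfect P \<and> leaves P \<subseteq> L"
    then obtain P where P: "perfect P" "leaves P \<subseteq> L" by blast
    have "s \<in> P \<Longrightarrow> large L s" for s
    proof (induction "k - lev s" arbitrary: s)
      case 0
      then have "lev s = k" using lev_le[of s] by simp
      then show ?case using 0 P(2) large_leaf[OF assms] by (auto simp: leaves_def)
    next
      case (Suc n)
      then have lt: "lev s < k" by simp
      have "P \<inter> ch s \<subseteq> {i \<in> ch s. large L i}" using Suc(1)[of _] Suc(2) ch_D(4) by fastforce
      moreover have "infinite (P \<inter> ch s)" using perfect_D(3)[OF P(1) Suc(3) lt] .
      ultimately show ?case using large_step[OF assms lt] infinite_super by blast
    qed
    then show "large L 0" using perfect_D(1)[OF P(1)] by blast
  qed
qed

end

section \<open>The order of the quotient algebra\<close>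

lemma fin_class_eq:
  assumes "X \<subseteq> tuples n" "Y \<subseteq> tuples n"
  shows "fin_class n X = fin_class n Y \<longleftrightarrow> X - Y \<in> fin_ideal n \<and> Y - X \<in> fin_ideal n"
proof
  assume "fin_class n X = fin_class n Y"
  moreover have "Y \<in> fin_class n Y" using assms fin_ideal_empty by (simp add: fin_class_def fin_equiv_def)
  ultimately have "Y \<in> fin_class n X" by simp
  then have "(X - Y) \<union> (Y - X) \<in> fin_ideal n" by (simp add: fin_class_def fin_equiv_def)
  then show "X - Y \<in> fin_ideal n \<and> Y - X \<in> fin_ideal n" using fin_ideal_subset by blast
next
  assume *: "X - Y \<in> fin_ideal n \<and> Y - X \<in> fin_ideal n"
  have tr: "(A - C) \<union> (C - A) \<in> fin_ideal n"
    if "A - B \<in> fin_ideal n" "B - A \<in> fin_ideal n" "(B - C) \<union> (C - B) \<in> fin_ideal n" for A B C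
    by (rule fin_ideal_subset[OF fin_ideal_Un[OF fin_ideal_Un[OF that(1,2)] that(3)]]) blast
  show "fin_class n X = fin_class n Y"
    using tr[of X Y] tr[of Y X] * assms by (auto simp: fin_class_def fin_equiv_def)
qed

lemma fin_ideal_Diff_trans: "X - Y \<in> fin_ideal n \<Longrightarrow> Y - Z \<in> fin_ideal n \<Longrightarrow> X - Z \<in> fin_ideal n"
  using fin_ideal_subset[OF fin_ideal_Un, of "X - Y" n "Y - Z" "X - Z"] by blast

lemma fin_ideal_Diff_subset: "A \<subseteq> B \<Longrightarrow> A - B \<in> fin_ideal n"
  using fin_ideal_empty[of n] Diff_eq_empty_iff[of A B] by metis

lemma pow_mod_fin_iff:
  assumes "X \<subseteq> tuples n" "Y \<subseteq> tuples n" "X \<notin> fin_ideal n" "Y \<notin> fin_ideal n"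
  shows "(fin_class n X, fin_class n Y) \<in> pow_mod_fin n \<longleftrightarrow> X - Y \<in> fin_ideal n"
proof
  assume "(fin_class n X, fin_class n Y) \<in> pow_mod_fin n"
  then obtain X' Y' where *: "fin_class n X = fin_class n X'" "fin_class n Y = fin_class n Y'"
    "X' \<subseteq> tuples n" "Y' \<subseteq> tuples n" "X' - Y' \<in> fin_ideal n"
    by (auto simp: pow_mod_fin_def)
  then have "X - X' \<in> fin_ideal n" "Y' - Y \<in> fin_ideal n"
    using fin_class_eq assms(1,2) by blast+
  then show "X - Y \<in> fin_ideal n" using *(5) fin_ideal_Diff_trans by blast
qed (use assms in \<open>auto simp: pow_mod_fin_def\<close>)

lemma pow_mod_fin_cases:
  assumes "(q, p) \<in> pow_mod_fin n"
  obtains X Y where "q = fin_class n X" "p = fin_class n Y" "X \<subseteq> tuples n" "Y \<subseteq> tuples n"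
    "X \<notin> fin_ideal n" "Y \<notin> fin_ideal n" "X - Y \<in> fin_ideal n"
  using assms by (auto simp: pow_mod_fin_def)

lemma pow_mod_fin_Field: "p \<in> Field (pow_mod_fin n) \<longleftrightarrow> (\<exists>X. p = fin_class n X \<and> X \<subseteq> tuples n \<and> X \<notin> fin_ideal n)"
proof
  assume "p \<in> Field (pow_mod_fin n)"
  then show "\<exists>X. p = fin_class n X \<and> X \<subseteq> tuples n \<and> X \<notin> fin_ideal n"
    by (auto simp: Field_def pow_mod_fin_def)
next
  assume "\<exists>X. p = fin_class n X \<and> X \<subseteq> tuples n \<and> X \<notin> fin_ideal n"
  then obtain X where X: "p = fin_class n X" "X \<subseteq> tuples n" "X \<notin> fin_ideal n" by blast
  then have "(p, p) \<in> pow_mod_fin n" using pow_mod_fin_iff[of X n X] fin_ideal_empty by simp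
  then show "p \<in> Field (pow_mod_fin n)" by (rule FieldI1)
qed

lemma pow_mod_fin_refl: "p \<in> Field (pow_mod_fin n) \<Longrightarrow> (p, p) \<in> pow_mod_fin n"
  using pow_mod_fin_iff fin_ideal_empty by (auto simp: pow_mod_fin_Field)

lemma trans_pow_mod_fin: "trans (pow_mod_fin n)"
proof (rule transI)
  fix x y z assume 1: "(x, y) \<in> pow_mod_fin n" and 2: "(y, z) \<in> pow_mod_fin n"
  from 1 obtain X Y where XY: "x = fin_class n X" "y = fin_class n Y" "X \<subseteq> tuples n" "Y \<subseteq> tuples n"
    "X \<notin> fin_ideal n" "Y \<notin> fin_ideal n" "X - Y \<in> fin_ideal n" by (rule pow_mod_fin_cases)
  from 2 obtain Y' Z where YZ: "y = fin_class n Y'" "z = fin_class n Z" "Y' \<subseteq> tuples n" "Z \<subseteq> tuples n"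
    "Y' \<notin> fin_ideal n" "Z \<notin> fin_ideal n" "Y' - Z \<in> fin_ideal n" by (rule pow_mod_fin_cases)
  have "Y - Z \<in> fin_ideal n" using pow_mod_fin_iff[OF XY(4) YZ(4) XY(6) YZ(6)] 2 XY(2) YZ(2) by simp
  then have "X - Z \<in> fin_ideal n" using XY(7) fin_ideal_Diff_trans by blast
  then show "(x, z) \<in> pow_mod_fin n" using pow_mod_fin_iff[OF XY(3) YZ(4) XY(5) YZ(6)] XY(1) YZ(2) by simp
qed

lemma forcing_base_pow_mod_fin:
  assumes "D \<subseteq> Field (pow_mod_fin n)" "\<And>p q. p \<in> D \<Longrightarrow> (q, p) \<in> pow_mod_fin n \<Longrightarrow> q \<in> D"
  shows "forcing_base (pow_mod_fin n) D"
  by unfold_locales (use assms pow_mod_fin_refl trans_pow_mod_fin in auto)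

context fan_tree
begin

section \<open>Conditions given by perfect subtrees\<close>

definition code :: "nat set \<Rightarrow> nat list set" where
  "code P = path ` leaves P"

definition cond :: "nat set \<Rightarrow> nat list set set" where
  "cond P = fin_class k (code P)"

abbreviation le :: "nat list set set rel" where
  "le \<equiv> pow_mod_fin k"

lemma leaves_mono: "P \<subseteq> Q \<Longrightarrow> leaves P \<subseteq> leaves Q"
  by (auto simp: leaves_def)

lemma code_mono: "P \<subseteq> Q \<Longrightarrow> code P \<subseteq> code Q"
  unfolding code_def by (intro image_mono leaves_mono)

lemma code_tuples: "code P \<subseteq> tuples k"
  by (auto simp: code_def leaves_def tuples_def length_path)

lemma code_positive: "perfect P \<Longrightarrow> code P \<notin> fin_ideal k"
  using positive_iff_perfect[of "leaves P"] leaves_mono[of P UNIV] by (auto simp: code_def)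

lemma cond_le:
  "perfect P \<Longrightarrow> X \<subseteq> tuples k \<Longrightarrow> X \<notin> fin_ideal k \<Longrightarrow> (cond P, fin_class k X) \<in> le \<longleftrightarrow> code P - X \<in> fin_ideal k"
  unfolding cond_def by (rule pow_mod_fin_iff[OF code_tuples _ code_positive])

lemma cond_mono: "perfect P \<Longrightarrow> perfect Q \<Longrightarrow> P \<subseteq> Q \<Longrightarrow> (cond P, cond Q) \<in> le"
proof -
  assume *: "perfect P" "perfect Q" "P \<subseteq> Q"
  show ?thesis
    using cond_le[OF *(1) code_tuples code_positive[OF *(2)]] fin_ideal_Diff_subset[OF code_mono[OF *(3)]]
    by (simp add: cond_def)
qed

text \<open>Up to small sets, a representative of \<open>q\<close> is contained in both
  \<open>code P\<close> and \<open>X\<close>. So the leaves common to all three are positive and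
  carry a perfect tree.\<close>

lemma refine:
  assumes P: "perfect P" and q: "(q, cond P) \<in> le" and X: "X \<subseteq> tuples k" "X \<notin> fin_ideal k" "(q, fin_class k X) \<in> le"
  obtains P' where "P' \<subseteq> P" "perfect P'" "(cond P', q) \<in> le" "code P' \<subseteq> X"
proof -
  from q obtain Y where Y: "q = fin_class k Y" "Y \<subseteq> tuples k" "Y \<notin> fin_ideal k"
    by (rule pow_mod_fin_cases)
  have YP: "Y - code P \<in> fin_ideal k" "Y - X \<in> fin_ideal k"
    using q X(3) pow_mod_fin_iff[OF Y(2) code_tuples Y(3) code_positive[OF P]] pow_mod_fin_iff[OF Y(2) X(1) Y(3) X(2)]
    unfolding cond_def Y(1) by auto
  define L where "L = {m \<in> leaves P. path m \<in> X \<and> path m \<in> Y}"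
  have L: "path ` L = Y \<inter> code P \<inter> X" by (auto simp: L_def code_def)
  have "path ` L \<notin> fin_ideal k"
  proof
    assume "path ` L \<in> fin_ideal k"
    then have "path ` L \<union> ((Y - code P) \<union> (Y - X)) \<in> fin_ideal k"
      using fin_ideal_Un YP by blast
    moreover have "Y \<subseteq> path ` L \<union> ((Y - code P) \<union> (Y - X))" unfolding L by blast
    ultimately show False using Y(3) fin_ideal_subset by blast
  qed
  moreover have "L \<subseteq> leaves UNIV" by (auto simp: L_def leaves_def)
  ultimately obtain P' where P': "perfect P'" "leaves P' \<subseteq> L" using positive_iff_perfect by blast
  have "leaves P' \<subseteq> leaves P" using P'(2) by (auto simp: L_def)
  then have sub: "P' \<subseteq> P" by (rule leaves_subset[OF P'(1) P])
  have c: "code P' \<subseteq> path ` L" unfolding code_def using P'(2) by (rule image_mono)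
  then have "code P' \<subseteq> Y" unfolding L by blast
  then have "(cond P', q) \<in> le" using cond_le[OF P'(1) Y(2,3)] fin_ideal_Diff_subset Y(1) by simp
  then show ?thesis using that sub P'(1) c unfolding L by blast
qed

lemma refine_cond:
  assumes "perfect P" "(q, cond P) \<in> le"
  obtains P' where "P' \<subseteq> P" "perfect P'" "(cond P', q) \<in> le"
  by (rule refine[OF assms code_tuples code_positive[OF assms(1)] assms(2)[unfolded cond_def]]) (rule that)

text \<open>The conditions that force \<open>\<W>\<^sub>k \<in> \<G>\<^sub>k\<close>.\<close>

definition \<D> :: "nat list set set set" where
  "\<D> = {p. (p, cond UNIV) \<in> le}"

lemma D_Field: "\<D> \<subseteq> Field le"
  by (auto simp: \<D>_def intro: FieldI1)

lemma conds_trans: "(x, y) \<in> le \<Longrightarrow> (y, z) \<in> le \<Longrightarrow> (x, z) \<in> le"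
  using trans_pow_mod_fin by (rule transD)

lemma conds_down: "p \<in> \<D> \<Longrightarrow> (q, p) \<in> le \<Longrightarrow> q \<in> \<D>"
  unfolding \<D>_def using conds_trans by blast

lemma conds_refl: "p \<in> \<D> \<Longrightarrow> (p, p) \<in> le"
  using D_Field pow_mod_fin_refl by blast

lemma cond_D: "perfect P \<Longrightarrow> cond P \<in> \<D>"
  using cond_mono perfect_UNIV by (simp add: \<D>_def)

lemma perfect_below: "p \<in> \<D> \<Longrightarrow> \<exists>P. perfect P \<and> (cond P, p) \<in> le"
  using refine_cond[OF perfect_UNIV, of p] unfolding \<D>_def mem_Collect_eq by metis

text \<open>\<open>Q\<close> follows \<open>P n\<close> above one node \<open>c n\<close> on level
  1, for each \<open>n\<close>. A leaf of \<open>Q\<close> outside \<open>P n\<close> lies above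
  some \<open>c i\<close> with \<open>i < n\<close>, and these finitely many nodes cannot be all the
  nodes on level 1 of a perfect tree.\<close>

lemma diagonal_intersection:
  assumes P: "\<And>n. perfect (P n)" "\<And>n. P (Suc n) \<subseteq> P n"
  obtains Q where "perfect Q" "Q \<subseteq> P 0" "\<And>n. (cond Q, cond (P n)) \<in> le"
proof -
  have anti: "i \<le> j \<Longrightarrow> P j \<subseteq> P i" for i j by (rule lift_Suc_antimono_le) (use P in auto)
  have "\<exists>c. \<forall>n. c n \<in> P n \<inter> ch 0 \<and> c n < c (Suc n)"
  proof (rule dependent_nat_choice)
    have inf: "infinite (P n \<inter> ch 0)" for n
      using perfect_D(3)[OF P(1) perfect_D(1)[OF P(1)]] lev_0 k_pos by simp
    show "\<exists>x. x \<in> P 0 \<inter> ch 0" using inf[of 0] unfolding infinite_nat_iff_unbounded by blast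
    show "\<exists>y. y \<in> P (Suc n) \<inter> ch 0 \<and> x < y" for x n
      using inf[of "Suc n"] unfolding infinite_nat_iff_unbounded by blast
  qed
  then obtain c where c: "\<And>n. c n \<in> P n" "\<And>n. c n \<in> ch 0" "\<And>n. c n < c (Suc n)" by blast
  have sm: "strict_mono c" using c(3) by (simp add: strict_mono_Suc_iff)
  then have inj: "inj c" by (rule strict_mono_imp_inj_on)
  define Q where "Q = insert 0 (\<Union>n. P n \<inter> grow UNIV {c n})"
  have QP: "Q \<subseteq> P 0" using anti[of 0] perfect_D(1)[OF P(1)] by (auto simp: Q_def)
  have pQ: "perfect Q"
    unfolding perfect_def
  proof (intro conjI ballI impI)
    show "par ` Q \<subseteq> Q"
    proof (rule image_subsetI)
      fix u assume "u \<in> Q"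
      then consider "u = 0" | n where "u \<in> P n" "u \<in> grow UNIV {c n}" by (auto simp: Q_def)
      then show "par u \<in> Q"
      proof cases
        case (2 n)
        show ?thesis
        proof (cases "u = c n")
          case True
          then show ?thesis using ch_D(2)[OF c(2)] by (simp add: Q_def)
        next
          case False
          then have "par u \<in> grow UNIV {c n}" using grow_par[OF 2(2)] by blast
          then show ?thesis using perfect_D(2)[OF P(1) 2(1)] by (auto simp: Q_def)
        qed
      qed (simp add: par_0 Q_def)
    qed
    fix s assume s: "s \<in> Q" "lev s < k"
    show "infinite (Q \<inter> ch s)"
    proof (cases "s = 0")
      case True
      have "range c \<subseteq> Q \<inter> ch s" using c True by (auto simp: Q_def intro: grow.base)
      then show ?thesis using range_inj_infinite[OF inj] infinite_super by blast
    next
      case False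
      then obtain n where n: "s \<in> P n" "s \<in> grow UNIV {c n}" using s(1) by (auto simp: Q_def)
      have "ch s \<subseteq> grow UNIV {c n}" using n(2) by (auto simp: ch_def intro: grow.step)
      then have "P n \<inter> ch s \<subseteq> Q \<inter> ch s" by (auto simp: Q_def)
      then show ?thesis using perfect_D(3)[OF P(1) n(1) s(2)] infinite_super by blast
    qed
  qed (simp add: Q_def)
  show ?thesis
  proof (rule that[OF pQ QP])
    fix n
    have "path ` (leaves Q - leaves (P n)) \<in> fin_ideal k"
    proof (rule ccontr)
      assume "\<not> ?thesis"
      moreover have "leaves Q - leaves (P n) \<subseteq> leaves UNIV" by (auto simp: leaves_def)
      ultimately obtain R where R: "perfect R" "leaves R \<subseteq> leaves Q - leaves (P n)"
        using positive_iff_perfect by blast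
      have "infinite (R \<inter> ch 0)" using perfect_D(3)[OF R(1) perfect_D(1)[OF R(1)]] lev_0 k_pos by simp
      \<comment> \<open>Beyond \<open>c n\<close>, hence different from every \<open>c i\<close>
        with \<open>i < n\<close>.\<close>
      then obtain u where u: "u \<in> R" "u \<in> ch 0" "c n < u" unfolding infinite_nat_iff_unbounded by blast
      obtain m where m: "m \<in> leaves R" "anc (lev u) m = u" using leaf_above[OF R(1) u(1)] by blast
      then have mQ: "m \<in> Q" "lev m = k" "m \<notin> P n" using R(2) by (auto simp: leaves_def)
      have "m \<noteq> 0"
      proof
        assume "m = 0"
        then show False using mQ(2) lev_0 k_pos by simp
      qed
      then obtain i where i: "m \<in> P i" "m \<in> grow UNIV {c i}" using mQ(1) by (auto simp: Q_def)
      have "i < n" using i(1) mQ(3) anti[of n i] by (cases "i < n") auto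
      have anc1: "anc 1 w = c i" if "w \<in> grow UNIV {c i}" for w
        using that
      proof induction
        case (base b)
        then have "lev b = 1" using ch_D(4)[OF c(2)[of i]] lev_0 by simp
        then show ?case using anc_self[of b] base by simp
      next
        case (step w)
        have "lev (par w) \<noteq> 0"
        proof
          assume "lev (par w) = 0"
          then have "par w = 0" by (simp add: lev_eq_0)
          then show False using step(3) grow_ge ch_D(1)[OF c(2)[of i]] by fastforce
        qed
        then have "1 < lev w" using lev_par[OF step(2)] by simp
        then show ?case using anc_step[of 1 w] step by simp
      qed
      have "lev u = 1" using ch_D(4)[OF u(2)] lev_0 by simp
      then have "u = c i" using anc1[OF i(2)] m(2) by simp
      then show False using u(3) strict_monoD[OF sm \<open>i < n\<close>] by simp
    qed
    moreover have "code Q - code (P n) = path ` (leaves Q - leaves (P n))"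
      unfolding code_def using inj_path by (simp add: image_set_diff)
    ultimately show "(cond Q, cond (P n)) \<in> le"
      using cond_le[OF pQ code_tuples code_positive[OF P(1)]] unfolding cond_def[of "P n"] by simp
  qed
qed

text \<open>One property is decided at a time along a decreasing sequence of perfect trees;
  \<open>diagonal_intersection\<close> yields a condition below all of them, which inherits the
  decisions.\<close>

lemma conds_decide:
  assumes p: "p \<in> \<D>" and \<Phi>: "\<And>n p q. \<Phi> n p \<Longrightarrow> (q, p) \<in> le \<Longrightarrow> \<Phi> n q"
  shows "\<exists>q. (q, p) \<in> le \<and> (\<forall>n::nat. \<Phi> n q \<or> (\<forall>q'. (q', q) \<in> le \<longrightarrow> \<not> \<Phi> n q'))"
proof -
  obtain P0 where P0: "perfect P0" "(cond P0, p) \<in> le" using perfect_below[OF p] by blast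
  define dec where "dec n P \<longleftrightarrow> \<Phi> n (cond P) \<or> (\<forall>q'. (q', cond P) \<in> le \<longrightarrow> \<not> \<Phi> n q')" for n P
  have "\<exists>P. P 0 = P0 \<and> (\<forall>n. perfect (P n) \<and> (P (Suc n) \<subseteq> P n \<and> dec n (P (Suc n))))"
  proof (rule dependent_choice_from[of perfect P0 "\<lambda>n P P'. P' \<subseteq> P \<and> dec n P'"])
    fix P n assume P: "perfect P"
    show "\<exists>P'. perfect P' \<and> (P' \<subseteq> P \<and> dec n P')"
    proof (cases "\<exists>q'. (q', cond P) \<in> le \<and> \<Phi> n q'")
      case True
      then obtain q' where q': "(q', cond P) \<in> le" "\<Phi> n q'" by blast
      obtain P' where "P' \<subseteq> P" "perfect P'" "(cond P', q') \<in> le" using refine_cond[OF P q'(1)] .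
      then show ?thesis using \<Phi>[OF q'(2)] unfolding dec_def by blast
    next
      case False
      then show ?thesis using P unfolding dec_def by blast
    qed
  qed (rule P0)
  then obtain P where P: "P 0 = P0" "\<And>n. perfect (P n)" "\<And>n. P (Suc n) \<subseteq> P n" "\<And>n. dec n (P (Suc n))" by blast
  obtain Q where Q: "perfect Q" "Q \<subseteq> P 0" "\<And>n. (cond Q, cond (P n)) \<in> le"
    using diagonal_intersection[of P, OF P(2,3)] by metis
  have "\<Phi> n (cond Q) \<or> (\<forall>q'. (q', cond Q) \<in> le \<longrightarrow> \<not> \<Phi> n q')" for n
    using P(4)[of n] \<Phi>[of n "cond (P (Suc n))" "cond Q"] conds_trans[OF _ Q(3)[of "Suc n"]] Q(3)[of "Suc n"]
    unfolding dec_def by blast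
  moreover have "(cond Q, p) \<in> le" using conds_trans[OF Q(3)[of 0]] P(1) P0(2) by simp
  ultimately show ?thesis by blast
qed

sublocale forcing le \<D>
  by unfold_locales (use conds_refl trans_pow_mod_fin conds_down conds_decide in auto)

end

section \<open>Tukey reductions of the generic ultrafilter\<close>

context fan_tree
begin

text \<open>The node to be extended is read off from the number of nodes in the position. So an
  infinite play serves each of its nodes below level \<open>k\<close> infinitely often and
  enumerates a perfect tree.\<close>

definition fair_sel :: "nat set \<Rightarrow> nat" where
  "fair_sel A = (let s = fst (prod_decode (card A)) in if s \<in> A \<and> lev s < k then s else 0)"

lemma fair_sel: "fincl A \<Longrightarrow> fair_sel A \<in> A \<and> lev (fair_sel A) < k"
  using fincl_D(2) lev_0 k_pos by (auto simp: fair_sel_def Let_def)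

lemma perfect_fair_run:
  assumes A: "\<And>i. fincl (A i)" "\<And>i. A (Suc i) = insert (m i) (A i)" "\<And>i. m i \<in> ch (fair_sel (A i))" "\<And>i. Max (A i) < m i"
  shows "perfect (\<Union>i. A i)" "(\<Union>i. A i) \<subseteq> cone (A i)" "\<exists>i. n \<le> Max (A i)"
proof -
  have mono: "i \<le> j \<Longrightarrow> A i \<subseteq> A j" for i j
    by (rule lift_Suc_mono_le) (auto simp: A(2))
  have Max: "Max (A (Suc i)) = m i" for i
    unfolding A(2) by (rule Max_insert_gt[OF A(1,4)])
  have large: "i \<le> Max (A i)" for i
  proof (induction i)
    case (Suc i)
    then show ?case using A(4)[of i] Max[of i] by simp
  qed simp
  then show "\<exists>i. n \<le> Max (A i)" by blast
  have card: "card (A i) = card (A 0) + i" for i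
  proof (induction i)
    case (Suc i)
    have "m i \<notin> A i" using fincl_Max(1)[OF A(1), of "m i" i] A(4)[of i] by auto
    then show ?case using Suc fincl_D(1)[OF A(1)] by (simp add: A(2))
  qed simp
  show "perfect (\<Union>i. A i)"
    unfolding perfect_def
  proof (intro conjI ballI impI)
    show "0 \<in> (\<Union>i. A i)" using fincl_D(2)[OF A(1)] by blast
    show "par ` (\<Union>i. A i) \<subseteq> (\<Union>i. A i)" using fincl_D(3)[OF A(1)] by blast
    fix s assume s: "s \<in> (\<Union>i. A i)" "lev s < k"
    then obtain i where i: "s \<in> A i" by blast
    show "infinite ((\<Union>i. A i) \<inter> ch s)"
      unfolding infinite_nat_iff_unbounded
    proof
      fix d
      \<comment> \<open>A code of \<open>s\<close> at which \<open>s\<close> is already present. The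
        offset is the size of the initial position, as the schedule counts nodes and not
        moves.\<close>
      define N where "N = prod_encode (s, card (A 0) + max i d)"
      have "card (A 0) + max i d \<le> N" unfolding N_def by (rule le_prod_encode_2)
      then obtain j where j: "N = card (A 0) + j" "max i d \<le> j"
        by (metis add_le_cancel_left le_iff_add add_leD1)
      have "s \<in> A j" using i mono[of i j] j(2) by auto
      then have "fair_sel (A j) = s"
        using s(2) card[of j] j(1)[symmetric] by (simp add: fair_sel_def N_def)
      then have "m j \<in> ch s" "d < m j" using A(3)[of j] A(4)[of j] large[of j] j(2) by auto
      then show "\<exists>n>d. n \<in> (\<Union>i. A i) \<inter> ch s" using A(2)[of j] by blast
    qed
  qed
  show "(\<Union>i. A i) \<subseteq> cone (A i)"
  proof
    fix u assume "u \<in> (\<Union>i. A i)"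
    then obtain j where "u \<in> A j" by blast
    then have u: "u \<in> A (i + j)" using mono[of j "i + j"] by auto
    have "A (i + j) \<subseteq> cone (A i)"
    proof (induction j)
      case 0
      then show ?case using cone_base by simp
    next
      case (Suc j)
      have "par (m (i + j)) \<in> cone (A i)"
        using ch_D(2)[OF A(3)] fair_sel[OF A(1)] Suc by auto
      moreover have "Max (A i) < m (i + j)"
        using fincl_Max_mono[OF A(1) A(1) mono[of i "i + j"]] A(4)[of "i + j"] by simp
      ultimately have "m (i + j) \<in> cone (A i)" by (rule cone_step)
      then show ?case using Suc A(2)[of "i + j"] by simp
    qed
    then show "u \<in> cone (A i)" using u by blast
  qed
qed

text \<open>\<open>neg Y n\<close> is read as ``\<open>Y\<close> forces that \<open>n\<close> is not in the image of any subset of \<open>Y\<close>''. By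
  fusion, whether this can be achieved by shrinking is decided by finite subtrees.\<close>

lemma front_of_negation:
  assumes P0: "perfect P0"
    and neg_mono: "\<And>Y Y' n. \<lbrakk>neg Y n; perfect Y; perfect Y'; Y' \<subseteq> Y\<rbrakk> \<Longrightarrow> neg Y' n"
    and neg_ex: "\<And>Y. \<lbrakk>perfect Y; Y \<subseteq> P0\<rbrakk> \<Longrightarrow> \<exists>n. \<not> neg Y n"
  obtains X val where "X \<subseteq> P0" "perfect X" "barred_tree k par lev fair_sel val"
    "\<And>Y. \<lbrakk>perfect Y; Y \<subseteq> X\<rbrakk> \<Longrightarrow> barred_tree.outs par fair_sel val (\<lambda>_. None) Y {0} \<subseteq> {n. \<not> neg Y n}"
proof -
  \<comment> \<open>Negation of \<open>n\<close> is either achieved on the part of \<open>Z\<close>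
    in \<open>cone A\<close> or unachievable there; cutting down to the cone makes the alternative
    local at \<open>A\<close>.\<close>
  define \<Phi>1 where "\<Phi>1 n A Z \<longleftrightarrow> neg (Z \<inter> cone A) n \<or> (\<forall>Y\<subseteq>Z \<inter> cone A. perfect Y \<longrightarrow> A \<subseteq> Y \<longrightarrow> \<not> neg Y n)" for n A Z
  have loc1: "\<Phi>1 n A Z'" if "fincl A" "perfect Z" "perfect Z'" "A \<subseteq> Z" "A \<subseteq> Z'" "Z' \<inter> cone A \<subseteq> Z" "\<Phi>1 n A Z" for n A Z Z'
  proof -
    have sub: "Z' \<inter> cone A \<subseteq> Z \<inter> cone A" using that(6) by blast
    from that(7) show ?thesis
      unfolding \<Phi>1_def
    proof
      assume "neg (Z \<inter> cone A) n"
      then have "neg (Z' \<inter> cone A) n"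
        by (rule neg_mono[OF _ perfect_Int_cone[OF that(2,1,4)] perfect_Int_cone[OF that(3,1,5)] sub])
      then show "neg (Z' \<inter> cone A) n \<or> (\<forall>Y\<subseteq>Z' \<inter> cone A. perfect Y \<longrightarrow> A \<subseteq> Y \<longrightarrow> \<not> neg Y n)" ..
    next
      assume "\<forall>Y\<subseteq>Z \<inter> cone A. perfect Y \<longrightarrow> A \<subseteq> Y \<longrightarrow> \<not> neg Y n"
      then have "\<forall>Y\<subseteq>Z' \<inter> cone A. perfect Y \<longrightarrow> A \<subseteq> Y \<longrightarrow> \<not> neg Y n" using sub by (meson subset_trans)
      then show "neg (Z' \<inter> cone A) n \<or> (\<forall>Y\<subseteq>Z' \<inter> cone A. perfect Y \<longrightarrow> A \<subseteq> Y \<longrightarrow> \<not> neg Y n)" ..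
    qed
  qed
  have dense1: "\<exists>Z'\<subseteq>Z. perfect Z' \<and> A \<subseteq> Z' \<and> \<Phi>1 n A Z'" if A: "fincl A" "perfect Z" "A \<subseteq> Z" for n A Z
  proof (cases "\<exists>Y\<subseteq>Z \<inter> cone A. perfect Y \<and> A \<subseteq> Y \<and> neg Y n")
    case True
    then obtain Y where Y: "Y \<subseteq> Z \<inter> cone A" "perfect Y" "A \<subseteq> Y" "neg Y n" by blast
    then have "Y \<inter> cone A = Y" by blast
    then have "\<Phi>1 n A Y" using Y(4) by (simp add: \<Phi>1_def)
    then show ?thesis using Y(1-3) by (intro exI[of _ Y]) simp
  next
    case False
    then have "\<Phi>1 n A Z" unfolding \<Phi>1_def by blast
    then show ?thesis using A by (intro exI[of _ Z]) simp
  qed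
  have denseN: "\<exists>Z'\<subseteq>Z. perfect Z' \<and> A \<subseteq> Z' \<and> (\<forall>n\<le>N. \<Phi>1 n A Z')" if A: "fincl A" "perfect Z" "A \<subseteq> Z" for N A Z
  proof (induction N)
    case 0
    then show ?case using dense1[OF A, of 0] by simp
  next
    case (Suc N)
    then obtain Z1 where Z1: "Z1 \<subseteq> Z" "perfect Z1" "A \<subseteq> Z1" "\<forall>n\<le>N. \<Phi>1 n A Z1" by blast
    obtain Z2 where Z2: "Z2 \<subseteq> Z1" "perfect Z2" "A \<subseteq> Z2" "\<Phi>1 (Suc N) A Z2" using dense1[OF A(1) Z1(2,3)] by blast
    have "Z2 \<inter> cone A \<subseteq> Z1" using Z2(1) by blast
    then have "\<Phi>1 n A Z2" if "n \<le> N" for n using loc1[OF A(1) Z1(2) Z2(2) Z1(3) Z2(3)] Z1(4) that by blast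
    then have "\<forall>n\<le>Suc N. \<Phi>1 n A Z2" using Z2(4) le_Suc_eq by auto
    then show ?case using Z2(1-3) Z1(1) by (intro exI[of _ Z2]) auto
  qed
  \<comment> \<open>The bound by \<open>Max A\<close> leaves finitely many numbers to be treated at
    each position, and every number is covered in the course of an infinite play.\<close>
  obtain X where X: "X \<subseteq> P0" "perfect X" "\<And>A. \<lbrakk>fincl A; {0} \<subseteq> A; A \<subseteq> X\<rbrakk> \<Longrightarrow> \<forall>n\<le>Max A. \<Phi>1 n A X"
  proof (rule fusion[OF P0 fincl_0, of "\<lambda>A Z. \<forall>n\<le>Max A. \<Phi>1 n A Z"])
    show "\<forall>n\<le>Max A. \<Phi>1 n A Z'"
      if "fincl A" "perfect Z" "perfect Z'" "A \<subseteq> Z" "A \<subseteq> Z'" "Z' \<inter> cone A \<subseteq> Z" "\<forall>n\<le>Max A. \<Phi>1 n A Z" for A Z Z'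
      using loc1[OF that(1-6)] that(7) by blast
    show "\<exists>X'\<subseteq>Z. perfect X' \<and> A \<subseteq> X' \<and> (\<forall>n\<le>Max A. \<Phi>1 n A X')" if "fincl A" "perfect Z" "A \<subseteq> Z" for A Z
      using denseN[OF that] .
  qed (use perfect_D(1)[OF P0] in auto)
  define open_at where "open_at A n \<longleftrightarrow> n \<le> Max A \<and> \<not> neg (X \<inter> cone A) n" for A n
  \<comment> \<open>Positions outside \<open>X\<close> end with a dummy output; plays in subsets of
    \<open>X\<close> do not reach them.\<close>
  define val where "val A = (if A \<subseteq> X then if \<exists>n. open_at A n then Some (LEAST n. open_at A n) else None else Some 0)" for A
  have val_None: "A \<subseteq> X" "n \<le> Max A \<Longrightarrow> neg (X \<inter> cone A) n" if "val A = None" for A n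
    using that by (auto simp: val_def open_at_def split: if_splits)
  have val_Some: "open_at A n" if "val A = Some n" "A \<subseteq> X" for A n
    using that LeastI_ex[of "open_at A"] by (auto simp: val_def split: if_splits)
  have tree: "barred_tree k par lev fair_sel val"
  proof unfold_locales
    show "wf {(insert m A, A) |A m. fincl A \<and> val A = None \<and> m \<in> ch (fair_sel A) \<and> Max A < m}" (is "wf ?R")
      unfolding wf_iff_no_infinite_down_chain
    proof
      \<comment> \<open>An infinite play would enumerate a perfect \<open>Y\<close> for which every
        number is negated, against \<open>neg_ex\<close>.\<close>
      assume "\<exists>f. \<forall>i. (f (Suc i), f i) \<in> ?R"
      then obtain A where "\<forall>i. (A (Suc i), A i) \<in> ?R" by blast
      then have "\<forall>i. \<exists>m. fincl (A i) \<and> val (A i) = None \<and> A (Suc i) = insert m (A i) \<and> m \<in> ch (fair_sel (A i)) \<and> Max (A i) < m"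
        by blast
      then obtain m where A: "\<And>i. fincl (A i)" "\<And>i. val (A i) = None" "\<And>i. A (Suc i) = insert (m i) (A i)"
        "\<And>i. m i \<in> ch (fair_sel (A i))" "\<And>i. Max (A i) < m i"
        by metis
      define Y where "Y = (\<Union>i. A i)"
      note run = perfect_fair_run[of A m, OF A(1,3,4,5), folded Y_def]
      have YX: "Y \<subseteq> X" using val_None(1)[OF A(2)] by (auto simp: Y_def)
      then obtain n where n: "\<not> neg Y n" using neg_ex[OF run(1)] X(1) by blast
      obtain i where i: "n \<le> Max (A i)" using run(3) by blast
      have "perfect (X \<inter> cone (A i))" by (rule perfect_Int_cone[OF X(2) A(1) val_None(1)[OF A(2)]])
      then have "neg Y n"
        using neg_mono[OF val_None(2)[OF A(2) i] _ run(1)] YX run(2)[of i] by blast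
      then show False using n by contradiction
    qed
  qed (use fair_sel in auto)
  interpret barred_tree k par lev fair_sel val by (rule tree)
  have out: "\<not> neg Y n" if "out (\<lambda>_. None) Y A n" "perfect Y" "Y \<subseteq> X" "fincl A" "A \<subseteq> Y" for Y A n
    using that
  proof (induction rule: out.induct)
    case (1 A n)
    have AX: "A \<subseteq> X" using 1 by blast
    have op: "open_at A n" using val_Some[OF 1(1) AX] .
    have "\<Phi>1 n A X" using X(3)[OF 1(4) _ AX] fincl_D(2)[OF 1(4)] op unfolding open_at_def by blast
    then have none: "\<forall>Y\<subseteq>X \<inter> cone A. perfect Y \<longrightarrow> A \<subseteq> Y \<longrightarrow> \<not> neg Y n"
      using op unfolding \<Phi>1_def open_at_def by blast
    have p: "perfect (Y \<inter> cone A)" by (rule perfect_Int_cone[OF 1(2,4,5)])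
    have "\<not> neg (Y \<inter> cone A) n"
      using none[rule_format, of "Y \<inter> cone A"] p 1(3,5) cone_base[of A] by blast
    then show ?case using neg_mono[OF _ 1(2) p] by blast
  next
    case (2 A m n)
    then show ?case using fincl_nxt[OF 2(8,3)] nxt_D(1)[OF 2(3)] by simp
  qed simp
  show ?thesis
  proof (rule that[OF X(1,2) tree])
    fix Y assume Y: "perfect Y" "Y \<subseteq> X"
    show "S Y {0} \<subseteq> {n. \<not> neg Y n}"
      using out[OF _ Y fincl_0] perfect_D(1)[OF Y(1)] by (auto simp: outs_def)
  qed
qed

section \<open>The generic ultrafilter on ground model sets\<close>

abbreviation G :: "(nat list, nat list set set) ifam" where
  "G \<equiv> generic_ultrafilter k"

text \<open>The quotient order is separative: if \<open>p\<close> is not below the class of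
  \<open>X\<close>, then the part of \<open>p\<close> outside \<open>X\<close> is a condition
  without extensions below that class.\<close>

lemma below_positive:
  assumes "p \<in> Field le" "X \<subseteq> tuples k" "X \<notin> fin_ideal k"
    and "\<And>q. (q, p) \<in> le \<Longrightarrow> \<exists>q'. (q', q) \<in> le \<and> (q', fin_class k X) \<in> le"
  shows "(p, fin_class k X) \<in> le"
proof (rule ccontr)
  assume neg: "\<not> ?thesis"
  obtain Z where Z: "p = fin_class k Z" "Z \<subseteq> tuples k" "Z \<notin> fin_ideal k"
    using assms(1) unfolding pow_mod_fin_Field by blast
  have ZX: "Z - X \<notin> fin_ideal k" "Z - X \<subseteq> tuples k"
    using neg pow_mod_fin_iff[OF Z(2) assms(2) Z(3) assms(3)] Z(1,2) by auto
  have "(fin_class k (Z - X), p) \<in> le"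
    using pow_mod_fin_iff[OF ZX(2) Z(2) ZX(1) Z(3)] fin_ideal_Diff_subset[of "Z - X" Z] Z(1) by auto
  then obtain q where q: "(q, fin_class k (Z - X)) \<in> le" "(q, fin_class k X) \<in> le" using assms(4) by blast
  from q(2) obtain Y where Y: "q = fin_class k Y" "Y \<subseteq> tuples k" "Y \<notin> fin_ideal k"
    by (rule pow_mod_fin_cases)
  have "Y - (Z - X) \<in> fin_ideal k" "Y - X \<in> fin_ideal k"
    using q pow_mod_fin_iff[OF Y(2) ZX(2) Y(3) ZX(1)] pow_mod_fin_iff[OF Y(2) assms(2) Y(3) assms(3)] Y(1) by auto
  then have "(Y - (Z - X)) \<union> (Y - X) \<in> fin_ideal k" by (rule fin_ideal_Un)
  moreover have "Y \<subseteq> (Y - (Z - X)) \<union> (Y - X)" by blast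
  ultimately show False using Y(3) fin_ideal_subset by blast
qed

text \<open>Ground model sets that are forced to be equal are equal, which identifies the set in the
  name; \<open>below_positive\<close> then removes the density from the clause for
  membership.\<close>

lemma G_check:
  assumes "p \<in> \<D>"
  shows "G (check_set X) le p \<longleftrightarrow> X \<subseteq> tuples k \<and> X \<notin> fin_ideal k \<and> (p, fin_class k X) \<in> le"
proof
  assume GX: "G (check_set X) le p"
  have *: "\<exists>q'. (q', q) \<in> le \<and> X \<subseteq> tuples k \<and> X \<notin> fin_ideal k \<and> (q', fin_class k X) \<in> le" if q: "(q, p) \<in> le" for q
  proof -
    obtain q' \<tau> s where q': "(q', q) \<in> le" "(\<tau>, s) \<in> {(X \<times> UNIV, fin_class k X) |X. X \<in> Pow (tuples k) - fin_ideal k}"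
      "(q', s) \<in> le" "(check_set X \<^bold>\<doteq> val_set \<tau>) le q'"
      using GX[unfolded generic_ultrafilter_def val_fam_def dense_below_def, rule_format, OF q] by blast
    obtain Y where "\<tau> = Y \<times> UNIV" "s = fin_class k Y" "Y \<subseteq> tuples k" "Y \<notin> fin_ideal k"
      using q'(2) by blast
    then have Y: "(q', q) \<in> le" "Y \<subseteq> tuples k" "Y \<notin> fin_ideal k" "(q', fin_class k Y) \<in> le"
      "(check_set X \<^bold>\<doteq> gname Y) le q'"
      using q' by simp_all
    have D: "q' \<in> \<D>" using conds_down[OF conds_down[OF assms q] Y(1)] .
    have "(check_set X \<^bold>\<doteq> check_set Y) le q'"
      by (rule iset_eq_trans[OF regs_check regs_val_set regs_check D Y(5) gname_eq[OF D]])
    then have "X = Y" by (simp add: check_eq_iff[OF D])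
    then show ?thesis using Y(1-4) by blast
  qed
  then have "X \<subseteq> tuples k" "X \<notin> fin_ideal k" using conds_refl[OF assms] by blast+
  moreover have "(p, fin_class k X) \<in> le"
    using below_positive[OF _ calculation] * assms D_Field by blast
  ultimately show "X \<subseteq> tuples k \<and> X \<notin> fin_ideal k \<and> (p, fin_class k X) \<in> le" by blast
next
  assume X: "X \<subseteq> tuples k \<and> X \<notin> fin_ideal k \<and> (p, fin_class k X) \<in> le"
  show "G (check_set X) le p"
    unfolding generic_ultrafilter_def val_fam_def dense_below_def
  proof (intro allI impI)
    fix q assume q: "(q, p) \<in> le"
    have D: "q \<in> \<D>" using conds_down[OF assms q] .
    have *: "(X \<times> UNIV, fin_class k X) \<in> {(X \<times> UNIV, fin_class k X) |X. X \<in> Pow (tuples k) - fin_ideal k}"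
      "(q, fin_class k X) \<in> le" "(check_set X \<^bold>\<doteq> gname X) le q"
      using X conds_trans[OF q] iset_eq_sym[OF regs_val_set regs_check D gname_eq[OF D]] by blast+
    show "\<exists>q'. (q', q) \<in> le \<and> (\<exists>\<tau> s. (\<tau>, s) \<in> {(X \<times> UNIV, fin_class k X) |X. X \<in> Pow (tuples k) - fin_ideal k} \<and>
        (q', s) \<in> le \<and> (check_set X \<^bold>\<doteq> val_set \<tau>) le q')"
      by (rule exI[of _ q], rule conjI[OF conds_refl[OF D]], rule exI, rule exI, rule conjI[OF *(1)], rule conjI[OF *(2,3)])
  qed
qed

lemma G_code: "perfect P \<Longrightarrow> G (check_set (code P)) le (cond P)"
  using G_check[OF cond_D] code_tuples code_positive conds_refl[OF cond_D] by (simp add: cond_def)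

lemma family_G: "family UNIV G"
  unfolding generic_ultrafilter_def by (rule family_UNIV_val_fam)

lemma G_refine:
  assumes "perfect P" "(q, cond P) \<in> le" "G (check_set X) le q"
  obtains P' where "P' \<subseteq> P" "perfect P'" "(cond P', q) \<in> le" "code P' \<subseteq> X"
proof -
  have "q \<in> \<D>" using conds_down[OF cond_D assms(2)] assms(1) by blast
  then have "X \<subseteq> tuples k" "X \<notin> fin_ideal k" "(q, fin_class k X) \<in> le" using G_check assms(3) by blast+
  then show ?thesis by (rule refine[OF assms(1,2)]) (rule that)
qed

text \<open>Outputs in \<open>Y\<close> are numbers that are not negated, that is, elements of some
  image of a subset of \<open>code Y\<close>. By convergence of the Tukey map, every member of
  \<open>V\<close> therefore contains \<open>S Y {0}\<close> for some \<open>Y\<close>. Since the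
  sets given by \<open>h\<close> meet these sets and can be decided, they generate \<open>V\<close>
  as well.\<close>

lemma tukey_structure:
  assumes V: "family UNIV V" and p: "p \<in> \<D>" "ultrafilter_on_omega V le p" "(V \<^bold>\<le>\<^sub>T G) le p"
  obtains X l h c where "perfect X" "(cond X, p) \<in> le" "l \<le> k"
    "\<And>U U'. U \<subseteq> U' \<Longrightarrow> h U \<subseteq> h U'"
    "\<And>Y. perfect Y \<Longrightarrow> Y \<subseteq> X \<Longrightarrow> V (check_set (h {u \<in> Y. lev u \<le> l})) le (cond Y)"
    "\<And>q B. (q, cond X) \<in> le \<Longrightarrow> V (check_set B) le q \<Longrightarrow> \<exists>Y\<subseteq>X. perfect Y \<and> (cond Y, q) \<in> le \<and> h {u \<in> Y. lev u \<le> l} \<subseteq> B"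
    "\<And>Y n. perfect Y \<Longrightarrow> Y \<subseteq> X \<Longrightarrow> n \<in> h {u \<in> Y. lev u \<le> l} \<Longrightarrow> c n \<in> Y \<and> lev (c n) = l"
    "\<And>Y. perfect Y \<Longrightarrow> Y \<subseteq> X \<Longrightarrow> h {u \<in> Y. lev u \<le> l} \<noteq> {}"
proof -
  obtain q0 f where q0: "(q0, p) \<in> le"
    and f1: "\<And>q' A B. (q', q0) \<in> le \<Longrightarrow> f q' A B \<Longrightarrow> V (check_set B) le q'"
    and f2: "\<And>q' A. (q', q0) \<in> le \<Longrightarrow> G (check_set A) le q' \<Longrightarrow> \<exists>q''. (q'', q') \<in> le \<and> (\<exists>B. f q'' A B)"
    and f3: "\<And>q' B. (q', q0) \<in> le \<Longrightarrow> V (check_set B) le q' \<Longrightarrow> \<exists>q''. (q'', q') \<in> le \<and> (\<exists>A. G (check_set A) le q'' \<and>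
      (\<forall>q3. (q3, q'') \<in> le \<longrightarrow> (\<forall>A'\<subseteq>A. G (check_set A') le q3 \<longrightarrow> (\<forall>B'. f q3 A' B' \<longrightarrow> B' \<subseteq> B))))"
    by (rule tukey_elim[OF family_G V p(1,3)]) blast
  obtain P0 where P0: "perfect P0" "(cond P0, q0) \<in> le" using perfect_below conds_down[OF p(1) q0] by blast
  define neg where "neg Y n \<longleftrightarrow> (\<forall>q A B. (q, cond Y) \<in> le \<longrightarrow> A \<subseteq> code Y \<longrightarrow> G (check_set A) le q \<longrightarrow> f q A B \<longrightarrow> n \<notin> B)" for Y n
  have neg_mono: "neg Y' n" if "neg Y n" "perfect Y" "perfect Y'" "Y' \<subseteq> Y" for Y Y' n
    unfolding neg_def
  proof (intro allI impI)
    fix q A B assume a: "(q, cond Y') \<in> le" "A \<subseteq> code Y'" "G (check_set A) le q" "f q A B"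
    have "(q, cond Y) \<in> le" using conds_trans[OF a(1) cond_mono[OF that(3,2,4)]] .
    moreover have "A \<subseteq> code Y" using a(2) code_mono[OF that(4)] by blast
    ultimately show "n \<notin> B" using that(1) a(3,4) unfolding neg_def by blast
  qed
  have below: "(q, q0) \<in> le" if "(q, cond Y) \<in> le" "perfect Y" "Y \<subseteq> P0" for q Y
    using conds_trans[OF that(1) conds_trans[OF cond_mono[OF that(2) P0(1) that(3)] P0(2)]] .
  have neg_ex: "\<exists>n. \<not> neg Y n" if Y: "perfect Y" "Y \<subseteq> P0" for Y
  proof -
    have Y0: "(cond Y, q0) \<in> le" by (rule below[OF conds_refl[OF cond_D[OF Y(1)]] Y])
    then obtain q B where q: "(q, cond Y) \<in> le" "f q (code Y) B" using f2[OF _ G_code[OF Y(1)]] by blast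
    have qq0: "(q, q0) \<in> le" by (rule below[OF q(1) Y])
    have "B \<noteq> {}" using ultrafilter_empty[OF p(2) conds_trans[OF qq0 q0]] f1[OF qq0 q(2)] by blast
    then obtain n where "n \<in> B" by blast
    then have "\<not> neg Y n" unfolding neg_def
      using q family_check_down[OF family_G G_code[OF Y(1)] q(1)] by blast
    then show ?thesis by blast
  qed
  have neg_cof: "\<exists>Y\<subseteq>P. perfect Y \<and> (cond Y, q) \<in> le \<and> (\<forall>n. \<not> neg Y n \<longrightarrow> n \<in> B)"
    if P: "perfect P" "P \<subseteq> P0" "(q, cond P) \<in> le" and B: "V (check_set B) le q" for P q B
  proof -
    from f3[OF below[OF P(3,1,2)] B] obtain q1 A where q1: "(q1, q) \<in> le" "G (check_set A) le q1"
      and all: "\<forall>q3. (q3, q1) \<in> le \<longrightarrow> (\<forall>A'\<subseteq>A. G (check_set A') le q3 \<longrightarrow> (\<forall>B'. f q3 A' B' \<longrightarrow> B' \<subseteq> B))"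
      by blast
    obtain Y where Y: "Y \<subseteq> P" "perfect Y" "(cond Y, q1) \<in> le" "code Y \<subseteq> A"
      by (rule G_refine[OF P(1) conds_trans[OF q1(1) P(3)] q1(2)])
    have "n \<in> B" if "\<not> neg Y n" for n
    proof -
      obtain q3 A' B' where q3: "(q3, cond Y) \<in> le" "A' \<subseteq> code Y" "G (check_set A') le q3" "f q3 A' B'" "n \<in> B'"
        using \<open>\<not> neg Y n\<close> unfolding neg_def by blast
      have "B' \<subseteq> B"
        using all[rule_format, OF conds_trans[OF q3(1) Y(3)] _ q3(3,4)] q3(2) Y(4) by blast
      then show ?thesis using q3(5) by blast
    qed
    then show ?thesis using Y(1,2) conds_trans[OF Y(3) q1(1)] by blast
  qed
  obtain X0 val where X0: "X0 \<subseteq> P0" "perfect X0" "barred_tree k par lev fair_sel val"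
    and outs: "\<And>Y. \<lbrakk>perfect Y; Y \<subseteq> X0\<rbrakk> \<Longrightarrow> barred_tree.outs par fair_sel val (\<lambda>_. None) Y {0} \<subseteq> {n. \<not> neg Y n}"
    by (rule front_of_negation[of P0 neg, OF P0(1) neg_mono neg_ex]) blast+
  interpret barred_tree k par lev fair_sel val by (rule X0(3))
  obtain X l h c where X: "X \<subseteq> X0" "perfect X" "l \<le> k" and mono: "\<And>U U'. U \<subseteq> U' \<Longrightarrow> h U \<subseteq> h U'"
    and meet: "\<And>Y. perfect Y \<Longrightarrow> Y \<subseteq> X \<Longrightarrow> S Y {0} \<inter> h {u \<in> Y. lev u \<le> l} \<noteq> {}"
    and dich: "\<And>B Y. perfect Y \<Longrightarrow> Y \<subseteq> X \<Longrightarrow> \<exists>Z\<subseteq>Y. perfect Z \<and> (h {u \<in> Z. lev u \<le> l} \<subseteq> B \<or> h {u \<in> Z. lev u \<le> l} \<inter> B = {})"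
    and code: "\<And>Z n. Z \<subseteq> X \<Longrightarrow> 0 \<in> Z \<Longrightarrow> n \<in> h Z \<Longrightarrow> c n \<in> Z \<and> lev (c n) = l"
    by (rule projection_structure[OF X0(2)]) blast
  have XP: "X \<subseteq> P0" using X(1) X0(1) by blast
  have cof: "\<exists>Y\<subseteq>P. perfect Y \<and> (cond Y, q) \<in> le \<and> S Y {0} \<subseteq> B"
    if P: "perfect P" "P \<subseteq> X" "(q, cond P) \<in> le" and B: "V (check_set B) le q" for P q B
  proof -
    obtain Y where Y: "Y \<subseteq> P" "perfect Y" "(cond Y, q) \<in> le" "\<forall>n. \<not> neg Y n \<longrightarrow> n \<in> B"
      using neg_cof[OF P(1) _ P(3) B] P(2) XP by blast
    have "Y \<subseteq> X0" using Y(1) P(2) X(1) by blast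
    then show ?thesis using Y outs[OF Y(2)] by blast
  qed
  show ?thesis
  proof (rule that[of X l h c])
    have "(cond X, q0) \<in> le" by (rule below[OF conds_refl[OF cond_D[OF X(2)]] X(2) XP])
    then show "(cond X, p) \<in> le" using q0 by (rule conds_trans)
    show "V (check_set (h {u \<in> Y. lev u \<le> l})) le (cond Y)" if Y: "perfect Y" "Y \<subseteq> X" for Y
    proof (rule reg_dense[OF family_reg[OF V regs_check] cond_D[OF Y(1)]])
      fix q assume q: "(q, cond Y) \<in> le"
      have "(q, p) \<in> le" using conds_trans[OF below[OF q Y(1)] q0] Y(2) XP by blast
      then obtain q' where q': "(q', q) \<in> le"
        "V (check_set (h {u \<in> Y. lev u \<le> l})) le q' \<or> V (check_set (- h {u \<in> Y. lev u \<le> l})) le q'"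
        using ultrafilter_cases[OF V p(1,2)] by blast
      \<comment> \<open>If the complement belonged to \<open>V\<close>, it would contain all outputs
        in some subtree, but some of these are in \<open>h\<close>.\<close>
      have "\<not> V (check_set (- h {u \<in> Y. lev u \<le> l})) le q'"
      proof
        assume "V (check_set (- h {u \<in> Y. lev u \<le> l})) le q'"
        then obtain Z where Z: "Z \<subseteq> Y" "perfect Z" "S Z {0} \<subseteq> - h {u \<in> Y. lev u \<le> l}"
          using cof[OF Y conds_trans[OF q'(1) q]] by blast
        have "h {u \<in> Z. lev u \<le> l} \<subseteq> h {u \<in> Y. lev u \<le> l}" by (rule mono) (use Z(1) in blast)
        moreover have "S Z {0} \<inter> h {u \<in> Z. lev u \<le> l} \<noteq> {}" by (rule meet) (use Z Y in auto)
        ultimately show False using Z(3) by blast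
      qed
      then show "\<exists>q'. (q', q) \<in> le \<and> V (check_set (h {u \<in> Y. lev u \<le> l})) le q'" using q' by blast
    qed
    show "\<exists>Y\<subseteq>X. perfect Y \<and> (cond Y, q) \<in> le \<and> h {u \<in> Y. lev u \<le> l} \<subseteq> B"
      if q: "(q, cond X) \<in> le" "V (check_set B) le q" for q B
    proof -
      obtain Y where Y: "Y \<subseteq> X" "perfect Y" "(cond Y, q) \<in> le" "S Y {0} \<subseteq> B" using cof[OF X(2) subset_refl q] by blast
      obtain Z where Z: "Z \<subseteq> Y" "perfect Z" "h {u \<in> Z. lev u \<le> l} \<subseteq> B \<or> h {u \<in> Z. lev u \<le> l} \<inter> B = {}"
        using dich[OF Y(2,1)] by blast
      have ZX: "Z \<subseteq> X" using Z(1) Y(1) by blast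
      have "S Z {0} \<subseteq> B" using S_mono[OF fincl_0 Z(1)] Y(4) by blast
      then have "h {u \<in> Z. lev u \<le> l} \<subseteq> B" using meet[OF Z(2) ZX] Z(3) by blast
      then show ?thesis using Z(2) ZX conds_trans[OF cond_mono[OF Z(2) Y(2) Z(1)] Y(3)] by blast
    qed
    show "c n \<in> Y \<and> lev (c n) = l" if "perfect Y" "Y \<subseteq> X" "n \<in> h {u \<in> Y. lev u \<le> l}" for Y n
      using code[of "{u \<in> Y. lev u \<le> l}" n] that perfect_D(1)[OF that(1)] lev_0 by auto
    show "h {u \<in> Y. lev u \<le> l} \<noteq> {}" if "perfect Y" "Y \<subseteq> X" for Y using meet[OF that] by blast
  qed (use X mono in auto)
qed

end

section \<open>The tree of nondecreasing sequences\<close>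

lemma seq_prec_irrefl: "\<not> js \<prec> js"
  by (auto simp: seq_prec_def lexord_irreflexive)

lemma seq_prec_trans: "js \<prec> ks \<Longrightarrow> ks \<prec> ls \<Longrightarrow> js \<prec> ls"
  by (auto simp: seq_prec_def intro: lexord_trans[OF _ _ trans_less_than])

lemma seq_prec_linear: "js \<noteq> ls \<Longrightarrow> js \<prec> ls \<or> ls \<prec> js"
proof -
  assume ne: "js \<noteq> ls"
  have "(js, ls) \<in> lexord less_than \<or> js = ls \<or> (ls, js) \<in> lexord less_than"
    by (rule lexord_linear) auto
  then show ?thesis using ne by (auto simp: seq_prec_def)
qed

text \<open>All entries of a nondecreasing sequence below \<open>ls\<close> are bounded by
  \<open>last ls\<close>, and its length is bounded by \<open>k\<close>.\<close>

lemma finite_seq_prec: "finite {js \<in> nondec_upto k. js \<prec> ls}"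
proof -
  have "{js \<in> nondec_upto k. js \<prec> ls} \<subseteq> {js. set js \<subseteq> {..last ls} \<and> length js \<le> k}"
  proof
    fix js assume js: "js \<in> {js \<in> nondec_upto k. js \<prec> ls}"
    have "set js \<subseteq> {..last ls}"
    proof (cases "js = []")
      case False
      then have le: "last js \<le> last ls" using js by (auto simp: seq_prec_def)
      have "a \<le> last js" if "a \<in> set js" for a
      proof -
        have s: "sorted (butlast js @ [last js])" using js False by (auto simp: nondec_upto_def)
        have "a \<in> set (butlast js) \<or> a = last js"
          using that False by (metis append_butlast_last_id rotate1.simps(2) set_ConsD set_rotate1)
        then show ?thesis using s unfolding sorted_append by auto
      qed
      then show ?thesis using le by fastforce
    qed simp
    then show "js \<in> {js. set js \<subseteq> {..last ls} \<and> length js \<le> k}" using js by (auto simp: nondec_upto_def)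
  qed
  then show ?thesis by (rule finite_subset) (rule finite_lists_length_le, simp)
qed

lemma seq_index_less:
  assumes "js \<in> nondec_upto k" "js \<prec> ls"
  shows "seq_index k js < seq_index k ls"
  unfolding seq_index_def
proof (rule psubset_card_mono[OF finite_seq_prec])
  show "{ks \<in> nondec_upto k. ks \<prec> js} \<subset> {ks \<in> nondec_upto k. ks \<prec> ls}"
    using assms seq_prec_irrefl[of js] seq_prec_trans by blast
qed

lemma inj_seq_index: "inj_on (seq_index k) (nondec_upto k)"
proof (rule inj_onI, rule ccontr)
  fix js ls assume *: "js \<in> nondec_upto k" "ls \<in> nondec_upto k" "seq_index k js = seq_index k ls" "js \<noteq> ls"
  then show False using seq_prec_linear[of js ls] seq_index_less by fastforce
qed

text \<open>The predecessors of \<open>ls\<close> have distinct indices smaller than that of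
  \<open>ls\<close>, and by definition of the index there are exactly as many predecessors as such
  numbers.\<close>

lemma seq_index_below: "seq_index k ` {js \<in> nondec_upto k. js \<prec> ls} = {..<seq_index k ls}"
proof (rule card_subset_eq)
  show "seq_index k ` {js \<in> nondec_upto k. js \<prec> ls} \<subseteq> {..<seq_index k ls}"
    using seq_index_less by auto
  have "inj_on (seq_index k) {js \<in> nondec_upto k. js \<prec> ls}"
    using inj_seq_index by (rule inj_on_subset) auto
  then have "card (seq_index k ` {js \<in> nondec_upto k. js \<prec> ls}) = card {js \<in> nondec_upto k. js \<prec> ls}"
    by (rule card_image)
  then show "card (seq_index k ` {js \<in> nondec_upto k. js \<prec> ls}) = card {..<seq_index k ls}"
    unfolding card_lessThan seq_index_def[of k ls] .
qed simp

lemma seq_index_range: "0 < k \<Longrightarrow> seq_index k ` nondec_upto k = UNIV"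
proof -
  assume k: "0 < k"
  have "infinite (seq_index k ` nondec_upto k)"
  proof
    assume "finite (seq_index k ` nondec_upto k)"
    then have "finite (nondec_upto k)" using inj_seq_index finite_imageD by blast
    moreover have "range (\<lambda>j. [j]) \<subseteq> nondec_upto k" using k by (auto simp: nondec_upto_def)
    ultimately have "finite (range (\<lambda>j :: nat. [j]))" by (rule finite_subset[rotated])
    moreover have "inj (\<lambda>j :: nat. [j])" by (simp add: inj_def)
    ultimately show False using finite_imageD by blast
  qed
  then have "n \<in> seq_index k ` nondec_upto k" for n
  proof -
    obtain ls where ls: "ls \<in> nondec_upto k" "n < seq_index k ls"
      using \<open>infinite (seq_index k ` nondec_upto k)\<close> unfolding infinite_nat_iff_unbounded by blast
    then have "n \<in> seq_index k ` {js \<in> nondec_upto k. js \<prec> ls}" unfolding seq_index_below by simp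
    then show ?thesis by blast
  qed
  then show ?thesis by blast
qed

section \<open>Nondecreasing sequences as nodes of a fan tree\<close>

definition node_par :: "nat \<Rightarrow> nat \<Rightarrow> nat" where
  "node_par k m = seq_index k (butlast (seq_enum k m))"

definition node_lev :: "nat \<Rightarrow> nat \<Rightarrow> nat" where
  "node_lev k m = length (seq_enum k m)"

locale seq_tree =
  fixes k :: nat
  assumes k_pos': "0 < k"
begin

lemma enum_mem: "seq_enum k m \<in> nondec_upto k"
  unfolding seq_enum_def by (rule inv_into_into) (simp add: seq_index_range[OF k_pos'])

lemma index_enum: "seq_index k (seq_enum k m) = m"
  unfolding seq_enum_def by (rule f_inv_into_f) (simp add: seq_index_range[OF k_pos'])

lemma enum_index: "js \<in> nondec_upto k \<Longrightarrow> seq_enum k (seq_index k js) = js"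
  unfolding seq_enum_def by (rule inv_into_f_f[OF inj_seq_index])

lemma nondec_upto_iff: "js \<in> nondec_upto k \<longleftrightarrow> (\<exists>m. js = seq_enum k m)"
  using enum_mem enum_index by metis

lemma Nil_mem: "[] \<in> nondec_upto k"
  by (simp add: nondec_upto_def)

lemma index_Nil: "seq_index k [] = 0"
  by (simp add: seq_index_def seq_prec_def)

lemma enum_0: "seq_enum k 0 = []"
  using enum_index[OF Nil_mem] index_Nil by simp

lemma enum_Nil_iff: "seq_enum k m = [] \<longleftrightarrow> m = 0"
  using enum_0 index_enum[of m] index_Nil by auto

lemma butlast_mem: "js \<in> nondec_upto k \<Longrightarrow> butlast js \<in> nondec_upto k"
  by (auto simp: nondec_upto_def butlast_conv_take)

lemma enum_par: "seq_enum k (node_par k m) = butlast (seq_enum k m)"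
  unfolding node_par_def by (rule enum_index[OF butlast_mem[OF enum_mem]])

lemma butlast_prec:
  assumes "js \<in> nondec_upto k" "js \<noteq> []"
  shows "butlast js \<prec> js"
proof (cases "butlast js = []")
  case False
  have s: "sorted (butlast js @ [last js])" using assms by (auto simp: nondec_upto_def)
  then have "last (butlast js) \<le> last js" using last_in_set[OF False] by (auto simp: sorted_append)
  moreover have "(butlast js, butlast js @ [last js]) \<in> lexord less_than" by (rule lexord_append_rightI) simp
  ultimately show ?thesis using assms(2) by (auto simp: seq_prec_def)
qed (use assms in \<open>simp add: seq_prec_def\<close>)

sublocale fan_tree k "node_par k" "node_lev k"
proof
  show "0 < k" by (rule k_pos')
  show "node_par k 0 = 0" by (simp add: node_par_def enum_0 index_Nil)
  show "node_lev k 0 = 0" by (simp add: node_lev_def enum_0)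
  show "node_par k m < m" if "0 < m" for m
    using seq_index_less[OF butlast_mem[OF enum_mem] butlast_prec[OF enum_mem]] that enum_Nil_iff[of m]
    by (simp add: node_par_def index_enum)
  show "node_lev k m = Suc (node_lev k (node_par k m))" if "0 < m" for m
    using that enum_Nil_iff[of m] by (simp add: node_lev_def enum_par)
  show "node_lev k m \<le> k" for m
    using enum_mem[of m] by (simp add: node_lev_def nondec_upto_def)
  show "infinite {m. 0 < m \<and> node_par k m = s}" if s: "node_lev k s < k" for s
  proof -
    \<comment> \<open>For the empty sequence \<open>last\<close> has an unspecified value, but at
      the root any number may be appended.\<close>
    let ?f = "\<lambda>j. seq_index k (seq_enum k s @ [last (seq_enum k s) + j])"
    have mem: "seq_enum k s @ [last (seq_enum k s) + j] \<in> nondec_upto k" for j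
    proof (cases "seq_enum k s = []")
      case True
      then show ?thesis using k_pos' by (simp add: nondec_upto_def)
    next
      case False
      have le: "a \<le> last (seq_enum k s)" if "a \<in> set (seq_enum k s)" for a
      proof -
        have "sorted (butlast (seq_enum k s) @ [last (seq_enum k s)])"
          using enum_mem[of s] False by (simp add: nondec_upto_def)
        moreover have "a \<in> set (butlast (seq_enum k s) @ [last (seq_enum k s)])" using that False by simp
        ultimately show ?thesis unfolding sorted_append by auto
      qed
      show ?thesis using enum_mem[of s] s le
        by (auto simp: nondec_upto_def node_lev_def sorted_append intro: trans_le_add1)
    qed
    have "inj ?f"
    proof (rule injI)
      fix i j assume "?f i = ?f j"
      then have "seq_enum k s @ [last (seq_enum k s) + i] = seq_enum k s @ [last (seq_enum k s) + j]"
        by (rule inj_onD[OF inj_seq_index _ mem mem])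
      then show "i = j" by simp
    qed
    then have "infinite (range ?f)" by (rule range_inj_infinite)
    moreover have "range ?f \<subseteq> {m. 0 < m \<and> node_par k m = s}"
    proof
      fix m assume "m \<in> range ?f"
      then obtain j where m: "m = ?f j" by blast
      have e: "seq_enum k m = seq_enum k s @ [last (seq_enum k s) + j]" unfolding m by (rule enum_index[OF mem])
      then have "m \<noteq> 0" using enum_Nil_iff[of m] by simp
      moreover have "node_par k m = s" by (simp add: node_par_def e index_enum)
      ultimately show "m \<in> {m. 0 < m \<and> node_par k m = s}" by simp
    qed
    ultimately show ?thesis by (rule infinite_super[rotated])
  qed
qed

lemma W_of_enum: "W_of k (seq_enum k m) = chain m"
proof (induction m rule: node_induct)
  case root
  then show ?case by (auto simp: W_of_def enum_0 chain_0)
next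
  case (step m)
  let ?js = "seq_enum k m"
  have ne: "?js \<noteq> []" using step(1) enum_Nil_iff[of m] by simp
  have "W_of k ?js = insert (seq_index k ?js) (W_of k (butlast ?js))"
  proof (intro set_eqI iffI)
    fix x assume "x \<in> W_of k ?js"
    then obtain q where q: "x = seq_index k (take q ?js)" "1 \<le> q" "q \<le> length ?js" by (auto simp: W_of_def)
    show "x \<in> insert (seq_index k ?js) (W_of k (butlast ?js))"
    proof (cases "q = length ?js")
      case False
      then have "take q (butlast ?js) = take q ?js" "q \<le> length (butlast ?js)" using q(3) by (auto simp: take_butlast)
      then show ?thesis using q(1,2) unfolding W_of_def by (metis (mono_tags, lifting) insertCI mem_Collect_eq)
    qed (use q in simp)
  next
    fix x assume "x \<in> insert (seq_index k ?js) (W_of k (butlast ?js))"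
    then consider "x = seq_index k ?js" | q where "x = seq_index k (take q (butlast ?js))" "1 \<le> q" "q \<le> length (butlast ?js)"
      by (auto simp: W_of_def)
    then show "x \<in> W_of k ?js"
    proof cases
      case 1
      then have "x = seq_index k (take (length ?js) ?js)" by simp
      moreover have "1 \<le> length ?js" using ne by (simp add: Suc_leI)
      ultimately show ?thesis unfolding W_of_def by blast
    next
      case (2 q)
      then have "take q (butlast ?js) = take q ?js" "q \<le> length ?js" using ne by (auto simp: take_butlast)
      then show ?thesis using 2 unfolding W_of_def by (metis (mono_tags, lifting) mem_Collect_eq)
    qed
  qed
  then show ?case using step chain_step[OF step(1)] by (simp add: index_enum flip: enum_par)
qed

lemma W_hat_eq: "W_hat k = range chain"
proof -
  have "nondec_upto k = range (seq_enum k)" using nondec_upto_iff by auto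
  then show ?thesis by (simp add: W_hat_def image_image W_of_enum)
qed

lemma nondec_iff: "js \<in> nondec k \<longleftrightarrow> (\<exists>m. js = seq_enum k m \<and> node_lev k m = k)"
proof -
  have "js \<in> nondec k \<longleftrightarrow> js \<in> nondec_upto k \<and> length js = k" by (auto simp: nondec_def nondec_upto_def)
  then show ?thesis unfolding nondec_upto_iff by (auto simp: node_lev_def)
qed

lemma W_max_eq: "W_max k = chain ` {m. node_lev k m = k}"
proof -
  have "nondec k = seq_enum k ` {m. node_lev k m = k}" using nondec_iff by auto
  then show ?thesis by (simp add: W_max_def image_image W_of_enum)
qed

lemma enum_anc: "l \<le> node_lev k m \<Longrightarrow> seq_enum k (anc l m) = take l (seq_enum k m)"
proof (induction m rule: node_induct)
  case root
  then show ?case using lev_0 by (simp add: enum_0 anc_def)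
next
  case (step m)
  show ?case
  proof (cases "l = node_lev k m")
    case True
    show ?thesis unfolding True anc_self by (simp add: node_lev_def)
  next
    case False
    then have l: "l < node_lev k m" "l \<le> node_lev k (node_par k m)" using step(1,3) lev_par[of m] by auto
    have "seq_enum k (anc l m) = take l (butlast (seq_enum k m))"
      using step(2)[OF l(2)] anc_step[OF l(1)] by (simp add: enum_par)
    moreover have "l < length (seq_enum k m)" using l(1) by (simp add: node_lev_def)
    ultimately show ?thesis by (simp add: take_butlast)
  qed
qed

lemma inj_enum: "inj (seq_enum k)"
  using index_enum by (metis injI)

lemma strict_prefix_enum: "strict_prefix (seq_enum k m) (seq_enum k n) \<longleftrightarrow> node_lev k m < node_lev k n \<and> anc (node_lev k m) n = m"
proof
  assume s: "strict_prefix (seq_enum k m) (seq_enum k n)"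
  then have l: "node_lev k m < node_lev k n" unfolding node_lev_def by (rule prefix_length_less)
  have "seq_enum k m = take (node_lev k m) (seq_enum k n)"
    using s unfolding node_lev_def by (metis append_eq_conv_conj prefix_def prefix_order.less_imp_le)
  then have "seq_enum k m = seq_enum k (anc (node_lev k m) n)" using enum_anc l by simp
  then show "node_lev k m < node_lev k n \<and> anc (node_lev k m) n = m" using l injD[OF inj_enum] by metis
next
  assume a: "node_lev k m < node_lev k n \<and> anc (node_lev k m) n = m"
  then have "seq_enum k m = take (node_lev k m) (seq_enum k n)" using enum_anc[of "node_lev k m" n] by simp
  then have "prefix (seq_enum k m) (seq_enum k n)" by (metis take_is_prefix)
  moreover have "seq_enum k m \<noteq> seq_enum k n" using a by (auto simp: node_lev_def)
  ultimately show "strict_prefix (seq_enum k m) (seq_enum k n)" by (simp add: strict_prefix_def)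
qed

end

context fan_tree
begin

section \<open>Initial segments, and copies of the whole tree in perfect subtrees\<close>

lemma path_anc: "l \<le> lev m \<Longrightarrow> path (anc l m) = take l (path m)"
proof (induction m rule: node_induct)
  case root
  then show ?case by (simp add: path_0 anc_def lev_0)
next
  case (step m)
  show ?case
  proof (cases "l = lev m")
    case True
    then show ?thesis using anc_self[of m] length_path[of m] by simp
  next
    case False
    then have l: "l < lev m" "l \<le> lev (par m)" using step(1,3) lev_par[of m] by auto
    then show ?thesis using step(2) anc_step[OF l(1)] path_step[OF step(1)] length_path[of "par m"] by simp
  qed
qed

lemma strict_prefix_path: "strict_prefix (path m) (path n) \<longleftrightarrow> lev m < lev n \<and> anc (lev m) n = m"
proof
  assume s: "strict_prefix (path m) (path n)"
  then have l: "lev m < lev n" using prefix_length_less[OF s] by (simp add: length_path)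
  have "path m = take (lev m) (path n)"
    using s by (metis append_eq_conv_conj prefix_def length_path prefix_order.less_imp_le)
  then have "path m = path (anc (lev m) n)" using path_anc l by simp
  then show "lev m < lev n \<and> anc (lev m) n = m" using l injD[OF inj_path] by metis
next
  assume a: "lev m < lev n \<and> anc (lev m) n = m"
  then have "path m = take (lev m) (path n)" using path_anc[of "lev m" n] by simp
  then have "prefix (path m) (path n)" by (metis take_is_prefix)
  moreover have "path m \<noteq> path n" using a length_path[of m] length_path[of n] by auto
  ultimately show "strict_prefix (path m) (path n)" by (simp add: strict_prefix_def)
qed

text \<open>The images of the nodes are chosen in the order of the numbering, each as a child of the
  image of the parent and beyond the previous image. This order is what makes the copy an element of
  \<open>\<E>\<^sub>k\<close>, which a perfect tree as such is not.\<close>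

lemma embedding:
  assumes P: "perfect P"
  obtains y where "strict_mono y" "range y \<subseteq> P" "perfect (range y)" "\<And>m. lev (y m) = lev m"
    "\<And>l m. anc l (y m) = y (anc l m)" "y 0 = 0"
proof -
  define good where "good ys \<longleftrightarrow> ys \<noteq> [] \<and> ys ! 0 = 0 \<and> set ys \<subseteq> P \<and> (\<forall>i<length ys. lev (ys ! i) = lev i) \<and>
    (\<forall>i. 0 < i \<longrightarrow> i < length ys \<longrightarrow> ys ! i \<in> ch (ys ! par i) \<and> ys ! (i - 1) < ys ! i)" for ys
  have "\<exists>f. f 0 = [0] \<and> (\<forall>n. good (f n) \<and> (\<exists>v. f (Suc n) = f n @ [v]))"
  proof (rule dependent_choice_from[of good "[0]" "\<lambda>n ys ys'. \<exists>v. ys' = ys @ [v]"])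
    show "good [0]" using perfect_D(1)[OF P] by (simp add: good_def)
    fix ys and n :: nat assume g: "good ys"
    let ?n = "length ys"
    have n: "0 < ?n" using g by (simp add: good_def)
    then have pn: "par ?n < ?n" by (rule par_less)
    have lp: "lev (ys ! par ?n) = lev (par ?n)" using g pn by (simp add: good_def)
    then have "lev (ys ! par ?n) < k" using lev_par[OF n] lev_le[of ?n] by simp
    moreover have "ys ! par ?n \<in> P" using g pn nth_mem by (auto simp: good_def)
    ultimately have "infinite (P \<inter> ch (ys ! par ?n))" using perfect_D(3)[OF P] by blast
    then obtain v where v: "v \<in> P" "v \<in> ch (ys ! par ?n)" "ys ! (?n - 1) < v"
      unfolding infinite_nat_iff_unbounded by blast
    have "good (ys @ [v])"
      unfolding good_def
    proof (intro conjI allI impI)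
      show "(ys @ [v]) ! 0 = 0" using g n by (simp add: good_def nth_append)
      show "set (ys @ [v]) \<subseteq> P" using g v by (simp add: good_def)
      show "lev ((ys @ [v]) ! i) = lev i" if "i < length (ys @ [v])" for i
        using g that ch_D(4)[OF v(2)] lp lev_par[OF n] by (cases "i = ?n") (auto simp: good_def nth_append)
      fix i assume i: "0 < i" "i < length (ys @ [v])"
      have pi: "par i < i" using par_less[OF i(1)] .
      show "(ys @ [v]) ! i \<in> ch ((ys @ [v]) ! par i)"
        using g i v(2) pi by (cases "i = ?n") (auto simp: good_def nth_append)
      show "(ys @ [v]) ! (i - 1) < (ys @ [v]) ! i"
        using g i v(3) by (cases "i = ?n") (auto simp: good_def nth_append)
    qed simp
    then show "\<exists>ys'. good ys' \<and> (\<exists>v. ys' = ys @ [v])" by blast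
  qed
  then obtain f where f: "f 0 = [0]" "\<And>n. good (f n)" "\<And>n. \<exists>v. f (Suc n) = f n @ [v]" by blast
  have len: "length (f n) = Suc n" for n
  proof (induction n)
    case (Suc n)
    then show ?case using f(3)[of n] by auto
  qed (simp add: f)
  define y where "y n = f n ! n" for n
  have y: "f n ! i = y i" if "i \<le> n" for n i
    using that
  proof (induction n)
    case (Suc n)
    show ?case
    proof (cases "i = Suc n")
      case False
      obtain v where "f (Suc n) = f n @ [v]" using f(3) by blast
      then show ?thesis using Suc False len[of n] by (simp add: nth_append)
    qed (simp add: y_def)
  qed (simp add: y_def)
  have y0: "y 0 = 0" by (simp add: y_def f(1))
  have yP: "y n \<in> P" for n
    using f(2)[of n] nth_mem[of n "f n"] len[of n] y[of n n] by (auto simp: good_def)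
  have ylev: "lev (y n) = lev n" for n
    using f(2)[of n] len[of n] y[of n n] by (auto simp: good_def)
  have ych: "y n \<in> ch (y (par n))" "y (n - 1) < y n" if "0 < n" for n
  proof -
    have "f n ! n \<in> ch (f n ! par n) \<and> f n ! (n - 1) < f n ! n"
      using f(2)[of n] len[of n] that unfolding good_def by (metis lessI)
    then show "y n \<in> ch (y (par n))" "y (n - 1) < y n"
      using y[of n n] y[of "par n" n] y[of "n - 1" n] par_le[of n] by simp_all
  qed
  have sm: "strict_mono y" using ych(2)[of "Suc _"] by (simp add: strict_mono_Suc_iff)
  have ypar: "par (y n) = y (par n)" for n
    using ch_D(2)[OF ych(1)] y0 par_0 by (cases "n = 0") auto
  have yfun: "(par ^^ i) (y n) = y ((par ^^ i) n)" for i n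
    by (induction i) (simp_all add: ypar)
  have inj: "inj y" using sm by (rule strict_mono_imp_inj_on)
  have "perfect (range y)"
    unfolding perfect_def
  proof (intro conjI ballI impI)
    show "0 \<in> range y" using y0 by (metis rangeI)
    show "par ` range y \<subseteq> range y" using ypar by auto
    fix s assume "s \<in> range y" "lev s < k"
    then obtain n where n: "s = y n" "lev n < k" using ylev by auto
    have "infinite (ch n)" using infinite_children[OF n(2)] by (simp add: ch_def)
    then have "infinite (y ` ch n)" using finite_imageD inj_on_subset[OF inj] by blast
    moreover have "y ` ch n \<subseteq> range y \<inter> ch s"
      using ych(1) n(1) by (force simp: ch_def)
    ultimately show "infinite (range y \<inter> ch s)" by (rule infinite_super[rotated])
  qed
  moreover have "anc l (y m) = y (anc l m)" for l m
    by (simp add: anc_def ylev yfun)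
  ultimately show ?thesis using that sm yP ylev y0 by blast
qed

lemma layer_eq: "perfect P \<Longrightarrow> l \<le> k \<Longrightarrow> proj l ` chain ` leaves P = chain ` {u \<in> P. lev u = l}"
proof (intro set_eqI iffI)
  fix w assume *: "perfect P" "l \<le> k"
  {
    assume "w \<in> proj l ` chain ` leaves P"
    then obtain m where m: "m \<in> P" "lev m = k" "w = proj l (chain m)" by (auto simp: leaves_def)
    then have "w = chain (anc l m)" "lev (anc l m) = l" "anc l m \<in> P"
      using proj_chain lev_anc anc_mem[OF *(1)] *(2) by auto
    then show "w \<in> chain ` {u \<in> P. lev u = l}" by blast
  next
    assume "w \<in> chain ` {u \<in> P. lev u = l}"
    then obtain u where u: "u \<in> P" "lev u = l" "w = chain u" by blast
    then obtain m where m: "m \<in> leaves P" "anc l m = u" using leaf_above[OF *(1)] by blast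
    then have "proj l (chain m) = w" using proj_chain[of l m] *(2) u(3) by (simp add: leaves_def)
    then show "w \<in> proj l ` chain ` leaves P" using m(1) by blast
  }
qed

section \<open>Sets of leaves in the generic ultrafilter\<close>

lemma sorted_list_chain_leaves: "sorted_list_of_set ` chain ` leaves P = code P"
  by (simp add: code_def path_def image_image)

lemma regs_image: "regs (iset_image f X)"
  unfolding regs_def iset_image_def by (intro allI reg_fex)

lemma image_gname:
  assumes "p \<in> \<D>"
  shows "(iset_image f (gname B) \<^bold>\<doteq> check_set (f ` B)) le p"
  unfolding iset_eq_iff[OF regs_image regs_check assms] check_set_iff
proof (intro allI impI)
  fix b q assume "(q, p) \<in> le"
  then have D: "q \<in> \<D>" using conds_down[OF assms] by blast
  show "iset_image f (gname B) b le q \<longleftrightarrow> b \<in> f ` B"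
  proof
    assume "iset_image f (gname B) b le q"
    then obtain q' a where q': "(q', q) \<in> le" "gname B a le q'" "b = f a"
      using conds_refl[OF D] unfolding iset_image_def fex_iff fand_def fground_def by blast
    have "a \<in> B" using q'(2) by (simp only: gname_iff[OF conds_down[OF D q'(1)]])
    then show "b \<in> f ` B" using q'(3) by simp
  next
    assume "b \<in> f ` B"
    then obtain a where a: "a \<in> B" "b = f a" by blast
    show "iset_image f (gname B) b le q"
      unfolding iset_image_def fex_iff fand_def fground_def
    proof (intro allI impI)
      fix q' assume q': "(q', q) \<in> le"
      have "gname B a le q'" using a(1) by (simp only: gname_iff[OF conds_down[OF D q']])
      then show "\<exists>q'' x. (q'', q') \<in> le \<and> gname B x le q'' \<and> b = f x"
        using conds_refl[OF conds_down[OF D q']] a(2) by blast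
    qed
  qed
qed

lemma mem_generic_leaves:
  assumes "perfect P"
  shows "mem_generic k (gname (chain ` leaves P)) le (cond P)"
  unfolding mem_generic_def
proof (rule family_ext[where U = G, OF family_G regs_check regs_image cond_D[OF assms]])
  show "G (check_set (code P)) le (cond P)" by (rule G_code[OF assms])
  show "(check_set (code P) \<^bold>\<doteq> iset_image sorted_list_of_set (gname (chain ` leaves P))) le (cond P)"
    using image_gname[OF cond_D[OF assms], of sorted_list_of_set "chain ` leaves P"]
    unfolding sorted_list_chain_leaves by (rule iset_eq_sym[OF regs_image regs_check cond_D[OF assms]])
qed

text \<open>Membership refers to the image under \<open>sorted_list_of_set\<close>. This map sends
  infinite sets to the empty list, so a nonempty list in its range comes from one set only, and
  membership can be pulled back from \<open>path m\<close> to \<open>chain m\<close>.\<close>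

lemma generic_preimage:
  assumes p: "perfect P" "(q, cond P) \<in> le" and G: "mem_generic k (val_set \<tau>) le q"
  obtains Q where "Q \<subseteq> P" "perfect Q" "(cond Q, q) \<in> le" "\<And>m. m \<in> leaves Q \<Longrightarrow> val_set \<tau> (chain m) le (cond Q)"
proof -
  have D: "q \<in> \<D>" using conds_down[OF cond_D[OF p(1)] p(2)] .
  let ?I = "iset_image sorted_list_of_set (val_set \<tau>)"
  have GI: "G ?I le q" using G unfolding mem_generic_def .
  obtain q2 C where q2: "(q2, q) \<in> le" "(?I \<^bold>\<doteq> check_set C) le q2" "G (check_set C) le q2"
    by (rule family_ground[where U = G, OF family_G regs_image D GI])
  obtain Q where Q: "Q \<subseteq> P" "perfect Q" "(cond Q, q2) \<in> le" "code Q \<subseteq> C"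
    by (rule G_refine[OF p(1) conds_trans[OF q2(1) p(2)] q2(3)])
  have D2: "q2 \<in> \<D>" using conds_down[OF D q2(1)] .
  have "val_set \<tau> (chain m) le (cond Q)" if m: "m \<in> leaves Q" for m
  proof (rule reg_dense[OF regs_reg[OF regs_val_set] cond_D[OF Q(2)]])
    fix q3 assume q3: "(q3, cond Q) \<in> le"
    have "path m \<in> C" using m Q(4) by (auto simp: code_def)
    then have I: "?I (path m) le q3"
      using q2(2)[unfolded iset_eq_iff[OF regs_image regs_check D2] check_set_iff] conds_trans[OF q3 Q(3)] by blast
    obtain q4 w where q4: "(q4, q3) \<in> le" "val_set \<tau> w le q4" "path m = sorted_list_of_set w"
      using I conds_refl[OF conds_down[OF cond_D[OF Q(2)] q3]] unfolding iset_image_def fex_iff fand_def fground_def by blast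
    have "length (path m) = k" using m by (simp add: length_path leaves_def)
    then have "path m \<noteq> []" using k_pos by auto
    have "finite w"
    proof (rule ccontr)
      assume "infinite w"
      then show False using q4(3) \<open>path m \<noteq> []\<close> by simp
    qed
    then have "w = set (path m)" using q4(3) by simp
    then have "w = chain m" by (simp only: set_path)
    then show "\<exists>q'. (q', q3) \<in> le \<and> val_set \<tau> (chain m) le q'" using q4(1,2) by blast
  qed
  then show ?thesis by (rule that[OF Q(1,2) conds_trans[OF Q(3) q2(1)]])
qed

text \<open>The leaves are divided according to whether their ancestor on level \<open>l\<close> is
  in \<open>C\<close>. One part is positive and contains the leaves of a perfect tree, all of whose
  nodes on level \<open>l\<close> are such ancestors.\<close>

lemma layer_split:
  assumes P: "perfect P" and l: "l \<le> k"
  shows "\<exists>Q\<subseteq>P. perfect Q \<and> ({u \<in> Q. lev u = l} \<subseteq> C \<or> {u \<in> Q. lev u = l} \<inter> C = {})"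
proof -
  have fin: "\<exists>Q\<subseteq>P. perfect Q \<and> {u \<in> Q. lev u = l} \<subseteq> C'"
    if pos: "path ` {m \<in> leaves P. anc l m \<in> C'} \<notin> fin_ideal k" for C'
  proof -
    have "{m \<in> leaves P. anc l m \<in> C'} \<subseteq> leaves UNIV" by (auto simp: leaves_def)
    then obtain Q where Q: "perfect Q" "leaves Q \<subseteq> {m \<in> leaves P. anc l m \<in> C'}"
      using positive_iff_perfect pos by metis
    have "Q \<subseteq> P" by (rule leaves_subset[OF Q(1) P]) (use Q(2) in auto)
    moreover have "u \<in> C'" if u: "u \<in> Q" "lev u = l" for u
    proof -
      obtain m where "m \<in> leaves Q" "anc (lev u) m = u" using leaf_above[OF Q(1) u(1)] by blast
      then show ?thesis using Q(2) u(2) by auto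
    qed
    ultimately show ?thesis using Q(1) by blast
  qed
  have "code P = path ` {m \<in> leaves P. anc l m \<in> C} \<union> path ` {m \<in> leaves P. anc l m \<in> - C}"
    by (auto simp: code_def)
  then have "path ` {m \<in> leaves P. anc l m \<in> C} \<notin> fin_ideal k \<or> path ` {m \<in> leaves P. anc l m \<in> - C} \<notin> fin_ideal k"
    using code_positive[OF P] fin_ideal_Un[of "path ` {m \<in> leaves P. anc l m \<in> C}" k "path ` {m \<in> leaves P. anc l m \<in> - C}"]
    by argo
  then show ?thesis
  proof
    assume "path ` {m \<in> leaves P. anc l m \<in> C} \<notin> fin_ideal k"
    from fin[OF this] show ?thesis by blast
  next
    assume "path ` {m \<in> leaves P. anc l m \<in> - C} \<notin> fin_ideal k"
    from fin[OF this] obtain Q where "Q \<subseteq> P" "perfect Q" "{u \<in> Q. lev u = l} \<subseteq> - C" by blast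
    then show ?thesis by blast
  qed
qed

end

context seq_tree
begin

text \<open>The tree maps \<open>seq_enum k m\<close> to \<open>chain (y m)\<close>. Strict
  monotonicity of \<open>y\<close> yields the increasing maxima, and compatibility with
  \<open>lev\<close> and \<open>anc\<close> the correspondence of initial segments.\<close>

lemma E_space_embedding:
  assumes y: "strict_mono y" "perfect (range y)" "\<And>m. node_lev k (y m) = node_lev k m" "\<And>l m. anc l (y m) = y (anc l m)"
    and p: "p \<in> \<D>"
  shows "E_space k (gname (chain ` leaves (range y))) le p"
proof -
  define T where "T = range (\<lambda>m. (seq_enum k m, chain (y m)))"
  have T: "(seq_enum k m, w) \<in> T \<longleftrightarrow> w = chain (y m)" for m w
    using injD[OF inj_enum] by (auto simp: T_def)
  have T_mem: "js \<in> nondec_upto k \<and> w \<in> W_hat k" if "(js, w) \<in> T" for js w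
    using that enum_mem by (auto simp: T_def W_hat_eq)
  have T_fun: "v = w" if "(js, v) \<in> T" "(js, w) \<in> T" for js v w
    using that injD[OF inj_enum] by (auto simp: T_def)
  have inj: "inj y" using y(1) by (rule strict_mono_imp_inj_on)
  have gT: "gname T x le q \<longleftrightarrow> x \<in> T" if "(q, p') \<in> le" "p' \<in> \<D>" for x q p'
    using gname_iff[OF conds_down[OF that(2,1)]] .
  have tree: "is_E_tree k (gname T) le q" if D: "q \<in> \<D>" for q
    unfolding is_E_tree_def fall_def
  proof (intro fandI allI)
    note g = gT[OF _ D]
    show "(gname T (js, w) \<^bold>\<longrightarrow> \<guillemotleft>js \<in> nondec_upto k \<and> w \<in> W_hat k\<guillemotright>) le q" for js w
      by (rule fimpI[OF _ D]) (simp add: g fground_def T_mem)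
    show "(\<guillemotleft>js \<in> nondec_upto k\<guillemotright> \<^bold>\<longrightarrow> (\<^bold>\<exists>w. gname T (js, w))) le q" for js
    proof (rule fimpI[OF _ D])
      fix q' assume q': "(q', q) \<in> le" "\<guillemotleft>js \<in> nondec_upto k\<guillemotright> le q'"
      then obtain m where "js = seq_enum k m" unfolding fground_def nondec_upto_iff by blast
      then have t: "(js, chain (y m)) \<in> T" using T by simp
      show "(\<^bold>\<exists>w. gname T (js, w)) le q'"
        unfolding fex_iff
      proof (intro allI impI)
        fix q2 assume q2: "(q2, q') \<in> le"
        have "(q2, q) \<in> le" using conds_trans[OF q2 q'(1)] .
        then show "\<exists>q3 w. (q3, q2) \<in> le \<and> gname T (js, w) le q3"
          using t conds_refl[OF conds_down[OF D]] g by blast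
      qed
    qed
    show "(gname T (js, v) \<^bold>\<and> gname T (js, w) \<^bold>\<longrightarrow> \<guillemotleft>v = w\<guillemotright>) le q" for js v w
    proof (rule fimpI[OF _ D])
      fix q' assume "(q', q) \<in> le" "(gname T (js, v) \<^bold>\<and> gname T (js, w)) le q'"
      then have "(js, v) \<in> T" "(js, w) \<in> T" by (simp_all add: fand_def g)
      then show "\<guillemotleft>v = w\<guillemotright> le q'" using T_fun unfolding fground_def by blast
    qed
    show "(gname T (seq_enum k m, w) \<^bold>\<longrightarrow> \<guillemotleft>card w = length (seq_enum k m)\<guillemotright>) le q" for m w
      by (rule fimpI[OF _ D]) (use y(3)[of m] in \<open>auto simp: g fground_def T card_chain node_lev_def\<close>)
    show "(\<guillemotleft>1 \<le> m\<guillemotright> \<^bold>\<and> gname T (seq_enum k m, v) \<^bold>\<and> gname T (seq_enum k (Suc m), w) \<^bold>\<longrightarrow> \<guillemotleft>Max v < Max w\<guillemotright>) le q" for m v w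
    proof (rule fimpI[OF _ D])
      fix q' assume q': "(q', q) \<in> le" "(\<guillemotleft>1 \<le> m\<guillemotright> \<^bold>\<and> gname T (seq_enum k m, v) \<^bold>\<and> gname T (seq_enum k (Suc m), w)) le q'"
      then have m: "1 \<le> m" "v = chain (y m)" "w = chain (y (Suc m))" by (simp_all add: fand_def fground_def g T)
      have "0 < y m" "y m < y (Suc m)" using strict_monoD[OF y(1), of 0 m] strict_monoD[OF y(1), of m "Suc m"] m(1) by auto
      then show "\<guillemotleft>Max v < Max w\<guillemotright> le q'" using Max_chain[of "y m"] Max_chain[of "y (Suc m)"] m(2,3) by (simp add: fground_def)
    qed
    show "(gname T (seq_enum k m, v) \<^bold>\<and> gname T (seq_enum k n, w) \<^bold>\<longrightarrow>
         \<guillemotleft>proper_initial_segment v w \<longleftrightarrow> strict_prefix (seq_enum k m) (seq_enum k n)\<guillemotright>) le q" for m n v w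
    proof (rule fimpI[OF _ D])
      fix q' assume q': "(q', q) \<in> le" "(gname T (seq_enum k m, v) \<^bold>\<and> gname T (seq_enum k n, w)) le q'"
      then have vw: "v = chain (y m)" "w = chain (y n)" by (simp_all add: fand_def g T)
      have "proper_initial_segment v w \<longleftrightarrow> strict_prefix (path (y m)) (path (y n))"
        by (simp add: proper_initial_segment_def vw path_def)
      also have "\<dots> \<longleftrightarrow> node_lev k m < node_lev k n \<and> y (anc (node_lev k m) n) = y m"
        by (simp add: strict_prefix_path y(3,4))
      also have "\<dots> \<longleftrightarrow> strict_prefix (seq_enum k m) (seq_enum k n)"
        by (simp add: strict_prefix_enum inj_eq[OF inj])
      finally show "\<guillemotleft>proper_initial_segment v w \<longleftrightarrow> strict_prefix (seq_enum k m) (seq_enum k n)\<guillemotright> le q'"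
        by (simp add: fground_def)
    qed
  qed
  have range: "(\<^bold>\<forall>w. gname (chain ` leaves (range y)) w \<^bold>\<longleftrightarrow> (\<^bold>\<exists>js. \<guillemotleft>js \<in> nondec k\<guillemotright> \<^bold>\<and> gname T (js, w))) le q" if D: "q \<in> \<D>" for q
    unfolding fall_def
  proof
    fix w
    show "(gname (chain ` leaves (range y)) w \<^bold>\<longleftrightarrow> (\<^bold>\<exists>js. \<guillemotleft>js \<in> nondec k\<guillemotright> \<^bold>\<and> gname T (js, w))) le q"
      unfolding fiff_iff[OF regs_reg[OF regs_val_set] reg_fex D]
    proof (intro allI impI)
      fix q' assume q': "(q', q) \<in> le"
      have D': "q' \<in> \<D>" using conds_down[OF D q'] .
      have "w \<in> chain ` leaves (range y) \<longleftrightarrow> (\<exists>js. js \<in> nondec k \<and> (js, w) \<in> T)"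
      proof
        assume "w \<in> chain ` leaves (range y)"
        then obtain m where "w = chain (y m)" "node_lev k m = k" by (auto simp: leaves_def y(3))
        then show "\<exists>js. js \<in> nondec k \<and> (js, w) \<in> T" using nondec_iff T by blast
      next
        assume "\<exists>js. js \<in> nondec k \<and> (js, w) \<in> T"
        then obtain m where m: "(seq_enum k m, w) \<in> T" "node_lev k m = k" unfolding nondec_iff by blast
        then have "w = chain (y m)" "y m \<in> leaves (range y)" using T by (auto simp: leaves_def y(3))
        then show "w \<in> chain ` leaves (range y)" by blast
      qed
      also have "\<dots> \<longleftrightarrow> (\<^bold>\<exists>js. \<guillemotleft>js \<in> nondec k\<guillemotright> \<^bold>\<and> gname T (js, w)) le q'"
      proof
        assume a: "\<exists>js. js \<in> nondec k \<and> (js, w) \<in> T"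
        show "(\<^bold>\<exists>js. \<guillemotleft>js \<in> nondec k\<guillemotright> \<^bold>\<and> gname T (js, w)) le q'"
          unfolding fex_iff fand_def fground_def
        proof (intro allI impI)
          fix q2 assume q2: "(q2, q') \<in> le"
          from a obtain js where js: "js \<in> nondec k" "(js, w) \<in> T" by blast
          have "gname T (js, w) le q2" using js(2) by (simp only: gT[OF q2 D'])
          then show "\<exists>q3 js. (q3, q2) \<in> le \<and> js \<in> nondec k \<and> gname T (js, w) le q3"
            using js(1) conds_refl[OF conds_down[OF D' q2]] by blast
        qed
      next
        assume "(\<^bold>\<exists>js. \<guillemotleft>js \<in> nondec k\<guillemotright> \<^bold>\<and> gname T (js, w)) le q'"
        then obtain q2 js where q2: "(q2, q') \<in> le" "js \<in> nondec k" "gname T (js, w) le q2"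
          using conds_refl[OF D'] unfolding fex_iff fand_def fground_def by meson
        have "(js, w) \<in> T" using q2(3) by (simp only: gT[OF q2(1) D'])
        then show "\<exists>js. js \<in> nondec k \<and> (js, w) \<in> T" using q2(2) by blast
      qed
      finally show "gname (chain ` leaves (range y)) w le q' \<longleftrightarrow> (\<^bold>\<exists>js. \<guillemotleft>js \<in> nondec k\<guillemotright> \<^bold>\<and> gname T (js, w)) le q'"
        by (simp only: gname_iff[OF D'])
    qed
  qed
  show ?thesis
    unfolding E_space_def fex_set_iff
  proof (intro allI impI)
    fix q assume q: "(q, p) \<in> le"
    have D: "q \<in> \<D>" using conds_down[OF p q] .
    show "\<exists>q' \<tau>. (q', q) \<in> le \<and> (is_E_tree k (val_set \<tau>) \<^bold>\<and>
        (\<^bold>\<forall>w. gname (chain ` leaves (range y)) w \<^bold>\<longleftrightarrow> (\<^bold>\<exists>js. \<guillemotleft>js \<in> nondec k\<guillemotright> \<^bold>\<and> val_set \<tau> (js, w)))) le q'"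
      by (rule exI[of _ q], rule exI[of _ "T \<times> UNIV"], rule conjI[OF conds_refl[OF D]], rule fandI, rule tree[OF D], rule range[OF D])
  qed
qed

end

section \<open>The projections of the generic ultrafilter\<close>

context forcing
begin

lemma pers_filter_premise: "pers (\<guillemotleft>a \<in> A\<guillemotright> \<^bold>\<and> (\<^bold>\<forall>i. \<guillemotleft>i < n\<guillemotright> \<^bold>\<longrightarrow> X (i, a)))"
  by (intro pers_fand reg_pers reg_fground pers_fall reg_fimp)

lemma family_generated_filter:
  fixes A :: "'a set" and S :: "('a, 'p) ifam"
  assumes "countable A"
  shows "family A (generated_filter A S)"
  unfolding family_def
proof (intro conjI allI impI)
  show "reg (generated_filter A S X)" if "regs X" for X
    unfolding generated_filter_def by (intro reg_fand reg_iset_subset that reg_fex)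
  show "(X \<^bold>\<subseteq> check_set A) r p" if "generated_filter A S X r p" for X p
    using that unfolding generated_filter_def by (rule fandD)
  fix X Y p assume XY: "regs X" "regs Y" "p \<in> D" "(X \<^bold>\<doteq> Y) r p" and F: "generated_filter A S X r p"
  \<comment> \<open>Apart from the inclusion in \<open>A\<close>, the only part of the definition in
    which the set itself occurs.\<close>
  define core where "core n \<tau> Z = (\<^bold>\<forall>a. \<guillemotleft>a \<in> A\<guillemotright> \<^bold>\<and> (\<^bold>\<forall>i. \<guillemotleft>i < n\<guillemotright> \<^bold>\<longrightarrow> val_set \<tau> (i, a)) \<^bold>\<longrightarrow> Z a)"
    for n :: nat and \<tau> :: "(nat \<times> 'a, 'p) set_name" and Z :: "('a, 'p) iset"
  have core: "core n \<tau> Y r q" if "core n \<tau> X r q" "(q, p) \<in> r" for n \<tau> q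
    unfolding core_def
  proof (rule fallI)
    fix a
    have imp: "(\<guillemotleft>a \<in> A\<guillemotright> \<^bold>\<and> (\<^bold>\<forall>i. \<guillemotleft>i < n\<guillemotright> \<^bold>\<longrightarrow> val_set \<tau> (i, a)) \<^bold>\<longrightarrow> X a) r q"
      using that(1) unfolding core_def by (rule fallD)
    have q: "q \<in> D" using D_down[OF XY(3) that(2)] .
    show "(\<guillemotleft>a \<in> A\<guillemotright> \<^bold>\<and> (\<^bold>\<forall>i. \<guillemotleft>i < n\<guillemotright> \<^bold>\<longrightarrow> val_set \<tau> (i, a)) \<^bold>\<longrightarrow> Y a) r q"
    proof (rule fimpI[OF _ q])
      fix q' assume q': "(q', q) \<in> r" "(\<guillemotleft>a \<in> A\<guillemotright> \<^bold>\<and> (\<^bold>\<forall>i. \<guillemotleft>i < n\<guillemotright> \<^bold>\<longrightarrow> val_set \<tau> (i, a))) r q'"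
      have "X a r q'" by (rule fimpD[OF imp pers_filter_premise regs_reg[OF XY(1)] q q'])
      moreover have "(q', p) \<in> r" using le_trans[OF q'(1) that(2)] .
      ultimately show "Y a r q'" using XY(4) unfolding iset_eq_iff[OF XY(1-3)] by simp
    qed
  qed
  show "generated_filter A S Y r p"
    unfolding generated_filter_def
  proof (rule fandI)
    have "(X \<^bold>\<subseteq> check_set A) r p" using F unfolding generated_filter_def by (rule fandD)
    then show "(Y \<^bold>\<subseteq> check_set A) r p"
      by (rule iset_subset_cong[OF XY(1) regs_check XY(2) regs_check XY(3,4) iset_eq_refl[OF regs_check XY(3)]])
    have ex: "(\<^bold>\<exists>n::nat. \<^bold>\<exists>\<^sub>S Z. (\<^bold>\<forall>i. \<guillemotleft>i < n\<guillemotright> \<^bold>\<longrightarrow> S (\<lambda>a. Z (i, a))) \<^bold>\<and>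
       (\<^bold>\<forall>a. \<guillemotleft>a \<in> A\<guillemotright> \<^bold>\<and> (\<^bold>\<forall>i. \<guillemotleft>i < n\<guillemotright> \<^bold>\<longrightarrow> Z (i, a)) \<^bold>\<longrightarrow> X a)) r p"
      using F unfolding generated_filter_def by (rule fandD)
    show "(\<^bold>\<exists>n::nat. \<^bold>\<exists>\<^sub>S Z. (\<^bold>\<forall>i. \<guillemotleft>i < n\<guillemotright> \<^bold>\<longrightarrow> S (\<lambda>a. Z (i, a))) \<^bold>\<and>
       (\<^bold>\<forall>a. \<guillemotleft>a \<in> A\<guillemotright> \<^bold>\<and> (\<^bold>\<forall>i. \<guillemotleft>i < n\<guillemotright> \<^bold>\<longrightarrow> Z (i, a)) \<^bold>\<longrightarrow> Y a)) r p"
      unfolding fex_iff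
    proof (intro allI impI)
      fix q assume q: "(q, p) \<in> r"
      from fexD[OF ex q] obtain q1 and n :: nat where q1: "(q1, q) \<in> r"
        and exn: "(\<^bold>\<exists>\<^sub>S Z. (\<^bold>\<forall>i. \<guillemotleft>i < n\<guillemotright> \<^bold>\<longrightarrow> S (\<lambda>a. Z (i, a))) \<^bold>\<and>
          (\<^bold>\<forall>a. \<guillemotleft>a \<in> A\<guillemotright> \<^bold>\<and> (\<^bold>\<forall>i. \<guillemotleft>i < n\<guillemotright> \<^bold>\<longrightarrow> Z (i, a)) \<^bold>\<longrightarrow> X a)) r q1"
        by blast
      have "(\<^bold>\<exists>\<^sub>S Z. (\<^bold>\<forall>i. \<guillemotleft>i < n\<guillemotright> \<^bold>\<longrightarrow> S (\<lambda>a. Z (i, a))) \<^bold>\<and>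
          (\<^bold>\<forall>a. \<guillemotleft>a \<in> A\<guillemotright> \<^bold>\<and> (\<^bold>\<forall>i. \<guillemotleft>i < n\<guillemotright> \<^bold>\<longrightarrow> Z (i, a)) \<^bold>\<longrightarrow> Y a)) r q1"
        unfolding fex_set_iff
      proof (intro allI impI)
        fix q2 assume q2: "(q2, q1) \<in> r"
        from fex_setD[OF exn this] obtain q3 \<tau> where q3: "(q3, q2) \<in> r"
          "((\<^bold>\<forall>i. \<guillemotleft>i < n\<guillemotright> \<^bold>\<longrightarrow> S (\<lambda>a. val_set \<tau> (i, a))) \<^bold>\<and> core n \<tau> X) r q3"
          unfolding core_def by blast
        have "(q3, p) \<in> r" using le_trans[OF q3(1) le_trans[OF q2 le_trans[OF q1 q]]] .
        then have "((\<^bold>\<forall>i. \<guillemotleft>i < n\<guillemotright> \<^bold>\<longrightarrow> S (\<lambda>a. val_set \<tau> (i, a))) \<^bold>\<and> core n \<tau> Y) r q3"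
          using q3(2) core unfolding fand_def by simp
        then show "\<exists>q' \<tau>. (q', q2) \<in> r \<and> ((\<^bold>\<forall>i. \<guillemotleft>i < n\<guillemotright> \<^bold>\<longrightarrow> S (\<lambda>a. val_set \<tau> (i, a))) \<^bold>\<and>
          (\<^bold>\<forall>a. \<guillemotleft>a \<in> A\<guillemotright> \<^bold>\<and> (\<^bold>\<forall>i. \<guillemotleft>i < n\<guillemotright> \<^bold>\<longrightarrow> val_set \<tau> (i, a)) \<^bold>\<longrightarrow> Y a)) r q'"
          using q3(1) unfolding core_def by blast
      qed
      then show "\<exists>q' (n::nat). (q', q) \<in> r \<and> (\<^bold>\<exists>\<^sub>S Z. (\<^bold>\<forall>i. \<guillemotleft>i < n\<guillemotright> \<^bold>\<longrightarrow> S (\<lambda>a. Z (i, a))) \<^bold>\<and>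
          (\<^bold>\<forall>a. \<guillemotleft>a \<in> A\<guillemotright> \<^bold>\<and> (\<^bold>\<forall>i. \<guillemotleft>i < n\<guillemotright> \<^bold>\<longrightarrow> Z (i, a)) \<^bold>\<longrightarrow> Y a)) r q'"
        using q1 by blast
    qed
  qed
qed (rule assms)

end

context seq_tree
begin

section \<open>Layers of perfect trees and the projected filter\<close>

abbreviation layer :: "nat \<Rightarrow> nat set \<Rightarrow> nat set set" where
  "layer l P \<equiv> chain ` {u \<in> P. node_lev k u = l}"

lemma proj_W_max: "l \<le> k \<Longrightarrow> proj l ` W_max k = layer l UNIV"
  using layer_eq[OF perfect_UNIV] by (simp add: W_max_eq leaves_def)

lemma family_proj_generic: "l \<le> k \<Longrightarrow> family (layer l UNIV) (proj_generic k l)"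
  unfolding proj_generic_def proj_W_max by (rule family_generated_filter) simp

text \<open>\<open>X\<close> is characterized by its forced elements instead of being given as a
  name, because in the generated filter it occurs as one section of a coded sequence.\<close>

lemma generic_layer:
  assumes P: "perfect P" and l: "l \<le> k" and q: "(q, cond P) \<in> le" and X: "regs X" "\<And>a q'. (q', q) \<in> le \<Longrightarrow> X a le q' \<longleftrightarrow> a \<in> layer l P"
    and y: "P = range y" "strict_mono y" "\<And>m. node_lev k (y m) = node_lev k m" "\<And>l m. anc l (y m) = y (anc l m)"
  shows "(\<^bold>\<exists>\<^sub>S Z. B_generic k Z \<^bold>\<and> X \<^bold>\<doteq> iset_image (proj l) Z) le q"
  unfolding fex_set_iff
proof (intro allI impI)
  fix q1 assume q1: "(q1, q) \<in> le"
  have q1P: "(q1, cond P) \<in> le" using conds_trans[OF q1 q] .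
  have D: "q1 \<in> \<D>" using conds_down[OF cond_D[OF P] q1P] .
  let ?Z = "gname (chain ` leaves P)"
  have "mem_generic k ?Z le q1"
    using mem_generic_leaves[OF P] family_reg[where U = G, OF family_G regs_image, THEN regD, OF _ q1P]
    unfolding mem_generic_def by simp
  moreover have "E_space k ?Z le q1"
    unfolding y(1) by (rule E_space_embedding) (use P y D in auto)
  moreover have "(X \<^bold>\<doteq> iset_image (proj l) ?Z) le q1"
    unfolding iset_eq_iff[OF X(1) regs_image D]
  proof (intro allI impI)
    fix a q2 assume q2: "(q2, q1) \<in> le"
    have "iset_image (proj l) ?Z a le q2 \<longleftrightarrow> a \<in> proj l ` chain ` leaves P"
      using image_gname[OF D, of "proj l" "chain ` leaves P", unfolded iset_eq_iff[OF regs_image regs_check D] check_set_iff] q2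
      by simp
    also have "\<dots> \<longleftrightarrow> X a le q2" unfolding layer_eq[OF P l] using X(2)[OF conds_trans[OF q2 q1]] by simp
    finally show "X a le q2 \<longleftrightarrow> iset_image (proj l) ?Z a le q2" ..
  qed
  ultimately have "(B_generic k ?Z \<^bold>\<and> X \<^bold>\<doteq> iset_image (proj l) ?Z) le q1"
    unfolding B_generic_def fand_def by simp
  then show "\<exists>q' \<tau>. (q', q1) \<in> le \<and> (B_generic k (val_set \<tau>) \<^bold>\<and> X \<^bold>\<doteq> iset_image (proj l) (val_set \<tau>)) le q'"
    using conds_refl[OF D] by blast
qed

text \<open>A sequence of one generator suffices: below every extension of \<open>cond P\<close>
  there is an embedded copy of the whole tree inside \<open>P\<close>, whose leaves form a member of
  \<open>\<B>\<^sub>k\<close> with its projection inside \<open>layer l P\<close>.\<close>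

lemma proj_genericI:
  assumes P: "perfect P" and l: "l \<le> k" and B: "layer l P \<subseteq> B" "B \<subseteq> layer l UNIV"
  shows "proj_generic k l (check_set B) le (cond P)"
  unfolding proj_generic_def generated_filter_def proj_W_max[OF l]
proof (rule fandI)
  let ?S = "\<lambda>Y. \<^bold>\<exists>\<^sub>S X. B_generic k X \<^bold>\<and> Y \<^bold>\<doteq> iset_image (proj l) X"
  show "(check_set B \<^bold>\<subseteq> check_set (layer l UNIV)) le (cond P)"
    using check_subset_iff[OF cond_D[OF P]] B(2) by blast
  have dense: "\<exists>q' \<tau>. (q', q) \<in> le \<and> ((\<^bold>\<forall>i. \<guillemotleft>i < Suc 0\<guillemotright> \<^bold>\<longrightarrow> ?S (\<lambda>a. val_set \<tau> (i, a))) \<^bold>\<and>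
      (\<^bold>\<forall>a. \<guillemotleft>a \<in> layer l UNIV\<guillemotright> \<^bold>\<and> (\<^bold>\<forall>i. \<guillemotleft>i < Suc 0\<guillemotright> \<^bold>\<longrightarrow> val_set \<tau> (i, a)) \<^bold>\<longrightarrow> check_set B a)) le q'"
    if q: "(q, cond P) \<in> le" for q
  proof -
    obtain P' where P': "P' \<subseteq> P" "perfect P'" "(cond P', q) \<in> le" by (rule refine_cond[OF P q])
    obtain y where y: "strict_mono y" "range y \<subseteq> P'" "perfect (range y)" "\<And>m. node_lev k (y m) = node_lev k m"
      "\<And>l m. anc l (y m) = y (anc l m)" by (rule embedding[OF P'(2)]) blast
    let ?Q = "range y"
    \<comment> \<open>Codes the sequence of length one whose entry at index 0 is the layer.\<close>
    define N where "N = {0 :: nat} \<times> layer l ?Q"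
    have D: "cond ?Q \<in> \<D>" using cond_D[OF y(3)] .
    have Qq: "(cond ?Q, q) \<in> le" using conds_trans[OF cond_mono[OF y(3) P'(2) y(2)] P'(3)] .
    have N: "gname N (0, a) le q' \<longleftrightarrow> a \<in> layer l ?Q" if "(q', cond ?Q) \<in> le" for a q'
      by (simp only: gname_iff[OF conds_down[OF D that]] N_def) simp
    have "(\<^bold>\<forall>i. \<guillemotleft>i < Suc 0\<guillemotright> \<^bold>\<longrightarrow> ?S (\<lambda>a. gname N (i, a))) le (cond ?Q)"
    proof (intro fallI fimpI[OF _ D])
      fix i :: nat and q' assume q': "(q', cond ?Q) \<in> le" "\<guillemotleft>i < Suc 0\<guillemotright> le q'"
      have i: "i = 0" using q'(2) by (simp add: fground_def)
      show "?S (\<lambda>a. gname N (i, a)) le q'"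
        unfolding i
      proof (rule generic_layer[OF y(3) l q'(1) _ _ refl y(1,4,5)])
        show "regs (\<lambda>a. gname N (0, a))" by (simp add: regs_def regs_reg[OF regs_val_set])
        show "gname N (0, a) le q'' \<longleftrightarrow> a \<in> layer l ?Q" if "(q'', q') \<in> le" for a q''
          by (rule N[OF conds_trans[OF that q'(1)]])
      qed
    qed
    moreover have "(\<^bold>\<forall>a. \<guillemotleft>a \<in> layer l UNIV\<guillemotright> \<^bold>\<and> (\<^bold>\<forall>i. \<guillemotleft>i < Suc 0\<guillemotright> \<^bold>\<longrightarrow> gname N (i, a)) \<^bold>\<longrightarrow> check_set B a) le (cond ?Q)"
    proof (intro fallI fimpI[OF _ D])
      fix a q' assume q': "(q', cond ?Q) \<in> le" "(\<guillemotleft>a \<in> layer l UNIV\<guillemotright> \<^bold>\<and> (\<^bold>\<forall>i. \<guillemotleft>i < Suc 0\<guillemotright> \<^bold>\<longrightarrow> gname N (i, a))) le q'"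
      have D': "q' \<in> \<D>" using conds_down[OF D q'(1)] .
      have "(\<^bold>\<forall>i. \<guillemotleft>i < Suc 0\<guillemotright> \<^bold>\<longrightarrow> gname N (i, a)) le q'" using q'(2) by (rule fandD)
      then have "(\<guillemotleft>0 < Suc 0\<guillemotright> \<^bold>\<longrightarrow> gname N (0, a)) le q'" by (rule fallD)
      then have "gname N (0, a) le q'"
        by (rule fimpD[OF _ reg_pers[OF reg_fground] regs_reg[OF regs_val_set] D' conds_refl[OF D']]) (simp add: fground_def)
      then have "a \<in> layer l ?Q" by (simp only: N[OF q'(1)])
      then show "check_set B a le q'" unfolding check_set_iff using B(1) y(2) P'(1) by blast
    qed
    ultimately have "((\<^bold>\<forall>i. \<guillemotleft>i < Suc 0\<guillemotright> \<^bold>\<longrightarrow> ?S (\<lambda>a. gname N (i, a))) \<^bold>\<and>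
      (\<^bold>\<forall>a. \<guillemotleft>a \<in> layer l UNIV\<guillemotright> \<^bold>\<and> (\<^bold>\<forall>i. \<guillemotleft>i < Suc 0\<guillemotright> \<^bold>\<longrightarrow> gname N (i, a)) \<^bold>\<longrightarrow> check_set B a)) le (cond ?Q)"
      by (rule fandI)
    then show ?thesis using Qq by blast
  qed
  show "(\<^bold>\<exists>n::nat. \<^bold>\<exists>\<^sub>S X. (\<^bold>\<forall>i. \<guillemotleft>i < n\<guillemotright> \<^bold>\<longrightarrow> ?S (\<lambda>a. X (i, a))) \<^bold>\<and>
      (\<^bold>\<forall>a. \<guillemotleft>a \<in> layer l UNIV\<guillemotright> \<^bold>\<and> (\<^bold>\<forall>i. \<guillemotleft>i < n\<guillemotright> \<^bold>\<longrightarrow> X (i, a)) \<^bold>\<longrightarrow> check_set B a)) le (cond P)"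
    unfolding fex_iff
  proof (intro allI impI)
    fix q assume q: "(q, cond P) \<in> le"
    have "(\<^bold>\<exists>\<^sub>S X. (\<^bold>\<forall>i. \<guillemotleft>i < Suc 0\<guillemotright> \<^bold>\<longrightarrow> ?S (\<lambda>a. X (i, a))) \<^bold>\<and>
      (\<^bold>\<forall>a. \<guillemotleft>a \<in> layer l UNIV\<guillemotright> \<^bold>\<and> (\<^bold>\<forall>i. \<guillemotleft>i < Suc 0\<guillemotright> \<^bold>\<longrightarrow> X (i, a)) \<^bold>\<longrightarrow> check_set B a)) le q"
      unfolding fex_set_iff using dense[OF conds_trans[OF _ q]] by (intro allI impI)
    then show "\<exists>q' (n::nat). (q', q) \<in> le \<and> (\<^bold>\<exists>\<^sub>S X. (\<^bold>\<forall>i. \<guillemotleft>i < n\<guillemotright> \<^bold>\<longrightarrow> ?S (\<lambda>a. X (i, a))) \<^bold>\<and>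
      (\<^bold>\<forall>a. \<guillemotleft>a \<in> layer l UNIV\<guillemotright> \<^bold>\<and> (\<^bold>\<forall>i. \<guillemotleft>i < n\<guillemotright> \<^bold>\<longrightarrow> X (i, a)) \<^bold>\<longrightarrow> check_set B a)) le q'"
      using conds_refl[OF conds_down[OF cond_D[OF P] q]] by blast
  qed
qed

text \<open>The finitely many generators are treated one after the other. Each comes from a member
  of the generic ultrafilter and so contains the layer of some subtree, and subtrees inherit what
  was achieved for the earlier generators.\<close>

lemma proj_generic_layer:
  assumes P0: "perfect P0" and l: "l \<le> k" and q: "(q, cond P0) \<in> le" and B: "proj_generic k l (check_set B) le q"
  obtains P where "P \<subseteq> P0" "perfect P" "(cond P, q) \<in> le" "layer l P \<subseteq> B"
proof -
  let ?S = "\<lambda>Y. \<^bold>\<exists>\<^sub>S X. B_generic k X \<^bold>\<and> Y \<^bold>\<doteq> iset_image (proj l) X"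
  have D: "q \<in> \<D>" using conds_down[OF cond_D[OF P0] q] .
  have "(\<^bold>\<exists>n::nat. \<^bold>\<exists>\<^sub>S X. (\<^bold>\<forall>i. \<guillemotleft>i < n\<guillemotright> \<^bold>\<longrightarrow> ?S (\<lambda>a. X (i, a))) \<^bold>\<and>
      (\<^bold>\<forall>a. \<guillemotleft>a \<in> layer l UNIV\<guillemotright> \<^bold>\<and> (\<^bold>\<forall>i. \<guillemotleft>i < n\<guillemotright> \<^bold>\<longrightarrow> X (i, a)) \<^bold>\<longrightarrow> check_set B a)) le q"
    using B unfolding proj_generic_def generated_filter_def proj_W_max[OF l] by (rule fandD)
  from fexD[OF this conds_refl[OF D]] obtain q1 and n :: nat where q1: "(q1, q) \<in> le" and ex: "(\<^bold>\<exists>\<^sub>S X. (\<^bold>\<forall>i. \<guillemotleft>i < n\<guillemotright> \<^bold>\<longrightarrow> ?S (\<lambda>a. X (i, a))) \<^bold>\<and>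
      (\<^bold>\<forall>a. \<guillemotleft>a \<in> layer l UNIV\<guillemotright> \<^bold>\<and> (\<^bold>\<forall>i. \<guillemotleft>i < n\<guillemotright> \<^bold>\<longrightarrow> X (i, a)) \<^bold>\<longrightarrow> check_set B a)) le q1"
    by blast
  from fex_setD[OF ex conds_refl[OF conds_down[OF D q1]]] obtain q2 \<tau> where q2: "(q2, q1) \<in> le" and both: "((\<^bold>\<forall>i. \<guillemotleft>i < n\<guillemotright> \<^bold>\<longrightarrow> ?S (\<lambda>a. val_set \<tau> (i, a))) \<^bold>\<and>
      (\<^bold>\<forall>a. \<guillemotleft>a \<in> layer l UNIV\<guillemotright> \<^bold>\<and> (\<^bold>\<forall>i. \<guillemotleft>i < n\<guillemotright> \<^bold>\<longrightarrow> val_set \<tau> (i, a)) \<^bold>\<longrightarrow> check_set B a)) le q2"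
    by blast
  have q2q: "(q2, q) \<in> le" using conds_trans[OF q2 q1] .
  have D2: "q2 \<in> \<D>" using conds_down[OF D q2q] .
  have S: "?S (\<lambda>a. val_set \<tau> (i, a)) le q'" if "i < n" "(q', q2) \<in> le" for i q'
  proof -
    have "(\<guillemotleft>i < n\<guillemotright> \<^bold>\<longrightarrow> ?S (\<lambda>a. val_set \<tau> (i, a))) le q2"
      using fandD(1)[OF both] by (rule fallD)
    then show ?thesis
      by (rule fimpD[OF _ reg_pers[OF reg_fground] reg_fex_set D2 that(2)]) (simp add: fground_def that(1))
  qed
  obtain P1 where P1: "P1 \<subseteq> P0" "perfect P1" "(cond P1, q2) \<in> le" by (rule refine_cond[OF P0 conds_trans[OF q2q q]])
  have "\<exists>P\<subseteq>P1. perfect P \<and> (\<forall>i<j. \<forall>u\<in>P. node_lev k u = l \<longrightarrow> val_set \<tau> (i, chain u) le (cond P))" if "j \<le> n" for j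
    using that
  proof (induction j)
    case 0
    then show ?case using P1(2) by blast
  next
    case (Suc j)
    then obtain P where P: "P \<subseteq> P1" "perfect P"
      and old: "\<forall>i<j. \<forall>u\<in>P. node_lev k u = l \<longrightarrow> val_set \<tau> (i, chain u) le (cond P)" by auto
    have Pq2: "(cond P, q2) \<in> le" using conds_trans[OF cond_mono[OF P(2) P1(2) P(1)] P1(3)] .
    have "?S (\<lambda>a. val_set \<tau> (j, a)) le (cond P)" by (rule S[OF _ Pq2]) (use Suc in simp)
    from fex_setD[OF this conds_refl[OF cond_D[OF P(2)]]] obtain q3 \<sigma> where q3: "(q3, cond P) \<in> le"
      "(B_generic k (val_set \<sigma>) \<^bold>\<and> (\<lambda>a. val_set \<tau> (j, a)) \<^bold>\<doteq> iset_image (proj l) (val_set \<sigma>)) le q3" by blast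
    have D3: "q3 \<in> \<D>" using conds_down[OF cond_D[OF P(2)] q3(1)] .
    have G: "mem_generic k (val_set \<sigma>) le q3" using fandD(1)[OF q3(2)] unfolding B_generic_def by (rule fandD)
    have regs: "regs (\<lambda>a. val_set \<tau> (j, a))" by (simp add: regs_def regs_reg[OF regs_val_set])
    have eq: "val_set \<tau> (j, a) le q' \<longleftrightarrow> iset_image (proj l) (val_set \<sigma>) a le q'" if "(q', q3) \<in> le" for a q'
      using fandD(2)[OF q3(2)] that unfolding iset_eq_iff[OF regs regs_image D3] by simp
    obtain Q where Q: "Q \<subseteq> P" "perfect Q" "(cond Q, q3) \<in> le" and leaf: "\<And>m. m \<in> leaves Q \<Longrightarrow> val_set \<sigma> (chain m) le (cond Q)"
      by (rule generic_preimage[OF P(2) q3(1) G]) blast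
    have "val_set \<tau> (i, chain u) le (cond Q)" if i: "i < Suc j" and u: "u \<in> Q" "node_lev k u = l" for i u
    proof (cases "i = j")
      case True
      obtain m where m: "m \<in> leaves Q" "anc (node_lev k u) m = u" using leaf_above[OF Q(2) u(1)] by blast
      then have "proj l (chain m) = chain u" using proj_chain[of l m] l u(2) by (simp add: leaves_def)
      have "iset_image (proj l) (val_set \<sigma>) (chain u) le (cond Q)"
        unfolding iset_image_def fex_iff
      proof (intro allI impI)
        fix q' assume q': "(q', cond Q) \<in> le"
        have "(val_set \<sigma> (chain m) \<^bold>\<and> \<guillemotleft>chain u = proj l (chain m)\<guillemotright>) le q'"
          using regs_reg[OF regs_val_set, THEN regD, OF leaf[OF m(1)] q'] \<open>proj l (chain m) = chain u\<close>
          by (simp add: fand_def fground_def)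
        then show "\<exists>q'' a. (q'', q') \<in> le \<and> (val_set \<sigma> a \<^bold>\<and> \<guillemotleft>chain u = proj l a\<guillemotright>) le q''"
          using conds_refl[OF conds_down[OF cond_D[OF Q(2)] q']] by blast
      qed
      then show ?thesis unfolding True eq[OF Q(3)] .
    next
      case False
      then have "val_set \<tau> (i, chain u) le (cond P)" using old i u Q(1) by auto
      then show ?thesis by (rule regs_reg[OF regs_val_set, THEN regD, OF _ cond_mono[OF Q(2) P(2) Q(1)]])
    qed
    then show ?case using Q(1,2) P(1) by (meson subset_trans)
  qed
  from this[OF order_refl] obtain P where P: "P \<subseteq> P1" "perfect P"
    and all: "\<forall>i<n. \<forall>u\<in>P. node_lev k u = l \<longrightarrow> val_set \<tau> (i, chain u) le (cond P)" by blast
  have Pq2: "(cond P, q2) \<in> le" using conds_trans[OF cond_mono[OF P(2) P1(2) P(1)] P1(3)] .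
  have "chain u \<in> B" if u: "u \<in> P" "node_lev k u = l" for u
  proof -
    have "(\<guillemotleft>chain u \<in> layer l UNIV\<guillemotright> \<^bold>\<and> (\<^bold>\<forall>i. \<guillemotleft>i < n\<guillemotright> \<^bold>\<longrightarrow> val_set \<tau> (i, chain u)) \<^bold>\<longrightarrow> check_set B (chain u)) le q2"
      using fandD(2)[OF both] by (rule fallD)
    then have "check_set B (chain u) le (cond P)"
    proof (rule fimpD[OF _ pers_filter_premise regs_reg[OF regs_check] D2 Pq2])
      have "(\<^bold>\<forall>i. \<guillemotleft>i < n\<guillemotright> \<^bold>\<longrightarrow> val_set \<tau> (i, chain u)) le (cond P)"
      proof (intro fallI fimpI[OF _ cond_D[OF P(2)]])
        fix i q' assume q': "(q', cond P) \<in> le" "\<guillemotleft>i < n\<guillemotright> le q'"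
        then have "val_set \<tau> (i, chain u) le (cond P)" using all u by (simp add: fground_def)
        then show "val_set \<tau> (i, chain u) le q'" by (rule regs_reg[OF regs_val_set, THEN regD, OF _ q'(1)])
      qed
      then show "(\<guillemotleft>chain u \<in> layer l UNIV\<guillemotright> \<^bold>\<and> (\<^bold>\<forall>i. \<guillemotleft>i < n\<guillemotright> \<^bold>\<longrightarrow> val_set \<tau> (i, chain u))) le (cond P)"
        using u(2) by (simp add: fand_def fground_def)
    qed
    then show ?thesis unfolding check_set_iff .
  qed
  then have "layer l P \<subseteq> B" by blast
  then show ?thesis by (rule that[OF subset_trans[OF P(1) P1(1)] P(2) conds_trans[OF Pq2 q2q]])
qed

end

context forcing
begin

lemma ultrafilter_pers:
  assumes "family UNIV V"
  shows "pers (ultrafilter_on_omega V)"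
  unfolding ultrafilter_on_omega_def fall_set_def fimp_def fdisj_def
  by (intro pers_fand pers_fall pers_fnot reg_pers family_reg[OF assms] regs_check)

lemma tukey_pers: "pers (V \<^bold>\<le>\<^sub>T U)"
  unfolding tukey_le_def fex_rel_def by (intro reg_pers reg_fex)

end

context fan_tree
begin

section \<open>Recovering the lower levels of a tree from a layer\<close>

lemma chain_lev: "v \<in> chain u \<Longrightarrow> lev v \<le> lev u"
proof (induction u rule: node_induct)
  case (step u)
  then show ?case using chain_step[of u] lev_par[of u] by auto
qed (simp add: chain_0)

lemma chain_perfect: "perfect P \<Longrightarrow> u \<in> P \<Longrightarrow> chain u \<subseteq> P"
proof (induction u rule: node_induct)
  case (step u)
  then show ?case using chain_step[of u] perfect_D(2)[of P u] by auto
qed (simp add: chain_0)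

text \<open>Turns functions of the levels up to \<open>l\<close> into functions on the sets of
  \<open>\<pi>\<^sub>l(\<G>\<^sub>k)\<close>. Elements of \<open>B\<close> that are not branches of
  length \<open>l\<close> are dropped; the root belongs to no branch and is added.\<close>

definition down :: "nat \<Rightarrow> nat set set \<Rightarrow> nat set" where
  "down l B = insert 0 (\<Union>(B \<inter> chain ` {u. lev u = l}))"

lemma down_mono: "A \<subseteq> B \<Longrightarrow> down l A \<subseteq> down l B"
  by (auto simp: down_def)

lemma down_layer:
  assumes P: "perfect P" and l: "l \<le> k"
  shows "down l (chain ` {u \<in> P. lev u = l}) = {u \<in> P. lev u \<le> l}"
proof
  show "down l (chain ` {u \<in> P. lev u = l}) \<subseteq> {u \<in> P. lev u \<le> l}"
    using perfect_D(1)[OF P] lev_0 chain_perfect[OF P] chain_lev by (fastforce simp: down_def)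
  show "{u \<in> P. lev u \<le> l} \<subseteq> down l (chain ` {u \<in> P. lev u = l})"
  proof
    fix u assume "u \<in> {u \<in> P. lev u \<le> l}"
    then have u: "u \<in> P" "lev u \<le> l" by auto
    obtain m where m: "m \<in> leaves P" "anc (lev u) m = u" using leaf_above[OF P u(1)] by blast
    then have mk: "m \<in> P" "lev m = k" by (auto simp: leaves_def)
    have w: "anc l m \<in> P" "lev (anc l m) = l" using anc_mem[OF P mk(1)] lev_anc l mk(2) by auto
    have "k - lev u = (l - lev u) + (k - l)" using u(2) l by simp
    then have "(par ^^ (l - lev u)) (anc l m) = u"
      using m(2) by (simp add: anc_def mk(2) funpow_add)
    then have "\<exists>i. u = (par ^^ i) (anc l m)" by metis
    then have "u = 0 \<or> u \<in> chain (anc l m)" by (cases "u = 0") (simp_all add: chain_def)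
    then show "u \<in> down l (chain ` {u \<in> P. lev u = l})" using w unfolding down_def by blast
  qed
qed

text \<open>The order of conditions ignores small sets, so it does not give inclusion of the trees;
  a subtree of both has to be found.\<close>

lemma common_refinement:
  assumes "perfect P" "perfect Q" "(cond P, cond Q) \<in> le"
  obtains R where "perfect R" "R \<subseteq> P" "R \<subseteq> Q"
proof -
  obtain R where R: "R \<subseteq> P" "perfect R" "(cond R, cond P) \<in> le" "code R \<subseteq> code Q"
    by (rule refine[OF assms(1) conds_refl[OF cond_D[OF assms(1)]] code_tuples code_positive[OF assms(2)] assms(3)[unfolded cond_def[of Q]]])
  have "leaves R \<subseteq> leaves Q" using R(4) unfolding code_def by (simp add: inj_image_subset_iff[OF inj_path])
  then have "R \<subseteq> Q" by (rule leaves_subset[OF R(2) assms(2)])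
  then show ?thesis by (rule that[OF R(2,1)])
qed

end

context seq_tree
begin

text \<open>From \<open>\<pi>\<^sub>l(\<G>\<^sub>k)\<close> to \<open>V\<close> the map is
  \<open>h\<close> after \<open>down l\<close>. In the other direction a set of outputs is sent to
  the branches of the nodes on level \<open>l\<close> that \<open>c\<close> decodes from it. Both
  maps are monotone and act on ground model sets, as \<open>tukey_intro\<close> requires.\<close>

lemma tukey_equiv_projection:
  assumes V: "family UNIV V" and p: "p \<in> \<D>" "ultrafilter_on_omega V le p" "(V \<^bold>\<le>\<^sub>T G) le p"
  shows "\<exists>q l. (q, p) \<in> le \<and> l \<le> k \<and> (V \<^bold>\<equiv>\<^sub>T proj_generic k l) le q"
proof -
  obtain X l h c where X: "perfect X" "(cond X, p) \<in> le" and l: "l \<le> k"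
    and h: "\<And>U U'. U \<subseteq> U' \<Longrightarrow> h U \<subseteq> h U'"
    and gen: "\<And>Y. perfect Y \<Longrightarrow> Y \<subseteq> X \<Longrightarrow> V (check_set (h {u \<in> Y. node_lev k u \<le> l})) le (cond Y)"
    and cof: "\<And>q B. (q, cond X) \<in> le \<Longrightarrow> V (check_set B) le q \<Longrightarrow>
      \<exists>Y\<subseteq>X. perfect Y \<and> (cond Y, q) \<in> le \<and> h {u \<in> Y. node_lev k u \<le> l} \<subseteq> B"
    and c: "\<And>Y n. perfect Y \<Longrightarrow> Y \<subseteq> X \<Longrightarrow> n \<in> h {u \<in> Y. node_lev k u \<le> l} \<Longrightarrow> c n \<in> Y \<and> node_lev k (c n) = l"
    and ne: "\<And>Y. perfect Y \<Longrightarrow> Y \<subseteq> X \<Longrightarrow> h {u \<in> Y. node_lev k u \<le> l} \<noteq> {}"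
    by (rule tukey_structure[OF V p]) blast
  note \<Pi> = family_proj_generic[OF l]
  have D: "cond X \<in> \<D>" using cond_D[OF X(1)] .
  have "(V \<^bold>\<le>\<^sub>T proj_generic k l) le (cond X)"
  proof (rule tukey_intro[where f = "\<lambda>B. h (down l B)", OF \<Pi> V D])
    fix q B assume q: "(q, cond X) \<in> le" and B: "proj_generic k l (check_set B) le q"
    show "V (check_set (h (down l B))) le q"
    proof (rule reg_dense[OF family_reg[OF V regs_check] conds_down[OF D q]])
      fix q1 assume q1: "(q1, q) \<in> le"
      obtain P where P: "P \<subseteq> X" "perfect P" "(cond P, q1) \<in> le" "layer l P \<subseteq> B"
        by (rule proj_generic_layer[OF X(1) l conds_trans[OF q1 q] family_check_down[OF \<Pi> B q1]])
      have "h {u \<in> P. node_lev k u \<le> l} \<subseteq> h (down l B)"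
        using h[OF down_mono[OF P(4), of l]] unfolding down_layer[OF P(2) l] .
      then have "V (check_set (h (down l B))) le (cond P)"
        by (rule ultrafilter_mono[OF V p(1,2) conds_trans[OF cond_mono[OF P(2) X(1) P(1)] X(2)] gen[OF P(2,1)]])
      then show "\<exists>q'. (q', q1) \<in> le \<and> V (check_set (h (down l B))) le q'" using P(3) by blast
    qed
  next
    show "h (down l A) \<subseteq> h (down l A')" if "A \<subseteq> A'" for A A' by (rule h[OF down_mono[OF that]])
  next
    fix q B assume q: "(q, cond X) \<in> le" and B: "V (check_set B) le q"
    obtain Y where Y: "perfect Y" "(cond Y, q) \<in> le" "h {u \<in> Y. node_lev k u \<le> l} \<subseteq> B" using cof[OF q B] by blast
    have "proj_generic k l (check_set (layer l Y)) le (cond Y)" by (rule proj_genericI[OF Y(1) l]) auto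
    moreover have "h (down l (layer l Y)) \<subseteq> B" unfolding down_layer[OF Y(1) l] by (rule Y(3))
    ultimately show "\<exists>q' A. (q', q) \<in> le \<and> proj_generic k l (check_set A) le q' \<and> h (down l A) \<subseteq> B"
      using Y(2) by blast
  qed
  moreover have "(proj_generic k l \<^bold>\<le>\<^sub>T V) le (cond X)"
  proof (rule tukey_intro[where f = "\<lambda>B. layer l (c ` B)", OF V \<Pi> D])
    fix q B assume q: "(q, cond X) \<in> le" and B: "V (check_set B) le q"
    show "proj_generic k l (check_set (layer l (c ` B))) le q"
    proof (rule reg_dense[OF family_reg[OF \<Pi> regs_check] conds_down[OF D q]])
      fix q1 assume q1: "(q1, q) \<in> le"
      obtain P where P: "P \<subseteq> X" "perfect P" "(cond P, q1) \<in> le" by (rule refine_cond[OF X(1) conds_trans[OF q1 q]])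
      obtain Q where Q: "Q \<subseteq> P" "perfect Q"
        "{u \<in> Q. node_lev k u = l} \<subseteq> c ` B \<or> {u \<in> Q. node_lev k u = l} \<inter> c ` B = {}"
        using layer_split[OF P(2) l, of "c ` B"] by blast
      have Qq1: "(cond Q, q1) \<in> le" using conds_trans[OF cond_mono[OF Q(2) P(2) Q(1)] P(3)] .
      have QX: "(cond Q, cond X) \<in> le" using conds_trans[OF Qq1 conds_trans[OF q1 q]] .
      \<comment> \<open>Some subtree has its \<open>h\<close> inside \<open>B\<close>. Refined so as
        to lie in \<open>Q\<close>, it still has an element in \<open>h\<close>, and this decodes to
        a node of \<open>Q\<close> on level \<open>l\<close>.\<close>
      have "{u \<in> Q. node_lev k u = l} \<inter> c ` B \<noteq> {}"
      proof -
        obtain Y where Y: "Y \<subseteq> X" "perfect Y" "(cond Y, cond Q) \<in> le" "h {u \<in> Y. node_lev k u \<le> l} \<subseteq> B"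
          using cof[OF QX family_check_down[OF V B conds_trans[OF Qq1 q1]]] by blast
        obtain R where R: "perfect R" "R \<subseteq> Y" "R \<subseteq> Q" by (rule common_refinement[OF Y(2) Q(2) Y(3)])
        have RX: "R \<subseteq> X" using R(2) Y(1) by blast
        obtain n where n: "n \<in> h {u \<in> R. node_lev k u \<le> l}" using ne[OF R(1) RX] by blast
        have "{u \<in> R. node_lev k u \<le> l} \<subseteq> {u \<in> Y. node_lev k u \<le> l}" using R(2) by blast
        then have "n \<in> B" using n h Y(4) by blast
        moreover have "c n \<in> Q" "node_lev k (c n) = l" using c[OF R(1) RX n] R(3) by auto
        ultimately show ?thesis by blast
      qed
      then have "{u \<in> Q. node_lev k u = l} \<subseteq> c ` B" using Q(3) by blast
      then have "layer l Q \<subseteq> layer l (c ` B)" by blast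
      then have "proj_generic k l (check_set (layer l (c ` B))) le (cond Q)"
        by (rule proj_genericI[OF Q(2) l]) auto
      then show "\<exists>q'. (q', q1) \<in> le \<and> proj_generic k l (check_set (layer l (c ` B))) le q'" using Qq1 by blast
    qed
  next
    show "layer l (c ` A) \<subseteq> layer l (c ` A')" if "A \<subseteq> A'" for A A' using that by blast
  next
    fix q B assume q: "(q, cond X) \<in> le" and B: "proj_generic k l (check_set B) le q"
    obtain P where P: "P \<subseteq> X" "perfect P" "(cond P, q) \<in> le" "layer l P \<subseteq> B"
      by (rule proj_generic_layer[OF X(1) l q B])
    have "c ` h {u \<in> P. node_lev k u \<le> l} \<subseteq> P" using c[OF P(2,1)] by blast
    then have "layer l (c ` h {u \<in> P. node_lev k u \<le> l}) \<subseteq> B" using P(4) by blast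
    then show "\<exists>q' A. (q', q) \<in> le \<and> V (check_set A) le q' \<and> layer l (c ` A) \<subseteq> B"
      using P(3) gen[OF P(2,1)] by blast
  qed
  ultimately show ?thesis using X(2) l unfolding tukey_equiv_def fand_def by blast
qed

text \<open>\<open>p\<close> is not known to lie in \<open>\<D>\<close> beforehand, so the facts
  about forcing are taken for the whole field. A ground model set forced to equal the code of
  \<open>\<W>\<^sub>k\<close> is that code, and \<open>below_positive\<close> passes from densely
  many extensions to \<open>p\<close>.\<close>

lemma W_max_generic:
  assumes "p \<in> Field le" "mem_generic k (check_set (W_max k)) le p"
  shows "p \<in> \<D>"
proof -
  interpret F: forcing_base le "Field le"
    by (rule forcing_base_pow_mod_fin) (auto intro: FieldI1)
  let ?I = "iset_image sorted_list_of_set (check_set (W_max k))"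
  have code: "code UNIV = sorted_list_of_set ` W_max k"
    unfolding W_max_eq using sorted_list_chain_leaves[of UNIV] by (simp add: leaves_def)
  have I: "?I a le q \<longleftrightarrow> a \<in> code UNIV" if q: "q \<in> Field le" for a q
  proof
    assume "?I a le q"
    then have "(\<^bold>\<exists>w. check_set (W_max k) w \<^bold>\<and> \<guillemotleft>a = sorted_list_of_set w\<guillemotright>) le q" unfolding iset_image_def .
    from fexD[OF this pow_mod_fin_refl[OF q]] obtain q' w where "(check_set (W_max k) w \<^bold>\<and> \<guillemotleft>a = sorted_list_of_set w\<guillemotright>) le q'" by blast
    then show "a \<in> code UNIV" unfolding code by (simp add: fand_def fground_def check_set_def)
  next
    assume "a \<in> code UNIV"
    then obtain w where w: "w \<in> W_max k" "a = sorted_list_of_set w" unfolding code by blast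
    show "?I a le q"
      unfolding iset_image_def fex_iff
    proof (intro allI impI)
      fix q' assume q': "(q', q) \<in> le"
      have "(check_set (W_max k) w \<^bold>\<and> \<guillemotleft>a = sorted_list_of_set w\<guillemotright>) le q'"
        using w by (simp add: fand_def fground_def check_set_def)
      then show "\<exists>q'' w. (q'', q') \<in> le \<and> (check_set (W_max k) w \<^bold>\<and> \<guillemotleft>a = sorted_list_of_set w\<guillemotright>) le q''"
        using pow_mod_fin_refl[OF FieldI1[OF q']] by blast
    qed
  qed
  have "(p, fin_class k (code UNIV)) \<in> le"
  proof (rule below_positive[OF assms(1) code_tuples code_positive[OF perfect_UNIV]])
    fix q assume q: "(q, p) \<in> le"
    let ?N = "{(X \<times> UNIV, fin_class k X) |X. X \<in> Pow (tuples k) - fin_ideal k}"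
    have dense: "dense_below le p (\<lambda>q. \<exists>\<tau> s. (\<tau>, s) \<in> ?N \<and> (q, s) \<in> le \<and> (?I \<^bold>\<doteq> val_set \<tau>) le q)"
      using assms(2) unfolding mem_generic_def generic_ultrafilter_def val_fam_def .
    from dense[unfolded dense_below_def, rule_format, OF q]
    obtain q' \<tau> s where q': "(q', q) \<in> le" "(q', s) \<in> le" "(?I \<^bold>\<doteq> val_set \<tau>) le q'" "(\<tau>, s) \<in> ?N" by blast
    obtain Y where Y: "\<tau> = Y \<times> UNIV" "s = fin_class k Y" using q'(4) by blast
    have D: "q' \<in> Field le" using FieldI1[OF q'(1)] .
    have regsI: "F.regs ?I" unfolding F.regs_def iset_image_def by (intro allI F.reg_fex)
    have "a \<in> Y \<longleftrightarrow> a \<in> code UNIV" for a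
      using q'(3)[unfolded F.iset_eq_iff[OF regsI F.regs_val_set D]] pow_mod_fin_refl[OF D] I[OF D, of a]
        F.gname_iff[OF D, of Y a] Y(1) by simp
    then have "Y = code UNIV" by blast
    then show "\<exists>q'. (q', q) \<in> le \<and> (q', fin_class k (code UNIV)) \<in> le" using q'(1,2) Y(2) by blast
  qed
  then show ?thesis by (simp add: \<D>_def cond_def)
qed

end

theorem theorem39:
  fixes k :: nat
  assumes "2 \<le> k"
  shows "holds_in_extension (pow_mod_fin k)
    (mem_generic k (check_set (W_max k)) \<^bold>\<longrightarrow>
      (\<^bold>\<forall>\<^sub>F V :: (nat, nat list set set) ifam.
         ultrafilter_on_omega V \<^bold>\<and> nonprincipal V \<^bold>\<and> V \<^bold>\<le>\<^sub>T generic_ultrafilter k \<^bold>\<longrightarrow>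
         (\<^bold>\<exists>l. \<guillemotleft>l \<le> k\<guillemotright> \<^bold>\<and> V \<^bold>\<equiv>\<^sub>T proj_generic k l)))"
proof -
  interpret seq_tree k by unfold_locales (use assms in simp)
  have main: "(\<^bold>\<forall>\<^sub>F V :: (nat, nat list set set) ifam.
         ultrafilter_on_omega V \<^bold>\<and> nonprincipal V \<^bold>\<and> V \<^bold>\<le>\<^sub>T G \<^bold>\<longrightarrow>
         (\<^bold>\<exists>l. \<guillemotleft>l \<le> k\<guillemotright> \<^bold>\<and> V \<^bold>\<equiv>\<^sub>T proj_generic k l)) le p" if p: "p \<in> \<D>" for p
    unfolding fall_fam_def
  proof (intro fallI fimpI[OF _ p])
    fix F :: "(nat, nat list set set) fam_name" and q
    let ?V = "val_fam F"
    assume q: "(q, p) \<in> le" "(ultrafilter_on_omega ?V \<^bold>\<and> nonprincipal ?V \<^bold>\<and> ?V \<^bold>\<le>\<^sub>T G) le q"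
    have V: "family UNIV ?V" by (rule family_UNIV_val_fam)
    have uf: "ultrafilter_on_omega ?V le q" "(?V \<^bold>\<le>\<^sub>T G) le q" using q(2) by (auto simp: fand_def)
    show "(\<^bold>\<exists>l. \<guillemotleft>l \<le> k\<guillemotright> \<^bold>\<and> ?V \<^bold>\<equiv>\<^sub>T proj_generic k l) le q"
      unfolding fex_iff
    proof (intro allI impI)
      fix q1 assume q1: "(q1, q) \<in> le"
      have D: "q1 \<in> \<D>" using conds_down[OF p conds_trans[OF q1 q(1)]] .
      have "\<exists>q' l. (q', q1) \<in> le \<and> l \<le> k \<and> (?V \<^bold>\<equiv>\<^sub>T proj_generic k l) le q'"
        by (rule tukey_equiv_projection[OF V D])
          (rule ultrafilter_pers[OF V, THEN persD, OF uf(1) q1], rule tukey_pers[THEN persD, OF uf(2) q1])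
      then show "\<exists>q' l. (q', q1) \<in> le \<and> (\<guillemotleft>l \<le> k\<guillemotright> \<^bold>\<and> ?V \<^bold>\<equiv>\<^sub>T proj_generic k l) le q'"
        unfolding fand_def fground_def by blast
    qed
  qed
  show ?thesis
    unfolding holds_in_extension_def
  proof
    fix p assume "p \<in> Field le"
    interpret F: forcing_base le "Field le"
      by (rule forcing_base_pow_mod_fin) (auto intro: FieldI1)
    show "(mem_generic k (check_set (W_max k)) \<^bold>\<longrightarrow>
      (\<^bold>\<forall>\<^sub>F V :: (nat, nat list set set) ifam.
         ultrafilter_on_omega V \<^bold>\<and> nonprincipal V \<^bold>\<and> V \<^bold>\<le>\<^sub>T generic_ultrafilter k \<^bold>\<longrightarrow>
         (\<^bold>\<exists>l. \<guillemotleft>l \<le> k\<guillemotright> \<^bold>\<and> V \<^bold>\<equiv>\<^sub>T proj_generic k l))) le p"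
    \<comment> \<open>Implication is checked at the extensions that force the premise; these lie in
      \<open>\<D>\<close>.\<close>
    proof (rule F.fimpI[OF _ \<open>p \<in> Field le\<close>])
      fix q assume "(q, p) \<in> le" and W: "mem_generic k (check_set (W_max k)) le q"
      then have "q \<in> Field le" by (auto intro: FieldI1)
      from main[OF W_max_generic[OF this W]]
      show "(\<^bold>\<forall>\<^sub>F V :: (nat, nat list set set) ifam.
         ultrafilter_on_omega V \<^bold>\<and> nonprincipal V \<^bold>\<and> V \<^bold>\<le>\<^sub>T generic_ultrafilter k \<^bold>\<longrightarrow>
         (\<^bold>\<exists>l. \<guillemotleft>l \<le> k\<guillemotright> \<^bold>\<and> V \<^bold>\<equiv>\<^sub>T proj_generic k l)) le q" .
    qed
  qed
qed

end
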